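(* Let $\Omega=(-1,1)^2\subset\mathbb{R}^2$ and fix $\xi\in(0,1)$. For $\varepsilon\to0$, let $k_\varepsilon\in W^{1,2}(\Omega;\mathbb{R}^2)$ and $B_\varepsilon\in H_{\mathrm{curl}}(\Omega;\mathbb{R}^{2\times2})$ satisfy $\sup_{\varepsilon>0}E_{\varepsilon,\xi}[k_\varepsilon,B_\varepsilon]<\infty$. Suppose further that $$B_\varepsilon\equiv0\ \text{ in }\Omega\setminus L_{\varepsilon,\xi}\qquad\text{and}\qquad\left|\int_\Omega\mathrm{curl}\,B_\varepsilon\,dx\right|=2 .$$ Then, up to a subsequence (not relabeled), $k_\varepsilon\to k$ strongly in $L^2(\Omega;\mathbb{R}^2)$, where $k\in SBV(\Omega;S^1)\cap W^{1,1}(\Omega\setminus\overline{L_{0,\xi}};S^1)$. Moreover, along this subsequence the rescaled curls $\mathrm{curl}_\varepsilon\tilde B_\varepsilon$ of the rescaled fields $\tilde B_\varepsilon(x_1,x_2):=\varepsilon B_\varepsilon(x_1,\varepsilon x_2)$ converge weakly in $L^2(L_{1,\xi};\mathbb{R}^2)$ to some $\alpha\in L^2(L_{1,\xi};\mathbb{R}^2)$, and, with $[\![k]\!]:=k^+-k^-$ denoting the jump of $k$ on $(-\xi,1)$ (identified with $(-\xi,1)\times\{0\}$), the compatibility condition $$[\![k]\!](s)=\int_{-\xi}^{s}\int_{-\xi/2}^{\xi/2}\alpha\,dx_2\,dx_1\qquad\text{and}\qquad|[\![k]\!](1)|=2$$ is satisfied for all $s\in(-\xi,1)$. Furthermore,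 writing $\nabla k$ for the part of $Dk$ that is absolutely continuous with respect to Lebesgue measure, one has, in the sense of distributions on $\Omega$ (row-wise), $$\mathrm{curl}(\nabla k)=-\frac{d}{dx_1}[\![k]\!]\;\mathcal{H}^1\llcorner_{(-\xi,1)\times\{0\}} .$$
   Context: For $\varepsilon>0$, the layer is $L_{\varepsilon,\xi}:=(-\xi,1)\times\left(-\frac{\varepsilon\xi}{2},\frac{\varepsilon\xi}{2}\right)$, and $L_{0,\xi}:=(-\xi,1)\times\{0\}$. The energy is $$E_{\varepsilon,\xi}[k,B]:=\int_\Omega\left[\frac{(|k|-1)^2}{\varepsilon\xi^2}+|\nabla k-B|^2+\varepsilon\xi^2|\mathrm{curl}\,B|^2+\frac{1}{\varepsilon\xi^2}W(\varepsilon\xi|B|)\right]dx,$$ where $W:[0,\infty)\to[0,\infty)$ is continuous, $\frac1C|x|^2-C\le W(x)\le C(1+|x|^2)$ for all $x\ge0$ and some $C>0$, and $\{W=0\}=\{0,2\}$. The curl of a $2\times2$ matrix field is taken row-wise and distributionally: for a row $g=(g_1,g_2)$, $\mathrm{curl}\,g=\partial_1g_2-\partial_2g_1$; so $\mathrm{curl}\,B$ is $\mathbb{R}^2$-valued. The scaled curl of a row is $\mathrm{curl}_\varepsilon g:=\partial_1g_2-\frac1\varepsilon\partial_2g_1$, also applied row-wise. $H_{\mathrm{curl}}(\Omega;\mathbb{R}^{2\times2})$ is the space of $L^2$ matrix fields with row-wise distributional curl in $L^2$. $k^+$ and $k^-$ are the traces of $k$ on $(-\xi,1)\times\{0\}$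 from $\{x_2>0\}$ and $\{x_2<0\}$, respectively. Pointwise values $[\![k]\!](s)$ and $[\![k]\!](1)$ refer to the continuous representative on $[-\xi,1]$. $SBV(\Omega;S^1)$ denotes the special functions of bounded variation with values in the unit circle a.e. $\mathcal{H}^1$ is the one-dimensional Hausdorff measure and $\llcorner$ denotes restriction of a measure. *)

theory Defs
  imports "HOL-Analysis.Analysis"
begin

section \<open>Function spaces and weak derivatives\<close>

definition dir_deriv :: "('a::euclidean_space \<Rightarrow> real) \<Rightarrow> 'a \<Rightarrow> 'a \<Rightarrow> real" where
  "dir_deriv \<phi> e x = frechet_derivative \<phi> (at x) e"

primrec Ck :: "nat \<Rightarrow> ('a::euclidean_space \<Rightarrow> real) \<Rightarrow> bool" where
  "Ck 0 f \<longleftrightarrow> continuous_on UNIV f"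
| "Ck (Suc n) f \<longleftrightarrow> (\<forall>x. f differentiable (at x)) \<and> (\<forall>e\<in>Basis. Ck n (dir_deriv f e))"

text \<open>The space \<open>C\<^sub>c\<^sup>\<infinity>(U)\<close>; its elements are extended by zero to the whole space.\<close>

definition test_functions :: "'a::euclidean_space set \<Rightarrow> ('a \<Rightarrow> real) set" where
  "test_functions U =
     {\<phi>. (\<forall>n. Ck n \<phi>) \<and> compact (closure {x. \<phi> x \<noteq> 0}) \<and> closure {x. \<phi> x \<noteq> 0} \<subseteq> U}"

text \<open>Functions on \<open>U\<close> are total functions whose values outside \<open>U\<close> are irrelevant;
  almost everywhere equal functions are not identified.\<close>

definition lp_on :: "nat \<Rightarrow> 'a::euclidean_space set \<Rightarrow> ('a \<Rightarrow> 'b::euclidean_space) \<Rightarrow> bool" where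
  "lp_on p U f \<longleftrightarrow> f \<in> borel_measurable (lebesgue_on U) \<and>
                   integrable (lebesgue_on U) (\<lambda>x. norm (f x) ^ p)"

definition locally_integrable_on :: "'a::euclidean_space set \<Rightarrow> ('a \<Rightarrow> 'b::euclidean_space) \<Rightarrow> bool" where
  "locally_integrable_on U f \<longleftrightarrow> (\<forall>K. compact K \<and> K \<subseteq> U \<longrightarrow> set_integrable lebesgue K f)"

definition L2_tendsto ::
  "'a::euclidean_space set \<Rightarrow> (nat \<Rightarrow> 'a \<Rightarrow> 'b::euclidean_space) \<Rightarrow> ('a \<Rightarrow> 'b) \<Rightarrow> bool" where
  "L2_tendsto U f g \<longleftrightarrow> (\<forall>n. lp_on 2 U (f n)) \<and> lp_on 2 U g \<and>
     (\<lambda>n. LINT x|lebesgue_on U. norm (f n x - g x) ^ 2) \<longlonglongrightarrow> 0"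

definition L2_weak_tendsto ::
  "'a::euclidean_space set \<Rightarrow> (nat \<Rightarrow> 'a \<Rightarrow> 'b::euclidean_space) \<Rightarrow> ('a \<Rightarrow> 'b) \<Rightarrow> bool" where
  "L2_weak_tendsto U f g \<longleftrightarrow> (\<forall>n. lp_on 2 U (f n)) \<and> lp_on 2 U g \<and>
     (\<forall>\<psi>. lp_on 2 U \<psi> \<longrightarrow>
        (\<lambda>n. LINT x|lebesgue_on U. f n x \<bullet> \<psi> x) \<longlonglongrightarrow> (LINT x|lebesgue_on U. g x \<bullet> \<psi> x))"

definition has_weak_deriv ::
  "'a::euclidean_space set \<Rightarrow> 'a \<Rightarrow> ('a \<Rightarrow> 'b::euclidean_space) \<Rightarrow> ('a \<Rightarrow> 'b) \<Rightarrow> bool" where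
  "has_weak_deriv U e f g \<longleftrightarrow> locally_integrable_on U f \<and> locally_integrable_on U g \<and>
     (\<forall>\<phi>\<in>test_functions U.
        (LINT x|lebesgue_on U. dir_deriv \<phi> e x *\<^sub>R f x) = - (LINT x|lebesgue_on U. \<phi> x *\<^sub>R g x))"

text \<open>Gradient matrices have the entries \<open>G $ i $ j = \<partial>\<^sub>j u\<^sub>i\<close>.\<close>

definition has_weak_grad ::
  "(real^2) set \<Rightarrow> (real^2 \<Rightarrow> real^2) \<Rightarrow> (real^2 \<Rightarrow> real^2^2) \<Rightarrow> bool" where
  "has_weak_grad U u G \<longleftrightarrow> (\<forall>j. has_weak_deriv U (axis j 1) u (\<lambda>x. column j (G x)))"

definition weak_grad :: "(real^2) set \<Rightarrow> (real^2 \<Rightarrow> real^2) \<Rightarrow> real^2 \<Rightarrow> real^2^2" where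
  "weak_grad U u = (SOME G. has_weak_grad U u G)"

text \<open>\<open>W\<^sup>1\<^sup>,\<^sup>p(U; \<real>\<^sup>2)\<close>\<close>

definition sobolev1 :: "nat \<Rightarrow> (real^2) set \<Rightarrow> (real^2 \<Rightarrow> real^2) \<Rightarrow> bool" where
  "sobolev1 p U u \<longleftrightarrow> lp_on p U u \<and> (\<exists>G. has_weak_grad U u G \<and> lp_on p U G)"

text \<open>Value at the test function \<open>\<phi>\<close> of the row-wise distribution
  \<open>\<partial>\<^sub>1 B\<^sub>\<cdot>\<^sub>2 - (1/\<epsilon>) \<partial>\<^sub>2 B\<^sub>\<cdot>\<^sub>1\<close>; the unscaled curl is the case \<open>\<epsilon> = 1\<close>.\<close>

definition distr_scaled_curl ::
  "real \<Rightarrow> (real^2) set \<Rightarrow> (real^2 \<Rightarrow> real^2^2) \<Rightarrow> (real^2 \<Rightarrow> real) \<Rightarrow> real^2" where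
  "distr_scaled_curl \<epsilon> U B \<phi> =
     - (LINT x|lebesgue_on U. dir_deriv \<phi> (axis 1 1) x *\<^sub>R column 2 (B x))
     + (1 / \<epsilon>) *\<^sub>R (LINT x|lebesgue_on U. dir_deriv \<phi> (axis 2 1) x *\<^sub>R column 1 (B x))"

abbreviation distr_curl ::
  "(real^2) set \<Rightarrow> (real^2 \<Rightarrow> real^2^2) \<Rightarrow> (real^2 \<Rightarrow> real) \<Rightarrow> real^2" where
  "distr_curl \<equiv> distr_scaled_curl 1"

definition has_scaled_curl ::
  "real \<Rightarrow> (real^2) set \<Rightarrow> (real^2 \<Rightarrow> real^2^2) \<Rightarrow> (real^2 \<Rightarrow> real^2) \<Rightarrow> bool" where
  "has_scaled_curl \<epsilon> U B c \<longleftrightarrow> locally_integrable_on U B \<and> locally_integrable_on U c \<and>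
     (\<forall>\<phi>\<in>test_functions U. distr_scaled_curl \<epsilon> U B \<phi> = (LINT x|lebesgue_on U. \<phi> x *\<^sub>R c x))"

abbreviation has_weak_curl ::
  "(real^2) set \<Rightarrow> (real^2 \<Rightarrow> real^2^2) \<Rightarrow> (real^2 \<Rightarrow> real^2) \<Rightarrow> bool" where
  "has_weak_curl \<equiv> has_scaled_curl 1"

definition weak_curl :: "(real^2) set \<Rightarrow> (real^2 \<Rightarrow> real^2^2) \<Rightarrow> real^2 \<Rightarrow> real^2" where
  "weak_curl U B = (SOME c. has_weak_curl U B c)"

definition H_curl :: "(real^2) set \<Rightarrow> (real^2 \<Rightarrow> real^2^2) \<Rightarrow> bool" where
  "H_curl U B \<longleftrightarrow> lp_on 2 U B \<and> (\<exists>c. has_weak_curl U B c \<and> lp_on 2 U c)"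

section \<open>Special functions of bounded variation, traces, Hausdorff measure\<close>

text \<open>The distributional derivative of \<open>u\<close> is a finite matrix-valued Borel measure \<open>Du\<close> on \<open>U\<close>,
  given through its polar decomposition \<open>Du = \<sigma> \<mu>\<close> with \<open>\<mu> = |Du|\<close> and \<open>|\<sigma>| = 1\<close>.\<close>

definition has_deriv_measure ::
  "(real^2) set \<Rightarrow> (real^2 \<Rightarrow> real^2) \<Rightarrow> (real^2) measure \<Rightarrow> (real^2 \<Rightarrow> real^2^2) \<Rightarrow> bool" where
  "has_deriv_measure U u \<mu> \<sigma> \<longleftrightarrow>
     finite_measure \<mu> \<and> sets \<mu> = sets (restrict_space borel U) \<and>
     \<sigma> \<in> borel_measurable \<mu> \<and> (AE x in \<mu>. norm (\<sigma> x) = 1) \<and>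
     (\<forall>\<phi>\<in>test_functions U. \<forall>j.
        (LINT x|lebesgue_on U. dir_deriv \<phi> (axis j 1) x *\<^sub>R u x) =
        - (LINT x|\<mu>. \<phi> x *\<^sub>R column j (\<sigma> x)))"

definition bv :: "(real^2) set \<Rightarrow> (real^2 \<Rightarrow> real^2) \<Rightarrow> bool" where
  "bv U u \<longleftrightarrow> lp_on 1 U u \<and> (\<exists>\<mu> \<sigma>. has_deriv_measure U u \<mu> \<sigma>)"

text \<open>Lebesgue decomposition of \<open>Du = \<sigma> \<mu>\<close>: off the Lebesgue-null Borel set \<open>N\<close> it has the density
  \<open>G\<close> with respect to Lebesgue measure, so its absolutely continuous part is \<open>G\<close> times Lebesgue
  measure and its singular part is the restriction of \<open>Du\<close> to \<open>N\<close>.\<close>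

definition lebesgue_decomp ::
  "(real^2) set \<Rightarrow> (real^2) measure \<Rightarrow> (real^2 \<Rightarrow> real^2^2) \<Rightarrow> (real^2 \<Rightarrow> real^2^2) \<Rightarrow> (real^2) set \<Rightarrow> bool"
  where
  "lebesgue_decomp U \<mu> \<sigma> G N \<longleftrightarrow>
     lp_on 1 U G \<and> N \<in> sets borel \<and> N \<subseteq> U \<and> N \<in> null_sets lebesgue \<and>
     (\<forall>A\<in>sets borel. A \<subseteq> U - N \<longrightarrow> (LINT x:A|\<mu>. \<sigma> x) = (LINT x:A|lebesgue. G x))"

text \<open>\<open>G\<close> is the density \<open>\<nabla>u\<close> of the absolutely continuous part of \<open>Du\<close>.\<close>

definition has_ac_grad ::
  "(real^2) set \<Rightarrow> (real^2 \<Rightarrow> real^2) \<Rightarrow> (real^2 \<Rightarrow> real^2^2) \<Rightarrow> bool" where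
  "has_ac_grad U u G \<longleftrightarrow>
     (\<exists>\<mu> \<sigma> N. has_deriv_measure U u \<mu> \<sigma> \<and> lebesgue_decomp U \<mu> \<sigma> G N)"

text \<open>Approximate limit of \<open>u\<close> at \<open>x\<close> within \<open>H\<close>.  If \<open>H\<close> is an open neighbourhood of \<open>x\<close> this is the
  usual approximate limit; if \<open>H\<close> is locally a half disc centred at \<open>x\<close> it is the pointwise trace
  at \<open>x\<close> from inside \<open>H\<close>.\<close>

definition approx_lim :: "(real^2) set \<Rightarrow> (real^2 \<Rightarrow> real^2) \<Rightarrow> real^2 \<Rightarrow> real^2 \<Rightarrow> bool" where
  "approx_lim H u x z \<longleftrightarrow>
     ((\<lambda>\<rho>. (LINT y:ball x \<rho> \<inter> H|lebesgue. norm (u y - z)) / measure lebesgue (ball x \<rho> \<inter> H))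
        \<longlongrightarrow> 0) (at_right 0)"

definition approx_discont_set :: "(real^2) set \<Rightarrow> (real^2 \<Rightarrow> real^2) \<Rightarrow> (real^2) set" where
  "approx_discont_set U u = {x\<in>U. \<nexists>z. approx_lim U u x z}"

text \<open>\<open>SBV(U; \<real>\<^sup>2)\<close>: the Cantor part of \<open>Du\<close>, which is the restriction of the singular part to the
  complement of the approximate discontinuity set, vanishes.\<close>

definition sbv :: "(real^2) set \<Rightarrow> (real^2 \<Rightarrow> real^2) \<Rightarrow> bool" where
  "sbv U u \<longleftrightarrow> bv U u \<and>
     (\<exists>\<mu> \<sigma> G N. has_deriv_measure U u \<mu> \<sigma> \<and> lebesgue_decomp U \<mu> \<sigma> G N \<and>
        (AE x in \<mu>. x \<in> N \<longrightarrow> x \<in> approx_discont_set U u))"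

definition circle_valued :: "(real^2) set \<Rightarrow> (real^2 \<Rightarrow> real^2) \<Rightarrow> bool" where
  "circle_valued U u \<longleftrightarrow> (AE x in lebesgue_on U. u x \<in> sphere 0 1)"

text \<open>In dimension one the normalising constant of the Hausdorff measure is \<open>1\<close>.
  The measure is defined on all Caratheodory-measurable sets.\<close>

definition hausdorff1_pre :: "real \<Rightarrow> (real^2) set \<Rightarrow> ennreal" where
  "hausdorff1_pre \<delta> A =
     (INF C\<in>{C :: nat \<Rightarrow> (real^2) set. A \<subseteq> (\<Union>i. C i) \<and> (\<forall>i. bounded (C i) \<and> diameter (C i) \<le> \<delta>)}.
        \<Sum>i. ennreal (diameter (C i)))"

definition hausdorff1_outer :: "(real^2) set \<Rightarrow> ennreal" where
  "hausdorff1_outer A = (SUP \<delta>\<in>{0<..}. hausdorff1_pre \<delta> A)"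

definition hausdorff1 :: "(real^2) measure" where
  "hausdorff1 = measure_of UNIV (lambda_system UNIV (Pow UNIV) hausdorff1_outer) hausdorff1_outer"

section \<open>The model\<close>

definition Omega :: "(real^2) set" where
  "Omega = box (vector [-1, -1]) (vector [1, 1])"

text \<open>The layer for \<open>\<epsilon> > 0\<close>; the limiting segment is not its instance at \<open>\<epsilon> = 0\<close>, which is empty.\<close>

definition layer :: "real \<Rightarrow> real \<Rightarrow> (real^2) set" where
  "layer \<epsilon> \<xi> = box (vector [-\<xi>, - (\<epsilon> * \<xi> / 2)]) (vector [1, \<epsilon> * \<xi> / 2])"

definition layer0 :: "real \<Rightarrow> (real^2) set" where
  "layer0 \<xi> = {x. -\<xi> < x $ 1 \<and> x $ 1 < 1 \<and> x $ 2 = 0}"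

definition energy ::
  "(real \<Rightarrow> real) \<Rightarrow> real \<Rightarrow> real \<Rightarrow> (real^2 \<Rightarrow> real^2) \<Rightarrow> (real^2 \<Rightarrow> real^2^2) \<Rightarrow> ennreal" where
  "energy W \<epsilon> \<xi> k B =
     (\<integral>\<^sup>+x. ennreal
        ((norm (k x) - 1)\<^sup>2 / (\<epsilon> * \<xi>\<^sup>2)
         + (norm (weak_grad Omega k x - B x))\<^sup>2
         + \<epsilon> * \<xi>\<^sup>2 * (norm (weak_curl Omega B x))\<^sup>2
         + 1 / (\<epsilon> * \<xi>\<^sup>2) * W (\<epsilon> * \<xi> * norm (B x))) \<partial>(lebesgue_on Omega))"

definition rescale :: "real \<Rightarrow> (real^2 \<Rightarrow> real^2^2) \<Rightarrow> real^2 \<Rightarrow> real^2^2" where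
  "rescale \<epsilon> B x = \<epsilon> *\<^sub>R B (vector [x $ 1, \<epsilon> * x $ 2])"

text \<open>\<open>J\<close> is the jump \<open>k\<^sup>+ - k\<^sup>-\<close> across \<open>(-\<xi>,1) \<times> {0}\<close>, as the continuous representative on
  \<open>[-\<xi>,1]\<close>.\<close>

definition has_jump :: "real \<Rightarrow> (real^2 \<Rightarrow> real^2) \<Rightarrow> (real \<Rightarrow> real^2) \<Rightarrow> bool" where
  "has_jump \<xi> k J \<longleftrightarrow> continuous_on {-\<xi>..1} J \<and>
     (\<exists>kp km.
        (AE s in lebesgue_on {-\<xi><..<1}. approx_lim (Omega \<inter> {x. x $ 2 > 0}) k (vector [s, 0]) (kp s)) \<and>
        (AE s in lebesgue_on {-\<xi><..<1}. approx_lim (Omega \<inter> {x. x $ 2 < 0}) k (vector [s, 0]) (km s)) \<and>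
        (AE s in lebesgue_on {-\<xi><..<1}. J s = kp s - km s))"

end

theory Submission
  imports Defs "HOL-Library.Diagonal_Subsequence"
begin

text \<open>The stretching \<open>(x\<^sub>1, x\<^sub>2) \<mapsto> (x\<^sub>1, \<epsilon> x\<^sub>2)\<close> turns the energy bound into \<open>L\<^sup>2\<close> bounds for \<open>k\<close>,
  for \<open>H = \<nabla>k - B\<close> and, on the fixed layer \<open>L\<^sub>1\<close>, for the rescaled \<open>B\<close> and its rescaled curl, so all of them
  converge weakly along a subsequence.  Moreover \<open>\<nabla>k\<close> is bounded in \<open>L\<^sup>1\<close>, and a Poincare inequality on
  small squares upgrades the convergence of \<open>k\<close> to strong convergence.  Let \<open>b\<^sub>j(x\<^sub>1)\<close> and \<open>a(x\<^sub>1)\<close> be the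
  integrals over the cross section of the layer of the columns of the limit of the rescaled \<open>B\<close> and of
  \<open>\<alpha>\<close>.  As distributions on \<open>\<Omega>\<close>, \<open>B\<close> and \<open>curl B\<close> converge to \<open>b\<close> and \<open>a\<close> times the length measure of
  the segment, whose curl equation splits into \<open>b\<^sub>1 = 0\<close> and \<open>b\<^sub>2' = a\<close>.  Hence \<open>b\<^sub>2 = J\<close> is the primitive of
  \<open>a\<close>, and \<open>Dk\<close> is \<open>H dx\<close> plus the second column \<open>J\<close> on the segment.  Integrating this identity in the
  direction \<open>x\<^sub>2\<close> shows that \<open>J\<close> is the difference of the two traces; in particular the segment consists of
  approximate discontinuities wherever \<open>J\<close> does not vanish.  The formula for \<open>curl(\<nabla>k)\<close> is the limit of
  \<open>curl(H + B) = 0\<close>.\<close>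

section \<open>Test functions\<close>

text \<open>The lower bound x^2 / K - K of the potential controls \<epsilon> |B|^2 in L^1, because
  the lost constant K / (\<epsilon> \<xi>^2) is integrated over a layer whose area is proportional
  to \<epsilon>. The factor \<epsilon> of the rescaling turns just this quantity into an L^2 norm,
  while for \<open>B\<close> itself only an L^1 bound remains. Compactness of \<open>k\<close> is
  therefore that of W^(1,1), and the step from L^1 to L^2 rests on |k| being close to 1: differences
  of size beyond 4 are paid for by the energy. The first density on the segment vanishes because it
  enters the curl with the transversal derivative of the length measure, which no other term can
  balance. The layer begins at -\<xi>, inside \<Omega>, but leaves \<Omega> at x_1 = 1. So the jump
  starts from 0, while its value at 1 is the total curl; test functions on \<Omega> do not see that
  end, and the mean of the curl is passed to the limit separately, with the constant function 1. The
  given fields are Lebesgue measurable with chosen weak derivatives. They are exchanged for Borel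
  functions on the whole plane, so that Fubini gives information on single lines.\<close>

lemma dir_deriv_eqI: "(f has_derivative f') (at x) \<Longrightarrow> dir_deriv f e x = f' e"
  unfolding dir_deriv_def using frechet_derivative_at by metis

lemma dir_deriv_real_eqI:
  "(f has_real_derivative d) (at x) \<Longrightarrow> dir_deriv f 1 x = d"
  using dir_deriv_eqI[of f "(*) d" x 1] by (simp add: has_field_derivative_def)

lemma Ck_Suc_has_derivative:
  "Ck (Suc n) f \<Longrightarrow> (f has_derivative frechet_derivative f (at x)) (at x)"
  using frechet_derivative_works by auto

lemma Ck_mono_Suc: "Ck (Suc n) f \<Longrightarrow> Ck n f"
proof (induction n arbitrary: f)
  case 0
  then show ?case
    by (auto simp: continuous_on_eq_continuous_at intro: differentiable_imp_continuous_within)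
next
  case (Suc n)
  then show ?case by simp
qed

lemma Ck_const: "Ck n (\<lambda>x. c)"
proof (induction n arbitrary: c)
  case (Suc n)
  have "dir_deriv (\<lambda>x. c) e = (\<lambda>x. 0)" for e :: 'a
    by (rule ext) (rule dir_deriv_eqI, rule has_derivative_const)
  with Suc show ?case by simp
qed simp

lemma Ck_add:
  assumes "Ck n f" "Ck n g"
  shows "Ck n (\<lambda>x. f x + g x)"
  using assms
proof (induction n arbitrary: f g)
  case 0
  then show ?case by (auto intro: continuous_on_add)
next
  case (Suc n)
  have "dir_deriv (\<lambda>x. f x + g x) e = (\<lambda>x. dir_deriv f e x + dir_deriv g e x)" for e
    unfolding dir_deriv_def[of f] dir_deriv_def[of g]
    by (intro ext dir_deriv_eqI has_derivative_add Ck_Suc_has_derivative[OF Suc.prems(1)]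
          Ck_Suc_has_derivative[OF Suc.prems(2)])
  with Suc show ?case by (auto intro!: differentiable_add)
qed

lemma Ck_mult:
  assumes "Ck n f" "Ck n g"
  shows "Ck n (\<lambda>x. f x * g x)"
  using assms
proof (induction n arbitrary: f g)
  case 0
  then show ?case by (auto intro: continuous_on_mult)
next
  case (Suc n)
  have "dir_deriv (\<lambda>x. f x * g x) e = (\<lambda>x. f x * dir_deriv g e x + dir_deriv f e x * g x)" for e
    unfolding dir_deriv_def[of f] dir_deriv_def[of g]
    by (intro ext dir_deriv_eqI has_derivative_mult Ck_Suc_has_derivative[OF Suc.prems(1)]
          Ck_Suc_has_derivative[OF Suc.prems(2)])
  moreover have "Ck n (\<lambda>x. f x * dir_deriv g e x + dir_deriv f e x * g x)" if "e \<in> Basis" for e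
    using that Suc.prems Ck_mono_Suc[OF Suc.prems(1)] Ck_mono_Suc[OF Suc.prems(2)]
    by (intro Ck_add Suc.IH) auto
  ultimately show ?case using Suc.prems by (auto intro!: differentiable_mult)
qed

lemma Ck_sum:
  assumes "\<And>i. i \<in> I \<Longrightarrow> Ck n (f i)"
  shows "Ck n (\<lambda>x. \<Sum>i\<in>I. f i x)"
  using assms by (induction I rule: infinite_finite_induct) (auto intro: Ck_const Ck_add)

lemma linear_expand_Basis:
  fixes L :: "'a::euclidean_space \<Rightarrow> real"
  assumes "linear L"
  shows "L v = (\<Sum>b\<in>Basis. (v \<bullet> b) * L b)"
proof -
  have "L v = L (\<Sum>b\<in>Basis. (v \<bullet> b) *\<^sub>R b)" by (simp add: euclidean_representation)
  also have "\<dots> = (\<Sum>b\<in>Basis. (v \<bullet> b) * L b)"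
    using assms by (simp add: linear_sum linear_cmul)
  finally show ?thesis .
qed

text \<open>Expanding the chain rule over \<open>Basis\<close> leaves only derivatives along basis
  vectors, the only ones that \<open>Ck\<close> controls.\<close>

lemma dir_deriv_affine:
  fixes L :: "'a::euclidean_space \<Rightarrow> 'b::euclidean_space"
  assumes "Ck (Suc n) f" "bounded_linear L"
  shows "dir_deriv (\<lambda>x. f (L x + c)) e = (\<lambda>x. \<Sum>b\<in>Basis. (L e \<bullet> b) * dir_deriv f b (L x + c))"
proof
  fix x
  let ?f' = "frechet_derivative f (at (L x + c))"
  have d: "(f has_derivative ?f') (at (L x + c))" by (rule Ck_Suc_has_derivative[OF assms(1)])
  have "((\<lambda>x. L x + c) has_derivative L) (at x)"
    using has_derivative_add[OF bounded_linear.has_derivative[OF assms(2) has_derivative_ident] has_derivative_const[of c]]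
    by simp
  from diff_chain_at[OF this d] have "((\<lambda>x. f (L x + c)) has_derivative (\<lambda>v. ?f' (L v))) (at x)"
    by (simp add: o_def)
  then have "dir_deriv (\<lambda>x. f (L x + c)) e x = ?f' (L e)"
    by (rule dir_deriv_eqI)
  also have "\<dots> = (\<Sum>b\<in>Basis. (L e \<bullet> b) * ?f' b)"
    by (rule linear_expand_Basis) (use d has_derivative_linear in blast)
  finally show "dir_deriv (\<lambda>x. f (L x + c)) e x = (\<Sum>b\<in>Basis. (L e \<bullet> b) * dir_deriv f b (L x + c))"
    by (simp add: dir_deriv_def)
qed

lemma Ck_affine:
  fixes L :: "'a::euclidean_space \<Rightarrow> 'b::euclidean_space"
  assumes "Ck n f" "bounded_linear L"
  shows "Ck n (\<lambda>x. f (L x + c))"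
  using assms(1)
proof (induction n arbitrary: f)
  case 0
  have "continuous_on UNIV (\<lambda>x. L x + c)"
    by (intro continuous_intros linear_continuous_on assms)
  with 0 show ?case
    by (auto intro: continuous_on_compose2)
next
  case (Suc n)
  have "(\<lambda>x. f (L x + c)) differentiable at x" for x
  proof -
    have "(\<lambda>x. L x + c) differentiable at x"
      using assms(2) by (intro differentiable_add differentiable_const bounded_linear_imp_differentiable)
    then show ?thesis
      using differentiable_chain_at[of "\<lambda>x. L x + c" x f] Suc.prems by (simp add: o_def)
  qed
  moreover have "Ck n (dir_deriv (\<lambda>x. f (L x + c)) e)" if "e \<in> Basis" for e
    unfolding dir_deriv_affine[OF Suc.prems assms(2)]
    using Suc by (intro Ck_sum Ck_mult Ck_const) auto
  ultimately show ?case by simp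
qed

lemma Ck_id_real: "Ck n (\<lambda>t::real. t)"
proof (cases n)
  case (Suc m)
  have "dir_deriv (\<lambda>t::real. t) 1 = (\<lambda>t. 1)"
    by (rule ext) (rule dir_deriv_real_eqI, rule DERIV_ident)
  with Suc show ?thesis by (simp add: Ck_const)
qed simp

text \<open>Any compact set outside which the function vanishes replaces the closure of the support,
  so later proofs only have to exhibit such a set.\<close>

lemma test_functionsI:
  assumes "\<And>n. Ck n \<phi>" "compact K" "K \<subseteq> U" "\<And>x. x \<notin> K \<Longrightarrow> \<phi> x = 0"
  shows "\<phi> \<in> test_functions U"
proof -
  have "closure {x. \<phi> x \<noteq> 0} \<subseteq> K"
    using assms(2,4) by (intro closure_minimal) (auto simp: compact_imp_closed)
  moreover have "compact (closure {x. \<phi> x \<noteq> 0})"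
    using assms(2) calculation by (metis closed_closure closed_Int_compact inf.absorb_iff1)
  ultimately show ?thesis
    using assms(1,3) unfolding test_functions_def by auto
qed

lemma test_functionsE:
  assumes "\<phi> \<in> test_functions U"
  obtains K where "compact K" "K \<subseteq> U" "\<And>x. x \<notin> K \<Longrightarrow> \<phi> x = 0"
  using assms closure_subset[of "{x. \<phi> x \<noteq> 0}"] unfolding test_functions_def by blast

lemma test_functions_Ck: "\<phi> \<in> test_functions U \<Longrightarrow> Ck n \<phi>"
  by (simp add: test_functions_def)

lemma test_functions_mono: "U \<subseteq> V \<Longrightarrow> test_functions U \<subseteq> test_functions V"
  by (auto simp: test_functions_def)

lemma test_functions_eq_0: "\<phi> \<in> test_functions U \<Longrightarrow> x \<notin> U \<Longrightarrow> \<phi> x = 0"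
  by (metis subsetD test_functionsE)

lemma test_functions_continuous: "\<phi> \<in> test_functions U \<Longrightarrow> continuous_on A \<phi>"
  using test_functions_Ck[of \<phi> U 0] by (auto intro: continuous_on_subset)

lemma test_functions_measurable [measurable (raw)]:
  "\<phi> \<in> test_functions U \<Longrightarrow> \<phi> \<in> borel_measurable borel"
  by (intro borel_measurable_continuous_onI test_functions_continuous)

lemma test_functions_bounded:
  assumes "\<phi> \<in> test_functions U"
  obtains C where "C > 0" "\<And>x. \<bar>\<phi> x\<bar> \<le> C"
proof -
  obtain K where K: "compact K" "\<And>x. x \<notin> K \<Longrightarrow> \<phi> x = 0"
    using test_functionsE[OF assms] by metis
  have "bounded (\<phi> ` K)"
    by (intro compact_imp_bounded compact_continuous_image test_functions_continuous[OF assms] K)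
  then obtain C where "C > 0" "\<forall>y\<in>\<phi> ` K. norm y \<le> C"
    by (auto simp: bounded_pos)
  with K that[of C] show ?thesis by (metis abs_zero imageI less_le real_norm_def)
qed

lemma test_functions_has_real_derivative:
  assumes "\<psi> \<in> test_functions (U::real set)"
  shows "(\<psi> has_real_derivative dir_deriv \<psi> 1 x) (at x)"
proof -
  have "\<psi> differentiable at x" using test_functions_Ck[OF assms, of 1] by simp
  then obtain d where "(\<psi> has_real_derivative d) (at x)"
    using real_differentiable_def by blast
  with dir_deriv_real_eqI[OF this] show ?thesis by simp
qed

lemma test_functions_dir_deriv:
  assumes "\<phi> \<in> test_functions U" "e \<in> Basis"
  shows "dir_deriv \<phi> e \<in> test_functions U"
proof -
  obtain K where K: "compact K" "K \<subseteq> U" "\<And>x. x \<notin> K \<Longrightarrow> \<phi> x = 0"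
    using test_functionsE[OF assms(1)] by metis
  show ?thesis
  proof (rule test_functionsI[OF _ K(1,2)])
    show "Ck n (dir_deriv \<phi> e)" for n
      using test_functions_Ck[OF assms(1), of "Suc n"] assms(2) by simp
    show "dir_deriv \<phi> e x = 0" if "x \<notin> K" for x
    proof (rule dir_deriv_eqI)
      have "open (- K)" using K by (simp add: compact_imp_closed open_Compl)
      then show "(\<phi> has_derivative (\<lambda>_. 0)) (at x)"
        by (rule has_derivative_transform_within_open[OF has_derivative_const[of 0]]) (use that K in auto)
    qed
  qed
qed

lemma test_functions_mult:
  assumes "\<phi> \<in> test_functions U" "\<And>n. Ck n f"
  shows "(\<lambda>x. f x * \<phi> x) \<in> test_functions U"
proof -
  obtain K where K: "compact K" "K \<subseteq> U" "\<And>x. x \<notin> K \<Longrightarrow> \<phi> x = 0"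
    using test_functionsE[OF assms(1)] by metis
  show ?thesis
    by (rule test_functionsI[OF _ K(1,2)]) (auto intro: Ck_mult assms test_functions_Ck[OF assms(1)] simp: K)
qed

lemma test_functions_add:
  assumes "\<phi> \<in> test_functions U" "\<psi> \<in> test_functions U"
  shows "(\<lambda>x. \<phi> x + \<psi> x) \<in> test_functions U"
proof -
  obtain K L where K: "compact K" "K \<subseteq> U" "\<And>x. x \<notin> K \<Longrightarrow> \<phi> x = 0"
    and L: "compact L" "L \<subseteq> U" "\<And>x. x \<notin> L \<Longrightarrow> \<psi> x = 0"
    using test_functionsE[OF assms(1)] test_functionsE[OF assms(2)] by metis
  show ?thesis
    by (rule test_functionsI[of _ "K \<union> L"])
       (use K L in \<open>auto intro: Ck_add test_functions_Ck[OF assms(1)] test_functions_Ck[OF assms(2)]\<close>)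
qed

section \<open>Smooth cutoff functions\<close>

text \<open>For \<open>k = 0\<close> this is the classical flat function exp(-1/t). The powers of
  1/t make the family closed under differentiation up to linear combinations, so smoothness becomes
  an induction over all \<open>k\<close> at once.\<close>

definition flat_exp :: "nat \<Rightarrow> real \<Rightarrow> real" where
  "flat_exp k t = (if t \<le> 0 then 0 else (1 / t) ^ k * exp (- (1 / t)))"

lemma flat_exp_tendsto_0: "(flat_exp k \<longlongrightarrow> 0) (at 0)"
proof -
  have "((\<lambda>t. (1 / t) ^ k * exp (- (1 / t))) \<longlongrightarrow> 0) (at_right (0::real))"
  proof -
    have "((\<lambda>y::real. y ^ k / exp y) \<longlongrightarrow> 0) at_top" by (rule tendsto_power_div_exp_0)
    from filterlim_compose[OF this filterlim_inverse_at_top_right]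
    show ?thesis by (simp add: exp_minus field_simps)
  qed
  then have "(flat_exp k \<longlongrightarrow> 0) (at_right 0)"
    by (rule Lim_transform_eventually)
       (auto simp: flat_exp_def eventually_at intro!: exI[of _ 1])
  moreover have "(flat_exp k \<longlongrightarrow> 0) (at_left 0)"
    by (rule Lim_transform_eventually[OF tendsto_const])
       (auto simp: flat_exp_def eventually_at intro!: exI[of _ 1])
  ultimately show ?thesis by (simp add: filterlim_split_at)
qed

lemma flat_exp_deriv:
  "(flat_exp k has_real_derivative (- real k * flat_exp (Suc k) t + flat_exp (k + 2) t)) (at t)"
proof (cases t "0::real" rule: linorder_cases)
  case less
  have "((\<lambda>_. 0) has_real_derivative 0) (at t)" by simp
  then have "(flat_exp k has_real_derivative 0) (at t)"
    by (rule has_field_derivative_transform_within[where d="-t"]) (use less in \<open>auto simp: flat_exp_def dist_real_def\<close>)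
  with less show ?thesis by (simp add: flat_exp_def)
next
  case equal
  \<comment> \<open>At the origin the difference quotient of \<open>flat_exp k\<close> is
    \<open>flat_exp (Suc k)\<close> itself.\<close>
  have "((\<lambda>h. (flat_exp k (0 + h) - flat_exp k 0) / h) \<longlongrightarrow> 0) (at 0)"
    by (rule Lim_transform_eventually[OF flat_exp_tendsto_0[of "Suc k"]])
       (auto simp: flat_exp_def eventually_at intro!: exI[of _ 1])
  then have "(flat_exp k has_real_derivative 0) (at 0)"
    by (simp add: DERIV_def)
  with equal show ?thesis by (simp add: flat_exp_def)
next
  case greater
  have "((\<lambda>t. (1 / t) ^ k * exp (- (1 / t))) has_real_derivative
      (- real k * (1/t)^(Suc k) + (1/t)^(k+2)) * exp (- (1/t))) (at t)"
  proof -
    have 1: "((\<lambda>t. 1 / t) has_real_derivative - ((1 / t)\<^sup>2)) (at t)"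
      "((\<lambda>t. exp (- (1 / t))) has_real_derivative exp (- (1 / t)) * (1 / t)\<^sup>2) (at t)"
      using greater by (auto intro!: derivative_eq_intros simp: power2_eq_square)
    show ?thesis
      by (rule DERIV_cong[OF DERIV_mult[OF DERIV_power[OF 1(1), of k] 1(2)]])
         (cases k; simp add: algebra_simps power2_eq_square add_divide_distrib diff_divide_distrib)
  qed
  then have "(flat_exp k has_real_derivative
      (- real k * (1/t)^(Suc k) + (1/t)^(k+2)) * exp (- (1/t))) (at t)"
    by (rule has_field_derivative_transform_within[where d=t]) (use greater in \<open>auto simp: flat_exp_def dist_real_def\<close>)
  with greater show ?thesis by (simp add: flat_exp_def algebra_simps)
qed

lemma Ck_flat_exp: "Ck n (flat_exp k)"
proof (induction n arbitrary: k)
  case 0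
  then show ?case
    by (auto simp: continuous_on_eq_continuous_at intro: DERIV_isCont flat_exp_deriv)
next
  case (Suc n)
  have "dir_deriv (flat_exp k) 1 = (\<lambda>t. - real k * flat_exp (Suc k) t + flat_exp (k + 2) t)"
    by (rule ext) (rule dir_deriv_real_eqI, rule flat_exp_deriv)
  moreover have "flat_exp k differentiable at t" for t
    using flat_exp_deriv real_differentiable_def by blast
  moreover have "Ck n (\<lambda>t. - real k * flat_exp (Suc k) t + flat_exp (k + 2) t)"
    by (intro Ck_add Ck_mult Ck_const Suc)
  ultimately show ?case by (simp del: Basis_real_def add: Basis_real_def)
qed

text \<open>The parameter \<open>m\<close> steepens both edges: as it grows, the bumps tend to the
  indicator of the open interval and stay between 0 and 1, so dominated convergence takes the place
  of mollification.\<close>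

definition bump :: "real \<Rightarrow> real \<Rightarrow> real \<Rightarrow> real \<Rightarrow> real" where
  "bump m a b t = flat_exp 0 (m * (t - a)) * flat_exp 0 (m * (b - t))"

lemma bump_test:
  assumes "m > 0" "{a..b} \<subseteq> U"
  shows "bump m a b \<in> test_functions U"
proof (rule test_functionsI[OF _ _ assms(2)])
  have "Ck n (\<lambda>t. flat_exp 0 (m * t + (- (m * a))))" "Ck n (\<lambda>t. flat_exp 0 ((- m) * t + m * b))" for n
    by (rule Ck_affine[OF Ck_flat_exp], rule bounded_linear_mult_right)+
  from Ck_mult[OF this] show "Ck n (bump m a b)" for n
    by (simp add: bump_def[abs_def] algebra_simps)
  show "bump m a b t = 0" if "t \<notin> {a..b}" for t
    using that assms(1) by (auto simp: bump_def flat_exp_def mult_le_0_iff not_le)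
qed simp

lemma flat_exp_0_bounds: "0 \<le> flat_exp 0 t" "flat_exp 0 t \<le> 1"
  by (auto simp: flat_exp_def)

lemma bump_bounds: "0 \<le> bump m a b t" "bump m a b t \<le> 1"
  using flat_exp_0_bounds by (auto simp: bump_def intro: mult_le_one)

lemma bump_pos: "m > 0 \<Longrightarrow> a < t \<Longrightarrow> t < b \<Longrightarrow> 0 < bump m a b t"
  by (auto simp: bump_def flat_exp_def mult_le_0_iff not_le)

lemma bump_tendsto_indicator:
  "(\<lambda>m. bump (real (Suc m)) a b t) \<longlonglongrightarrow> indicator {a<..<b} t"
proof (cases "t \<in> {a<..<b}")
  case True
  have lim: "(\<lambda>m. flat_exp 0 (real (Suc m) * d)) \<longlonglongrightarrow> 1" if "d > 0" for d
  proof -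
    have "(\<lambda>m. exp (- (inverse (real (Suc m)) * (1 / d)))) \<longlonglongrightarrow> exp (- (0 * (1/d)))"
      by (intro tendsto_intros LIMSEQ_inverse_real_of_nat)
    moreover have "flat_exp 0 (real (Suc m) * d) = exp (- (inverse (real (Suc m)) * (1 / d)))" for m
      using that by (auto simp: flat_exp_def field_simps mult_le_0_iff not_le add_pos_nonneg)
    ultimately show ?thesis by simp
  qed
  show ?thesis
    using tendsto_mult[OF lim[of "t - a"] lim[of "b - t"]] True by (simp add: bump_def)
next
  case False
  then have "bump (real (Suc m)) a b t = 0" for m
    by (auto simp: bump_def flat_exp_def mult_le_0_iff not_le not_less)
  with False show ?thesis by simp
qed

section \<open>Coordinates, mixed derivatives and product test functions\<close>

abbreviation pt :: "real \<Rightarrow> real \<Rightarrow> real^2" where "pt s t \<equiv> vector [s, t]"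

lemma pt_eta [simp]: "pt (x $ 1) (x $ 2) = x"
  by (simp add: vec_eq_iff forall_2)

lemma pt_eq_axis: "pt s t = s *\<^sub>R axis 1 1 + t *\<^sub>R axis 2 1"
  by (simp add: vec_eq_iff forall_2 axis_def)

lemma continuous_on_pt [continuous_intros]:
  "continuous_on A f \<Longrightarrow> continuous_on A g \<Longrightarrow> continuous_on A (\<lambda>x. pt (f x) (g x))"
  unfolding pt_eq_axis by (intro continuous_intros)

lemma borel_measurable_pt [measurable]: "(\<lambda>(s, t). pt s t) \<in> borel_measurable (borel \<Otimes>\<^sub>M borel)"
  unfolding pt_eq_axis by measurable

lemma measurable_vec_nth_2 [measurable (raw)]:
  fixes f :: "'a \<Rightarrow> real^2"
  assumes "f \<in> borel_measurable M"
  shows "(\<lambda>x. f x $ i) \<in> borel_measurable M"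
  by (rule measurable_compose[OF assms]) (intro borel_measurable_continuous_onI continuous_intros)

lemma indicator_atMost_measurable [measurable (raw)]:
  fixes f g :: "'a \<Rightarrow> real"
  assumes [measurable]: "f \<in> borel_measurable M" "g \<in> borel_measurable M"
  shows "(\<lambda>x. indicator {..f x} (g x) :: real) \<in> borel_measurable M"
proof -
  have "(\<lambda>x. indicator {..f x} (g x) :: real) = (\<lambda>x. if g x \<le> f x then 1 else 0)"
    by (auto simp: indicator_def)
  then show ?thesis by simp
qed

lemma axis_Basis_2 [simp]: "axis i (1::real) \<in> (Basis :: (real^2) set)"
  by (simp add: axis_in_Basis_iff)

lemma axis_nth_2 [simp]:
  "(axis 1 1 :: real^2) $ 1 = 1" "(axis 1 1 :: real^2) $ 2 = 0"
  "(axis 2 1 :: real^2) $ 1 = 0" "(axis 2 1 :: real^2) $ 2 = 1"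
  by (simp_all add: axis_def)

lemma Basis_real2: "(Basis :: (real^2) set) = {axis 1 1, axis 2 1}"
  by (auto simp: Basis_vec_def exhaust_2) (metis exhaust_2)

lemma line_has_real_derivative:
  assumes "\<phi> differentiable (at (y + t *\<^sub>R e))"
  shows "((\<lambda>t. \<phi> (y + t *\<^sub>R e)) has_real_derivative dir_deriv \<phi> e (y + t *\<^sub>R e)) (at t)"
proof -
  let ?D = "frechet_derivative \<phi> (at (y + t *\<^sub>R e))"
  have D: "(\<phi> has_derivative ?D) (at (y + t *\<^sub>R e))"
    using assms frechet_derivative_works by blast
  have "((\<lambda>t. y + t *\<^sub>R e) has_derivative (\<lambda>h. h *\<^sub>R e)) (at t)"
    by (auto intro!: derivative_eq_intros)
  from diff_chain_at[OF this D] have "((\<lambda>t. \<phi> (y + t *\<^sub>R e)) has_derivative (\<lambda>h. ?D (h *\<^sub>R e))) (at t)"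
    by (simp add: o_def)
  moreover have "?D (h *\<^sub>R e) = ?D e * h" for h
    using linear_cmul[OF has_derivative_linear[OF D], of h e] by simp
  ultimately show ?thesis
    by (simp add: has_field_derivative_def dir_deriv_def)
qed

text \<open>Two applications of the mean value theorem, one in each direction, turn the second
  difference into the mixed derivative at an intermediate point. Since the difference is symmetric
  in \<open>a\<close> and \<open>b\<close>, its limit shows that mixed derivatives commute.\<close>

lemma second_difference_tendsto:
  assumes "Ck 2 \<phi>" "a \<in> Basis" "b \<in> Basis"
  shows "((\<lambda>h. (\<phi> (x + h *\<^sub>R a + h *\<^sub>R b) - \<phi> (x + h *\<^sub>R a) - \<phi> (x + h *\<^sub>R b) + \<phi> x) / h\<^sup>2)
    \<longlongrightarrow> dir_deriv (dir_deriv \<phi> a) b x) (at_right 0)"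
proof (rule tendstoI)
  fix e :: real assume "e > 0"
  let ?D = "dir_deriv (dir_deriv \<phi> a) b"
  have C1: "Ck 1 (dir_deriv \<phi> a)" and C2: "Ck 1 \<phi>"
    using assms Ck_mono_Suc[of 1 \<phi>] by (auto simp: numeral_2_eq_2)
  have "continuous_on UNIV ?D"
    using C1 assms(3) by simp
  then obtain d where d: "d > 0" "\<And>y. dist y x < d \<Longrightarrow> dist (?D y) (?D x) < e"
    using \<open>e > 0\<close> by (metis UNIV_I continuous_on_iff)
  have "dist ((\<phi> (x + h *\<^sub>R a + h *\<^sub>R b) - \<phi> (x + h *\<^sub>R a) - \<phi> (x + h *\<^sub>R b) + \<phi> x) / h\<^sup>2) (?D x) < e"
    if h: "0 < h" "h < d / 2" for h
  proof -
    have "((\<lambda>t. \<phi> (x + h *\<^sub>R b + t *\<^sub>R a) - \<phi> (x + t *\<^sub>R a)) has_real_derivative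
        dir_deriv \<phi> a (x + h *\<^sub>R b + t *\<^sub>R a) - dir_deriv \<phi> a (x + t *\<^sub>R a)) (at t)" for t
      using C2 by (intro DERIV_diff line_has_real_derivative) simp_all
    then obtain s where s: "0 < s" "s < h"
      "(\<phi> (x + h *\<^sub>R b + h *\<^sub>R a) - \<phi> (x + h *\<^sub>R a)) - (\<phi> (x + h *\<^sub>R b + 0 *\<^sub>R a) - \<phi> (x + 0 *\<^sub>R a))
       = (h - 0) * (dir_deriv \<phi> a (x + h *\<^sub>R b + s *\<^sub>R a) - dir_deriv \<phi> a (x + s *\<^sub>R a))"
      using MVT2[OF h(1), of "\<lambda>t. \<phi> (x + h *\<^sub>R b + t *\<^sub>R a) - \<phi> (x + t *\<^sub>R a)"
          "\<lambda>t. dir_deriv \<phi> a (x + h *\<^sub>R b + t *\<^sub>R a) - dir_deriv \<phi> a (x + t *\<^sub>R a)"] by blast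
    have "((\<lambda>t. dir_deriv \<phi> a (x + s *\<^sub>R a + t *\<^sub>R b)) has_real_derivative
        ?D (x + s *\<^sub>R a + t *\<^sub>R b)) (at t)" for t
      using C1 by (intro line_has_real_derivative) simp_all
    then obtain r where r: "0 < r" "r < h"
      "dir_deriv \<phi> a (x + s *\<^sub>R a + h *\<^sub>R b) - dir_deriv \<phi> a (x + s *\<^sub>R a + 0 *\<^sub>R b)
       = (h - 0) * ?D (x + s *\<^sub>R a + r *\<^sub>R b)"
      using MVT2[OF h(1), of "\<lambda>t. dir_deriv \<phi> a (x + s *\<^sub>R a + t *\<^sub>R b)"
          "\<lambda>t. ?D (x + s *\<^sub>R a + t *\<^sub>R b)"] by blast
    have "(\<phi> (x + h *\<^sub>R a + h *\<^sub>R b) - \<phi> (x + h *\<^sub>R a) - \<phi> (x + h *\<^sub>R b) + \<phi> x) = h * (h * ?D (x + s *\<^sub>R a + r *\<^sub>R b))"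
      using s(3) r(3) by (simp add: algebra_simps)
    moreover have "dist (x + s *\<^sub>R a + r *\<^sub>R b) x < d"
    proof -
      have "dist (x + s *\<^sub>R a + r *\<^sub>R b) x = norm (s *\<^sub>R a + r *\<^sub>R b)"
        by (simp add: dist_norm algebra_simps)
      also have "\<dots> \<le> s + r"
        using assms s(1) r(1) norm_triangle_ineq[of "s *\<^sub>R a" "r *\<^sub>R b"] by simp
      finally show ?thesis using s(2) r(2) h(2) by linarith
    qed
    ultimately show ?thesis
      using d(2)[of "x + s *\<^sub>R a + r *\<^sub>R b"] h by (simp add: power2_eq_square)
  qed
  then show "\<forall>\<^sub>F h in at_right 0.
      dist ((\<phi> (x + h *\<^sub>R a + h *\<^sub>R b) - \<phi> (x + h *\<^sub>R a) - \<phi> (x + h *\<^sub>R b) + \<phi> x) / h\<^sup>2) (?D x) < e"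
    unfolding eventually_at_right_field using d(1) by (intro exI[of _ "d/2"]) auto
qed

lemma dir_deriv_commute:
  assumes "Ck 2 \<phi>" "a \<in> Basis" "b \<in> Basis"
  shows "dir_deriv (dir_deriv \<phi> a) b x = dir_deriv (dir_deriv \<phi> b) a x"
proof (rule tendsto_unique[OF trivial_limit_at_right_real second_difference_tendsto[OF assms]])
  show "((\<lambda>h. (\<phi> (x + h *\<^sub>R a + h *\<^sub>R b) - \<phi> (x + h *\<^sub>R a) - \<phi> (x + h *\<^sub>R b) + \<phi> x) / h\<^sup>2)
    \<longlongrightarrow> dir_deriv (dir_deriv \<phi> b) a x) (at_right 0)"
    using second_difference_tendsto[OF assms(1,3,2), of x] by (simp add: algebra_simps)
qed

lemma prod_test_dir_deriv:
  assumes "\<psi> \<in> test_functions S" "\<theta> \<in> test_functions T"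
  shows "dir_deriv (\<lambda>x::real^2. \<psi> (x $ 1) * \<theta> (x $ 2)) (axis 1 1) x = dir_deriv \<psi> 1 (x $ 1) * \<theta> (x $ 2)"
    and "dir_deriv (\<lambda>x::real^2. \<psi> (x $ 1) * \<theta> (x $ 2)) (axis 2 1) x = \<psi> (x $ 1) * dir_deriv \<theta> 1 (x $ 2)"
proof -
  have 1: "((\<lambda>x::real^2. \<psi> (x $ 1)) has_derivative (\<lambda>v. dir_deriv \<psi> 1 (x $ 1) * (v $ 1))) (at x)"
    using diff_chain_at[OF bounded_linear_imp_has_derivative[OF bounded_linear_vec_nth[of 1]]
        test_functions_has_real_derivative[OF assms(1), unfolded has_field_derivative_def]]
    by (simp add: o_def)
  have 2: "((\<lambda>x::real^2. \<theta> (x $ 2)) has_derivative (\<lambda>v. dir_deriv \<theta> 1 (x $ 2) * (v $ 2))) (at x)"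
    using diff_chain_at[OF bounded_linear_imp_has_derivative[OF bounded_linear_vec_nth[of 2]]
        test_functions_has_real_derivative[OF assms(2), unfolded has_field_derivative_def]]
    by (simp add: o_def)
  show "dir_deriv (\<lambda>x::real^2. \<psi> (x $ 1) * \<theta> (x $ 2)) (axis 1 1) x = dir_deriv \<psi> 1 (x $ 1) * \<theta> (x $ 2)"
    "dir_deriv (\<lambda>x::real^2. \<psi> (x $ 1) * \<theta> (x $ 2)) (axis 2 1) x = \<psi> (x $ 1) * dir_deriv \<theta> 1 (x $ 2)"
    using dir_deriv_eqI[OF has_derivative_mult[OF 1 2], of "axis 1 1"]
      dir_deriv_eqI[OF has_derivative_mult[OF 1 2], of "axis 2 1"]
    by (simp_all add: axis_def)
qed

lemma prod_test:
  assumes "\<psi> \<in> test_functions S" "\<theta> \<in> test_functions T"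
  shows "(\<lambda>x::real^2. \<psi> (x $ 1) * \<theta> (x $ 2)) \<in> test_functions {x. x $ 1 \<in> S \<and> x $ 2 \<in> T}"
proof -
  obtain K L where K: "compact K" "K \<subseteq> S" "\<And>x. x \<notin> K \<Longrightarrow> \<psi> x = 0"
    and L: "compact L" "L \<subseteq> T" "\<And>x. x \<notin> L \<Longrightarrow> \<theta> x = 0"
    using test_functionsE[OF assms(1)] test_functionsE[OF assms(2)] by metis
  show ?thesis
  proof (rule test_functionsI)
    show "compact ((\<lambda>z. pt (fst z) (snd z)) ` (K \<times> L))"
      using K L by (intro compact_continuous_image compact_Times continuous_intros)
    show "(\<lambda>z. pt (fst z) (snd z)) ` (K \<times> L) \<subseteq> {x. x $ 1 \<in> S \<and> x $ 2 \<in> T}"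
      using K L by auto
    show "Ck n (\<lambda>x::real^2. \<psi> (x $ 1) * \<theta> (x $ 2))" for n
      using Ck_affine[OF test_functions_Ck[OF assms(1)] bounded_linear_vec_nth, of n "1::2" 0]
        Ck_affine[OF test_functions_Ck[OF assms(2)] bounded_linear_vec_nth, of n "2::2" 0]
      by (intro Ck_mult) simp_all
    fix x :: "real^2"
    assume "x \<notin> (\<lambda>z. pt (fst z) (snd z)) ` (K \<times> L)"
    then have "\<not> (x $ 1 \<in> K \<and> x $ 2 \<in> L)"
      by (auto simp: image_iff) (metis pt_eta)
    then show "\<psi> (x $ 1) * \<theta> (x $ 2) = 0"
      using K L by auto
  qed
qed

lemma test_functions_integrable:
  fixes \<phi> :: "'a::euclidean_space \<Rightarrow> real"
  assumes "\<phi> \<in> test_functions U"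
  shows "integrable lborel \<phi>"
proof -
  obtain K where K: "compact K" "K \<subseteq> U" "\<And>x. x \<notin> K \<Longrightarrow> \<phi> x = 0"
    using test_functionsE[OF assms] by metis
  have "integrable lborel (\<lambda>x. indicator K x *\<^sub>R \<phi> x)"
    by (rule borel_integrable_compact[OF K(1) test_functions_continuous[OF assms]])
  moreover have "(\<lambda>x. indicator K x *\<^sub>R \<phi> x) = \<phi>"
    using K by (auto simp: indicator_def of_bool_def fun_eq_iff)
  ultimately show ?thesis by simp
qed

text \<open>A primitive that vanishes to the left of the support is constant to the right of it, and
  this constant is the integral of \<theta>, hence 0.\<close>

lemma test_antiderivative:
  fixes \<theta> :: "real \<Rightarrow> real"
  assumes "\<theta> \<in> test_functions {a<..<b}" "(LINT t|lborel. \<theta> t) = 0"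
  obtains X where "X \<in> test_functions {a<..<b}" "\<And>t. dir_deriv X 1 t = \<theta> t"
proof -
  obtain K where K: "compact K" "K \<subseteq> {a<..<b}" "\<And>x. x \<notin> K \<Longrightarrow> \<theta> x = 0"
    using test_functionsE[OF assms(1)] by metis
  obtain c d where cd: "a < c" "d < b" "K \<subseteq> {c..d}"
  proof (cases "K = {}")
    case True
    then show ?thesis using that[of "a + 1" "b - 1"] by simp
  next
    case False
    obtain c d where "c \<in> K" "\<forall>x\<in>K. c \<le> x" "d \<in> K" "\<forall>x\<in>K. x \<le> d"
      using compact_attains_inf[OF K(1) False] compact_attains_sup[OF K(1) False] by metis
    moreover from this K(2) have "a < c" "d < b" by auto
    moreover have "K \<subseteq> {c..d}" using calculation by auto
    ultimately show ?thesis by (intro that[of c d])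
  qed
  have z: "\<theta> t = 0" if "t < c \<or> t > d" for t
  proof (rule K(3))
    show "t \<notin> K" using that cd(3) by auto
  qed
  \<comment> \<open>Starting at \<open>a - 1\<close> leaves room to the left of \<open>c\<close>, so
    that the fundamental theorem gives a two-sided derivative at every point from \<open>c\<close>
    on.\<close>
  define X where "X t = integral {a - 1..t} \<theta>" for t
  have cont: "continuous_on A \<theta>" for A by (rule test_functions_continuous[OF assms(1)])
  have X0: "X t = 0" if "t < c" for t
  proof -
    have "integral {a - 1..t} \<theta> = integral {a - 1..t} (\<lambda>_. 0)"
      using that by (intro integral_cong z) auto
    then show ?thesis by (simp add: X_def)
  qed
  have X1: "X t = 0" if "t > d" for t
  proof -
    have "integral {a - 1..t} \<theta> = integral UNIV (\<lambda>s. if s \<in> {a - 1..t} then \<theta> s else 0)"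
      by (simp only: integral_restrict_UNIV)
    also have "(\<lambda>s. if s \<in> {a - 1..t} then \<theta> s else 0) = \<theta>"
    proof
      fix s show "(if s \<in> {a - 1..t} then \<theta> s else 0) = \<theta> s"
        using that cd z[of s] by (cases "s \<in> {a - 1..t}") auto
    qed
    also have "integral UNIV \<theta> = 0"
      using integral_unique[OF has_integral_integral_lborel[OF test_functions_integrable[OF assms(1)]]] assms(2)
      by simp
    finally show ?thesis by (simp add: X_def)
  qed
  have der: "(X has_real_derivative \<theta> t) (at t)" for t
  proof (cases "t < c")
    case True
    have "((\<lambda>_. 0) has_real_derivative 0) (at t)" by simp
    then have "(X has_real_derivative 0) (at t)"
      by (rule has_field_derivative_transform_within[where d = "c - t"])
         (use True in \<open>auto simp: dist_real_def intro!: X0\<close>)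
    with True z show ?thesis by simp
  next
    case False
    have "(X has_real_derivative \<theta> t) (at t within {a - 1..t + 1})"
      unfolding X_def by (rule integral_has_real_derivative[OF cont]) (use False cd in auto)
    moreover have "at t within {a - 1..t + 1} = at t"
      by (rule at_within_interior) (use False cd in auto)
    ultimately show ?thesis by simp
  qed
  have dd: "dir_deriv X 1 = \<theta>" by (rule ext, rule dir_deriv_real_eqI, rule der)
  have "X \<in> test_functions {a<..<b}"
  proof (rule test_functionsI)
    show "Ck n X" for n
    proof (rule Ck_mono_Suc)
      have "X differentiable at t" for t
        using der real_differentiable_def by blast
      then show "Ck (Suc n) X"
        using dd test_functions_Ck[OF assms(1), of n] by simp
    qed
    show "compact {c..d}" "{c..d} \<subseteq> {a<..<b}" using cd by auto
    show "X t = 0" if "t \<notin> {c..d}" for t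
      using that X0[of t] X1[of t] by (cases "t < c") auto
  qed
  from that[OF this] dd show ?thesis by simp
qed

lemma bounded_linear_stretch: "bounded_linear (\<lambda>y::real^2. pt (y $ 1) (c * y $ 2))"
  unfolding pt_eq_axis
  by (intro bounded_linear_add bounded_linear_scaleR_const bounded_linear_const_mult bounded_linear_vec_nth)

text \<open>Only the vertical derivative picks up the factor \<open>c\<close>; this is the origin of
  the factor 1/\<epsilon> in the scaled curl.\<close>

lemma stretch_dir_deriv:
  fixes \<phi> :: "real^2 \<Rightarrow> real"
  assumes "\<phi> \<in> test_functions U"
  shows "dir_deriv (\<lambda>y::real^2. \<phi> (pt (y $ 1) (c * y $ 2))) (axis 1 1) y = dir_deriv \<phi> (axis 1 1) (pt (y $ 1) (c * y $ 2))" (is ?t1)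
    and "dir_deriv (\<lambda>y::real^2. \<phi> (pt (y $ 1) (c * y $ 2))) (axis 2 1) y = c * dir_deriv \<phi> (axis 2 1) (pt (y $ 1) (c * y $ 2))" (is ?t2)
proof -
  have *: "dir_deriv (\<lambda>y::real^2. \<phi> (pt (y $ 1) (c * y $ 2) + 0)) e y
      = (pt (e $ 1) (c * e $ 2) \<bullet> axis 1 1) * dir_deriv \<phi> (axis 1 1) (pt (y $ 1) (c * y $ 2) + 0)
      + (pt (e $ 1) (c * e $ 2) \<bullet> axis 2 1) * dir_deriv \<phi> (axis 2 1) (pt (y $ 1) (c * y $ 2) + 0)" for e :: "real^2"
    using fun_cong[OF dir_deriv_affine[OF test_functions_Ck[OF assms] bounded_linear_stretch[of c],
        where c = 0 and e = e], of y]
    by (simp only: Basis_real2 sum.insert finite.intros sum.empty) (simp add: axis_eq_axis)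
  from *[of "axis 1 1"] *[of "axis 2 1"] show ?t1 ?t2 by (simp_all add: inner_axis)
qed

lemma stretch_test:
  fixes \<phi> :: "real^2 \<Rightarrow> real"
  assumes "\<phi> \<in> test_functions U" "c \<noteq> 0" "\<And>y::real^2. pt (y $ 1) (c * y $ 2) \<in> U \<Longrightarrow> y \<in> V"
  shows "(\<lambda>y::real^2. \<phi> (pt (y $ 1) (c * y $ 2))) \<in> test_functions V"
proof -
  obtain K where K: "compact K" "K \<subseteq> U" "\<And>x. x \<notin> K \<Longrightarrow> \<phi> x = 0"
    using test_functionsE[OF assms(1)] by metis
  let ?K = "(\<lambda>x. pt (x $ 1) (inverse c * x $ 2)) ` K"
  show ?thesis
  proof (rule test_functionsI)
    show "Ck n (\<lambda>y::real^2. \<phi> (pt (y $ 1) (c * y $ 2)))" for n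
      using Ck_affine[OF test_functions_Ck[OF assms(1)] bounded_linear_stretch, of n c 0] by simp
    show "compact ?K"
      by (intro compact_continuous_image K continuous_intros)
    show "?K \<subseteq> V"
    proof safe
      fix x assume "x \<in> K"
      moreover have "pt (pt (x $ 1) (inverse c * x $ 2) $ 1) (c * pt (x $ 1) (inverse c * x $ 2) $ 2) = x"
        using assms(2) by (simp add: mult.assoc[symmetric])
      ultimately show "pt (x $ 1) (inverse c * x $ 2) \<in> V"
        using K(2) assms(3)[of "pt (x $ 1) (inverse c * x $ 2)"] by (metis subsetD)
    qed
    fix y :: "real^2" assume y: "y \<notin> ?K"
    have eq: "y = pt (pt (y $ 1) (c * y $ 2) $ 1) (inverse c * pt (y $ 1) (c * y $ 2) $ 2)"
      using assms(2) by (simp add: mult.assoc[symmetric])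
    have "pt (y $ 1) (c * y $ 2) \<notin> K"
    proof
      assume "pt (y $ 1) (c * y $ 2) \<in> K"
      then have "y \<in> ?K" by (rule image_eqI[rotated]) (rule eq)
      with y show False by contradiction
    qed
    then show "\<phi> (pt (y $ 1) (c * y $ 2)) = 0" by (rule K)
  qed
qed

section \<open>Integration over the plane and Borel representatives\<close>

text \<open>Agreement on boxes identifies the measure on \<open>real^2\<close> with a product
  measure, which makes the Fubini theorems available for it.\<close>

lemma lborel_real2: "(lborel :: (real^2) measure) = distr (lborel \<Otimes>\<^sub>M lborel) borel (\<lambda>(s, t). pt s t)"
proof (rule lborel_eqI)
  fix l u :: "real^2"
  assume le: "\<And>b. b \<in> Basis \<Longrightarrow> l \<bullet> b \<le> u \<bullet> b"
  have "l $ 1 \<le> u $ 1" "l $ 2 \<le> u $ 2"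
    using le[of "axis 1 1"] le[of "axis 2 1"] by (simp_all add: inner_axis)
  moreover have "(\<lambda>(s, t). pt s t) -` box l u \<inter> space (lborel \<Otimes>\<^sub>M lborel)
      = {l $ 1<..<u $ 1} \<times> {l $ 2<..<u $ 2}"
    by (auto simp: space_pair_measure mem_box Basis_real2 inner_axis)
  moreover have "(\<Prod>b\<in>Basis. (u - l) \<bullet> b) = (u $ 1 - l $ 1) * (u $ 2 - l $ 2)"
    by (simp add: Basis_real2 axis_eq_axis inner_axis)
  ultimately show "emeasure (distr (lborel \<Otimes>\<^sub>M lborel) borel (\<lambda>(s, t). pt s t)) (box l u) = (\<Prod>b\<in>Basis. (u - l) \<bullet> b)"
    by (simp add: emeasure_distr lborel.emeasure_pair_measure_Times ennreal_mult)
qed simp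

lemma nn_integral_pt:
  fixes f :: "real^2 \<Rightarrow> ennreal"
  assumes [measurable]: "f \<in> borel_measurable borel"
  shows "(\<integral>\<^sup>+x. f x \<partial>lborel) = (\<integral>\<^sup>+s. \<integral>\<^sup>+t. f (pt s t) \<partial>lborel \<partial>lborel)"
proof -
  have "(\<integral>\<^sup>+x. f x \<partial>lborel) = (\<integral>\<^sup>+z. f (case z of (s, t) \<Rightarrow> pt s t) \<partial>(lborel \<Otimes>\<^sub>M lborel))"
    by (subst lborel_real2, rule nn_integral_distr) measurable
  also have "\<dots> = (\<integral>\<^sup>+s. \<integral>\<^sup>+t. f (pt s t) \<partial>lborel \<partial>lborel)"
    by (subst lborel.nn_integral_fst[symmetric]) simp_all
  finally show ?thesis .
qed

lemma AE_pt:
  assumes "AE x in lborel. P x"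
  shows "AE s in lborel. AE t in lborel. P (pt s t)"
proof -
  have "AE x in distr (lborel \<Otimes>\<^sub>M lborel) borel (\<lambda>(s, t). pt s t). P x"
    using assms by (subst (asm) lborel_real2)
  from AE_distrD[OF _ this] have "AE z in lborel \<Otimes>\<^sub>M lborel. P (case z of (s, t) \<Rightarrow> pt s t)"
    by measurable
  from lborel_pair.AE_pair[OF this] show ?thesis by simp
qed

lemma AE_pt_swap:
  assumes "AE x in lborel. P x"
  shows "AE t in lborel. AE s in lborel. P (pt s t)"
proof -
  have "AE x in distr (lborel \<Otimes>\<^sub>M lborel) borel (\<lambda>(s, t). pt s t). P x"
    using assms by (subst (asm) lborel_real2)
  from AE_distrD[OF _ this] have "AE z in lborel \<Otimes>\<^sub>M lborel. P (case z of (s, t) \<Rightarrow> pt s t)"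
    by measurable
  then have "AE z in lborel \<Otimes>\<^sub>M lborel. P (case z of (t, s) \<Rightarrow> pt s t)"
    by (subst (asm) lborel_pair.distr_pair_swap) (auto dest!: AE_distrD[rotated] simp: case_prod_beta)
  from lborel_pair.AE_pair[OF this] show ?thesis by simp
qed

lemma AE_pt_iff:
  assumes [measurable]: "Measurable.pred borel P"
  shows "(AE x in lborel. P x) \<longleftrightarrow> (AE s in lborel. AE t in lborel. P (pt s t))"
proof
  assume "AE s in lborel. AE t in lborel. P (pt s t)"
  moreover have "Measurable.pred (lborel \<Otimes>\<^sub>M lborel) (\<lambda>z. P (pt (fst z) (snd z)))"
    by (rule measurable_compose[OF _ assms]) simp
  ultimately have "AE z in lborel \<Otimes>\<^sub>M lborel. P (case z of (s, t) \<Rightarrow> pt s t)"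
    by (intro lborel_pair.AE_pair_measure) (simp_all add: case_prod_beta pred_def)
  then show "AE x in lborel. P x"
    by (subst lborel_real2, subst AE_distr_iff) (simp_all)
qed (rule AE_pt)

context
  fixes f :: "real^2 \<Rightarrow> 'b::euclidean_space"
  assumes f: "integrable lborel f"
begin

lemma integrable_pair_pt: "integrable (lborel \<Otimes>\<^sub>M lborel) (\<lambda>(s, t). f (pt s t))"
proof -
  have "integrable (distr (lborel \<Otimes>\<^sub>M lborel) borel (\<lambda>(s, t). pt s t)) f"
    using f by (subst (asm) lborel_real2)
  from integrable_distr[OF _ this] show ?thesis by (simp add: case_prod_beta')
qed

lemma integral_pair_pt: "(LINT x|lborel. f x) = (LINT z|(lborel \<Otimes>\<^sub>M lborel). (case z of (s, t) \<Rightarrow> f (pt s t)))"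
  using f by (subst lborel_real2, subst integral_distr)
    (auto simp: case_prod_beta' dest: borel_measurable_integrable)

lemma integral_pt: "(LINT x|lborel. f x) = (LINT s|lborel. LINT t|lborel. f (pt s t))"
  unfolding integral_pair_pt using lborel_pair.integral_fst'[OF integrable_pair_pt] by simp

lemma integral_pt_swap: "(LINT x|lborel. f x) = (LINT t|lborel. LINT s|lborel. f (pt s t))"
  unfolding integral_pair_pt using lborel_pair.integral_snd[OF integrable_pair_pt] by simp

lemma integrable_pt: "AE s in lborel. integrable lborel (\<lambda>t. f (pt s t))"
  using lborel_pair.AE_integrable_fst'[OF integrable_pair_pt] by simp

lemma integrable_pt_outer: "integrable lborel (\<lambda>s. LINT t|lborel. f (pt s t))"
  using lborel_pair.integrable_fst'[OF integrable_pair_pt] by simp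

lemma integrable_pt_outer_swap: "integrable lborel (\<lambda>t. LINT s|lborel. f (pt s t))"
  using lborel_pair.integrable_snd[OF integrable_pair_pt] by simp

end

text \<open>This symmetry reduces every statement about the direction x_1 to the one about
  x_2.\<close>

lemma lborel_real2_swap: "(lborel :: (real^2) measure) = distr lborel borel (\<lambda>x::real^2. pt (x $ 2) (x $ 1))"
proof (rule lborel_eqI)
  fix l u :: "real^2"
  assume le: "\<And>b. b \<in> Basis \<Longrightarrow> l \<bullet> b \<le> u \<bullet> b"
  have "l $ 1 \<le> u $ 1" "l $ 2 \<le> u $ 2"
    using le[of "axis 1 1"] le[of "axis 2 1"] by (simp_all add: inner_axis)
  moreover have "(\<lambda>x::real^2. pt (x $ 2) (x $ 1)) -` box l u = box (pt (l $ 2) (l $ 1)) (pt (u $ 2) (u $ 1))"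
    by (auto simp: mem_box Basis_real2 inner_axis)
  ultimately show "emeasure (distr lborel borel (\<lambda>x::real^2. pt (x $ 2) (x $ 1))) (box l u) = (\<Prod>b\<in>Basis. (u - l) \<bullet> b)"
    by (simp add: emeasure_distr emeasure_lborel_box_eq Basis_real2 axis_eq_axis inner_axis mult.commute)
qed simp

text \<open>Each of the finitely many components has a Borel version, and their exceptional null
  sets can be united. The extension by zero lets all later integrals run over the whole
  space.\<close>

lemma borel_rep:
  fixes f :: "'a::euclidean_space \<Rightarrow> 'b::euclidean_space"
  assumes "f \<in> borel_measurable (lebesgue_on U)" and U[measurable]: "U \<in> sets borel"
  obtains g where "g \<in> borel_measurable borel" "AE x in lborel. x \<in> U \<longrightarrow> f x = g x" "\<And>x. x \<notin> U \<Longrightarrow> g x = 0"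
proof -
  have U': "U \<in> sets lebesgue" using U by simp
  have m: "(\<lambda>x. indicator U x *\<^sub>R f x) \<in> borel_measurable lebesgue"
    using assms(1) U' by (simp add: borel_measurable_restrict_space_iff mult.commute)
  have "\<exists>g\<in>borel_measurable lborel. AE x in lborel. (indicator U x *\<^sub>R f x) \<bullet> b = g x" for b
    by (rule completion_ex_borel_measurable_real) (use m in measurable)
  then obtain g where g: "\<And>b. g b \<in> borel_measurable lborel"
    "\<And>b. AE x in lborel. (indicator U x *\<^sub>R f x) \<bullet> b = g b x" by metis
  let ?g = "\<lambda>x. indicator U x *\<^sub>R (\<Sum>b\<in>Basis. g b x *\<^sub>R b)"
  show ?thesis
  proof (rule that)
    have [measurable]: "g b \<in> borel_measurable borel" for b using g(1)[of b] by simp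
    show "?g \<in> borel_measurable borel" by measurable
    have "AE x in lborel. \<forall>b\<in>Basis. (indicator U x *\<^sub>R f x) \<bullet> b = g b x"
      using g(2) by (intro AE_finite_allI) auto
    then show "AE x in lborel. x \<in> U \<longrightarrow> f x = ?g x"
    proof eventually_elim
      case (elim x)
      show ?case
      proof
        assume "x \<in> U"
        with elim have "(\<Sum>b\<in>Basis. g b x *\<^sub>R b) = (\<Sum>b\<in>Basis. (f x \<bullet> b) *\<^sub>R b)"
          by (intro sum.cong) auto
        with \<open>x \<in> U\<close> show "f x = ?g x" by (simp add: euclidean_representation)
      qed
    qed
  qed simp
qed

lemma integral_lebesgue_on_eq:
  fixes f g :: "'a::euclidean_space \<Rightarrow> 'b::euclidean_space"
  assumes "f \<in> borel_measurable (lebesgue_on U)" "U \<in> sets borel" "g \<in> borel_measurable borel"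
    "AE x in lborel. x \<in> U \<longrightarrow> f x = g x" "\<And>x. x \<notin> U \<Longrightarrow> g x = 0"
  shows "(LINT x|lebesgue_on U. f x) = (LINT x|lborel. g x)"
proof -
  have U': "U \<in> sets lebesgue" using assms by simp
  have "(LINT x|lebesgue_on U. f x) = (LINT x|lebesgue. indicator U x *\<^sub>R f x)"
    using U' by (intro integral_restrict_space) simp
  also have "\<dots> = (LINT x|lebesgue. g x)"
  proof (rule integral_cong_AE)
    show "(\<lambda>x. indicator U x *\<^sub>R f x) \<in> borel_measurable lebesgue"
      using assms(1) U' by (simp add: borel_measurable_restrict_space_iff mult.commute)
    show "g \<in> borel_measurable lebesgue" using assms(3) by (simp add: measurable_completion)
    show "AE x in lebesgue. indicator U x *\<^sub>R f x = g x"
      using assms(4,5) by (intro AE_completion) (auto split: split_indicator elim!: eventually_mono)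
  qed
  also have "\<dots> = (LINT x|lborel. g x)"
    using assms(3) by (intro integral_completion) simp
  finally show ?thesis .
qed

lemma borel_measurable_lebesgue_on:
  "g \<in> borel_measurable borel \<Longrightarrow> g \<in> borel_measurable (lebesgue_on U)"
  by (intro measurable_restrict_space1 measurable_completion) simp

lemma integral_lebesgue_on_borel:
  fixes g :: "'a::euclidean_space \<Rightarrow> 'b::euclidean_space"
  assumes [measurable]: "U \<in> sets borel" "g \<in> borel_measurable borel"
  shows "(LINT x|lebesgue_on U. g x) = (LINT x|lborel. indicator U x *\<^sub>R g x)"
  by (rule integral_lebesgue_on_eq)
     (auto simp: borel_measurable_lebesgue_on)

lemma integrable_lebesgue_on_eq:
  fixes f g :: "'a::euclidean_space \<Rightarrow> 'b::euclidean_space"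
  assumes "f \<in> borel_measurable (lebesgue_on U)" "U \<in> sets borel" "g \<in> borel_measurable borel"
    "AE x in lborel. x \<in> U \<longrightarrow> f x = g x" "\<And>x. x \<notin> U \<Longrightarrow> g x = 0"
  shows "integrable (lebesgue_on U) f \<longleftrightarrow> integrable lborel g"
proof -
  have U': "U \<in> sets lebesgue" using assms by simp
  have "integrable (lebesgue_on U) f \<longleftrightarrow> integrable lebesgue (\<lambda>x. indicator U x *\<^sub>R f x)"
    using U' by (intro integrable_restrict_space) simp
  also have "\<dots> \<longleftrightarrow> integrable lebesgue g"
  proof (rule integrable_cong_AE)
    show "(\<lambda>x. indicator U x *\<^sub>R f x) \<in> borel_measurable lebesgue"
      using assms(1) U' by (simp add: borel_measurable_restrict_space_iff mult.commute)
    show "g \<in> borel_measurable lebesgue" using assms(3) by (simp add: measurable_completion)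
    show "AE x in lebesgue. indicator U x *\<^sub>R f x = g x"
      using assms(4,5) by (intro AE_completion) (auto split: split_indicator elim!: eventually_mono)
  qed
  also have "\<dots> \<longleftrightarrow> integrable lborel g"
    using assms(3) by (intro integrable_completion) simp
  finally show ?thesis .
qed

lemma lp_on_rep_iff:
  fixes f g :: "'a::euclidean_space \<Rightarrow> 'b::euclidean_space"
  assumes "f \<in> borel_measurable (lebesgue_on U)" "U \<in> sets borel" and [measurable]: "g \<in> borel_measurable borel"
    and "AE x in lborel. x \<in> U \<longrightarrow> f x = g x" "\<And>x. x \<notin> U \<Longrightarrow> g x = 0" "p > 0"
  shows "lp_on p U f \<longleftrightarrow> integrable lborel (\<lambda>x. norm (g x) ^ p)"
proof -
  have "integrable (lebesgue_on U) (\<lambda>x. norm (f x) ^ p) \<longleftrightarrow> integrable lborel (\<lambda>x. norm (g x) ^ p)"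
    using assms by (intro integrable_lebesgue_on_eq) (auto elim!: eventually_mono)
  with assms(1) show ?thesis by (simp add: lp_on_def)
qed

lemma lp_on_borel:
  fixes g :: "'a::euclidean_space \<Rightarrow> 'b::euclidean_space"
  assumes [measurable]: "U \<in> sets borel" "g \<in> borel_measurable borel" and "p > 0"
  shows "lp_on p U g \<longleftrightarrow> integrable lborel (\<lambda>x. indicator U x * norm (g x) ^ p)"
proof -
  have "integrable (lebesgue_on U) (\<lambda>x. norm (g x) ^ p) \<longleftrightarrow> integrable lborel (\<lambda>x. indicator U x * norm (g x) ^ p)"
    using assms by (intro integrable_lebesgue_on_eq borel_measurable_lebesgue_on) auto
  then show ?thesis by (simp add: lp_on_def borel_measurable_lebesgue_on assms)
qed

lemma AE_lebesgue_on_iff: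
  assumes "U \<in> sets borel"
  shows "(AE x in lebesgue_on U. P x) \<longleftrightarrow> (AE x in lborel. x \<in> U \<longrightarrow> P x)"
  using assms by (subst AE_restrict_space_iff) (simp_all add: AE_completion_iff)

text \<open>Local integrability gives measurability on compact subsets, and an open set is a
  countable union of those.\<close>

lemma locally_integrable_on_measurable:
  assumes "locally_integrable_on U f" "open U"
  shows "f \<in> borel_measurable (lebesgue_on U)"
proof -
  obtain K :: "nat \<Rightarrow> 'a set" where K: "\<And>n. compact (K n)" "\<And>n. K n \<subseteq> U" "(\<Union>n. K n) = U"
    using open_Union_compact_subsets[OF assms(2)] by metis
  have "f \<in> borel_measurable (lebesgue_on (\<Union>n. K n))"
  proof (rule measurable_piecewise_restrict2[where A = K])
    show "K n \<in> sets (lebesgue_on (\<Union>n. K n))" for n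
      using K(1)[of n] K(2)[of n] by (auto simp: sets_restrict_space_iff K(3) assms(2) borel_open intro!: image_eqI[of _ _ "K n"]
         lmeasurable_compact fmeasurableD)
    show "space (lebesgue_on (\<Union>n. K n)) = \<Union> (range K)" by (simp add: space_restrict_space)
    fix n
    have "(\<lambda>x. indicator (K n) x *\<^sub>R f x) \<in> borel_measurable lebesgue"
      using assms(1) K(1,2)[of n] unfolding locally_integrable_on_def set_integrable_def by auto
    then have "(\<lambda>x. indicator (K n) x *\<^sub>R f x) \<in> borel_measurable (lebesgue_on (\<Union>n. K n))"
      by (rule measurable_restrict_space1)
    then show "\<exists>h\<in>borel_measurable (lebesgue_on (\<Union>n. K n)). \<forall>x\<in>K n. f x = h x"
      by (rule bexI[rotated]) simp
  qed
  with K(3) show ?thesis by simp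
qed

section \<open>Weak derivatives in the plane\<close>

lemma mem_Omega: "x \<in> Omega \<longleftrightarrow> -1 < x $ 1 \<and> x $ 1 < 1 \<and> -1 < x $ 2 \<and> x $ 2 < 1"
  by (auto simp: Omega_def mem_box Basis_real2 inner_axis)

lemma Omega_eq: "Omega = {x. x $ 1 \<in> {-1<..<1} \<and> x $ 2 \<in> {-1<..<1}}"
  by (auto simp: mem_Omega)

lemma open_Omega: "open Omega"
  by (simp add: Omega_def open_box)

lemma sets_Omega [measurable]: "Omega \<in> sets borel"
  by (simp add: open_Omega)

lemma prod_test_Omega:
  assumes "\<psi> \<in> test_functions {-1<..<1}" "\<theta> \<in> test_functions {-1<..<1}"
  shows "(\<lambda>x::real^2. \<psi> (x $ 1) * \<theta> (x $ 2)) \<in> test_functions Omega"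
  unfolding Omega_eq by (rule prod_test[OF assms])

lemma integrable_bounded_scaleR:
  fixes f :: "'a \<Rightarrow> 'b::euclidean_space"
  assumes "integrable M f" "g \<in> borel_measurable M" "\<And>x. \<bar>g x\<bar> \<le> C"
  shows "integrable M (\<lambda>x. g x *\<^sub>R f x)"
proof (rule Bochner_Integration.integrable_bound)
  show "integrable M (\<lambda>x. C *\<^sub>R norm (f x))" using assms(1) by simp
  show "(\<lambda>x. g x *\<^sub>R f x) \<in> borel_measurable M"
    using assms by (intro borel_measurable_scaleR) auto
  show "AE x in M. norm (g x *\<^sub>R f x) \<le> norm (C *\<^sub>R norm (f x))"
  proof (intro AE_I2)
    fix x
    have "norm (g x *\<^sub>R f x) \<le> \<bar>C\<bar> * norm (f x)"
      using assms(3)[of x] by (simp add: mult_right_mono)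
    then show "norm (g x *\<^sub>R f x) \<le> norm (C *\<^sub>R norm (f x))" by (simp add: abs_mult)
  qed
qed

lemma integrable_test_scaleR:
  fixes f :: "'a::euclidean_space \<Rightarrow> 'b::euclidean_space"
  assumes "integrable lborel f" "\<phi> \<in> test_functions U"
  shows "integrable lborel (\<lambda>x. \<phi> x *\<^sub>R f x)"
proof -
  obtain C where "\<And>x. \<bar>\<phi> x\<bar> \<le> C" using test_functions_bounded[OF assms(2)] by metis
  with assms show ?thesis by (intro integrable_bounded_scaleR[where C = C]) auto
qed

lemma bump_measurable [measurable]: "m > 0 \<Longrightarrow> bump m a b \<in> borel_measurable borel"
  by (rule test_functions_measurable[OF bump_test[of m a b UNIV]]) auto

section \<open>The fundamental lemma of the calculus of variations\<close>

text \<open>Products of steepening bumps converge to the indicator of the open rectangle, dominated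
  by 1; the boundary of the rectangle is negligible.\<close>

lemma integral_box_0:
  fixes F :: "real^2 \<Rightarrow> 'b::euclidean_space"
  assumes F: "integrable lborel F"
    and z: "\<And>m. m > 0 \<Longrightarrow> (LINT x|lborel. (bump m a b (x $ 1) * bump m c d (x $ 2)) *\<^sub>R F x) = 0"
  shows "integral (cbox (pt a c) (pt b d)) F = 0"
proof -
  note [measurable] = borel_measurable_integrable[OF F]
  let ?B = "\<lambda>x::real^2. indicator {a<..<b} (x $ 1) * indicator {c<..<d} (x $ 2) :: real"
  have "(\<lambda>n. LINT x|lborel. (bump (real (Suc n)) a b (x $ 1) * bump (real (Suc n)) c d (x $ 2)) *\<^sub>R F x)
      \<longlonglongrightarrow> (LINT x|lborel. ?B x *\<^sub>R F x)"
  proof (rule integral_dominated_convergence[where w = "\<lambda>x. norm (F x)"])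
    show "AE x in lborel. norm ((bump (real (Suc n)) a b (x $ 1) * bump (real (Suc n)) c d (x $ 2)) *\<^sub>R F x) \<le> norm (F x)" for n
      using bump_bounds by (intro AE_I2) (auto simp: abs_mult intro!: mult_left_le_one_le mult_le_one)
    show "AE x in lborel. (\<lambda>n. (bump (real (Suc n)) a b (x $ 1) * bump (real (Suc n)) c d (x $ 2)) *\<^sub>R F x)
        \<longlonglongrightarrow> ?B x *\<^sub>R F x"
      by (intro AE_I2 tendsto_intros bump_tendsto_indicator)
  qed (use F in \<open>auto intro!: integrable_norm\<close>)
  moreover have "(\<lambda>n. LINT x|lborel. (bump (real (Suc n)) a b (x $ 1) * bump (real (Suc n)) c d (x $ 2)) *\<^sub>R F x) = (\<lambda>n. 0)"
    using z by auto
  ultimately have "(LINT x|lborel. ?B x *\<^sub>R F x) = 0"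
    by (simp add: LIMSEQ_const_iff)
  moreover have "?B x *\<^sub>R F x = indicator (box (pt a c) (pt b d)) x *\<^sub>R F x" for x
    by (auto simp: indicator_def mem_box Basis_real2 inner_axis)
  ultimately have "(LINT x:box (pt a c) (pt b d)|lborel. F x) = 0"
    by (simp add: set_lebesgue_integral_def)
  moreover have "set_integrable lborel (box (pt a c) (pt b d)) F"
    unfolding set_integrable_def by (intro integrable_mult_indicator F) auto
  ultimately have "integral (box (pt a c) (pt b d)) F = 0"
    using set_borel_integral_eq_integral(2) by metis
  then show ?thesis by (simp add: integral_open_interval)
qed

text \<open>If the averages over all small squares in \<open>V\<close> vanish, so does the function
  at its Lebesgue points. Testing is restricted to products of bumps, because the equations for
  fields depending on one coordinate are available only for products.\<close>

lemma fundamental_lemma_box: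
  fixes F :: "real^2 \<Rightarrow> 'b::euclidean_space"
  assumes F: "integrable lborel F" and V: "open V"
    and z: "\<And>m a b c d. \<lbrakk>m > 0; a < b; c < d; cbox (pt a c) (pt b d) \<subseteq> V\<rbrakk> \<Longrightarrow>
      (LINT x|lborel. (bump m a b (x $ 1) * bump m c d (x $ 2)) *\<^sub>R F x) = 0"
  shows "AE x in lborel. x \<in> V \<longrightarrow> F x = 0"
proof -
  have "F integrable_on cbox a b" for a b
    using integrable_on_lborel[OF F] integrable_on_subcbox by blast
  then obtain N where N: "negligible N"
    and lim: "\<And>x e. \<lbrakk>x \<notin> N; 0 < e\<rbrakk> \<Longrightarrow> \<exists>d>0. \<forall>h. 0 < h \<and> h < d \<longrightarrow>
       norm(integral (cbox x (x + h *\<^sub>R One)) F /\<^sub>R h ^ DIM(real^2) - F x) < e"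
    using integrable_ccontinuous_explicit by blast
  have "F x = 0" if x: "x \<notin> N" "x \<in> V" for x
  proof (rule ccontr)
    assume "F x \<noteq> 0"
    then obtain d where d: "d > 0" "\<And>h. 0 < h \<Longrightarrow> h < d \<Longrightarrow>
       norm(integral (cbox x (x + h *\<^sub>R One)) F /\<^sub>R h ^ DIM(real^2) - F x) < norm (F x)"
      using lim[OF x(1), of "norm (F x)"] by auto
    obtain e where e: "e > 0" "cball x e \<subseteq> V"
      using V x(2) open_contains_cball by blast
    define h where "h = min (d / 2) (e / 2)"
    have h: "0 < h" "h < d" "2 * h \<le> e" using d e by (auto simp: h_def)
    have eq: "x + h *\<^sub>R One = pt (x $ 1 + h) (x $ 2 + h)"
      by (simp add: vec_eq_iff forall_2 Basis_real2 axis_eq_axis)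
    have "cbox x (x + h *\<^sub>R One) \<subseteq> cball x e"
    proof
      fix y assume "y \<in> cbox x (x + h *\<^sub>R One)"
      then have y: "\<bar>y $ 1 - x $ 1\<bar> \<le> h" "\<bar>y $ 2 - x $ 2\<bar> \<le> h"
        unfolding eq by (auto simp: mem_box Basis_real2 inner_axis)
      have "norm (x - y) \<le> \<bar>(x - y) $ 1\<bar> + \<bar>(x - y) $ 2\<bar>"
        using norm_le_l1_cart[of "x - y"] by (simp add: sum_2)
      with y h show "y \<in> cball x e" by (simp add: dist_norm)
    qed
    with e have "cbox x (x + h *\<^sub>R One) \<subseteq> V" by blast
    then have "integral (cbox x (x + h *\<^sub>R One)) F = 0"
      unfolding eq using h integral_box_0[OF F z, of "x $ 1" "x $ 1 + h" "x $ 2" "x $ 2 + h"] by simp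
    with d(2)[OF h(1,2)] show False by simp
  qed
  moreover have "AE x in lebesgue. x \<notin> N"
    using N by (intro AE_not_in) (simp add: negligible_iff_null_sets)
  then have "AE x in lborel. x \<notin> N" by (simp only: AE_completion_iff)
  ultimately show ?thesis by (auto elim: eventually_mono)
qed

section \<open>Primitives along coordinate lines\<close>

text \<open>The lower limit minus infinity is harmless: an integrable function is integrable on
  almost every vertical line.\<close>

definition prim :: "(real^2 \<Rightarrow> 'b::euclidean_space) \<Rightarrow> real^2 \<Rightarrow> 'b" where
  "prim g x = (LINT t|lborel. indicator {..x $ 2} t *\<^sub>R g (pt (x $ 1) t))"

lemma prim_measurable [measurable]:
  assumes [measurable]: "g \<in> borel_measurable borel"
  shows "prim g \<in> borel_measurable borel"
  unfolding prim_def by measurable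

lemma norm_prim_le:
  assumes "integrable lborel (\<lambda>t. g (pt (x $ 1) t))"
  shows "norm (prim g x) \<le> (LINT t|lborel. norm (g (pt (x $ 1) t)))"
proof -
  have "norm (prim g x) \<le> (LINT t|lborel. norm (indicator {..x $ 2} t *\<^sub>R g (pt (x $ 1) t)))"
    unfolding prim_def by (rule integral_norm_bound)
  also have "\<dots> \<le> (LINT t|lborel. norm (g (pt (x $ 1) t)))"
    using assms by (intro integral_mono integrable_norm integrable_mult_indicator) (auto split: split_indicator)
  finally show ?thesis .
qed

text \<open>On almost every vertical line the primitive is bounded by the line integral of the norm
  of \<open>g\<close>. It need not decay for large x_2, hence the cutoff, whose length 2 is the
  constant in the estimate.\<close>

lemma integrable_prim:
  fixes g :: "real^2 \<Rightarrow> 'b::euclidean_space"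
  assumes g: "integrable lborel g"
  shows "integrable lborel (\<lambda>x. indicator {-1<..<1} (x $ 2) *\<^sub>R prim g x)"
proof (rule integrableI_bounded)
  note [measurable] = borel_measurable_integrable[OF g]
  show "(\<lambda>x. indicator {-1<..<1} (x $ 2) *\<^sub>R prim g x) \<in> borel_measurable lborel" by measurable
  have "(\<integral>\<^sup>+x. norm (indicator {-1<..<1} (x $ 2) *\<^sub>R prim g x) \<partial>lborel)
     = (\<integral>\<^sup>+s. \<integral>\<^sup>+t. norm (indicator {-1<..<1} t *\<^sub>R prim g (pt s t)) \<partial>lborel \<partial>lborel)"
    by (subst nn_integral_pt) (simp_all del: norm_scaleR)
  also have "\<dots> \<le> (\<integral>\<^sup>+s. \<integral>\<^sup>+t. indicator {-1<..<1} (t::real) * ennreal (LINT r|lborel. norm (g (pt s r))) \<partial>lborel \<partial>lborel)"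
  proof (rule nn_integral_mono_AE)
    show "AE s in lborel. (\<integral>\<^sup>+t. norm (indicator {-1<..<1} t *\<^sub>R prim g (pt s t)) \<partial>lborel)
      \<le> (\<integral>\<^sup>+t. indicator {-1<..<1} (t::real) * ennreal (LINT r|lborel. norm (g (pt s r))) \<partial>lborel)"
      using integrable_pt[OF g]
    proof eventually_elim
      case (elim s)
      show ?case
      proof (rule nn_integral_mono)
        fix t show "ennreal (norm (indicator {-1<..<1} t *\<^sub>R prim g (pt s t)))
            \<le> indicator {-1<..<1} t * ennreal (LINT r|lborel. norm (g (pt s r)))"
          using norm_prim_le[of g "pt s t"] elim by (auto split: split_indicator intro!: ennreal_leI)
      qed
    qed
  qed
  also have "\<dots> = (\<integral>\<^sup>+s. 2 * ennreal (LINT r|lborel. norm (g (pt s r))) \<partial>lborel)"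
    by (subst nn_integral_multc) auto
  also have "\<dots> < \<infinity>"
    using integrable_pt_outer[OF integrable_norm[OF g]]
    by (subst nn_integral_cmult) (auto simp: nn_integral_eq_integral ennreal_mult_less_top)
  finally show "(\<integral>\<^sup>+x. norm (indicator {-1<..<1} (x $ 2) *\<^sub>R prim g x) \<partial>lborel) < \<infinity>" .
qed

text \<open>The primitive of an integrable \<open>u\<close> need not be differentiable everywhere.
  Fubini avoids this: for fixed \<open>r\<close> the derivative of \<open>X\<close> is integrated
  over all t \<ge> r, which gives \<open>- X r\<close>.\<close>

lemma integral_by_parts_test:
  fixes u :: "real \<Rightarrow> 'b::euclidean_space"
  assumes u: "integrable lborel u" and X: "X \<in> test_functions {a<..<b}"
  shows "(LINT t|lborel. dir_deriv X 1 t *\<^sub>R (LINT r|lborel. indicator {..t} r *\<^sub>R u r)) = - (LINT r|lborel. X r *\<^sub>R u r)"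
proof -
  let ?D = "dir_deriv X 1"
  have D: "?D \<in> test_functions {a<..<b}" by (rule test_functions_dir_deriv[OF X]) simp
  note [measurable] = test_functions_measurable[OF D] borel_measurable_integrable[OF u]
  define k where "k t r = ?D t *\<^sub>R (indicator {..t} r *\<^sub>R u r)" for t r
  have [measurable]: "(\<lambda>z. k (fst z) (snd z)) \<in> borel_measurable (borel \<Otimes>\<^sub>M borel)"
    unfolding k_def by measurable
  have int: "integrable (lborel \<Otimes>\<^sub>M lborel) (\<lambda>z. k (fst z) (snd z))"
  proof (rule Bochner_Integration.integrable_bound)
    show "integrable (lborel \<Otimes>\<^sub>M lborel) (\<lambda>(t, r). ?D t *\<^sub>R u r)"
    proof (rule lborel_pair.Fubini_integrable)
      show "integrable lborel (\<lambda>t. LINT r|lborel. norm (case (t, r) of (t, r) \<Rightarrow> ?D t *\<^sub>R u r))"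
        using test_functions_integrable[OF D] by simp
    qed (use u in \<open>auto intro: AE_I2\<close>)
    show "AE z in lborel \<Otimes>\<^sub>M lborel. norm (k (fst z) (snd z)) \<le> norm (case z of (t, r) \<Rightarrow> ?D t *\<^sub>R u r)"
      by (auto simp: k_def split: split_indicator)
  qed simp
  have inner: "(LINT t|lborel. k t r) = - X r *\<^sub>R u r" for r
  proof -
    \<comment> \<open>This endpoint lies beyond both \<open>r\<close> and the support of
      \<open>X\<close>, so the integral over the half line becomes one over a compact
      interval.\<close>
    define c where "c = max r b"
    have "?D t = 0" if "c < t" for t
      by (rule test_functions_eq_0[OF D]) (use that in \<open>auto simp: c_def\<close>)
    then have "k t r = (indicator {r..c} t *\<^sub>R ?D t) *\<^sub>R u r" for t
      by (cases "c < t") (auto simp: k_def split: split_indicator)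
    then have "(LINT t|lborel. k t r) = (LINT t|lborel. indicator {r..c} t *\<^sub>R ?D t) *\<^sub>R u r"
      by (simp only:) (rule integral_scaleR_left, intro integrable_mult_indicator test_functions_integrable[OF D], simp)
    also have "(LINT t|lborel. indicator {r..c} t *\<^sub>R ?D t) = X c - X r"
      using test_functions_has_real_derivative[OF X]
      by (intro integral_FTC_Icc test_functions_continuous[OF D])
         (auto simp: c_def has_real_derivative_iff_has_vector_derivative intro: has_vector_derivative_at_within)
    also have "X c = 0" by (rule test_functions_eq_0[OF X]) (simp add: c_def)
    finally show ?thesis by simp
  qed
  have "(LINT t|lborel. ?D t *\<^sub>R (LINT r|lborel. indicator {..t} r *\<^sub>R u r)) = (LINT t|lborel. LINT r|lborel. k t r)"
  proof (intro Bochner_Integration.integral_cong refl)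
    fix t show "?D t *\<^sub>R (LINT r|lborel. indicator {..t} r *\<^sub>R u r) = (LINT r|lborel. k t r)"
      unfolding k_def by (rule integral_scaleR_right[symmetric])
  qed
  also have "\<dots> = (LINT r|lborel. LINT t|lborel. k t r)"
    using lborel_pair.Fubini_integral[of k] int by (simp add: case_prod_beta')
  also have "\<dots> = - (LINT r|lborel. X r *\<^sub>R u r)"
    unfolding inner by simp
  finally show ?thesis .
qed

lemma integrable_prod_pt:
  fixes T :: "real \<Rightarrow> 'b::euclidean_space" and h :: "real \<Rightarrow> real"
  assumes h: "integrable lborel h" and T: "integrable lborel T"
  shows "integrable lborel (\<lambda>x::real^2. h (x $ 2) *\<^sub>R T (x $ 1))"
proof (rule integrableI_bounded)
  note [measurable] = borel_measurable_integrable[OF h] borel_measurable_integrable[OF T]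
  show "(\<lambda>x::real^2. h (x $ 2) *\<^sub>R T (x $ 1)) \<in> borel_measurable lborel" by measurable
  have "(\<integral>\<^sup>+(x::real^2). norm (h (x $ 2) *\<^sub>R T (x $ 1)) \<partial>lborel)
     = (\<integral>\<^sup>+s. \<integral>\<^sup>+t. norm (T s) * ennreal (norm (h t)) \<partial>lborel \<partial>lborel)"
    by (subst nn_integral_pt) (simp_all add: ennreal_mult mult.commute)
  also have "\<dots> = (\<integral>\<^sup>+s. norm (T s) \<partial>lborel) * (\<integral>\<^sup>+t. norm (h t) \<partial>lborel)"
    by (simp add: nn_integral_cmult nn_integral_multc)
  also have "\<dots> < \<infinity>"
    using h T by (simp add: integrable_iff_bounded ennreal_mult_less_top)
  finally show "(\<integral>\<^sup>+(x::real^2). norm (h (x $ 2) *\<^sub>R T (x $ 1)) \<partial>lborel) < \<infinity>" .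
qed

text \<open>The integral 1 serves to split off the mean of a test function, the positive value at 0
  to test measures on the segment x_2 = 0.\<close>

lemma ex_test_integral_1:
  obtains \<eta> where "\<eta> \<in> test_functions {-1<..<1::real}" "(LINT t|lborel. \<eta> t) = 1" "\<eta> 0 > 0"
proof -
  let ?b = "bump 1 (-1/2) (1/2)"
  have b: "?b \<in> test_functions {-1<..<1}" by (rule bump_test) auto
  have "(LINT t|lborel. ?b t) \<noteq> 0"
  proof
    assume "(LINT t|lborel. ?b t) = 0"
    then have "AE t in lborel. ?b t = 0"
      using integral_nonneg_eq_0_iff_AE[OF test_functions_integrable[OF b]] bump_bounds by simp
    then have "AE t in lborel. t \<notin> {-1/2<..<1/2::real}"
    proof eventually_elim
      case (elim t)
      then show ?case using bump_pos[of 1 "-1/2" t "1/2"] by auto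
    qed
    then have "{-1/2<..<1/2::real} \<in> null_sets lborel"
      by (subst AE_iff_null_sets) auto
    then show False by (simp add: null_sets_def)
  qed
  moreover have "(LINT t|lborel. ?b t) \<ge> 0"
    by (rule integral_nonneg_AE) (simp add: bump_bounds)
  ultimately have pos: "(LINT t|lborel. ?b t) > 0" by simp
  show ?thesis
  proof (rule that)
    show "(\<lambda>t. inverse (LINT t|lborel. ?b t) * ?b t) \<in> test_functions {-1<..<1}"
      by (rule test_functions_mult[OF b Ck_const])
    show "(LINT t|lborel. inverse (LINT t|lborel. ?b t) * ?b t) = 1"
      using pos by simp
    show "0 < inverse (LINT t|lborel. ?b t) * ?b 0"
      using pos bump_pos[of 1 "-1/2" 0 "1/2"] by simp
  qed
qed

lemma cbox_subset_Omega:
  assumes "cbox (pt a c) (pt b d) \<subseteq> Omega" "a < b" "c < d"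
  shows "{a..b} \<subseteq> {-1<..<1}" "{c..d} \<subseteq> {-1<..<1}"
proof -
  have "pt a c \<in> cbox (pt a c) (pt b d)" "pt b d \<in> cbox (pt a c) (pt b d)"
    using assms(2,3) by (auto simp: mem_box Basis_real2 inner_axis)
  with assms(1) have "pt a c \<in> Omega" "pt b d \<in> Omega" by auto
  then show "{a..b} \<subseteq> {-1<..<1}" "{c..d} \<subseteq> {-1<..<1}" by (auto simp: mem_Omega)
qed

text \<open>The argument of du Bois-Reymond: \<open>f\<close> minus a vertical primitive of
  \<open>g\<close> has weak vertical derivative zero, so it is a function of x_1 alone. Indeed,
  every test function is a multiple of \<eta> plus one of mean zero, and the latter is the
  derivative of a test function.\<close>

lemma weak_deriv_2_imp_prim:
  fixes f g :: "real^2 \<Rightarrow> 'b::euclidean_space"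
  assumes f: "integrable lborel f" and g: "integrable lborel g"
    and f0: "\<And>x. x \<notin> Omega \<Longrightarrow> f x = 0"
    and weak: "\<And>\<psi> \<theta>. \<psi> \<in> test_functions {-1<..<1} \<Longrightarrow> \<theta> \<in> test_functions {-1<..<1} \<Longrightarrow>
      (LINT x|lborel. (\<psi> (x $ 1) * dir_deriv \<theta> 1 (x $ 2)) *\<^sub>R f x) = - (LINT x|lborel. (\<psi> (x $ 1) * \<theta> (x $ 2)) *\<^sub>R g x)"
  obtains T where "integrable lborel T" "AE x in lborel. x \<in> Omega \<longrightarrow> f x = T (x $ 1) + prim g x"
proof -
  note [measurable] = borel_measurable_integrable[OF f] borel_measurable_integrable[OF g]
  obtain \<eta> where \<eta>: "\<eta> \<in> test_functions {-1<..<1::real}" "(LINT t|lborel. \<eta> t) = 1"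
    using ex_test_integral_1 by metis
  let ?I = "\<lambda>x::real^2. indicator {-1<..<1} (x $ 2) :: real"
  define P where "P x = ?I x *\<^sub>R prim g x" for x
  have P: "integrable lborel P"
    unfolding P_def by (rule integrable_prim[OF g])
  define D where "D x = f x - P x" for x
  have D: "integrable lborel D" unfolding D_def by (intro Bochner_Integration.integrable_diff f P)
  \<comment> \<open>A function constant on vertical lines is recovered by averaging over them with
    the weight \<eta> of integral 1.\<close>
  define T where "T s = (LINT t|lborel. \<eta> t *\<^sub>R D (pt s t))" for s
  have mult: "integrable lborel (\<lambda>x. (\<psi> (x $ 1) * \<theta> (x $ 2)) *\<^sub>R G x)"
    if "\<psi> \<in> test_functions {-1<..<1}" "\<theta> \<in> test_functions {-1<..<1}" "integrable lborel G"
    for \<psi> \<theta> and G :: "real^2 \<Rightarrow> 'b"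
    by (rule integrable_test_scaleR[OF that(3) prod_test_Omega[OF that(1,2)]])
  have "integrable lborel (\<lambda>x. \<eta> (x $ 2) *\<^sub>R D x)"
  proof -
    obtain C where "\<And>x. \<bar>\<eta> x\<bar> \<le> C" using test_functions_bounded[OF \<eta>(1)] by metis
    moreover have [measurable]: "\<eta> \<in> borel_measurable borel" by (rule test_functions_measurable[OF \<eta>(1)])
    ultimately show ?thesis using D by (intro integrable_bounded_scaleR[where C = C]) auto
  qed
  from integrable_pt_outer[OF this] have T: "integrable lborel T"
    by (simp add: T_def[abs_def])
  define F where "F x = D x - ?I x *\<^sub>R T (x $ 1)" for x
  have IT: "integrable lborel (\<lambda>x. ?I x *\<^sub>R T (x $ 1))"
    by (rule integrable_prod_pt[OF _ T]) (simp add: integrable_real_indicator)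
  have F: "integrable lborel F" unfolding F_def
    by (intro Bochner_Integration.integrable_diff D IT)
  have zero: "(LINT x|lborel. (\<psi> (x $ 1) * \<theta> (x $ 2)) *\<^sub>R F x) = 0"
    if \<psi>: "\<psi> \<in> test_functions {-1<..<1}" and \<theta>: "\<theta> \<in> test_functions {-1<..<1}" for \<psi> \<theta>
  proof -
    define c where "c = (LINT t|lborel. \<theta> t)"
    \<comment> \<open>The part of \<theta> of mean zero; it has a primitive \<open>X\<close> that
      may be inserted into the weak equation.\<close>
    define \<theta>0 where "\<theta>0 t = \<theta> t + (- c) * \<eta> t" for t
    have \<theta>0: "\<theta>0 \<in> test_functions {-1<..<1}"
      unfolding \<theta>0_def by (intro test_functions_add \<theta> test_functions_mult[OF \<eta>(1) Ck_const])
    have "(LINT t|lborel. \<theta>0 t) = 0"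
      unfolding \<theta>0_def using test_functions_integrable[OF \<theta>] test_functions_integrable[OF \<eta>(1)] \<eta>(2)
      by (simp add: c_def)
    then obtain X where X: "X \<in> test_functions {-1<..<1}" "\<And>t. dir_deriv X 1 t = \<theta>0 t"
      using test_antiderivative[OF \<theta>0] by metis
    have "(LINT x|lborel. (\<psi> (x $ 1) * \<theta>0 (x $ 2)) *\<^sub>R P x) = (LINT s|lborel. LINT t|lborel. (\<psi> s * \<theta>0 t) *\<^sub>R P (pt s t))"
      by (subst integral_pt[OF mult[OF \<psi> \<theta>0 P]]) simp
    also have "\<dots> = (LINT s|lborel. \<psi> s *\<^sub>R (LINT t|lborel. \<theta>0 t *\<^sub>R prim g (pt s t)))"
    proof (intro Bochner_Integration.integral_cong refl)
      fix s
      have "(\<psi> s * \<theta>0 t) *\<^sub>R P (pt s t) = \<psi> s *\<^sub>R (\<theta>0 t *\<^sub>R prim g (pt s t))" for t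
        using test_functions_eq_0[OF \<theta>0, of t] by (cases "t \<in> {-1<..<1}") (auto simp: P_def)
      then show "(LINT t|lborel. (\<psi> s * \<theta>0 t) *\<^sub>R P (pt s t)) = \<psi> s *\<^sub>R (LINT t|lborel. \<theta>0 t *\<^sub>R prim g (pt s t))"
        by (simp only: integral_scaleR_right)
    qed
    also have "\<dots> = (LINT s|lborel. \<psi> s *\<^sub>R - (LINT t|lborel. X t *\<^sub>R g (pt s t)))"
    proof (rule integral_cong_AE)
      show "AE s in lborel. \<psi> s *\<^sub>R (LINT t|lborel. \<theta>0 t *\<^sub>R prim g (pt s t)) = \<psi> s *\<^sub>R - (LINT t|lborel. X t *\<^sub>R g (pt s t))"
        using integrable_pt[OF g]
      proof eventually_elim
        case (elim s)
        show ?case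
          using integral_by_parts_test[OF elim X(1)] by (simp add: X(2) prim_def)
      qed
      note [measurable] = test_functions_measurable[OF \<psi>] test_functions_measurable[OF \<theta>0] test_functions_measurable[OF X(1)]
      show "(\<lambda>s. \<psi> s *\<^sub>R (LINT t|lborel. \<theta>0 t *\<^sub>R prim g (pt s t))) \<in> borel_measurable lborel" by measurable
      show "(\<lambda>s. \<psi> s *\<^sub>R - (LINT t|lborel. X t *\<^sub>R g (pt s t))) \<in> borel_measurable lborel" by measurable
    qed
    also have "\<dots> = - (LINT s|lborel. LINT t|lborel. (\<psi> s * X t) *\<^sub>R g (pt s t))"
      by (simp flip: scaleR_scaleR)
    also have "\<dots> = - (LINT x|lborel. (\<psi> (x $ 1) * X (x $ 2)) *\<^sub>R g x)"
      by (subst integral_pt[OF mult[OF \<psi> X(1) g]]) simp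
    also have "\<dots> = (LINT x|lborel. (\<psi> (x $ 1) * \<theta>0 (x $ 2)) *\<^sub>R f x)"
      using weak[OF \<psi> X(1)] by (simp add: X(2))
    finally have 1: "(LINT x|lborel. (\<psi> (x $ 1) * \<theta>0 (x $ 2)) *\<^sub>R D x) = 0"
      unfolding D_def using mult[OF \<psi> \<theta>0 f] mult[OF \<psi> \<theta>0 P] by (simp add: scaleR_diff_right)
    have 2: "(LINT x|lborel. (\<psi> (x $ 1) * \<eta> (x $ 2)) *\<^sub>R D x) = (LINT s|lborel. \<psi> s *\<^sub>R T s)"
      by (subst integral_pt[OF mult[OF \<psi> \<eta>(1) D]]) (simp add: T_def flip: scaleR_scaleR)
    have 3: "(LINT x|lborel. (\<psi> (x $ 1) * \<theta> (x $ 2)) *\<^sub>R (?I x *\<^sub>R T (x $ 1))) = c *\<^sub>R (LINT s|lborel. \<psi> s *\<^sub>R T s)"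
    proof -
      have eq: "(\<psi> s * \<theta> t) *\<^sub>R (indicator {-1<..<1} t *\<^sub>R T s) = \<theta> t *\<^sub>R (\<psi> s *\<^sub>R T s)" for s t
        using test_functions_eq_0[OF \<theta>, of t] by (cases "t \<in> {-1<..<1}") auto
      have "(LINT x|lborel. (\<psi> (x $ 1) * \<theta> (x $ 2)) *\<^sub>R (?I x *\<^sub>R T (x $ 1)))
         = (LINT s|lborel. LINT t|lborel. \<theta> t *\<^sub>R (\<psi> s *\<^sub>R T s))"
        by (subst integral_pt[OF mult[OF \<psi> \<theta> IT]]) (simp only: vector_2 eq)
      also have "\<dots> = (LINT s|lborel. c *\<^sub>R (\<psi> s *\<^sub>R T s))"
        unfolding c_def
        by (intro Bochner_Integration.integral_cong refl integral_scaleR_left test_functions_integrable[OF \<theta>])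
      also have "\<dots> = c *\<^sub>R (LINT s|lborel. \<psi> s *\<^sub>R T s)"
        by (rule integral_scaleR_right)
      finally show ?thesis .
    qed
    have "(LINT x|lborel. (\<psi> (x $ 1) * \<theta> (x $ 2)) *\<^sub>R D x)
       = (LINT x|lborel. (\<psi> (x $ 1) * \<theta>0 (x $ 2)) *\<^sub>R D x + c *\<^sub>R ((\<psi> (x $ 1) * \<eta> (x $ 2)) *\<^sub>R D x))"
      by (intro Bochner_Integration.integral_cong refl) (simp add: \<theta>0_def algebra_simps)
    also have "\<dots> = c *\<^sub>R (LINT s|lborel. \<psi> s *\<^sub>R T s)"
    proof -
      have "integrable lborel (\<lambda>x. c *\<^sub>R ((\<psi> (x $ 1) * \<eta> (x $ 2)) *\<^sub>R D x))"
        using mult[OF \<psi> \<eta>(1) D] by (intro integrable_scaleR_right)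
      from Bochner_Integration.integral_add[OF mult[OF \<psi> \<theta>0 D] this]
      show ?thesis by (simp only: integral_scaleR_right 1 2 add_0)
    qed
    finally show ?thesis
      unfolding F_def using mult[OF \<psi> \<theta> D] mult[OF \<psi> \<theta> IT] 3 by (simp add: scaleR_diff_right)
  qed
  have "AE x in lborel. x \<in> Omega \<longrightarrow> F x = 0"
  proof (rule fundamental_lemma_box[OF F open_Omega])
    fix m a b c d :: real
    assume *: "m > 0" "a < b" "c < d" "cbox (pt a c) (pt b d) \<subseteq> Omega"
    then show "(LINT x|lborel. (bump m a b (x $ 1) * bump m c d (x $ 2)) *\<^sub>R F x) = 0"
      using cbox_subset_Omega[OF *(4,2,3)] by (intro zero bump_test)
  qed
  then have "AE x in lborel. x \<in> Omega \<longrightarrow> f x = T (x $ 1) + prim g x"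
    by eventually_elim (auto simp: F_def D_def P_def mem_Omega algebra_simps)
  with T that show ?thesis by blast
qed

lemma AE_swap:
  assumes "AE x in (lborel :: (real^2) measure). P x"
  shows "AE x::real^2 in lborel. P (pt (x $ 2) (x $ 1))"
proof -
  have "AE x in distr lborel borel (\<lambda>x::real^2. pt (x $ 2) (x $ 1)). P x"
    using assms by (subst (asm) lborel_real2_swap)
  then show ?thesis by (rule AE_distrD[rotated]) simp
qed

lemma integrable_swap:
  fixes f :: "real^2 \<Rightarrow> 'b::euclidean_space"
  assumes "integrable lborel f"
  shows "integrable lborel (\<lambda>x::real^2. f (pt (x $ 2) (x $ 1)))"
proof -
  have "integrable (distr lborel borel (\<lambda>x::real^2. pt (x $ 2) (x $ 1))) f"
    using assms by (subst (asm) lborel_real2_swap)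
  then show ?thesis by (rule integrable_distr[rotated]) simp
qed

lemma integral_swap:
  fixes f :: "real^2 \<Rightarrow> 'b::euclidean_space"
  assumes "f \<in> borel_measurable borel"
  shows "(LINT x::real^2|lborel. f (pt (x $ 2) (x $ 1))) = (LINT x|lborel. f x)"
  by (subst (2) lborel_real2_swap, subst integral_distr) (use assms in auto)

text \<open>Exchanging the coordinates yields the vertical case, with \<psi> and \<theta> in
  exchanged roles.\<close>

lemma weak_deriv_1_imp_prim:
  fixes f g :: "real^2 \<Rightarrow> 'b::euclidean_space"
  assumes f: "integrable lborel f" and g: "integrable lborel g"
    and f0: "\<And>x. x \<notin> Omega \<Longrightarrow> f x = 0"
    and weak: "\<And>\<psi> \<theta>. \<psi> \<in> test_functions {-1<..<1} \<Longrightarrow> \<theta> \<in> test_functions {-1<..<1} \<Longrightarrow>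
      (LINT x|lborel. (dir_deriv \<psi> 1 (x $ 1) * \<theta> (x $ 2)) *\<^sub>R f x) = - (LINT x|lborel. (\<psi> (x $ 1) * \<theta> (x $ 2)) *\<^sub>R g x)"
  obtains S where "integrable lborel S" "AE x in lborel. x \<in> Omega \<longrightarrow> f x = S (x $ 2) +
    (LINT t|lborel. indicator {..x $ 1} t *\<^sub>R g (pt t (x $ 2)))"
proof -
  note [measurable] = borel_measurable_integrable[OF f] borel_measurable_integrable[OF g]
  obtain S where S: "integrable lborel S" "AE x in lborel. x \<in> Omega \<longrightarrow>
      f (pt (x $ 2) (x $ 1)) = S (x $ 1) + prim (\<lambda>x. g (pt (x $ 2) (x $ 1))) x"
  proof (rule weak_deriv_2_imp_prim[OF integrable_swap[OF f] integrable_swap[OF g]])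
    fix \<psi> \<theta> :: "real \<Rightarrow> real"
    assume t: "\<psi> \<in> test_functions {-1<..<1}" "\<theta> \<in> test_functions {-1<..<1}"
    have d: "dir_deriv \<theta> 1 \<in> test_functions {-1<..<1}" by (rule test_functions_dir_deriv[OF t(2)]) simp
    note [measurable] = test_functions_measurable[OF t(1)] test_functions_measurable[OF t(2)] test_functions_measurable[OF d]
    have 1: "(LINT x::real^2|lborel. (\<psi> (x $ 1) * dir_deriv \<theta> 1 (x $ 2)) *\<^sub>R f (pt (x $ 2) (x $ 1)))
       = (LINT x|lborel. (dir_deriv \<theta> 1 (x $ 1) * \<psi> (x $ 2)) *\<^sub>R f x)"
      by (subst integral_swap[symmetric]) (simp_all add: mult.commute)
    have 2: "(LINT x::real^2|lborel. (\<psi> (x $ 1) * \<theta> (x $ 2)) *\<^sub>R g (pt (x $ 2) (x $ 1)))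
       = (LINT x|lborel. (\<theta> (x $ 1) * \<psi> (x $ 2)) *\<^sub>R g x)"
      by (subst integral_swap[symmetric]) (simp_all add: mult.commute)
    show "(LINT x::real^2|lborel. (\<psi> (x $ 1) * dir_deriv \<theta> 1 (x $ 2)) *\<^sub>R f (pt (x $ 2) (x $ 1)))
       = - (LINT x::real^2|lborel. (\<psi> (x $ 1) * \<theta> (x $ 2)) *\<^sub>R g (pt (x $ 2) (x $ 1)))"
      unfolding 1 2 by (rule weak[OF t(2,1)])
  qed (use f0 in \<open>auto simp: mem_Omega\<close>)
  show ?thesis
  proof (rule that[OF S(1)])
    show "AE x in lborel. x \<in> Omega \<longrightarrow> f x = S (x $ 2) +
      (LINT t|lborel. indicator {..x $ 1} t *\<^sub>R g (pt t (x $ 2)))"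
      using AE_swap[OF S(2)] by eventually_elim (auto simp: mem_Omega prim_def)
  qed
qed

section \<open>Poincare inequalities in L^1\<close>

text \<open>Two values of the primitive on the interval differ at most by the integral of the norm
  of \<open>v\<close>; averaging over one of the two points brings in the mean of \<open>u\<close>.
  The term with the mean is the norm of an integral, not of an average, so that it needs no division
  by the length.\<close>

lemma poincare_interval:
  fixes u v :: "real \<Rightarrow> 'b::euclidean_space"
  assumes ab: "a < b" and v: "integrable lborel v"
    and u: "AE t in lborel. t \<in> {a<..b} \<longrightarrow> u t = \<tau> + (LINT r|lborel. indicator {..t} r *\<^sub>R v r)"
    and ui: "integrable lborel u"
  shows "(LINT t|lborel. indicator {a<..b} t * norm (u t)) \<le>
     norm (LINT t|lborel. indicator {a<..b} t *\<^sub>R u t) + (b - a) * (LINT t|lborel. indicator {a<..b} t * norm (v t))"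
proof -
  let ?i = "indicator {a<..b} :: real \<Rightarrow> real"
  note [measurable] = borel_measurable_integrable[OF v] borel_measurable_integrable[OF ui]
  define U where "U t = \<tau> + (LINT r|lborel. indicator {..t} r *\<^sub>R v r)" for t
  define m where "m = (LINT t|lborel. ?i t * norm (v t))"
  have vi: "integrable lborel (\<lambda>r. indicator A r *\<^sub>R v r)" if "A \<in> sets borel" for A
    by (rule integrable_mult_indicator) (use v that in auto)
  have vn: "integrable lborel (\<lambda>r. ?i r * norm (v r))"
    using integrable_mult_indicator[of "{a<..b}" lborel "\<lambda>r. norm (v r)"] v by auto
  have le: "norm (U t - U r) \<le> m" if "t \<in> {a<..b}" "r \<in> {a<..b}" "r \<le> t" for t r
  proof -
    have "U t - U r = (LINT q|lborel. indicator {..t} q *\<^sub>R v q - indicator {..r} q *\<^sub>R v q)"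
      unfolding U_def by (subst Bochner_Integration.integral_diff) (auto intro: vi)
    also have "norm \<dots> \<le> (LINT q|lborel. ?i q * norm (v q))"
      by (rule order_trans[OF integral_norm_bound], rule integral_mono)
         (use that in \<open>auto intro!: vn integrable_norm Bochner_Integration.integrable_diff vi split: split_indicator\<close>)
    finally show ?thesis by (simp add: m_def)
  qed
  have le': "norm (U t - U r) \<le> m" if "t \<in> {a<..b}" "r \<in> {a<..b}" for t r
    using le[OF that] le[OF that(2,1)] by (metis linear norm_minus_commute)
  have iu: "integrable lborel (\<lambda>t. ?i t *\<^sub>R u t)"
    by (rule integrable_mult_indicator) (use ui in auto)
  have UI: "AE t in lborel. ?i t *\<^sub>R U t = ?i t *\<^sub>R u t"
    using u by eventually_elim (auto simp: U_def split: split_indicator)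
  have [measurable]: "U \<in> borel_measurable borel"
    unfolding U_def by measurable
  have iU: "integrable lborel (\<lambda>t. ?i t *\<^sub>R U t)"
    by (rule integrable_cong_AE_imp[OF iu]) (use UI in \<open>auto elim!: eventually_mono\<close>)
  have eqU: "(LINT t|lborel. ?i t *\<^sub>R U t) = (LINT t|lborel. ?i t *\<^sub>R u t)"
    by (rule integral_cong_AE) (use UI in auto)
  have lenI: "(LINT t|lborel. ?i t) = b - a" using ab by simp
  have intI: "integrable lborel ?i" using ab by (intro integrable_real_indicator) auto
  \<comment> \<open>The pointwise bound is multiplied by the length of the interval, which replaces
    averages by integrals; the length is cancelled at the end.\<close>
  have pw: "(b - a) * norm (U t) \<le> norm (LINT t|lborel. ?i t *\<^sub>R u t) + (b - a) * m" if t: "t \<in> {a<..b}" for t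
  proof -
    have i1: "integrable lborel (\<lambda>r. ?i r *\<^sub>R U t)" using intI by simp
    have "(b - a) *\<^sub>R U t = (LINT r|lborel. ?i r *\<^sub>R U t)"
      using lenI intI by simp
    also have "\<dots> = (LINT r|lborel. ?i r *\<^sub>R U r) + (LINT r|lborel. ?i r *\<^sub>R (U t - U r))"
      by (subst Bochner_Integration.integral_add[symmetric])
         (use i1 iU in \<open>auto simp: scaleR_diff_right\<close>)
    finally have "norm ((b - a) *\<^sub>R U t) \<le> norm (LINT r|lborel. ?i r *\<^sub>R U r) + norm (LINT r|lborel. ?i r *\<^sub>R (U t - U r))"
      using norm_triangle_ineq by metis
    moreover have "norm (LINT r|lborel. ?i r *\<^sub>R (U t - U r)) \<le> (LINT r|lborel. ?i r * m)"
      by (rule order_trans[OF integral_norm_bound], rule integral_mono)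
         (use i1 iU intI le'[OF t] in \<open>auto simp: scaleR_diff_right intro!: integrable_norm Bochner_Integration.integrable_diff split: split_indicator\<close>)
    moreover have "(LINT r|lborel. ?i r * m) = (b - a) * m"
      using lenI intI by simp
    ultimately show ?thesis using ab eqU by simp
  qed
  have "(b - a) * (LINT t|lborel. ?i t * norm (u t)) = (LINT t|lborel. ?i t * ((b - a) * norm (U t)))"
    unfolding integral_mult_right_zero[symmetric]
  proof (rule integral_cong_AE)
    show "AE t in lborel. (b - a) * (?i t * norm (u t)) = ?i t * ((b - a) * norm (U t))"
      using u by eventually_elim (auto simp: U_def split: split_indicator)
  qed measurable
  also have "\<dots> \<le> (LINT t|lborel. ?i t * (norm (LINT t|lborel. ?i t *\<^sub>R u t) + (b - a) * m))"
  proof (rule integral_mono)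
    show "integrable lborel (\<lambda>t. ?i t * ((b - a) * norm (U t)))"
      using integrable_norm[OF iU] by (simp add: mult.left_commute integrable_mult_right)
    show "?i t * ((b - a) * norm (U t)) \<le> ?i t * (norm (LINT t|lborel. ?i t *\<^sub>R u t) + (b - a) * m)" for t
      using pw[of t] by (auto split: split_indicator)
  qed (use intI in auto)
  also have "\<dots> = (b - a) * (norm (LINT t|lborel. ?i t *\<^sub>R u t) + (b - a) * m)"
    using lenI intI by simp
  finally show ?thesis
    using ab unfolding m_def by (simp only: mult_le_cancel_left_pos diff_gt_0_iff_gt)
qed

lemma integrable_indicator_scaleR:
  fixes h :: "real \<Rightarrow> 'b::euclidean_space"
  assumes "integrable lborel h"
  shows "integrable lborel (\<lambda>t. indicator {c<..d} t *\<^sub>R h t)"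
  by (rule integrable_mult_indicator) (use assms in auto)

lemma integral_rectangle:
  fixes h :: "real^2 \<Rightarrow> 'b::euclidean_space"
  assumes h: "integrable lborel h"
  shows "(LINT x|lborel. (indicator {a<..b} (x $ 1) * indicator {c<..d} (x $ 2)) *\<^sub>R h x)
      = (LINT s|lborel. indicator {a<..b} s *\<^sub>R (LINT t|lborel. indicator {c<..d} t *\<^sub>R h (pt s t)))"
    and "integrable lborel (\<lambda>s. indicator {a<..b} s *\<^sub>R (LINT t|lborel. indicator {c<..d} t *\<^sub>R h (pt s t)))"
    and integrable_rectangle: "integrable lborel (\<lambda>x. (indicator {a<..b} (x $ 1) * indicator {c<..d} (x $ 2)) *\<^sub>R h x)"
proof -
  show Q: "integrable lborel (\<lambda>x. (indicator {a<..b} (x $ 1) * indicator {c<..d} (x $ 2)) *\<^sub>R h x)"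
    by (rule integrable_bounded_scaleR[where C = 1, OF h]) (auto split: split_indicator)
  have "(LINT t|lborel. (indicator {a<..b} (pt s t $ 1) * indicator {c<..d} (pt s t $ 2)) *\<^sub>R h (pt s t))
      = indicator {a<..b} s *\<^sub>R (LINT t|lborel. indicator {c<..d} t *\<^sub>R h (pt s t))" for s
    by (simp flip: scaleR_scaleR)
  then show "(LINT x|lborel. (indicator {a<..b} (x $ 1) * indicator {c<..d} (x $ 2)) *\<^sub>R h x)
      = (LINT s|lborel. indicator {a<..b} s *\<^sub>R (LINT t|lborel. indicator {c<..d} t *\<^sub>R h (pt s t)))"
    "integrable lborel (\<lambda>s. indicator {a<..b} s *\<^sub>R (LINT t|lborel. indicator {c<..d} t *\<^sub>R h (pt s t)))"
    using integral_pt[OF Q] integrable_pt_outer[OF Q] by (simp_all only:)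
qed

text \<open>The inequality on an interval is used twice: on vertical lines for \<open>f\<close>
  itself, then in x_1 for the vertical integrals \<open>v\<close> of \<open>f\<close>, whose
  derivative \<open>w\<close> is the vertical integral of \<open>g1\<close>.\<close>

lemma poincare_square:
  fixes f g1 g2 :: "real^2 \<Rightarrow> 'b::euclidean_space"
  assumes f: "integrable lborel f" and g1: "integrable lborel g1" and g2: "integrable lborel g2"
    and S: "integrable lborel S"
    and ab: "a < b" and cd: "c < d"
    and R1: "AE x in lborel. x $ 1 \<in> {a<..b} \<and> x $ 2 \<in> {c<..d} \<longrightarrow>
      f x = S (x $ 2) + (LINT t|lborel. indicator {..x $ 1} t *\<^sub>R g1 (pt t (x $ 2)))"
    and R2: "AE x in lborel. x $ 1 \<in> {a<..b} \<and> x $ 2 \<in> {c<..d} \<longrightarrow> f x = T (x $ 1) + prim g2 x"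
  defines "Q \<equiv> \<lambda>x::real^2. indicator {a<..b} (x $ 1) * indicator {c<..d} (x $ 2) :: real"
  shows "(LINT x|lborel. Q x * norm (f x)) \<le>
     norm (LINT x|lborel. Q x *\<^sub>R f x) + (b - a) * (LINT x|lborel. Q x * norm (g1 x)) + (d - c) * (LINT x|lborel. Q x * norm (g2 x))"
proof -
  let ?i = "indicator {a<..b} :: real \<Rightarrow> real" and ?j = "indicator {c<..d} :: real \<Rightarrow> real"
  note [measurable] = borel_measurable_integrable[OF f] borel_measurable_integrable[OF g1]
    borel_measurable_integrable[OF g2] borel_measurable_integrable[OF S]
  have Qx: "indicator {a<..b} (x $ 1) * indicator {c<..d} (x $ 2) = Q x" for x by (simp add: Q_def)
  note Q_pt = integral_rectangle[where a = a and b = b and c = c and d = d, unfolded Qx]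
  note Q_pt_real = integral_rectangle[where 'b = real and a = a and b = b and c = c and d = d, unfolded Qx real_scaleR_def]
  define v where "v s = (LINT t|lborel. ?j t *\<^sub>R f (pt s t))" for s
  define w where "w r = (LINT t|lborel. ?j t *\<^sub>R g1 (pt r t))" for r
  define n2 where "n2 s = (LINT t|lborel. ?j t * norm (g2 (pt s t)))" for s
  have outer: "integrable lborel (\<lambda>s. LINT t|lborel. ?j t *\<^sub>R h (pt s t))" if "integrable lborel h" for h :: "real^2 \<Rightarrow> 'b"
  proof -
    have "integrable lborel (\<lambda>x. ?j (x $ 2) *\<^sub>R h x)"
      by (rule integrable_bounded_scaleR[where C = 1, OF that]) (auto split: split_indicator)
    from integrable_pt_outer[OF this] show ?thesis by simp
  qed
  have v: "integrable lborel v" unfolding v_def by (rule outer[OF f])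
  have w: "integrable lborel w" unfolding w_def by (rule outer[OF g1])
  have iv: "integrable lborel (\<lambda>s. ?i s * norm (v s))"
    using integrable_mult_indicator[of "{a<..b}" lborel "\<lambda>s. norm (v s)"] v by auto
  have step1: "(LINT x|lborel. Q x * norm (f x)) \<le> (LINT s|lborel. ?i s * norm (v s)) + (d - c) * (LINT x|lborel. Q x * norm (g2 x))"
  proof -
    have "(LINT x|lborel. Q x * norm (f x)) = (LINT s|lborel. ?i s * (LINT t|lborel. ?j t * norm (f (pt s t))))"
      by (rule Q_pt_real(1)[OF integrable_norm[OF f]])
    also have "\<dots> \<le> (LINT s|lborel. ?i s * norm (v s) + (d - c) * (?i s * n2 s))"
    proof (rule integral_mono_AE)
      show "integrable lborel (\<lambda>s. ?i s * (LINT t|lborel. ?j t * norm (f (pt s t))))"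
        by (rule Q_pt_real(2)[OF integrable_norm[OF f]])
      show "integrable lborel (\<lambda>s. ?i s * norm (v s) + (d - c) * (?i s * n2 s))"
        using Q_pt_real(2)[OF integrable_norm[OF g2]] iv unfolding n2_def
        by (intro Bochner_Integration.integrable_add integrable_mult_right)
      show "AE s in lborel. ?i s * (LINT t|lborel. ?j t * norm (f (pt s t))) \<le> ?i s * norm (v s) + (d - c) * (?i s * n2 s)"
        using AE_pt[OF R2] integrable_pt[OF f] integrable_pt[OF g2]
      proof eventually_elim
        case (elim s)
        show ?case
        proof (cases "s \<in> {a<..b}")
          case True
          have "(LINT t|lborel. ?j t * norm (f (pt s t))) \<le> norm (v s) + (d - c) * n2 s"
            unfolding v_def n2_def
            by (rule poincare_interval[OF cd elim(3) _ elim(2), where \<tau> = "T s"])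
               (use elim(1) True in \<open>auto simp: prim_def elim!: eventually_mono\<close>)
          with True show ?thesis by simp
        qed simp
      qed
    qed
    also have "\<dots> = (LINT s|lborel. ?i s * norm (v s)) + (d - c) * (LINT s|lborel. ?i s * n2 s)"
      using Q_pt_real(2)[OF integrable_norm[OF g2]] iv unfolding n2_def
      by (subst Bochner_Integration.integral_add) (auto intro: integrable_mult_right)
    also have "(LINT s|lborel. ?i s * n2 s) = (LINT x|lborel. Q x * norm (g2 x))"
      unfolding n2_def by (rule Q_pt_real(1)[OF integrable_norm[OF g2], symmetric])
    finally show ?thesis .
  qed
  \<comment> \<open>By Fubini the vertical integral of the horizontal primitives is the primitive of
    the vertical integrals; the part depending on x_2 alone becomes a constant.\<close>
  have rep: "AE s in lborel. s \<in> {a<..b} \<longrightarrow> v s = (LINT t|lborel. ?j t *\<^sub>R S t) + (LINT r|lborel. indicator {..s} r *\<^sub>R w r)"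
    using AE_pt[OF R1]
  proof eventually_elim
    case (elim s)
    show ?case
    proof
      assume s: "s \<in> {a<..b}"
      let ?h = "\<lambda>x. (?j (x $ 2) * indicator {..s} (x $ 1)) *\<^sub>R g1 x"
      have h: "integrable lborel ?h"
        by (rule integrable_bounded_scaleR[where C = 1, OF g1]) (auto split: split_indicator)
      have hint: "integrable lborel (\<lambda>t. ?j t *\<^sub>R (LINT r|lborel. indicator {..s} r *\<^sub>R g1 (pt r t)))"
        using integrable_pt_outer_swap[OF h] by (simp flip: scaleR_scaleR)
      have "v s = (LINT t|lborel. ?j t *\<^sub>R S t + ?j t *\<^sub>R (LINT r|lborel. indicator {..s} r *\<^sub>R g1 (pt r t)))"
        unfolding v_def
      proof (rule integral_cong_AE)
        show "AE t in lborel. ?j t *\<^sub>R f (pt s t) = ?j t *\<^sub>R S t + ?j t *\<^sub>R (LINT r|lborel. indicator {..s} r *\<^sub>R g1 (pt r t))"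
          using elim by eventually_elim (use s in \<open>auto split: split_indicator simp: scaleR_add_right\<close>)
      qed measurable
      also have "\<dots> = (LINT t|lborel. ?j t *\<^sub>R S t) + (LINT t|lborel. ?j t *\<^sub>R (LINT r|lborel. indicator {..s} r *\<^sub>R g1 (pt r t)))"
        by (rule Bochner_Integration.integral_add[OF integrable_indicator_scaleR[OF S] hint])
      also have "(LINT t|lborel. ?j t *\<^sub>R (LINT r|lborel. indicator {..s} r *\<^sub>R g1 (pt r t))) = (LINT x|lborel. ?h x)"
        by (subst integral_pt_swap[OF h]) (simp flip: scaleR_scaleR)
      also have "(LINT x|lborel. ?h x) = (LINT r|lborel. indicator {..s} r *\<^sub>R w r)"
        by (subst integral_pt[OF h]) (simp add: w_def mult.commute[of "indicator {c<..d} _"] flip: scaleR_scaleR)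
      finally show "v s = (LINT t|lborel. ?j t *\<^sub>R S t) + (LINT r|lborel. indicator {..s} r *\<^sub>R w r)" .
    qed
  qed
  have "(LINT s|lborel. ?i s * norm (v s)) \<le> norm (LINT s|lborel. ?i s *\<^sub>R v s) + (b - a) * (LINT s|lborel. ?i s * norm (w s))"
    by (rule poincare_interval[OF ab w rep v])
  also have "(LINT s|lborel. ?i s *\<^sub>R v s) = (LINT x|lborel. Q x *\<^sub>R f x)"
    unfolding v_def by (rule Q_pt(1)[OF f, symmetric])
  also have "(LINT s|lborel. ?i s * norm (w s)) \<le> (LINT x|lborel. Q x * norm (g1 x))"
  proof -
    have "(LINT s|lborel. ?i s * norm (w s)) \<le> (LINT s|lborel. ?i s * (LINT t|lborel. ?j t * norm (g1 (pt s t))))"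
    proof (rule integral_mono)
      show "integrable lborel (\<lambda>s. ?i s * norm (w s))"
        using integrable_mult_indicator[of "{a<..b}" lborel "\<lambda>s. norm (w s)"] w by auto
      show "integrable lborel (\<lambda>s. ?i s * (LINT t|lborel. ?j t * norm (g1 (pt s t))))"
        by (rule Q_pt_real(2)[OF integrable_norm[OF g1]])
      show "?i s * norm (w s) \<le> ?i s * (LINT t|lborel. ?j t * norm (g1 (pt s t)))" for s
        using integral_norm_bound[of lborel "\<lambda>t. ?j t *\<^sub>R g1 (pt s t)"] by (auto simp: w_def intro!: mult_left_mono)
    qed
    then show ?thesis using Q_pt_real(1)[OF integrable_norm[OF g1]] by simp
  qed
  finally show ?thesis using step1 ab by (simp add: mult_left_mono)
qed

lemma sum_indicator_grid:
  fixes p :: "nat \<Rightarrow> real"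
  assumes "\<And>i. p i \<le> p (Suc i)"
  shows "(\<Sum>i<n. indicator {p i<..p (Suc i)} t) = (indicator {p 0<..p n} t :: real)"
proof (induction n)
  case (Suc n)
  have "p 0 \<le> p n" by (rule lift_Suc_mono_le[of p]) (use assms in auto)
  with assms[of n] Suc show ?case by (auto split: split_indicator)
qed simp

lemma AE_vec_nth_ne: "AE x::real^2 in lborel. x $ i \<noteq> c"
proof -
  have "AE s::real in lborel. s \<noteq> c" by (rule AE_lborel_singleton)
  then have "AE s::real in lborel. AE t::real in lborel. pt s t $ i \<noteq> c"
    using exhaust_2[of i]
  proof (elim disjE)
    assume "i = 1"
    with \<open>AE s in lborel. s \<noteq> c\<close> show ?thesis by (auto elim!: eventually_mono)
  qed (simp add: AE_lborel_singleton)
  then show ?thesis by (subst AE_pt_iff) auto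
qed

text \<open>Only \<open>L\<^sup>1\<close> norms of the gradient enter, as \<open>B\<^sub>\<epsilon>\<close> is not bounded in \<open>L\<^sup>2\<close>.\<close>

lemma poincare_Omega:
  fixes f g1 g2 :: "real^2 \<Rightarrow> 'b::euclidean_space" and N :: nat
  assumes f: "integrable lborel f" and g1: "integrable lborel g1" and g2: "integrable lborel g2"
    and f0: "\<And>x. x \<notin> Omega \<Longrightarrow> f x = 0" and g10: "\<And>x. x \<notin> Omega \<Longrightarrow> g1 x = 0" and g20: "\<And>x. x \<notin> Omega \<Longrightarrow> g2 x = 0"
    and weak1: "\<And>\<psi> \<theta>. \<psi> \<in> test_functions {-1<..<1} \<Longrightarrow> \<theta> \<in> test_functions {-1<..<1} \<Longrightarrow>
      (LINT x|lborel. (dir_deriv \<psi> 1 (x $ 1) * \<theta> (x $ 2)) *\<^sub>R f x) = - (LINT x|lborel. (\<psi> (x $ 1) * \<theta> (x $ 2)) *\<^sub>R g1 x)"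
    and weak2: "\<And>\<psi> \<theta>. \<psi> \<in> test_functions {-1<..<1} \<Longrightarrow> \<theta> \<in> test_functions {-1<..<1} \<Longrightarrow>
      (LINT x|lborel. (\<psi> (x $ 1) * dir_deriv \<theta> 1 (x $ 2)) *\<^sub>R f x) = - (LINT x|lborel. (\<psi> (x $ 1) * \<theta> (x $ 2)) *\<^sub>R g2 x)"
    and N: "N > 0"
  defines "p \<equiv> \<lambda>i::nat. -1 + real i * (2 / real N)"
  defines "Q \<equiv> \<lambda>i j (x::real^2). indicator {p i<..p (Suc i)} (x $ 1) * indicator {p j<..p (Suc j)} (x $ 2) :: real"
  shows "(LINT x|lborel. norm (f x)) \<le>
     (\<Sum>i<N. \<Sum>j<N. norm (LINT x|lborel. Q i j x *\<^sub>R f x)) + 2 / real N * ((LINT x|lborel. norm (g1 x)) + (LINT x|lborel. norm (g2 x)))"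
proof -
  obtain S where S: "integrable lborel S" "AE x in lborel. x \<in> Omega \<longrightarrow> f x = S (x $ 2) +
    (LINT t|lborel. indicator {..x $ 1} t *\<^sub>R g1 (pt t (x $ 2)))"
    by (rule weak_deriv_1_imp_prim[OF f g1 f0 weak1])
  obtain T where "integrable lborel T" and T: "AE x in lborel. x \<in> Omega \<longrightarrow> f x = T (x $ 1) + prim g2 x"
    by (rule weak_deriv_2_imp_prim[OF f g2 f0 weak2])
  have step: "p (Suc i) - p i = 2 / real N" for i by (simp add: p_def algebra_simps add_divide_distrib)
  have "0 < 2 / real N" using N by simp
  then have mono: "p i < p (Suc i)" for i using step[of i] by linarith
  have pN: "p N = 1" using N by (simp add: p_def)
  have pb: "-1 \<le> p i" "i < N \<Longrightarrow> p (Suc i) \<le> 1" for i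
    using N by (auto simp: p_def field_simps)
  have sumQ: "(\<Sum>i<N. \<Sum>j<N. Q i j x) = indicator {-1<..1} (x $ 1) * indicator {-1<..1} (x $ 2)" for x
  proof -
    have "(\<Sum>i<N. \<Sum>j<N. Q i j x) = (\<Sum>i<N. indicator {p i<..p (Suc i)} (x $ 1)) * (\<Sum>j<N. indicator {p j<..p (Suc j)} (x $ 2))"
      by (simp add: Q_def sum_product)
    also have "\<dots> = indicator {-1<..1} (x $ 1) * indicator {-1<..1} (x $ 2)"
      using less_imp_le[OF mono] by (simp add: sum_indicator_grid pN) (simp add: p_def)
    finally show ?thesis .
  qed
  have Qi: "integrable lborel (\<lambda>x. Q i j x * norm (h x))" if "integrable lborel h" for i j and h :: "real^2 \<Rightarrow> 'b"
    using integrable_rectangle[OF integrable_norm[OF that]] by (simp add: Q_def)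
  have total: "(LINT x|lborel. norm (h x)) = (\<Sum>i<N. \<Sum>j<N. (LINT x|lborel. Q i j x * norm (h x)))"
    if h: "integrable lborel h" "\<And>x. x \<notin> Omega \<Longrightarrow> h x = 0" for h :: "real^2 \<Rightarrow> 'b"
  proof -
    have "norm (h x) = (\<Sum>i<N. \<Sum>j<N. Q i j x * norm (h x))" for x
    proof -
      have "(\<Sum>i<N. \<Sum>j<N. Q i j x * norm (h x)) = (\<Sum>i<N. \<Sum>j<N. Q i j x) * norm (h x)"
        by (simp add: sum_distrib_right)
      with h(2)[of x] show ?thesis unfolding sumQ by (auto simp: mem_Omega split: split_indicator)
    qed
    then have "(LINT x|lborel. norm (h x)) = (LINT x|lborel. (\<Sum>i<N. \<Sum>j<N. Q i j x * norm (h x)))" by simp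
    also have "\<dots> = (\<Sum>i<N. \<Sum>j<N. (LINT x|lborel. Q i j x * norm (h x)))"
      using Qi[OF h(1)] by (simp add: Bochner_Integration.integral_sum)
    finally show ?thesis .
  qed
  have "(LINT x|lborel. Q i j x * norm (f x)) \<le> norm (LINT x|lborel. Q i j x *\<^sub>R f x) +
      2 / real N * ((LINT x|lborel. Q i j x * norm (g1 x)) + (LINT x|lborel. Q i j x * norm (g2 x)))" if "i < N" "j < N" for i j
  proof -
    \<comment> \<open>The half-open squares reach the right and upper sides of the boundary of
      \<Omega>, where the representations say nothing. The lines x_1 = 1 and x_2 = 1 are therefore
      removed as null sets.\<close>
    have in_O: "x \<in> Omega" if "x $ 1 \<noteq> 1" "x $ 2 \<noteq> 1" "x $ 1 \<in> {p i<..p (Suc i)} \<and> x $ 2 \<in> {p j<..p (Suc j)}" for x :: "real^2"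
      using pb(1)[of i] pb(1)[of j] pb(2)[OF \<open>i < N\<close>] pb(2)[OF \<open>j < N\<close>] that by (auto simp: mem_Omega)
    have "(LINT x|lborel. Q i j x * norm (f x)) \<le> norm (LINT x|lborel. Q i j x *\<^sub>R f x) +
      (p (Suc i) - p i) * (LINT x|lborel. Q i j x * norm (g1 x)) + (p (Suc j) - p j) * (LINT x|lborel. Q i j x * norm (g2 x))"
      unfolding Q_def
    proof (rule poincare_square[OF f g1 g2 S(1) mono mono])
      show "AE x in lborel. x $ 1 \<in> {p i<..p (Suc i)} \<and> x $ 2 \<in> {p j<..p (Suc j)} \<longrightarrow>
          f x = S (x $ 2) + (LINT t|lborel. indicator {..x $ 1} t *\<^sub>R g1 (pt t (x $ 2)))"
        using S(2) AE_vec_nth_ne[of 1 1] AE_vec_nth_ne[of 2 1] by eventually_elim (use in_O in blast)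
      show "AE x in lborel. x $ 1 \<in> {p i<..p (Suc i)} \<and> x $ 2 \<in> {p j<..p (Suc j)} \<longrightarrow> f x = T (x $ 1) + prim g2 x"
        using T AE_vec_nth_ne[of 1 1] AE_vec_nth_ne[of 2 1] by eventually_elim (use in_O in blast)
    qed
    then show ?thesis by (simp add: step distrib_left)
  qed
  then have "(\<Sum>i<N. \<Sum>j<N. (LINT x|lborel. Q i j x * norm (f x))) \<le> (\<Sum>i<N. \<Sum>j<N. norm (LINT x|lborel. Q i j x *\<^sub>R f x) +
      2 / real N * ((LINT x|lborel. Q i j x * norm (g1 x)) + (LINT x|lborel. Q i j x * norm (g2 x))))"
    by (intro sum_mono) auto
  moreover note total[of f, OF f] total[of g1, OF g1] total[of g2, OF g2]
  ultimately show ?thesis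
    using f0 g10 g20 by (simp add: sum.distrib sum_distrib_left distrib_left)
qed

section \<open>Weak compactness in \<open>L\<^sup>2\<close>\<close>

text \<open>Choose elements of nearly minimal norm in the convex hulls of the tails. The minimal
  norms \<open>d N\<close> increase to a limit \<open>L\<close>, midpoints stay in the larger hull,
  and the parallelogram law then makes the choice a Cauchy sequence. Its limit is the candidate for
  the weak limit.\<close>

lemma convex_tail_limit:
  fixes X :: "nat \<Rightarrow> 'h::{real_inner,complete_space}"
  assumes bd: "\<And>n. norm (X n) \<le> M"
  obtains f s where "\<And>N. s N \<in> convex hull (X ` {N..})" "s \<longlonglongrightarrow> f"
proof -
  define C where "C N = convex hull (X ` {N..})" for N
  define d where "d N = Inf (norm ` C N)" for N
  have ne: "norm ` C N \<noteq> {}" and bb: "bdd_below (norm ` C N)" for N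
    by (auto simp: C_def intro!: bdd_belowI2[where m = 0])
  have anti: "C m \<subseteq> C N" if "N \<le> m" for N m
    unfolding C_def using that by (intro hull_mono) auto
  have XC: "X N \<in> C N" for N unfolding C_def by (intro hull_inc) auto
  have d0: "0 \<le> d N" for N unfolding d_def using ne by (intro cInf_greatest) auto
  have dle: "d N \<le> norm z" if "z \<in> C N" for N z
    unfolding d_def using bb that by (intro cInf_lower) auto
  have "incseq d"
    unfolding incseq_def d_def by (intro allI impI cInf_superset_mono image_mono ne bb anti)
  moreover have "d N \<le> M" for N using dle[OF XC] bd order_trans by blast
  ultimately obtain L where L: "d \<longlonglongrightarrow> L" "\<And>N. d N \<le> L"
    using incseq_convergent[of d M] by blast
  have "\<exists>z\<in>C N. norm z < d N + 1 / real (Suc N)" for N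
    using cInf_lessD[OF ne, of N "d N + 1 / real (Suc N)"] by (auto simp: d_def)
  then obtain s where s: "\<And>N. s N \<in> C N" "\<And>N. norm (s N) < d N + 1 / real (Suc N)" by metis
  \<comment> \<open>The right-hand side of the parallelogram law: both norms are estimated from
    above by \<open>d N\<close> and \<open>L\<close> with the error of the choice, the norm of the
    sum from below by \<open>2 * d N\<close>.\<close>
  define e where "e N = 2 * (d N + inverse (real (Suc N)))\<^sup>2 + 2 * (L + inverse (real (Suc N)))\<^sup>2 - 4 * (d N)\<^sup>2" for N
  have "e \<longlonglongrightarrow> 2 * (L + 0)\<^sup>2 + 2 * (L + 0)\<^sup>2 - 4 * L\<^sup>2"
    unfolding e_def by (intro tendsto_intros L LIMSEQ_inverse_real_of_nat)
  then have e0: "e \<longlonglongrightarrow> 0" by simp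
  have dist: "(dist (s N) (s m))\<^sup>2 \<le> e N" if "N \<le> m" for N m
  proof -
    have "s m \<in> C N" using s(1) anti[OF that] by blast
    then have "(1/2) *\<^sub>R s N + (1/2) *\<^sub>R s m \<in> C N"
      using s(1)[of N] unfolding C_def by (intro convexD convex_convex_hull) auto
    then have "d N \<le> norm ((1/2) *\<^sub>R (s N + s m))" using dle by (simp add: scaleR_add_right)
    then have "2 * d N \<le> norm (s N + s m)" by simp
    then have "(2 * d N)\<^sup>2 \<le> (norm (s N + s m))\<^sup>2" using d0[of N] by (intro power_mono) auto
    moreover have "(norm (s N))\<^sup>2 \<le> (d N + inverse (real (Suc N)))\<^sup>2"
      using s(2)[of N] by (intro power_mono) (auto simp: inverse_eq_divide)
    moreover have "norm (s m) \<le> L + inverse (real (Suc N))"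
    proof -
      have "inverse (real (Suc m)) \<le> inverse (real (Suc N))" using that by (intro le_imp_inverse_le) auto
      with s(2)[of m] L(2)[of m] show ?thesis by (simp add: inverse_eq_divide)
    qed
    then have "(norm (s m))\<^sup>2 \<le> (L + inverse (real (Suc N)))\<^sup>2" by (intro power_mono) auto
    moreover have "(norm (s N - s m))\<^sup>2 + (norm (s N + s m))\<^sup>2 = 2 * (norm (s N))\<^sup>2 + 2 * (norm (s m))\<^sup>2"
      by (simp add: power2_norm_eq_inner algebra_simps inner_commute)
    ultimately show ?thesis unfolding e_def dist_norm by (simp add: power_mult_distrib)
  qed
  have "Cauchy s"
    unfolding Cauchy_altdef
  proof (intro allI impI)
    fix r :: real assume "r > 0"
    then have "\<forall>\<^sub>F N in sequentially. e N < r\<^sup>2" using e0 by (intro order_tendstoD) auto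
    then obtain N0 where N0: "\<And>N. N \<ge> N0 \<Longrightarrow> e N < r\<^sup>2" by (auto simp: eventually_sequentially)
    have "dist (s m) (s n) < r" if "m \<ge> N0" "n > m" for m n
      using dist[of m n] N0[OF that(1)] that(2) \<open>r > 0\<close> by (intro power_less_imp_less_base[of _ 2 r]) auto
    then show "\<exists>M. \<forall>m\<ge>M. \<forall>n>m. dist (s m) (s n) < r" by blast
  qed
  then obtain f where "s \<longlonglongrightarrow> f" using Cauchy_convergent convergent_def by blast
  with s(1) that show ?thesis unfolding C_def by blast
qed

text \<open>A tail of \<open>Y\<close> lies in a thin slab around the value \<open>c\<close>, and
  slabs are convex, so the convex hull of the tail lies there too.\<close>

lemma convex_tail_inner_limit:
  fixes Y :: "nat \<Rightarrow> 'h::real_inner"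
  assumes s: "\<And>N. s N \<in> convex hull (Y ` {N..})" "s \<longlonglongrightarrow> f" and c: "(\<lambda>n. Y n \<bullet> y) \<longlonglongrightarrow> c"
  shows "f \<bullet> y = c"
proof (rule LIMSEQ_unique)
  show "(\<lambda>N. s N \<bullet> y) \<longlonglongrightarrow> f \<bullet> y" by (intro tendsto_intros s)
  show "(\<lambda>N. s N \<bullet> y) \<longlonglongrightarrow> c"
  proof (rule LIMSEQ_I)
    fix e :: real assume "e > 0"
    then obtain N0 where N0: "\<And>n. n \<ge> N0 \<Longrightarrow> \<bar>Y n \<bullet> y - c\<bar> < e / 2"
      using LIMSEQ_D[OF c, of "e/2"] by auto
    have "norm (s N \<bullet> y - c) < e" if "N \<ge> N0" for N
    proof -
      let ?H = "{z. y \<bullet> z \<le> c + e / 2} \<inter> {z. y \<bullet> z \<ge> c - e / 2}"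
      have "convex hull (Y ` {N..}) \<subseteq> ?H"
      proof (rule hull_minimal)
        show "Y ` {N..} \<subseteq> ?H"
        proof
          fix z assume "z \<in> Y ` {N..}"
          then obtain n where "z = Y n" "n \<ge> N" by auto
          with N0[of n] that have "\<bar>y \<bullet> z - c\<bar> < e / 2" by (simp add: inner_commute)
          then have "y \<bullet> z \<le> c + e / 2" "y \<bullet> z \<ge> c - e / 2" by linarith+
          then show "z \<in> ?H" by blast
        qed
        show "convex ?H" by (intro convex_Int convex_halfspace_le convex_halfspace_ge)
      qed
      with s(1)[of N] have "y \<bullet> s N \<le> c + e / 2" "y \<bullet> s N \<ge> c - e / 2" by blast+
      then have "\<bar>y \<bullet> s N - c\<bar> < e" using \<open>e > 0\<close> by linarith
      then show ?thesis by (simp add: inner_commute)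
    qed
    then show "\<exists>no. \<forall>n\<ge>no. norm (s n \<bullet> y - c) < e" by blast
  qed
qed

text \<open>A diagonal sequence makes the inner products with every \<open>X m\<close> converge;
  \<open>f\<close> is a limit of convex combinations of it. If some product with \<open>y\<close>
  failed to converge to that of \<open>f\<close>, a further subsequence would produce another limit
  \<open>f'\<close> with the same products against all \<open>X m\<close>. The difference of
  \<open>f'\<close> and \<open>f\<close> is then orthogonal to the span of the sequence and also
  lies in its closure, so it vanishes.\<close>

theorem bounded_weakly_convergent_subsequence:
  fixes X :: "nat \<Rightarrow> 'h::{real_inner,complete_space}"
  assumes bd: "\<And>n. norm (X n) \<le> M"
  obtains r l where "strict_mono r" "\<And>y. (\<lambda>n. X (r n) \<bullet> y) \<longlonglongrightarrow> l \<bullet> y"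
proof -
  have conv_sub: "\<exists>r c. strict_mono (r :: nat \<Rightarrow> nat) \<and> (\<lambda>n. X (q (r n)) \<bullet> y) \<longlonglongrightarrow> c" for q y
  proof -
    have "bounded (range (\<lambda>n. X (q n) \<bullet> y))"
    proof (rule boundedI)
      fix z assume "z \<in> range (\<lambda>n. X (q n) \<bullet> y)"
      then obtain n where "z = X (q n) \<bullet> y" by auto
      then show "norm z \<le> M * norm y"
        using Cauchy_Schwarz_ineq2[of "X (q n)" y] mult_right_mono[OF bd[of "q n"] norm_ge_zero[of y]] by simp
    qed
    from bounded_imp_convergent_subsequence[OF this] show ?thesis by (auto simp: o_def)
  qed
  interpret subseqs "\<lambda>m s. convergent (\<lambda>n. X (s n) \<bullet> X m)"
  proof
    fix m and s :: "nat \<Rightarrow> nat"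
    from conv_sub[of s "X m"] show "\<exists>r'. strict_mono r' \<and> convergent (\<lambda>n. X ((s \<circ> r') n) \<bullet> X m)"
      by (auto simp: convergent_def)
  qed
  define r where "r = diagseq"
  have r: "strict_mono r" unfolding r_def by (rule subseq_diagseq)
  have "convergent (\<lambda>n. X (r n) \<bullet> X m)" for m
  proof -
    have "convergent (\<lambda>n. X ((diagseq \<circ> (+) (Suc m)) n) \<bullet> X m)"
    proof (rule diagseq_holds)
      fix r s :: "nat \<Rightarrow> nat" and n
      assume "strict_mono r" "convergent (\<lambda>k. X (s k) \<bullet> X n)"
      then show "convergent (\<lambda>k. X ((s \<circ> r) k) \<bullet> X n)"
        using convergent_subseq_convergent[of "\<lambda>k. X (s k) \<bullet> X n" r] by (simp add: o_def)
    qed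
    \<comment> \<open>The diagonal sequence is a subsequence of the \<open>m\<close>-th selected
      sequence only after its first \<open>Suc m\<close> terms; dropping these does not affect
      convergence.\<close>
    then have "convergent (\<lambda>n. X (r (n + Suc m)) \<bullet> X m)" by (simp add: r_def o_def add.commute)
    then show ?thesis
      unfolding convergent_def using LIMSEQ_offset[of "\<lambda>n. X (r n) \<bullet> X m" "Suc m"] by blast
  qed
  then obtain a where a: "\<And>m. (\<lambda>n. X (r n) \<bullet> X m) \<longlonglongrightarrow> a m" unfolding convergent_def by metis
  obtain f s where f: "\<And>N. s N \<in> convex hull ((\<lambda>n. X (r n)) ` {N..})" "s \<longlonglongrightarrow> f"
    using convex_tail_limit[where X = "\<lambda>n. X (r n)", OF bd] by blast
  have fX: "f \<bullet> X m = a m" for m by (rule convex_tail_inner_limit[OF f a])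
  have hull_span: "convex hull (X ` A) \<subseteq> span (range X)" for A
    by (intro hull_minimal subspace_imp_convex subspace_span) (auto intro: span_base)
  have "(\<lambda>n. X (r n) \<bullet> y) \<longlonglongrightarrow> f \<bullet> y" for y
  proof (rule ccontr)
    assume "\<not> (\<lambda>n. X (r n) \<bullet> y) \<longlonglongrightarrow> f \<bullet> y"
    then obtain e where e: "e > 0" "\<not> (\<forall>\<^sub>F n in sequentially. dist (X (r n) \<bullet> y) (f \<bullet> y) < e)"
      by (auto simp: tendsto_iff)
    then obtain q where q: "strict_mono (q :: nat \<Rightarrow> nat)" "\<And>n. \<not> dist (X (r (q n)) \<bullet> y) (f \<bullet> y) < e"
      using not_eventually_sequentiallyD by blast
    obtain p c where p: "strict_mono (p :: nat \<Rightarrow> nat)" "(\<lambda>n. X (r (q (p n))) \<bullet> y) \<longlonglongrightarrow> c"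
      using conv_sub[of "\<lambda>n. r (q n)" y] by blast
    define Z where "Z n = X (r (q (p n)))" for n
    have Zb: "norm (Z n) \<le> M" for n by (simp add: Z_def bd)
    obtain f' s' where f': "\<And>N. s' N \<in> convex hull (Z ` {N..})" "s' \<longlonglongrightarrow> f'"
      using convex_tail_limit[where X = Z, OF Zb] by blast
    have "f' \<bullet> y = c" using p(2) by (intro convex_tail_inner_limit[OF f']) (simp add: Z_def)
    have f'X: "f' \<bullet> X m = a m" for m
    proof (rule convex_tail_inner_limit[OF f'])
      have "strict_mono (q \<circ> p)" using q(1) p(1) by (rule strict_mono_o)
      from LIMSEQ_subseq_LIMSEQ[OF a this] show "(\<lambda>n. Z n \<bullet> X m) \<longlonglongrightarrow> a m" by (simp add: Z_def o_def)
    qed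
    have orth: "(f' - f) \<bullet> v = 0" if "v \<in> span (range X)" for v
      using that by (induction rule: span_induct_alt) (auto simp: inner_add_right inner_diff_left fX f'X)
    have "s' N \<in> span (range X)" "s N \<in> span (range X)" for N
    proof -
      have "convex hull (Z ` {N..}) \<subseteq> span (range X)"
        using hull_span[of "(\<lambda>n. r (q (p n))) ` {N..}"] by (simp add: Z_def image_image)
      with f'(1)[of N] show "s' N \<in> span (range X)" by blast
      have "convex hull ((\<lambda>n. X (r n)) ` {N..}) \<subseteq> span (range X)"
        using hull_span[of "r ` {N..}"] by (simp add: image_image)
      with f(1)[of N] show "s N \<in> span (range X)" by blast
    qed
    then have "(f' - f) \<bullet> (s' N - s N) = 0" for N
      by (intro orth span_diff)
    \<comment> \<open>Approximation of \<open>f' - f\<close> by elements of the span turns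
      orthogonality to the span into orthogonality to itself.\<close>
    moreover have "(\<lambda>N. (f' - f) \<bullet> (s' N - s N)) \<longlonglongrightarrow> (f' - f) \<bullet> (f' - f)"
      by (intro tendsto_intros f f')
    ultimately have "(f' - f) \<bullet> (f' - f) = 0" using LIMSEQ_unique[OF _ tendsto_const] by fastforce
    then have "f' = f" by simp
    have "(\<lambda>n. dist (X (r (q (p n))) \<bullet> y) (f \<bullet> y)) \<longlonglongrightarrow> dist c (f \<bullet> y)"
      by (intro tendsto_intros p)
    then have "e \<le> dist c (f \<bullet> y)"
      by (rule LIMSEQ_le_const) (use q(2) in \<open>auto simp: not_less\<close>)
    with \<open>f' \<bullet> y = c\<close> \<open>f' = f\<close> e(1) show False by simp
  qed
  with r that show ?thesis by blast
qed

section \<open>The Hilbert space of square integrable functions\<close>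

definition sq_integrable :: "('a::euclidean_space \<Rightarrow> 'b::euclidean_space) \<Rightarrow> bool" where
  "sq_integrable f \<longleftrightarrow> f \<in> borel_measurable borel \<and> integrable lborel (\<lambda>x. (norm (f x))\<^sup>2)"

lemma sq_integrable_measurable [measurable_dest]: "sq_integrable f \<Longrightarrow> f \<in> borel_measurable borel"
  by (simp add: sq_integrable_def)

lemma sq_integrable_norm: "sq_integrable f \<Longrightarrow> integrable lborel (\<lambda>x. (norm (f x))\<^sup>2)"
  by (simp add: sq_integrable_def)

lemma sq_integrable_0: "sq_integrable (\<lambda>x. 0)"
  by (simp add: sq_integrable_def)

lemma sq_integrable_scaleR: "sq_integrable f \<Longrightarrow> sq_integrable (\<lambda>x. c *\<^sub>R f x)"
  by (auto simp: sq_integrable_def power_mult_distrib)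

lemma sq_integrable_bounded_by:
  assumes "sq_integrable f" "g \<in> borel_measurable borel" "\<And>x. norm (g x) \<le> norm (f x)"
  shows "sq_integrable g"
  unfolding sq_integrable_def
proof
  show "integrable lborel (\<lambda>x. (norm (g x))\<^sup>2)"
    by (rule Bochner_Integration.integrable_bound[OF sq_integrable_norm[OF assms(1)]])
       (use assms in \<open>auto intro!: power_mono\<close>)
qed fact

lemma norm_add_sq_le: "(norm (a + b))\<^sup>2 \<le> 2 * (norm a)\<^sup>2 + 2 * (norm (b::'b::real_inner))\<^sup>2"
proof -
  have "(norm (a + b))\<^sup>2 + (norm (a - b))\<^sup>2 = 2 * (norm a)\<^sup>2 + 2 * (norm b)\<^sup>2"
    by (simp add: power2_norm_eq_inner algebra_simps inner_commute)
  then show ?thesis using zero_le_power2[of "norm (a - b)"] by linarith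
qed

lemma sq_integrable_add:
  assumes "sq_integrable f" "sq_integrable g"
  shows "sq_integrable (\<lambda>x. f x + g x)"
proof -
  note [measurable] = assms[THEN sq_integrable_measurable]
  have "integrable lborel (\<lambda>x. (norm (f x + g x))\<^sup>2)"
    by (rule Bochner_Integration.integrable_bound[where f = "\<lambda>x. 2 * (norm (f x))\<^sup>2 + 2 * (norm (g x))\<^sup>2"])
       (use assms in \<open>auto simp: norm_add_sq_le sq_integrable_def\<close>)
  then show ?thesis by (simp add: sq_integrable_def)
qed

lemma sq_integrable_diff:
  assumes "sq_integrable f" "sq_integrable g"
  shows "sq_integrable (\<lambda>x. f x - g x)"
  using sq_integrable_add[OF assms(1) sq_integrable_scaleR[OF assms(2), of "-1"]] by simp

lemma integrable_inner_sq:
  assumes "sq_integrable f" "sq_integrable g"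
  shows "integrable lborel (\<lambda>x. f x \<bullet> g x)"
proof (rule Bochner_Integration.integrable_bound[where f = "\<lambda>x. (norm (f x))\<^sup>2 + (norm (g x))\<^sup>2"])
  note [measurable] = assms[THEN sq_integrable_measurable]
  show "integrable lborel (\<lambda>x. (norm (f x))\<^sup>2 + (norm (g x))\<^sup>2)"
    using assms by (simp add: sq_integrable_def)
  show "(\<lambda>x. f x \<bullet> g x) \<in> borel_measurable lborel" by measurable
  have "\<bar>a \<bullet> b\<bar> \<le> (norm a)\<^sup>2 + (norm b)\<^sup>2" for a b :: 'b
  proof -
    have "\<bar>a \<bullet> b\<bar> \<le> norm a * norm b" by (rule Cauchy_Schwarz_ineq2)
    moreover have "2 * (norm a * norm b) \<le> (norm a)\<^sup>2 + (norm b)\<^sup>2"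
      using zero_le_power2[of "norm a - norm b"] by (simp add: power2_diff)
    moreover have "0 \<le> norm a * norm b" by simp
    ultimately show ?thesis by linarith
  qed
  then show "AE x in lborel. norm (f x \<bullet> g x) \<le> norm ((norm (f x))\<^sup>2 + (norm (g x))\<^sup>2)"
    by simp
qed

\<comment> \<open>A type of classes is formed because the compactness theorem is stated for types
  that are complete inner product spaces.\<close>
quotient_type (overloaded) ('a, 'b) l2 = "'a::euclidean_space \<Rightarrow> 'b::euclidean_space" / partial:
  "\<lambda>f g. sq_integrable f \<and> sq_integrable g \<and> (AE x in lborel. f x = g x)"
proof (rule part_equivpI)
  show "\<exists>f::'a \<Rightarrow> 'b. sq_integrable f \<and> sq_integrable f \<and> (AE x in lborel. f x = f x)"
    using sq_integrable_0 by auto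
  show "symp (\<lambda>f (g::'a \<Rightarrow> 'b). sq_integrable f \<and> sq_integrable g \<and> (AE x in lborel. f x = g x))"
    by (rule sympI) (auto elim!: eventually_mono)
  show "transp (\<lambda>f (g::'a \<Rightarrow> 'b). sq_integrable f \<and> sq_integrable g \<and> (AE x in lborel. f x = g x))"
    by (rule transpI) (auto elim: eventually_elim2)
qed

instantiation l2 :: (euclidean_space, euclidean_space) real_inner
begin

lift_definition zero_l2 :: "('a, 'b) l2" is "\<lambda>x. 0" by (simp add: sq_integrable_0)

lift_definition plus_l2 :: "('a, 'b) l2 \<Rightarrow> ('a, 'b) l2 \<Rightarrow> ('a, 'b) l2" is "\<lambda>f g x. f x + g x"
proof -
  fix f f' g g' :: "'a \<Rightarrow> 'b"
  assume *: "sq_integrable f \<and> sq_integrable f' \<and> (AE x in lborel. f x = f' x)"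
    "sq_integrable g \<and> sq_integrable g' \<and> (AE x in lborel. g x = g' x)"
  then have "AE x in lborel. f x = f' x" "AE x in lborel. g x = g' x" by auto
  then have "AE x in lborel. f x + g x = f' x + g' x" by eventually_elim simp
  with * show "sq_integrable (\<lambda>x. f x + g x) \<and> sq_integrable (\<lambda>x. f' x + g' x) \<and> (AE x in lborel. f x + g x = f' x + g' x)"
    by (auto intro: sq_integrable_add)
qed

lift_definition minus_l2 :: "('a, 'b) l2 \<Rightarrow> ('a, 'b) l2 \<Rightarrow> ('a, 'b) l2" is "\<lambda>f g x. f x - g x"
proof -
  fix f f' g g' :: "'a \<Rightarrow> 'b"
  assume *: "sq_integrable f \<and> sq_integrable f' \<and> (AE x in lborel. f x = f' x)"
    "sq_integrable g \<and> sq_integrable g' \<and> (AE x in lborel. g x = g' x)"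
  then have "AE x in lborel. f x = f' x" "AE x in lborel. g x = g' x" by auto
  then have "AE x in lborel. f x - g x = f' x - g' x" by eventually_elim simp
  with * show "sq_integrable (\<lambda>x. f x - g x) \<and> sq_integrable (\<lambda>x. f' x - g' x) \<and> (AE x in lborel. f x - g x = f' x - g' x)"
    by (auto intro: sq_integrable_diff)
qed

lift_definition uminus_l2 :: "('a, 'b) l2 \<Rightarrow> ('a, 'b) l2" is "\<lambda>f x. - f x"
  using sq_integrable_scaleR[where c = "-1"] by (auto elim!: eventually_mono)

lift_definition scaleR_l2 :: "real \<Rightarrow> ('a, 'b) l2 \<Rightarrow> ('a, 'b) l2" is "\<lambda>c f x. c *\<^sub>R f x"
  by (auto simp: sq_integrable_scaleR elim!: eventually_mono)

lift_definition inner_l2 :: "('a, 'b) l2 \<Rightarrow> ('a, 'b) l2 \<Rightarrow> real" is "\<lambda>f g. LINT x|lborel. f x \<bullet> g x"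
proof -
  fix f f' g g' :: "'a \<Rightarrow> 'b"
  assume *: "sq_integrable f \<and> sq_integrable f' \<and> (AE x in lborel. f x = f' x)"
    "sq_integrable g \<and> sq_integrable g' \<and> (AE x in lborel. g x = g' x)"
  then have [measurable]: "f \<in> borel_measurable borel" "f' \<in> borel_measurable borel"
    "g \<in> borel_measurable borel" "g' \<in> borel_measurable borel" by (auto dest: sq_integrable_measurable)
  from * have "AE x in lborel. f x = f' x" "AE x in lborel. g x = g' x" by auto
  then have "AE x in lborel. f x \<bullet> g x = f' x \<bullet> g' x" by eventually_elim simp
  then show "(LINT x|lborel. f x \<bullet> g x) = (LINT x|lborel. f' x \<bullet> g' x)"
    by (intro integral_cong_AE) auto
qed

definition norm_l2 :: "('a, 'b) l2 \<Rightarrow> real" where "norm_l2 f = sqrt (f \<bullet> f)"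

definition sgn_l2 :: "('a, 'b) l2 \<Rightarrow> ('a, 'b) l2" where "sgn_l2 f = inverse (norm f) *\<^sub>R f"

definition dist_l2 :: "('a, 'b) l2 \<Rightarrow> ('a, 'b) l2 \<Rightarrow> real" where "dist_l2 f g = norm (f - g)"

definition uniformity_l2 :: "(('a, 'b) l2 \<times> ('a, 'b) l2) filter" where
  "uniformity_l2 = (INF e\<in>{0<..}. principal {(x, y). dist x y < e})"

definition open_l2 :: "('a, 'b) l2 set \<Rightarrow> bool" where
  "open_l2 U \<longleftrightarrow> (\<forall>x\<in>U. \<forall>\<^sub>F (x', y) in uniformity. x' = x \<longrightarrow> y \<in> U)"

instance
proof
  fix f g h :: "('a, 'b) l2" and c d :: real and U :: "('a, 'b) l2 set"
  have cong: "sq_integrable u \<Longrightarrow> sq_integrable v \<Longrightarrow> (\<And>x. u x = v x) \<Longrightarrow>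
     sq_integrable u \<and> sq_integrable v \<and> (AE x in lborel. u x = v x)" for u v :: "'a \<Rightarrow> 'b" by simp
  note si = sq_integrable_add sq_integrable_diff sq_integrable_scaleR sq_integrable_0
  have neg: "sq_integrable u \<Longrightarrow> sq_integrable (\<lambda>x. - u x)" for u :: "'a \<Rightarrow> 'b"
    using sq_integrable_scaleR[of u "-1"] by simp
  show "f + g + h = f + (g + h)" by transfer (auto intro: si simp: add.assoc)
  show "f + g = g + f" by transfer (auto intro: si simp: add.commute)
  show "0 + f = f" by transfer auto
  show "- f + f = 0" by transfer (auto intro: si)
  show "f - g = f + - g" by transfer (auto intro: si neg)
  show "c *\<^sub>R (f + g) = c *\<^sub>R f + c *\<^sub>R g" by transfer (auto intro: si simp: scaleR_add_right)
  show "(c + d) *\<^sub>R f = c *\<^sub>R f + d *\<^sub>R f" by transfer (auto intro: si simp: scaleR_add_left)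
  show "c *\<^sub>R d *\<^sub>R f = (c * d) *\<^sub>R f" by transfer (auto intro: si)
  show "1 *\<^sub>R f = f" by transfer auto
  show "f \<bullet> g = g \<bullet> f" by transfer (simp add: inner_commute)
  show "(f + g) \<bullet> h = f \<bullet> h + g \<bullet> h"
    by transfer (auto simp: inner_add_left intro!: Bochner_Integration.integral_add integrable_inner_sq)
  show "(c *\<^sub>R f) \<bullet> g = c * (f \<bullet> g)" by transfer simp
  show "0 \<le> f \<bullet> f" by transfer (auto intro: integral_nonneg_AE)
  show "(f \<bullet> f = 0) = (f = 0)"
    by transfer (auto simp: sq_integrable_0 integral_nonneg_eq_0_iff_AE integrable_inner_sq)
qed (simp_all add: norm_l2_def sgn_l2_def dist_l2_def uniformity_l2_def open_l2_def)

end

text \<open>The default 0 for functions that are not square integrable makes the map total.\<close>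

lift_definition to_l2 :: "('a::euclidean_space \<Rightarrow> 'b::euclidean_space) \<Rightarrow> ('a, 'b) l2"
  is "\<lambda>f. if sq_integrable f then f else (\<lambda>x. 0)"
  by (simp add: sq_integrable_0)

lemma to_l2_cases: obtains f where "sq_integrable f" "F = to_l2 f"
proof -
  have "\<exists>f. sq_integrable f \<and> F = to_l2 f" by transfer auto
  with that show ?thesis by blast
qed

lemma inner_to_l2:
  "sq_integrable f \<Longrightarrow> sq_integrable g \<Longrightarrow> to_l2 f \<bullet> to_l2 g = (LINT x|lborel. f x \<bullet> g x)"
  by transfer simp

lemma to_l2_diff:
  "sq_integrable f \<Longrightarrow> sq_integrable g \<Longrightarrow> to_l2 f - to_l2 g = to_l2 (\<lambda>x. f x - g x)"
  by transfer (simp add: sq_integrable_diff)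

lemma norm_to_l2: "sq_integrable f \<Longrightarrow> (norm (to_l2 f))\<^sup>2 = (LINT x|lborel. (norm (f x))\<^sup>2)"
  by (simp add: power2_norm_eq_inner inner_to_l2)

lemma dist_to_l2:
  "sq_integrable f \<Longrightarrow> sq_integrable g \<Longrightarrow> (dist (to_l2 f) (to_l2 g))\<^sup>2 = (LINT x|lborel. (norm (f x - g x))\<^sup>2)"
  by (simp add: dist_norm to_l2_diff norm_to_l2 sq_integrable_diff)

lemma nn_integral_sq_integrable:
  "sq_integrable f \<Longrightarrow> (\<integral>\<^sup>+x. ennreal ((norm (f x))\<^sup>2) \<partial>lborel) = ennreal ((norm (to_l2 f))\<^sup>2)"
  by (simp add: norm_to_l2 nn_integral_eq_integral sq_integrable_norm)

text \<open>The heart of the Riesz-Fischer theorem. The squared increments are so small that they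
  stay summable after multiplication by 2^n; this gives convergence almost everywhere, and Fatou's
  lemma turns the pointwise limit into a limit in norm.\<close>

lemma rapid_l2_convergent:
  fixes f :: "nat \<Rightarrow> 'a::euclidean_space \<Rightarrow> 'b::euclidean_space"
  assumes f: "\<And>n. sq_integrable (f n)"
    and rapid: "\<And>n m. n \<le> m \<Longrightarrow> norm (to_l2 (\<lambda>x. f m x - f n x)) \<le> (1/2) ^ n"
  obtains F where "sq_integrable F" "(\<lambda>n. to_l2 (f n)) \<longlonglongrightarrow> to_l2 F"
proof -
  have [measurable]: "f n \<in> borel_measurable borel" for n by (rule sq_integrable_measurable[OF f])
  have fatou: "(\<integral>\<^sup>+x. ennreal ((norm (F x - f n x))\<^sup>2) \<partial>lborel) \<le> ennreal (((1/2) ^ n)\<^sup>2)"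
    if [measurable]: "F \<in> borel_measurable borel" and F: "AE x in lborel. (\<lambda>n. f n x) \<longlonglongrightarrow> F x" for F n
  proof -
    have "(\<integral>\<^sup>+x. ennreal ((norm (F x - f n x))\<^sup>2) \<partial>lborel)
       = (\<integral>\<^sup>+x. liminf (\<lambda>m. ennreal ((norm (f m x - f n x))\<^sup>2)) \<partial>lborel)"
    proof (rule nn_integral_cong_AE)
      show "AE x in lborel. ennreal ((norm (F x - f n x))\<^sup>2) = liminf (\<lambda>m. ennreal ((norm (f m x - f n x))\<^sup>2))"
        using F
      proof eventually_elim
        case (elim x)
        then have "(\<lambda>m. ennreal ((norm (f m x - f n x))\<^sup>2)) \<longlonglongrightarrow> ennreal ((norm (F x - f n x))\<^sup>2)"
          by (intro tendsto_intros)
        from lim_imp_Liminf[OF _ this] show ?case by simp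
      qed
    qed
    also have "\<dots> \<le> liminf (\<lambda>m. \<integral>\<^sup>+x. ennreal ((norm (f m x - f n x))\<^sup>2) \<partial>lborel)"
      by (rule nn_integral_liminf) measurable
    also have "\<dots> \<le> liminf (\<lambda>m. ennreal (((1/2) ^ n)\<^sup>2))"
    proof (rule Liminf_mono, rule eventually_sequentiallyI)
      fix m assume "n \<le> m"
      have "(norm (to_l2 (\<lambda>x. f m x - f n x)))\<^sup>2 \<le> ((1/2) ^ n)\<^sup>2"
        by (rule power_mono[OF rapid[OF \<open>n \<le> m\<close>]]) simp
      then show "(\<integral>\<^sup>+x. ennreal ((norm (f m x - f n x))\<^sup>2) \<partial>lborel) \<le> ennreal (((1/2) ^ n)\<^sup>2)"
        by (subst nn_integral_sq_integrable[OF sq_integrable_diff[OF f f]]) (rule ennreal_leI)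
    qed
    also have "\<dots> = ennreal (((1/2) ^ n)\<^sup>2)" by (simp add: Liminf_const)
    finally show ?thesis .
  qed
  define D where "D x = (\<Sum>n. ennreal (2 ^ n * (norm (f (Suc n) x - f n x))\<^sup>2))" for x
  have "(\<integral>\<^sup>+x. D x \<partial>lborel) = (\<Sum>n. \<integral>\<^sup>+x. ennreal (2 ^ n * (norm (f (Suc n) x - f n x))\<^sup>2) \<partial>lborel)"
    unfolding D_def by (rule nn_integral_suminf) measurable
  also have "\<dots> \<le> (\<Sum>n. ennreal ((1/2) ^ n))"
  proof (rule suminf_le)
    fix n
    have "(\<integral>\<^sup>+x. ennreal (2 ^ n * (norm (f (Suc n) x - f n x))\<^sup>2) \<partial>lborel)
       = ennreal (2 ^ n) * ennreal ((norm (to_l2 (\<lambda>x. f (Suc n) x - f n x)))\<^sup>2)"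
      by (subst nn_integral_sq_integrable[OF sq_integrable_diff[OF f f], symmetric])
         (simp add: ennreal_mult nn_integral_cmult)
    also have "\<dots> \<le> ennreal (2 ^ n) * ennreal (((1/2) ^ n)\<^sup>2)"
      by (intro mult_left_mono ennreal_leI power_mono rapid) auto
    also have "\<dots> = ennreal ((1/2) ^ n)"
      by (subst ennreal_mult[symmetric]) (auto simp: power2_eq_square field_simps power_mult_distrib[symmetric])
    finally show "(\<integral>\<^sup>+x. ennreal (2 ^ n * (norm (f (Suc n) x - f n x))\<^sup>2) \<partial>lborel) \<le> ennreal ((1/2) ^ n)" .
  qed auto
  also have "\<dots> < \<infinity>"
    by (subst suminf_ennreal2) (auto intro: summable_geometric)
  finally have "AE x in lborel. D x \<noteq> \<infinity>"
    unfolding D_def by (intro nn_integral_PInf_AE) (auto simp: D_def)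
  then have conv: "AE x in lborel. convergent (\<lambda>n. f n x)"
  proof eventually_elim
    case (elim x)
    let ?d = "\<lambda>n. norm (f (Suc n) x - f n x)"
    have "summable (\<lambda>n. 2 ^ n * (?d n)\<^sup>2)"
      using elim by (intro summable_suminf_not_top) (auto simp: D_def)
    moreover have "summable (\<lambda>n. (1/2::real) ^ n)" by (simp add: summable_geometric)
    ultimately have "summable (\<lambda>n. 2 ^ n * (?d n)\<^sup>2 + (1/2) ^ n)" by (rule summable_add)
    then have "summable ?d"
    proof (rule summable_comparison_test'[where N = 0])
      fix n
      \<comment> \<open>Completing the square bounds an increment \<open>?d n\<close> by 2^n times
        its square plus 2^(-n), so that summability of the weighted squares gives summability of the
        increments.\<close>
      have "(2::real) ^ n * (1/2) ^ n = 1" by (simp add: power_mult_distrib[symmetric])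
      moreover have "2 ^ n * (?d n - (1/2) ^ n)\<^sup>2
          = 2 ^ n * (?d n)\<^sup>2 - 2 * (2 ^ n * (1/2) ^ n) * ?d n + (2 ^ n * (1/2) ^ n) * (1/2) ^ n"
        by (simp add: power2_eq_square algebra_simps)
      ultimately have "2 ^ n * (?d n)\<^sup>2 + (1/2) ^ n - 2 * ?d n = 2 ^ n * (?d n - (1/2) ^ n)\<^sup>2"
        by simp
      also have "\<dots> \<ge> 0" by simp
      finally have "2 * ?d n \<le> 2 ^ n * (?d n)\<^sup>2 + (1/2) ^ n" by simp
      moreover have "?d n \<le> 2 * ?d n" by simp
      ultimately have "?d n \<le> 2 ^ n * (?d n)\<^sup>2 + (1/2) ^ n" by linarith
      then show "norm (?d n) \<le> 2 ^ n * (?d n)\<^sup>2 + (1/2) ^ n" by simp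
    qed
    then have "summable (\<lambda>n. f (Suc n) x - f n x)" by (rule summable_norm_cancel)
    then have "convergent (\<lambda>n. (\<Sum>i<n. f (Suc i) x - f i x) + f 0 x)"
      by (intro convergent_add convergent_const) (simp add: summable_iff_convergent)
    then show "convergent (\<lambda>n. f n x)"
      using sum_lessThan_telescope[of "\<lambda>n. f n x"] by simp
  qed
  \<comment> \<open>On the null set of divergence the value of \<open>lim\<close> is arbitrary, but
    \<open>F\<close> is still Borel.\<close>
  define F where "F x = lim (\<lambda>n. f n x)" for x
  have [measurable]: "F \<in> borel_measurable borel" unfolding F_def by measurable
  have F: "AE x in lborel. (\<lambda>n. f n x) \<longlonglongrightarrow> F x"
    using conv by eventually_elim (simp add: F_def convergent_LIMSEQ_iff)
  have sq: "sq_integrable (\<lambda>x. F x - f n x)" for n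
    unfolding sq_integrable_def
  proof
    show "integrable lborel (\<lambda>x. (norm (F x - f n x))\<^sup>2)"
      using fatou[OF _ F, of n] by (intro integrableI_bounded) (auto intro: le_less_trans)
  qed measurable
  have "sq_integrable F" using sq_integrable_add[OF sq[of 0] f[of 0]] by simp
  moreover have "(\<lambda>n. to_l2 (f n)) \<longlonglongrightarrow> to_l2 F"
  proof (rule metric_LIMSEQ_I)
    fix e :: real assume "e > 0"
    then obtain n0 where n0: "(1/2) ^ n0 < e" using real_arch_pow_inv[of e "1/2"] by auto
    have "dist (to_l2 (f n)) (to_l2 F) < e" if "n \<ge> n0" for n
    proof -
      have "ennreal ((norm (to_l2 (\<lambda>x. F x - f n x)))\<^sup>2) \<le> ennreal (((1/2) ^ n)\<^sup>2)"
        using fatou[OF _ F, of n] by (simp add: nn_integral_sq_integrable[OF sq])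
      then have "norm (to_l2 (\<lambda>x. F x - f n x)) \<le> (1/2) ^ n"
        by (simp add: ennreal_le_iff power2_le_iff_abs_le)
      moreover have "(1/2::real) ^ n \<le> (1/2) ^ n0" using that by (intro power_decreasing) auto
      moreover have "dist (to_l2 (f n)) (to_l2 F) = norm (to_l2 (\<lambda>x. F x - f n x))"
        using \<open>sq_integrable F\<close> f by (subst dist_commute) (simp add: dist_norm to_l2_diff)
      ultimately show ?thesis using n0 by linarith
    qed
    then show "\<exists>no. \<forall>n\<ge>no. dist (to_l2 (f n)) (to_l2 F) < e" by blast
  qed
  ultimately show ?thesis using that by blast
qed

instance l2 :: (euclidean_space, euclidean_space) complete_space
proof
  fix X :: "nat \<Rightarrow> ('a, 'b) l2"
  assume X: "Cauchy X"
  obtain r where r: "strict_mono (r :: nat \<Rightarrow> nat)" "\<And>n m. n \<le> m \<Longrightarrow> dist (X (r m)) (X (r n)) \<le> (1/2) ^ n"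
  proof -
    have "\<exists>N. \<forall>m\<ge>N. \<forall>n\<ge>N. dist (X m) (X n) \<le> (1/2) ^ k" for k :: nat
      using metric_CauchyD[OF X, of "(1/2)^k"] by (auto intro: less_imp_le)
    then obtain N where N: "\<And>k m n. m \<ge> N k \<Longrightarrow> n \<ge> N k \<Longrightarrow> dist (X m) (X n) \<le> (1/2) ^ k" by metis
    \<comment> \<open>Summing the successors makes the indices strictly increasing and keeps the
      \<open>k\<close>-th one above \<open>N k\<close>.\<close>
    define r where "r k = (\<Sum>i\<le>k. Suc (N i))" for k
    have "strict_mono r" unfolding r_def by (intro strict_monoI_Suc) simp
    moreover have rN: "r k \<ge> N k" for k
      unfolding r_def using member_le_sum[of k "{..k}" "\<lambda>i. Suc (N i)"] by auto
    moreover have "dist (X (r m)) (X (r n)) \<le> (1/2) ^ n" if "n \<le> m" for n m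
    proof (rule N)
      have "r n \<le> r m" using \<open>strict_mono r\<close> that by (simp add: strict_mono_less_eq)
      with rN[of n] show "N n \<le> r m" by simp
    qed (rule rN)
    ultimately show ?thesis by (intro that)
  qed
  have "\<forall>n. \<exists>f. sq_integrable f \<and> X (r n) = to_l2 f" by (metis to_l2_cases)
  then obtain f where f: "\<And>n. sq_integrable (f n)" "\<And>n. X (r n) = to_l2 (f n)" by metis
  obtain F where "sq_integrable F" "(\<lambda>n. to_l2 (f n)) \<longlonglongrightarrow> to_l2 F"
    using rapid_l2_convergent[of f] f r(2) by (auto simp: dist_norm to_l2_diff)
  then have "(X \<circ> r) \<longlonglongrightarrow> to_l2 F" by (simp add: o_def f(2))
  with X r(1) show "convergent X" using Cauchy_converges_subseq[of X r "to_l2 F"] by (auto simp: convergent_def)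
qed

section \<open>Blowing up the layer\<close>

text \<open>The bound on \<open>X\<close> absorbs the strongly vanishing error in
  \<open>Y\<close>.\<close>

lemma weak_strong_inner:
  fixes X Y :: "nat \<Rightarrow> 'h::real_inner"
  assumes bd: "\<And>n. norm (X n) \<le> M" and X: "\<And>y. (\<lambda>n. X n \<bullet> y) \<longlonglongrightarrow> l \<bullet> y" and Y: "Y \<longlonglongrightarrow> y"
  shows "(\<lambda>n. X n \<bullet> Y n) \<longlonglongrightarrow> l \<bullet> y"
proof -
  have "(\<lambda>n. X n \<bullet> (Y n - y)) \<longlonglongrightarrow> 0"
  proof (rule Lim_null_comparison)
    show "\<forall>\<^sub>F n in sequentially. norm (X n \<bullet> (Y n - y)) \<le> M * norm (Y n - y)"
      using order_trans[OF Cauchy_Schwarz_ineq2 mult_right_mono[OF bd norm_ge_zero]]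
      by (intro always_eventually allI) simp
    have "(\<lambda>n. Y n - y) \<longlonglongrightarrow> 0" using Y by (simp add: LIM_zero)
    from tendsto_mult[OF tendsto_const tendsto_norm[OF this], of M]
    show "(\<lambda>n. M * norm (Y n - y)) \<longlonglongrightarrow> 0" by simp
  qed
  from tendsto_add[OF this X[of y]] show ?thesis by (simp add: inner_diff_right)
qed

section \<open>The anisotropic change of variables\<close>

lemma lborel_stretch:
  assumes "c > 0"
  shows "lborel = density (distr lborel borel (\<lambda>x::real^2. pt (x $ 1) (c * x $ 2))) (\<lambda>_. ennreal c)"
proof (rule lborel_eqI)
  fix l u :: "real^2"
  assume le: "\<And>b. b \<in> Basis \<Longrightarrow> l \<bullet> b \<le> u \<bullet> b"
  have le': "l $ 1 \<le> u $ 1" "l $ 2 \<le> u $ 2"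
    using le[of "axis 1 1"] le[of "axis 2 1"] by (simp_all add: inner_axis)
  have eq: "(\<lambda>x::real^2. pt (x $ 1) (c * x $ 2)) -` box l u = box (pt (l $ 1) (l $ 2 / c)) (pt (u $ 1) (u $ 2 / c))"
    using assms by (auto simp: mem_box Basis_real2 inner_axis field_simps)
  have "l $ 2 / c \<le> u $ 2 / c" using le' assms by (simp add: divide_right_mono)
  then have "emeasure lborel (box (pt (l $ 1) (l $ 2 / c)) (pt (u $ 1) (u $ 2 / c))) = ennreal ((u $ 1 - l $ 1) * (u $ 2 / c - l $ 2 / c))"
    using le' by (simp add: emeasure_lborel_box_eq Basis_real2 axis_eq_axis inner_axis)
  moreover have "c * ((u $ 1 - l $ 1) * (u $ 2 / c - l $ 2 / c)) = (u $ 1 - l $ 1) * (u $ 2 - l $ 2)"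
    using assms by (simp add: field_simps)
  ultimately show "emeasure (density (distr lborel borel (\<lambda>x::real^2. pt (x $ 1) (c * x $ 2))) (\<lambda>_. ennreal c)) (box l u) = (\<Prod>b\<in>Basis. (u - l) \<bullet> b)"
    using assms le' \<open>l $ 2 / c \<le> u $ 2 / c\<close>
    by (simp add: emeasure_density nn_integral_cmult_indicator emeasure_distr eq Basis_real2 axis_eq_axis inner_axis
          ennreal_mult[symmetric])
qed simp

lemma integrable_stretch_iff:
  fixes f :: "real^2 \<Rightarrow> 'b::euclidean_space"
  assumes "c > 0" and [measurable]: "f \<in> borel_measurable borel"
  shows "integrable lborel (\<lambda>x::real^2. f (pt (x $ 1) (c * x $ 2))) \<longleftrightarrow> integrable lborel f"
proof -
  have "integrable lborel f \<longleftrightarrow> integrable (density (distr lborel borel (\<lambda>x::real^2. pt (x $ 1) (c * x $ 2))) (\<lambda>_. ennreal c)) f"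
    by (subst lborel_stretch[OF assms(1)]) simp
  also have "\<dots> \<longleftrightarrow> integrable lborel (\<lambda>x::real^2. f (pt (x $ 1) (c * x $ 2)))"
  proof -
    have "integrable lborel (\<lambda>x. c *\<^sub>R h x) \<longleftrightarrow> integrable lborel h" for h :: "real^2 \<Rightarrow> 'b"
      using integrable_scaleR_right[of "inverse c" lborel "\<lambda>x. c *\<^sub>R h x"]
        integrable_scaleR_right[of c lborel h] assms(1) by auto
    then show ?thesis
      using assms(1) by (subst integrable_density) (auto simp: integrable_distr_eq)
  qed
  finally show ?thesis by simp
qed

lemma integral_stretch:
  fixes f :: "real^2 \<Rightarrow> 'b::euclidean_space"
  assumes "c > 0" and [measurable]: "f \<in> borel_measurable borel"
  shows "(LINT x|lborel. f x) = c *\<^sub>R (LINT x::real^2|lborel. f (pt (x $ 1) (c * x $ 2)))"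
proof -
  have "(LINT x|lborel. f x) = (LINT x|density (distr lborel borel (\<lambda>x::real^2. pt (x $ 1) (c * x $ 2))) (\<lambda>_. ennreal c). f x)"
    by (subst lborel_stretch[OF assms(1)]) simp
  also have "\<dots> = c *\<^sub>R (LINT x::real^2|lborel. f (pt (x $ 1) (c * x $ 2)))"
    using assms(1) by (subst integral_density) (auto simp: integral_distr)
  finally show ?thesis .
qed

lemma mem_layer: "x \<in> layer c \<xi> \<longleftrightarrow> -\<xi> < x $ 1 \<and> x $ 1 < 1 \<and> - (c * \<xi> / 2) < x $ 2 \<and> x $ 2 < c * \<xi> / 2"
  by (auto simp: layer_def mem_box Basis_real2 inner_axis)

lemma stretch_mem_layer: "c > 0 \<Longrightarrow> pt (x $ 1) (c * x $ 2) \<in> layer c \<xi> \<longleftrightarrow> x \<in> layer 1 \<xi>"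
  using mult_less_cancel_left_pos[of c "- (\<xi> / 2)" "x $ 2"] mult_less_cancel_left_pos[of c "x $ 2" "\<xi> / 2"]
  by (simp add: mem_layer)

lemma open_layer: "open (layer c \<xi>)"
  by (simp add: layer_def open_box)

lemma sets_layer [measurable]: "layer c \<xi> \<in> sets borel"
  by (simp add: open_layer)

lemma emeasure_layer_finite: "emeasure lborel (layer c \<xi>) < \<infinity>"
  unfolding layer_def by (rule emeasure_bounded_finite) (rule bounded_box)

lemma emeasure_Omega_finite: "emeasure lborel Omega < \<infinity>"
  unfolding Omega_def by (rule emeasure_bounded_finite) (rule bounded_box)

text \<open>The inequality |f| \<le> 1 + |f|^2 on \<open>S\<close> stands in for Cauchy-Schwarz; it
  is not homogeneous, but bounds in L^2 still give bounds in L^1.\<close>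

lemma sq_integrable_imp_integrable:
  fixes f :: "'a::euclidean_space \<Rightarrow> 'b::euclidean_space"
  assumes f: "sq_integrable f" and S: "S \<in> sets borel" "emeasure lborel S < \<infinity>" "\<And>x. x \<notin> S \<Longrightarrow> f x = 0"
  shows "integrable lborel f" "(LINT x|lborel. norm (f x)) \<le> measure lborel S + (norm (to_l2 f))\<^sup>2"
proof -
  note [measurable] = sq_integrable_measurable[OF f]
  have le: "norm (f x) \<le> indicator S x + (norm (f x))\<^sup>2" for x
  proof (cases "x \<in> S")
    case True
    have "2 * norm (f x) \<le> 1 + (norm (f x))\<^sup>2" using zero_le_power2[of "norm (f x) - 1"] by (simp add: power2_diff)
    with True show ?thesis using norm_ge_zero[of "f x"] by (simp, linarith)
  qed (simp add: S(3))
  have i: "integrable lborel (\<lambda>x. indicator S x + (norm (f x))\<^sup>2)"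
    using S by (intro Bochner_Integration.integrable_add sq_integrable_norm f integrable_real_indicator) auto
  show fi: "integrable lborel f"
    by (rule Bochner_Integration.integrable_bound[OF i]) (use le in \<open>auto intro: order_trans[OF le]\<close>)
  have "(LINT x|lborel. norm (f x)) \<le> (LINT x|lborel. indicator S x + (norm (f x))\<^sup>2)"
    by (rule integral_mono[OF integrable_norm[OF fi] i le])
  also have "\<dots> = measure lborel S + (norm (to_l2 f))\<^sup>2"
    using S by (subst Bochner_Integration.integral_add)
      (auto simp: norm_to_l2 f intro!: sq_integrable_norm integrable_real_indicator)
  finally show "(LINT x|lborel. norm (f x)) \<le> measure lborel S + (norm (to_l2 f))\<^sup>2" .
qed

text \<open>The same formula as \<open>rescale\<close>, for any target space, because it is applied
  to the curl as well. The factor \<open>c\<close> is the Jacobian of the stretching: integrals are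
  preserved, and the squared L^2 norm is multiplied by \<open>c\<close>.\<close>

definition blow_up :: "real \<Rightarrow> (real^2 \<Rightarrow> 'b::euclidean_space) \<Rightarrow> real^2 \<Rightarrow> 'b" where
  "blow_up c F x = c *\<^sub>R F (pt (x $ 1) (c * x $ 2))"

lemma blow_up_measurable [measurable]:
  assumes [measurable]: "F \<in> borel_measurable borel"
  shows "blow_up c F \<in> borel_measurable borel"
  unfolding blow_up_def by measurable

lemma blow_up_sq:
  fixes F :: "real^2 \<Rightarrow> 'b::euclidean_space"
  assumes F: "sq_integrable F" and c: "c > 0"
  shows "sq_integrable (blow_up c F)"
    and "(norm (to_l2 (blow_up c F)))\<^sup>2 = c * (LINT x|lborel. (norm (F x))\<^sup>2)"
proof -
  note [measurable] = sq_integrable_measurable[OF F]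
  have "integrable lborel (\<lambda>x::real^2. (norm (F (pt (x $ 1) (c * x $ 2))))\<^sup>2)"
    using sq_integrable_norm[OF F] c by (subst integrable_stretch_iff[where f = "\<lambda>x. (norm (F x))\<^sup>2"]) auto
  then show sq: "sq_integrable (blow_up c F)"
    by (simp add: sq_integrable_def blow_up_measurable) (simp add: blow_up_def power_mult_distrib)
  have "(norm (to_l2 (blow_up c F)))\<^sup>2 = c\<^sup>2 * (LINT x::real^2|lborel. (norm (F (pt (x $ 1) (c * x $ 2))))\<^sup>2)"
    by (simp add: norm_to_l2[OF sq]) (simp add: blow_up_def power_mult_distrib)
  also have "\<dots> = c * (LINT x|lborel. (norm (F x))\<^sup>2)"
    by (subst integral_stretch[OF c]) (simp_all add: power2_eq_square)
  finally show "(norm (to_l2 (blow_up c F)))\<^sup>2 = c * (LINT x|lborel. (norm (F x))\<^sup>2)" .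
qed

lemma integral_blow_up:
  fixes F :: "real^2 \<Rightarrow> 'b::euclidean_space"
  assumes [measurable]: "F \<in> borel_measurable borel" "\<phi> \<in> borel_measurable borel" and c: "c > 0"
  shows "(LINT x|lborel. \<phi> x *\<^sub>R F x) = (LINT x|lborel. \<phi> (pt (x $ 1) (c * x $ 2)) *\<^sub>R blow_up c F x)"
  by (subst integral_stretch[OF c]) (simp_all add: blow_up_def mult.commute flip: integral_scaleR_right)

text \<open>The stretched test functions flatten to their values on x_2 = 0. On the fixed layer this
  is strong convergence in L^2, which can be paired with the weak convergence of the fields.\<close>

lemma blow_up_limit:
  fixes F :: "nat \<Rightarrow> real^2 \<Rightarrow> 'b::euclidean_space" and G :: "real^2 \<Rightarrow> 'b" and \<epsilon> :: "nat \<Rightarrow> real"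
  assumes \<epsilon>: "\<epsilon> \<longlonglongrightarrow> 0"
    and F: "\<And>n. sq_integrable (F n)" "\<And>n x. x \<notin> layer 1 \<xi> \<Longrightarrow> F n x = 0" "\<And>n. norm (to_l2 (F n)) \<le> M"
    and G: "sq_integrable G" "\<And>x. x \<notin> layer 1 \<xi> \<Longrightarrow> G x = 0"
    and weak: "\<And>y. (\<lambda>n. to_l2 (F n) \<bullet> y) \<longlonglongrightarrow> to_l2 G \<bullet> y"
    and \<phi>: "continuous_on UNIV \<phi>" "\<And>x. \<bar>\<phi> x\<bar> \<le> C"
  shows "(\<lambda>n. LINT x|lborel. \<phi> (pt (x $ 1) (\<epsilon> n * x $ 2)) *\<^sub>R F n x) \<longlonglongrightarrow> (LINT x|lborel. \<phi> (pt (x $ 1) 0) *\<^sub>R G x)"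
proof -
  let ?L = "layer 1 \<xi>"
  have [measurable]: "\<phi> \<in> borel_measurable borel" by (rule borel_measurable_continuous_onI[OF \<phi>(1)])
  have fin: "emeasure lborel ?L < \<infinity>" by (rule emeasure_layer_finite)
  have "C \<ge> 0" using \<phi>(2) abs_ge_zero order_trans by blast
  have Li: "integrable lborel (indicator ?L :: real^2 \<Rightarrow> real)"
    using fin by (intro integrable_real_indicator) auto
  have int: "integrable lborel (\<lambda>x. \<phi> (g x) *\<^sub>R h x)"
    if "sq_integrable h" "\<And>x. x \<notin> ?L \<Longrightarrow> h x = 0" "g \<in> borel_measurable borel" for h :: "real^2 \<Rightarrow> 'b" and g :: "real^2 \<Rightarrow> real^2"
    by (rule integrable_bounded_scaleR[OF sq_integrable_imp_integrable(1)[OF that(1) _ fin that(2)]])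
       (use that \<phi>(2) in auto)
  have "(\<lambda>n. (LINT x|lborel. \<phi> (pt (x $ 1) (\<epsilon> n * x $ 2)) *\<^sub>R F n x) \<bullet> b) \<longlonglongrightarrow> (LINT x|lborel. \<phi> (pt (x $ 1) 0) *\<^sub>R G x) \<bullet> b"
    if b: "b \<in> Basis" for b
  proof -
    \<comment> \<open>One component of the stretched test function, cut off to the layer to become
      square integrable; \<open>Y 0\<close> is the flattened function.\<close>
    define Y where "Y e x = (indicator ?L x * \<phi> (pt (x $ 1) (e * x $ 2))) *\<^sub>R b" for e and x :: "real^2"
    have Ysq: "sq_integrable (Y e)" for e
      unfolding sq_integrable_def
    proof
      show "Y e \<in> borel_measurable borel" unfolding Y_def by measurable
      show "integrable lborel (\<lambda>x. (norm (Y e x))\<^sup>2)"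
      proof (rule Bochner_Integration.integrable_bound[where f = "\<lambda>x. C\<^sup>2 * indicator ?L x"])
        show "integrable lborel (\<lambda>x. C\<^sup>2 * indicator ?L x :: real)" using Li by simp
        show "(\<lambda>x. (norm (Y e x))\<^sup>2) \<in> borel_measurable lborel" unfolding Y_def by measurable
        show "AE x in lborel. norm ((norm (Y e x))\<^sup>2) \<le> norm (C\<^sup>2 * indicator ?L x :: real)"
          using \<phi>(2) b \<open>C \<ge> 0\<close> by (intro AE_I2) (auto simp: Y_def split: split_indicator simp flip: abs_le_square_iff)
      qed
    qed
    have "(\<lambda>n. to_l2 (Y (\<epsilon> n))) \<longlonglongrightarrow> to_l2 (Y 0)"
    proof -
      have "(\<lambda>n. LINT x|lborel. (norm (Y (\<epsilon> n) x - Y 0 x))\<^sup>2) \<longlonglongrightarrow> (LINT x::real^2|lborel. 0)"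
      proof (rule integral_dominated_convergence[where w = "\<lambda>x. (2 * C)\<^sup>2 * indicator ?L x"])
        show "AE x in lborel. (\<lambda>n. (norm (Y (\<epsilon> n) x - Y 0 x))\<^sup>2) \<longlonglongrightarrow> 0"
        proof (rule AE_I2)
          fix x :: "real^2"
          have "(\<lambda>n. pt (x $ 1) (\<epsilon> n * x $ 2)) \<longlonglongrightarrow> pt (x $ 1) (0 * x $ 2)"
            unfolding pt_eq_axis by (intro tendsto_intros \<epsilon>)
          then have "(\<lambda>n. \<phi> (pt (x $ 1) (\<epsilon> n * x $ 2))) \<longlonglongrightarrow> \<phi> (pt (x $ 1) (0 * x $ 2))"
            using \<phi>(1) by (auto intro: continuous_on_tendsto_compose)
          then have "(\<lambda>n. (norm (Y (\<epsilon> n) x - Y 0 x))\<^sup>2) \<longlonglongrightarrow> (norm (Y 0 x - Y 0 x))\<^sup>2"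
            unfolding Y_def by (intro tendsto_intros)
          then show "(\<lambda>n. (norm (Y (\<epsilon> n) x - Y 0 x))\<^sup>2) \<longlonglongrightarrow> 0" by simp
        qed
        show "AE x in lborel. norm ((norm (Y (\<epsilon> n) x - Y 0 x))\<^sup>2) \<le> (2 * C)\<^sup>2 * indicator ?L x" for n
        proof (rule AE_I2)
          fix x :: "real^2"
          have "norm (Y (\<epsilon> n) x - Y 0 x) = indicator ?L x * \<bar>\<phi> (pt (x $ 1) (\<epsilon> n * x $ 2)) - \<phi> (pt (x $ 1) (0 * x $ 2))\<bar>"
            using b unfolding Y_def scaleR_diff_left[symmetric] by (simp split: split_indicator)
          also have "\<dots> \<le> 2 * C * indicator ?L x"
          proof -
            have "\<bar>\<phi> (pt (x $ 1) (\<epsilon> n * x $ 2)) - \<phi> (pt (x $ 1) (0 * x $ 2))\<bar> \<le> 2 * C"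
              using \<phi>(2)[of "pt (x $ 1) (\<epsilon> n * x $ 2)"] \<phi>(2)[of "pt (x $ 1) (0 * x $ 2)"] by linarith
            then show ?thesis by (simp split: split_indicator)
          qed
          finally have "(norm (Y (\<epsilon> n) x - Y 0 x))\<^sup>2 \<le> (2 * C * indicator ?L x)\<^sup>2" by (intro power_mono) auto
          also have "(2 * C * indicator ?L x)\<^sup>2 = (2 * C)\<^sup>2 * indicator ?L x"
            by (simp split: split_indicator)
          finally show "norm ((norm (Y (\<epsilon> n) x - Y 0 x))\<^sup>2) \<le> (2 * C)\<^sup>2 * indicator ?L x"
            by (simp only: real_norm_def abs_of_nonneg zero_le_power2)
        qed
      qed (use Li in \<open>auto simp: Y_def\<close>)
      then have "(\<lambda>n. (dist (to_l2 (Y (\<epsilon> n))) (to_l2 (Y 0)))\<^sup>2) \<longlonglongrightarrow> 0"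
        by (simp add: dist_to_l2 Ysq)
      from tendsto_real_sqrt[OF this] have "(\<lambda>n. dist (to_l2 (Y (\<epsilon> n))) (to_l2 (Y 0))) \<longlonglongrightarrow> 0"
        by simp
      then have "(\<lambda>n. to_l2 (Y (\<epsilon> n))) \<longlonglongrightarrow> to_l2 (Y 0)"
        by (subst tendsto_dist_iff)
      then show ?thesis .
    qed
    from weak_strong_inner[OF F(3) weak this]
    have "(\<lambda>n. LINT x|lborel. F n x \<bullet> Y (\<epsilon> n) x) \<longlonglongrightarrow> (LINT x|lborel. G x \<bullet> Y 0 x)"
      by (simp add: inner_to_l2 F G Ysq)
    moreover have "(LINT x|lborel. F n x \<bullet> Y (\<epsilon> n) x) = (LINT x|lborel. \<phi> (pt (x $ 1) (\<epsilon> n * x $ 2)) *\<^sub>R F n x) \<bullet> b" for n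
    proof -
      have "F n x \<bullet> Y (\<epsilon> n) x = (\<phi> (pt (x $ 1) (\<epsilon> n * x $ 2)) *\<^sub>R F n x) \<bullet> b" for x
        using F(2)[of x n] by (cases "x \<in> ?L") (simp_all add: Y_def)
      moreover have "integrable lborel (\<lambda>x. \<phi> (pt (x $ 1) (\<epsilon> n * x $ 2)) *\<^sub>R F n x)"
        by (rule int[OF F(1) F(2)]) simp_all
      ultimately show ?thesis by (simp only: integral_inner_left)
    qed
    moreover have "(LINT x|lborel. G x \<bullet> Y 0 x) = (LINT x|lborel. \<phi> (pt (x $ 1) 0) *\<^sub>R G x) \<bullet> b"
    proof -
      have "G x \<bullet> Y 0 x = (\<phi> (pt (x $ 1) 0) *\<^sub>R G x) \<bullet> b" for x
        using G(2)[of x] by (cases "x \<in> ?L") (simp_all add: Y_def)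
      moreover have "integrable lborel (\<lambda>x. \<phi> (pt (x $ 1) 0) *\<^sub>R G x)"
        by (rule int[OF G]) simp_all
      ultimately show ?thesis by (simp only: integral_inner_left)
    qed
    ultimately show ?thesis by simp
  qed
  then show ?thesis by (subst tendsto_componentwise_iff) auto
qed

lemma bounded_linear_column: "bounded_linear (column j :: real^2^2 \<Rightarrow> real^2)"
proof -
  have "linear (column j :: real^2^2 \<Rightarrow> real^2)"
    by (rule linearI) (simp_all add: column_def vec_eq_iff)
  then show ?thesis by (simp add: linear_conv_bounded_linear)
qed

lemma column_add: "column j (A + B) = column j A + column j (B :: real^2^2)"
  and column_diff: "column j (A - B) = column j A - column j (B :: real^2^2)"
  and column_0: "column j (0 :: real^2^2) = 0"
  by (simp_all add: column_def vec_eq_iff)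

lemma column_measurable [measurable (raw)]:
  "f \<in> borel_measurable M \<Longrightarrow> (\<lambda>x. column j (f x :: real^2^2)) \<in> borel_measurable M"
  by (rule measurable_compose[of f M borel "column j"])
     (auto intro!: borel_measurable_continuous_onI linear_continuous_on bounded_linear_column)

lemma norm_column_le: "norm (column j A) \<le> norm (A :: real^2^2)"
proof -
  have "(norm (column j A))\<^sup>2 \<le> (norm A)\<^sup>2"
    using exhaust_2[of j]
    by (auto simp: power2_norm_eq_inner inner_vec_def sum_2 column_def)
  then show ?thesis by (simp add: power2_le_iff_abs_le)
qed

text \<open>Here \<open>a\<close> is the distance of two values of \<open>k\<close>, and
  \<open>e\<close>, \<open>f\<close> are the deviations of their lengths from 1. Either
  \<open>a\<close> is at most 4 and its square at most \<open>4 * a\<close>, or the deviations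
  exceed half of \<open>a\<close>. Thus L^1 convergence yields L^2 convergence although no uniform
  bound on \<open>k\<close> is available.\<close>

lemma sq_le_dichotomy:
  fixes a e f :: real
  assumes "0 \<le> a" "0 \<le> e" "0 \<le> f" "a \<le> 2 + e + f"
  shows "a\<^sup>2 \<le> 4 * a + 8 * e\<^sup>2 + 8 * f\<^sup>2"
proof (cases "a \<le> 4")
  case True
  then have "a\<^sup>2 \<le> 4 * a" using assms by (simp add: power2_eq_square mult_right_mono)
  then show ?thesis using zero_le_power2[of e] zero_le_power2[of f] by linarith
next
  case False
  then have "2 * a \<le> a + 2 * (e + f)" using assms(4) by simp
  then have "a \<le> 2 * (e + f)" by simp
  then have "a\<^sup>2 \<le> (2 * (e + f))\<^sup>2" using assms by (intro power_mono)
  also have "\<dots> \<le> 8 * e\<^sup>2 + 8 * f\<^sup>2"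
    using zero_le_power2[of "e - f"] by (simp add: power2_eq_square algebra_simps)
  finally show ?thesis using assms by linarith
qed

text \<open>\<open>H\<close> and \<open>C\<close> stand for \<open>\<nabla>k - B\<close> and \<open>curl B\<close>; all fields are Borel and extended by zero.\<close>

locale layer_sequence =
  fixes \<xi> M :: real and \<epsilon> :: "nat \<Rightarrow> real"
    and k :: "nat \<Rightarrow> real^2 \<Rightarrow> real^2" and H B :: "nat \<Rightarrow> real^2 \<Rightarrow> real^2^2" and C :: "nat \<Rightarrow> real^2 \<Rightarrow> real^2"
  assumes \<xi>: "0 < \<xi>" "\<xi> < 1"
    and \<epsilon>: "\<And>n. 0 < \<epsilon> n" "\<And>n. \<epsilon> n < 1" "\<epsilon> \<longlonglongrightarrow> 0"
    and k_sq: "\<And>n. sq_integrable (k n)" and k_0: "\<And>n x. x \<notin> Omega \<Longrightarrow> k n x = 0"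
    and k_unit: "\<And>n. (LINT x|lborel. indicator Omega x * (norm (k n x) - 1)\<^sup>2) \<le> M * \<epsilon> n"
    and H_sq: "\<And>n. sq_integrable (H n)" and H_0: "\<And>n x. x \<notin> Omega \<Longrightarrow> H n x = 0"
    and H_bd: "\<And>n. (LINT x|lborel. (norm (H n x))\<^sup>2) \<le> M"
    and B_sq: "\<And>n. sq_integrable (B n)" and B_0: "\<And>n x. x \<notin> layer (\<epsilon> n) \<xi> \<Longrightarrow> B n x = 0"
    and B_bd: "\<And>n. \<epsilon> n * (LINT x|lborel. (norm (B n x))\<^sup>2) \<le> M"
    and C_sq: "\<And>n. sq_integrable (C n)" and C_0: "\<And>n x. x \<notin> layer (\<epsilon> n) \<xi> \<Longrightarrow> C n x = 0"
    and C_bd: "\<And>n. \<epsilon> n * (LINT x|lborel. (norm (C n x))\<^sup>2) \<le> M"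
    and C_mean: "\<And>n. norm (LINT x|lborel. C n x) = 2"
    and grad: "\<And>n j \<phi>. \<phi> \<in> test_functions Omega \<Longrightarrow>
      (LINT x|lborel. dir_deriv \<phi> (axis j 1) x *\<^sub>R k n x) = - (LINT x|lborel. \<phi> x *\<^sub>R column j (H n x + B n x))"
    and curl: "\<And>n \<phi>. \<phi> \<in> test_functions Omega \<Longrightarrow>
      - (LINT x|lborel. dir_deriv \<phi> (axis 1 1) x *\<^sub>R column 2 (B n x))
      + (LINT x|lborel. dir_deriv \<phi> (axis 2 1) x *\<^sub>R column 1 (B n x)) = (LINT x|lborel. \<phi> x *\<^sub>R C n x)"
begin

abbreviation "Bt n \<equiv> blow_up (\<epsilon> n) (B n)"
abbreviation "Ct n \<equiv> blow_up (\<epsilon> n) (C n)"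

section \<open>Uniform bounds and strong compactness\<close>

lemma M_nonneg: "0 \<le> M"
  by (rule order_trans[OF _ H_bd[of 0]]) (simp add: integral_nonneg_AE)

lemma layer_subset_Omega: "layer (\<epsilon> n) \<xi> \<subseteq> Omega"
proof
  fix x assume x: "x \<in> layer (\<epsilon> n) \<xi>"
  have "\<epsilon> n * \<xi> \<le> 1 * 1" using \<epsilon>(1,2)[of n] \<xi> by (intro mult_mono) (auto intro: less_imp_le)
  with x \<xi> show "x \<in> Omega" by (auto simp: mem_layer mem_Omega)
qed

lemma B_0': "x \<notin> Omega \<Longrightarrow> B n x = 0"
  using B_0 layer_subset_Omega by blast

lemma Bt_0: "x \<notin> layer 1 \<xi> \<Longrightarrow> Bt n x = 0"
  by (simp add: blow_up_def B_0 stretch_mem_layer \<epsilon>)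

lemma Ct_0: "x \<notin> layer 1 \<xi> \<Longrightarrow> Ct n x = 0"
  by (simp add: blow_up_def C_0 stretch_mem_layer \<epsilon>)

lemma Bt_sq: "sq_integrable (Bt n)" and Ct_sq: "sq_integrable (Ct n)"
  by (simp_all add: blow_up_sq(1) B_sq C_sq \<epsilon>)

lemma le_sqrt_M: "x\<^sup>2 \<le> M \<Longrightarrow> x \<le> sqrt M"
  by (rule real_le_rsqrt)

lemma norm_Bt: "norm (to_l2 (Bt n)) \<le> sqrt M"
  by (rule le_sqrt_M) (simp add: blow_up_sq(2) B_sq \<epsilon> B_bd)

lemma norm_Ct: "norm (to_l2 (Ct n)) \<le> sqrt M"
  by (rule le_sqrt_M) (simp add: blow_up_sq(2) C_sq \<epsilon> C_bd)

lemma norm_H: "norm (to_l2 (H n)) \<le> sqrt M"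
  by (rule le_sqrt_M) (simp add: norm_to_l2 H_sq H_bd)

lemma integrable_Omega:
  fixes f :: "real^2 \<Rightarrow> 'b::euclidean_space"
  assumes "sq_integrable f" "\<And>x. x \<notin> Omega \<Longrightarrow> f x = 0"
  shows "integrable lborel f"
  using sq_integrable_imp_integrable(1)[OF assms(1) sets_Omega emeasure_Omega_finite assms(2)] .

lemma unit_integrable: "integrable lborel (\<lambda>x. indicator Omega x * (norm (k n x) - 1)\<^sup>2)"
proof (rule Bochner_Integration.integrable_bound[where f = "\<lambda>x. 2 * (norm (k n x))\<^sup>2 + 2 * indicator Omega x"])
  note [measurable] = sq_integrable_measurable[OF k_sq]
  show "integrable lborel (\<lambda>x. 2 * (norm (k n x))\<^sup>2 + 2 * indicator Omega x :: real)"
    using emeasure_Omega_finite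
    by (intro Bochner_Integration.integrable_add integrable_mult_right sq_integrable_norm k_sq integrable_real_indicator) auto
  show "(\<lambda>x. indicator Omega x * (norm (k n x) - 1)\<^sup>2) \<in> borel_measurable lborel" by measurable
  show "AE x in lborel. norm (indicator Omega x * (norm (k n x) - 1)\<^sup>2) \<le> norm (2 * (norm (k n x))\<^sup>2 + 2 * indicator Omega x :: real)"
    using norm_add_sq_le[of "norm (k n _)" "-1::real"] by (intro AE_I2) (auto split: split_indicator)
qed

lemma norm_k: "norm (to_l2 (k n)) \<le> sqrt (2 * M + 2 * measure lborel Omega)"
proof (rule real_le_rsqrt)
  note [measurable] = sq_integrable_measurable[OF k_sq]
  have "(norm (to_l2 (k n)))\<^sup>2 = (LINT x|lborel. (norm (k n x))\<^sup>2)" by (rule norm_to_l2[OF k_sq])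
  also have "\<dots> \<le> (LINT x|lborel. 2 * (indicator Omega x * (norm (k n x) - 1)\<^sup>2) + 2 * indicator Omega x)"
  proof (rule integral_mono[OF sq_integrable_norm[OF k_sq]])
    show "integrable lborel (\<lambda>x. 2 * (indicator Omega x * (norm (k n x) - 1)\<^sup>2) + 2 * indicator Omega x :: real)"
      using emeasure_Omega_finite unit_integrable
      by (intro Bochner_Integration.integrable_add integrable_mult_right integrable_real_indicator) auto
    show "(norm (k n x))\<^sup>2 \<le> 2 * (indicator Omega x * (norm (k n x) - 1)\<^sup>2) + 2 * indicator Omega x" for x
      using norm_add_sq_le[of "norm (k n x) - 1" "1::real"] k_0[of x n] by (auto split: split_indicator)
  qed
  also have "\<dots> = 2 * (LINT x|lborel. indicator Omega x * (norm (k n x) - 1)\<^sup>2) + 2 * measure lborel Omega"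
    using emeasure_Omega_finite unit_integrable[of n]
    by (subst Bochner_Integration.integral_add) (auto intro!: integrable_real_indicator)
  also have "\<dots> \<le> 2 * M + 2 * measure lborel Omega"
    using k_unit[of n] \<epsilon>(2)[of n] M_nonneg mult_left_mono[of "\<epsilon> n" 1 M] by simp
  finally show "(norm (to_l2 (k n)))\<^sup>2 \<le> 2 * M + 2 * measure lborel Omega" .
qed

text \<open>The constant results from integrating |f| \<le> 1 + |f|^2 for \<open>H\<close> on
  \<Omega> and for \<open>Bt\<close> on the fixed layer.\<close>

definition K where "K = measure lborel Omega + measure lborel (layer 1 \<xi>) + 2 * M"

text \<open>The stretching preserves the L^1 norm, so the L^2 bound on \<open>Bt\<close> becomes an
  L^1 bound on \<open>B\<close>.\<close>

lemma L1_grad: "(LINT x|lborel. norm (H n x)) + (LINT x|lborel. norm (B n x)) \<le> K"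
proof -
  have "(LINT x|lborel. norm (H n x)) \<le> measure lborel Omega + (norm (to_l2 (H n)))\<^sup>2"
    by (rule sq_integrable_imp_integrable(2)[OF H_sq sets_Omega emeasure_Omega_finite H_0])
  moreover have "(norm (to_l2 (H n)))\<^sup>2 \<le> M" by (simp add: norm_to_l2 H_sq H_bd)
  moreover have "(LINT x|lborel. norm (Bt n x)) \<le> measure lborel (layer 1 \<xi>) + (norm (to_l2 (Bt n)))\<^sup>2"
    by (rule sq_integrable_imp_integrable(2)[OF Bt_sq sets_layer emeasure_layer_finite Bt_0])
  moreover have "(norm (to_l2 (Bt n)))\<^sup>2 \<le> M" by (simp add: blow_up_sq(2) B_sq \<epsilon> B_bd)
  moreover have "(LINT x|lborel. norm (B n x)) = (LINT x|lborel. norm (Bt n x))"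
  proof -
    note [measurable] = sq_integrable_measurable[OF B_sq]
    show ?thesis
      using integral_stretch[of "\<epsilon> n" "\<lambda>x. norm (B n x)"] \<epsilon>(1)[of n] by (simp add: blow_up_def less_imp_le)
  qed
  ultimately show ?thesis by (simp add: K_def)
qed

text \<open>The gradients of \<open>k n\<close> and \<open>k m\<close> have L^1 norm at most
  \<open>K\<close> each. Two columns of their difference, each bounded by \<open>2 * K\<close>, and
  the mesh size 2/N give the last term.\<close>

lemma L1_diff_le:
  fixes N :: nat
  assumes N: "N > 0"
  defines "p \<equiv> \<lambda>i::nat. -1 + real i * (2 / real N)"
  defines "Q \<equiv> \<lambda>i j (x::real^2). indicator {p i<..p (Suc i)} (x $ 1) * indicator {p j<..p (Suc j)} (x $ 2) :: real"
  shows "(LINT x|lborel. norm (k n x - k m x)) \<le>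
    (\<Sum>i<N. \<Sum>j<N. norm (LINT x|lborel. Q i j x *\<^sub>R (k n x - k m x))) + 8 * K / real N"
proof -
  define g where "g j x = column j (H n x + B n x - H m x - B m x)" for j :: 2 and x
  have Gi: "integrable lborel (\<lambda>x. H n x + B n x - H m x - B m x)"
    by (intro Bochner_Integration.integrable_add Bochner_Integration.integrable_diff integrable_Omega H_sq B_sq H_0 B_0')
  have g: "integrable lborel (g j)" for j
    unfolding g_def by (rule integrable_bounded_linear[OF bounded_linear_column Gi])
  have g1: "(LINT x|lborel. norm (g j x)) \<le> (LINT x|lborel. norm (H n x) + norm (B n x) + norm (H m x) + norm (B m x))" for j
  proof (rule integral_mono[OF integrable_norm[OF g]])
    show "integrable lborel (\<lambda>x. norm (H n x) + norm (B n x) + norm (H m x) + norm (B m x))"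
      by (intro Bochner_Integration.integrable_add integrable_norm integrable_Omega H_sq B_sq H_0 B_0')
    show "norm (g j x) \<le> norm (H n x) + norm (B n x) + norm (H m x) + norm (B m x)" for x
    proof -
      have "norm (H n x + B n x - H m x - B m x) \<le> norm (H n x) + norm (B n x) + norm (H m x) + norm (B m x)"
        using norm_triangle_ineq4[of "H n x + B n x - H m x" "B m x"] norm_triangle_ineq4[of "H n x + B n x" "H m x"]
          norm_triangle_ineq[of "H n x" "B n x"] by linarith
      then show ?thesis using norm_column_le[of j "H n x + B n x - H m x - B m x"] by (simp add: g_def)
    qed
  qed
  have "(LINT x|lborel. norm (H n x) + norm (B n x) + norm (H m x) + norm (B m x))
      = (LINT x|lborel. norm (H n x)) + (LINT x|lborel. norm (B n x)) + (LINT x|lborel. norm (H m x)) + (LINT x|lborel. norm (B m x))"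
    using integrable_Omega[OF H_sq H_0] integrable_Omega[OF B_sq B_0'] by simp
  with L1_grad[of n] L1_grad[of m] have gK: "(LINT x|lborel. norm (g j x)) \<le> 2 * K" for j
    using g1[of j] by simp
  have kd: "integrable lborel (\<lambda>x. k n x - k m x)"
    by (intro Bochner_Integration.integrable_diff integrable_Omega k_sq k_0)
  have weak: "(LINT x|lborel. dir_deriv \<phi> (axis j 1) x *\<^sub>R (k n x - k m x)) = - (LINT x|lborel. \<phi> x *\<^sub>R g j x)"
    if \<phi>: "\<phi> \<in> test_functions Omega" for \<phi> j
  proof -
    have i: "integrable lborel (\<lambda>x. dir_deriv \<phi> (axis j 1) x *\<^sub>R k l x)" for l
      by (rule integrable_test_scaleR[OF integrable_Omega[OF k_sq k_0] test_functions_dir_deriv[OF \<phi> axis_Basis_2]])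
    have c: "integrable lborel (\<lambda>x. \<phi> x *\<^sub>R column j (H l x + B l x))" for l
      by (intro integrable_test_scaleR[OF _ \<phi>] integrable_bounded_linear[OF bounded_linear_column]
          Bochner_Integration.integrable_add integrable_Omega H_sq B_sq H_0 B_0')
    have "(LINT x|lborel. dir_deriv \<phi> (axis j 1) x *\<^sub>R (k n x - k m x))
       = - (LINT x|lborel. \<phi> x *\<^sub>R column j (H n x + B n x)) + (LINT x|lborel. \<phi> x *\<^sub>R column j (H m x + B m x))"
      using i grad[OF \<phi>] by (simp add: scaleR_diff_right)
    also have "\<dots> = - (LINT x|lborel. \<phi> x *\<^sub>R column j (H n x + B n x) - \<phi> x *\<^sub>R column j (H m x + B m x))"
      using c by simp
    also have "\<dots> = - (LINT x|lborel. \<phi> x *\<^sub>R g j x)"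
      by (simp add: g_def column_add column_diff algebra_simps)
    finally show ?thesis .
  qed
  have "(LINT x|lborel. norm (k n x - k m x)) \<le>
     (\<Sum>i<N. \<Sum>j<N. norm (LINT x|lborel. Q i j x *\<^sub>R (k n x - k m x)))
       + 2 / real N * ((LINT x|lborel. norm (g 1 x)) + (LINT x|lborel. norm (g 2 x)))"
    unfolding Q_def p_def
  proof (rule poincare_Omega[OF kd g g _ _ _ _ _ N])
    fix \<psi> \<theta> :: "real \<Rightarrow> real"
    assume t: "\<psi> \<in> test_functions {-1<..<1}" "\<theta> \<in> test_functions {-1<..<1}"
    show "(LINT x|lborel. (dir_deriv \<psi> 1 (x $ 1) * \<theta> (x $ 2)) *\<^sub>R (k n x - k m x)) = - (LINT x|lborel. (\<psi> (x $ 1) * \<theta> (x $ 2)) *\<^sub>R g 1 x)"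
      using weak[OF prod_test_Omega[OF t], of 1] by (simp add: prod_test_dir_deriv[OF t])
    show "(LINT x|lborel. (\<psi> (x $ 1) * dir_deriv \<theta> 1 (x $ 2)) *\<^sub>R (k n x - k m x)) = - (LINT x|lborel. (\<psi> (x $ 1) * \<theta> (x $ 2)) *\<^sub>R g 2 x)"
      using weak[OF prod_test_Omega[OF t], of 2] by (simp add: prod_test_dir_deriv[OF t])
  qed (simp_all add: k_0 g_def H_0 B_0' column_0)
  also have "2 / real N * ((LINT x|lborel. norm (g 1 x)) + (LINT x|lborel. norm (g 2 x))) \<le> 2 / real N * (2 * K + 2 * K)"
    by (intro mult_left_mono add_mono gK) simp
  finally show ?thesis by simp
qed

lemma L2_diff_le:
  "(dist (to_l2 (k n)) (to_l2 (k m)))\<^sup>2 \<le> 4 * (LINT x|lborel. norm (k n x - k m x)) + 8 * M * \<epsilon> n + 8 * M * \<epsilon> m"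
proof -
  let ?e = "\<lambda>n x. indicator Omega x * (norm (k n x) - 1)\<^sup>2"
  have kd: "integrable lborel (\<lambda>x. k n x - k m x)"
    by (intro Bochner_Integration.integrable_diff integrable_Omega k_sq k_0)
  have "(dist (to_l2 (k n)) (to_l2 (k m)))\<^sup>2 = (LINT x|lborel. (norm (k n x - k m x))\<^sup>2)"
    by (rule dist_to_l2[OF k_sq k_sq])
  also have "\<dots> \<le> (LINT x|lborel. 4 * norm (k n x - k m x) + 8 * ?e n x + 8 * ?e m x)"
  proof (rule integral_mono)
    show "integrable lborel (\<lambda>x. (norm (k n x - k m x))\<^sup>2)"
      by (intro sq_integrable_norm sq_integrable_diff k_sq)
    show "integrable lborel (\<lambda>x. 4 * norm (k n x - k m x) + 8 * ?e n x + 8 * ?e m x)"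
      by (intro Bochner_Integration.integrable_add integrable_mult_right integrable_norm kd unit_integrable)
    fix x :: "real^2"
    show "(norm (k n x - k m x))\<^sup>2 \<le> 4 * norm (k n x - k m x) + 8 * ?e n x + 8 * ?e m x"
    proof (cases "x \<in> Omega")
      case True
      have "norm (k n x - k m x) \<le> 2 + \<bar>norm (k n x) - 1\<bar> + \<bar>norm (k m x) - 1\<bar>"
        using norm_triangle_ineq4[of "k n x" "k m x"] by linarith
      with sq_le_dichotomy[OF norm_ge_zero abs_ge_zero abs_ge_zero this] True show ?thesis by simp
    qed (simp add: k_0)
  qed
  also have "\<dots> = 4 * (LINT x|lborel. norm (k n x - k m x)) + 8 * (LINT x|lborel. ?e n x) + 8 * (LINT x|lborel. ?e m x)"
    using kd unit_integrable by simp
  also have "\<dots> \<le> 4 * (LINT x|lborel. norm (k n x - k m x)) + 8 * (M * \<epsilon> n) + 8 * (M * \<epsilon> m)"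
    using k_unit[of n] k_unit[of m] by linarith
  finally show ?thesis by simp
qed

text \<open>Weak convergence makes the integrals over the squares of a fixed grid converge, and the
  Poincare inequality makes the oscillation inside the squares uniformly small for fine grids. Hence
  the sequence is Cauchy, and its strong limit must be the weak one.\<close>

lemma strongly_convergent:
  assumes weak: "\<And>y. (\<lambda>n. to_l2 (k n) \<bullet> y) \<longlonglongrightarrow> l \<bullet> y"
  shows "(\<lambda>n. to_l2 (k n)) \<longlonglongrightarrow> l"
proof -
  have avg: "convergent (\<lambda>n. LINT x|lborel. (indicator {a<..b} (x $ 1) * indicator {c<..d} (x $ 2)) *\<^sub>R k n x)" for a b c d
  proof -
    let ?Q = "\<lambda>x::real^2. indicator {a<..b} (x $ 1) * indicator {c<..d} (x $ 2) :: real"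
    have [measurable]: "Omega \<in> sets borel" by (rule sets_Omega)
    have Y: "sq_integrable (\<lambda>x. (indicator Omega x * ?Q x) *\<^sub>R v)" for v :: "real^2"
    proof -
      have "integrable lborel (\<lambda>x. (norm ((indicator Omega x * ?Q x) *\<^sub>R v))\<^sup>2)"
      proof (rule Bochner_Integration.integrable_bound[where f = "\<lambda>x. (norm v)\<^sup>2 * indicator Omega x"])
        show "integrable lborel (\<lambda>x. (norm v)\<^sup>2 * indicator Omega x :: real)"
          using emeasure_Omega_finite by (intro integrable_mult_right integrable_real_indicator) auto
      qed (auto split: split_indicator)
      then show ?thesis by (simp add: sq_integrable_def)
    qed
    define L where "L = (\<Sum>v\<in>Basis. (l \<bullet> to_l2 (\<lambda>x. (indicator Omega x * ?Q x) *\<^sub>R v)) *\<^sub>R v)"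
    have "(\<lambda>n. (LINT x|lborel. ?Q x *\<^sub>R k n x) \<bullet> v) \<longlonglongrightarrow> L \<bullet> v" if v: "v \<in> Basis" for v
    proof -
      have "to_l2 (k n) \<bullet> to_l2 (\<lambda>x. (indicator Omega x * ?Q x) *\<^sub>R v) = (LINT x|lborel. ?Q x *\<^sub>R k n x) \<bullet> v" for n
      proof -
        have "to_l2 (k n) \<bullet> to_l2 (\<lambda>x. (indicator Omega x * ?Q x) *\<^sub>R v) = (LINT x|lborel. (?Q x *\<^sub>R k n x) \<bullet> v)"
          unfolding inner_to_l2[OF k_sq Y]
          by (intro Bochner_Integration.integral_cong refl) (use k_0 in \<open>auto split: split_indicator\<close>)
        also have "\<dots> = (LINT x|lborel. ?Q x *\<^sub>R k n x) \<bullet> v"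
          using integrable_rectangle[OF integrable_Omega[OF k_sq k_0]] by (intro integral_inner_left) auto
        finally show ?thesis .
      qed
      moreover have "L \<bullet> v = l \<bullet> to_l2 (\<lambda>x. (indicator Omega x * ?Q x) *\<^sub>R v)"
        unfolding L_def using v by (simp add: inner_sum_left inner_Basis if_distrib cong: if_cong)
      ultimately show ?thesis using weak[of "to_l2 (\<lambda>x. (indicator Omega x * ?Q x) *\<^sub>R v)"] by simp
    qed
    then have "(\<lambda>n. LINT x|lborel. ?Q x *\<^sub>R k n x) \<longlonglongrightarrow> L"
      by (subst tendsto_componentwise_iff) auto
    then show ?thesis by (auto simp: convergent_def)
  qed
  have "Cauchy (\<lambda>n. to_l2 (k n))"
  proof (rule metric_CauchyI)
    fix e :: real assume "e > 0"
    \<comment> \<open>The grid is so fine that the oscillation, four times \<open>8 * K / N\<close>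
      in the squared distance, takes at most half of e^2.\<close>
    define N where "N = nat \<lceil>64 * K / e\<^sup>2\<rceil> + 1"
    have N: "N > 0" "32 * K / real N \<le> e\<^sup>2 / 2"
    proof -
      have "64 * K / e\<^sup>2 \<le> real N" unfolding N_def by linarith
      then show "32 * K / real N \<le> e\<^sup>2 / 2" using \<open>e > 0\<close> by (simp add: N_def field_simps)
    qed (simp add: N_def)
    let ?p = "\<lambda>i::nat. -1 + real i * (2 / real N)"
    define Q where "Q i j (x::real^2) = (indicator {?p i<..?p (Suc i)} (x $ 1) * indicator {?p j<..?p (Suc j)} (x $ 2) :: real)" for i j x
    define A where "A i j n = (LINT x|lborel. Q i j x *\<^sub>R k n x)" for i j n
    have "\<exists>a. A i j \<longlonglongrightarrow> a" for i j
      using avg unfolding A_def Q_def convergent_def by blast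
    then obtain a where a: "\<And>i j. A i j \<longlonglongrightarrow> a i j" by metis
    \<comment> \<open>The share of the index \<open>n\<close> in the squared distance for this grid;
      each of two late indices contributes less than a quarter of e^2.\<close>
    define E where "E n = 4 * (\<Sum>i<N. \<Sum>j<N. norm (A i j n - a i j)) + 8 * M * \<epsilon> n" for n
    have "E \<longlonglongrightarrow> 4 * (\<Sum>i<N. \<Sum>j<N. norm (a i j - a i j)) + 8 * M * 0"
      unfolding E_def by (intro tendsto_intros a \<epsilon>)
    then have "E \<longlonglongrightarrow> 0" by simp
    then have "\<forall>\<^sub>F n in sequentially. E n < e\<^sup>2 / 4" using \<open>e > 0\<close> by (intro order_tendstoD) auto
    then obtain n0 where n0: "\<And>n. n \<ge> n0 \<Longrightarrow> E n < e\<^sup>2 / 4" by (auto simp: eventually_sequentially)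
    have "dist (to_l2 (k n)) (to_l2 (k m)) < e" if "n \<ge> n0" "m \<ge> n0" for n m
    proof -
      have "norm (LINT x|lborel. Q i j x *\<^sub>R (k n x - k m x)) \<le> norm (A i j n - a i j) + norm (A i j m - a i j)" for i j
      proof -
        have "(LINT x|lborel. Q i j x *\<^sub>R (k n x - k m x)) = A i j n - A i j m"
          unfolding A_def Q_def scaleR_diff_right
          by (intro Bochner_Integration.integral_diff integrable_rectangle integrable_Omega k_sq k_0)
        then show ?thesis using norm_triangle_ineq4[of "A i j n - a i j" "A i j m - a i j"] by simp
      qed
      then have "(\<Sum>i<N. \<Sum>j<N. norm (LINT x|lborel. Q i j x *\<^sub>R (k n x - k m x)))
          \<le> (\<Sum>i<N. \<Sum>j<N. norm (A i j n - a i j) + norm (A i j m - a i j))"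
        by (intro sum_mono)
      also have "\<dots> = (\<Sum>i<N. \<Sum>j<N. norm (A i j n - a i j)) + (\<Sum>i<N. \<Sum>j<N. norm (A i j m - a i j))"
        by (simp add: sum.distrib)
      finally have "(LINT x|lborel. norm (k n x - k m x)) \<le> (\<Sum>i<N. \<Sum>j<N. norm (A i j n - a i j)) + (\<Sum>i<N. \<Sum>j<N. norm (A i j m - a i j)) + 8 * K / real N"
        using L1_diff_le[OF N(1), of n m] unfolding Q_def by linarith
      then have "(dist (to_l2 (k n)) (to_l2 (k m)))\<^sup>2 \<le> E n + E m + 4 * (8 * K / real N)"
        using L2_diff_le[of n m] unfolding E_def by linarith
      also have "\<dots> < e\<^sup>2" using n0[OF that(1)] n0[OF that(2)] N(2) by simp
      finally show ?thesis using \<open>e > 0\<close> by (intro power_less_imp_less_base[of _ 2 e]) auto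
    qed
    then show "\<exists>M. \<forall>m\<ge>M. \<forall>n\<ge>M. dist (to_l2 (k m)) (to_l2 (k n)) < e" by blast
  qed
  then obtain l' where l': "(\<lambda>n. to_l2 (k n)) \<longlonglongrightarrow> l'" using Cauchy_convergent convergent_def by blast
  have "l' \<bullet> y = l \<bullet> y" for y
    by (rule LIMSEQ_unique[OF tendsto_inner[OF l' tendsto_const] weak])
  from this[of "l' - l"] have "(l' - l) \<bullet> (l' - l) = 0" by (simp add: inner_diff_left)
  with l' show ?thesis by simp
qed

end

section \<open>The limit equations\<close>

text \<open>The part \<open>E\<close> of the limit outside \<open>S\<close> is orthogonal to all
  \<open>F n\<close>, hence to the limit, hence to itself.\<close>

lemma weak_limit_support:
  fixes F :: "nat \<Rightarrow> 'a::euclidean_space \<Rightarrow> 'b::euclidean_space"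
  assumes F: "\<And>n. sq_integrable (F n)" "\<And>n x. x \<notin> S \<Longrightarrow> F n x = 0" and S[measurable]: "S \<in> sets borel"
    and weak: "\<And>y. (\<lambda>n. to_l2 (F n) \<bullet> y) \<longlonglongrightarrow> l \<bullet> y"
  obtains G where "sq_integrable G" "\<And>x. x \<notin> S \<Longrightarrow> G x = 0" "l = to_l2 G"
proof -
  obtain G0 where G0: "sq_integrable G0" "l = to_l2 G0" by (rule to_l2_cases)
  note [measurable] = sq_integrable_measurable[OF G0(1)]
  define G where "G x = indicator S x *\<^sub>R G0 x" for x
  define E where "E x = indicator (- S) x *\<^sub>R G0 x" for x
  have G: "sq_integrable G"
    by (rule sq_integrable_bounded_by[OF G0(1)]) (auto simp: G_def[abs_def] split: split_indicator)
  have E: "sq_integrable E"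
    by (rule sq_integrable_bounded_by[OF G0(1)]) (auto simp: E_def[abs_def] split: split_indicator)
  have "to_l2 (F n) \<bullet> to_l2 E = 0" for n
  proof -
    have "F n x \<bullet> E x = 0" for x using F(2)[of x n] by (simp add: E_def split: split_indicator)
    then show ?thesis by (simp add: inner_to_l2 F E)
  qed
  then have "l \<bullet> to_l2 E = 0" using LIMSEQ_unique[OF weak, of "to_l2 E" 0] by simp
  moreover have "to_l2 G0 \<bullet> to_l2 E = to_l2 E \<bullet> to_l2 E"
    unfolding inner_to_l2[OF G0(1) E] inner_to_l2[OF E E]
    by (intro Bochner_Integration.integral_cong refl) (simp add: E_def split: split_indicator)
  ultimately have "to_l2 E = 0" by (simp add: G0(2))
  moreover have "E = (\<lambda>x. G0 x - G x)" by (auto simp: G_def E_def split: split_indicator)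
  ultimately have "to_l2 G0 = to_l2 G" using to_l2_diff[OF G0(1) G] by simp
  then have "l = to_l2 G" by (simp add: G0(2))
  moreover have "G x = 0" if "x \<notin> S" for x using that by (simp add: G_def)
  ultimately show ?thesis using G that by blast
qed

lemma AE_interval_const:
  assumes "AE t in lborel. t \<in> {c<..<d::real} \<longrightarrow> P" "c < d"
  shows P
proof (rule ccontr)
  assume "\<not> P"
  with assms(1) have "AE t in lborel. t \<notin> {c<..<d}" by simp
  then have "{c<..<d} \<in> null_sets lborel" by (subst AE_iff_null_sets) auto
  with assms(2) show False by (simp add: null_sets_def)
qed

lemma AE_interval_ex:
  assumes "AE t in lborel. t \<in> {c<..<d::real} \<longrightarrow> P t" "c < d"
  obtains t where "t \<in> {c<..<d}" "P t"
proof -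
  have "\<exists>t\<in>{c<..<d}. P t"
  proof (rule AE_interval_const[OF _ assms(2)])
    show "AE t in lborel. t \<in> {c<..<d} \<longrightarrow> (\<exists>t\<in>{c<..<d}. P t)"
      using assms(1) by eventually_elim blast
  qed
  with that show ?thesis by blast
qed

lemma integral_prod_test:
  fixes u :: "real \<Rightarrow> 'b::euclidean_space"
  assumes u: "integrable lborel u" and \<psi>: "\<psi> \<in> test_functions {-1<..<1}" and \<theta>: "\<theta> \<in> test_functions {-1<..<1}"
  shows "(LINT x::real^2|lborel. (\<psi> (x $ 1) * \<theta> (x $ 2)) *\<^sub>R (indicator {-1<..<1} (x $ 2) *\<^sub>R u (x $ 1)))
     = (LINT t|lborel. \<theta> t) *\<^sub>R (LINT s|lborel. \<psi> s *\<^sub>R u s)"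
proof -
  have eq: "(\<psi> s * \<theta> t) *\<^sub>R (indicator {-1<..<1} t *\<^sub>R u s) = \<theta> t *\<^sub>R (\<psi> s *\<^sub>R u s)" for s t
    using test_functions_eq_0[OF \<theta>, of t] by (cases "t \<in> {-1<..<1}") auto
  have "integrable lborel (\<lambda>x::real^2. indicator {-1<..<1} (x $ 2) *\<^sub>R u (x $ 1))"
    by (rule integrable_prod_pt[OF _ u]) (simp add: integrable_real_indicator)
  from integrable_test_scaleR[OF this prod_test_Omega[OF \<psi> \<theta>]]
  have "integrable lborel (\<lambda>x::real^2. (\<psi> (x $ 1) * \<theta> (x $ 2)) *\<^sub>R (indicator {-1<..<1} (x $ 2) *\<^sub>R u (x $ 1)))" .
  from integral_pt[OF this]
  have "(LINT x::real^2|lborel. (\<psi> (x $ 1) * \<theta> (x $ 2)) *\<^sub>R (indicator {-1<..<1} (x $ 2) *\<^sub>R u (x $ 1)))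
      = (LINT s|lborel. LINT t|lborel. \<theta> t *\<^sub>R (\<psi> s *\<^sub>R u s))"
    by (simp only: vector_2 eq)
  also have "\<dots> = (LINT s|lborel. (LINT t|lborel. \<theta> t) *\<^sub>R (\<psi> s *\<^sub>R u s))"
    by (intro Bochner_Integration.integral_cong refl integral_scaleR_left test_functions_integrable[OF \<theta>])
  also have "\<dots> = (LINT t|lborel. \<theta> t) *\<^sub>R (LINT s|lborel. \<psi> s *\<^sub>R u s)"
    by (rule integral_scaleR_right)
  finally show ?thesis .
qed

text \<open>Read as a function on the square that does not depend on x_2, \<open>u\<close> falls
  under the planar lemma; a vertical line then gives the value.\<close>

lemma fundamental_lemma_real:
  fixes u :: "real \<Rightarrow> 'b::euclidean_space"
  assumes u: "integrable lborel u"
    and z: "\<And>\<psi>. \<psi> \<in> test_functions {-1<..<1} \<Longrightarrow> (LINT s|lborel. \<psi> s *\<^sub>R u s) = 0"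
  shows "AE s in lborel. s \<in> {-1<..<1} \<longrightarrow> u s = 0"
proof -
  let ?F = "\<lambda>x::real^2. indicator {-1<..<1} (x $ 2) *\<^sub>R u (x $ 1)"
  have F: "integrable lborel ?F"
    by (rule integrable_prod_pt[OF _ u]) (simp add: integrable_real_indicator)
  have "AE x in lborel. x \<in> Omega \<longrightarrow> ?F x = 0"
  proof (rule fundamental_lemma_box[OF F open_Omega])
    fix m a b c d :: real
    assume *: "m > 0" "a < b" "c < d" "cbox (pt a c) (pt b d) \<subseteq> Omega"
    then have "bump m a b \<in> test_functions {-1<..<1}" "bump m c d \<in> test_functions {-1<..<1}"
      using cbox_subset_Omega[OF *(4,2,3)] by (auto intro: bump_test)
    from integral_prod_test[OF u this] z[OF this(1)]
    show "(LINT x|lborel. (bump m a b (x $ 1) * bump m c d (x $ 2)) *\<^sub>R ?F x) = 0" by simp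
  qed
  from AE_pt[OF this] show ?thesis
  proof eventually_elim
    case (elim s)
    show ?case
    proof
      assume s: "s \<in> {-1<..<1}"
      from elim have "AE t in lborel. t \<in> {-1<..<1::real} \<longrightarrow> u s = 0"
        by eventually_elim (use s in \<open>auto simp: mem_Omega\<close>)
      then show "u s = 0" by (rule AE_interval_const) simp
    qed
  qed
qed

section \<open>Selection of a convergent subsequence\<close>

lemma (in layer_sequence) subsequence:
  assumes r: "strict_mono (r :: nat \<Rightarrow> nat)"
  shows "layer_sequence \<xi> M (\<lambda>n. \<epsilon> (r n)) (\<lambda>n. k (r n)) (\<lambda>n. H (r n)) (\<lambda>n. B (r n)) (\<lambda>n. C (r n))"
proof
  show "(\<lambda>n. \<epsilon> (r n)) \<longlonglongrightarrow> 0" using LIMSEQ_subseq_LIMSEQ[OF \<epsilon>(3) r] by (simp add: o_def)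
qed (fact \<xi> \<epsilon>(1,2) k_sq k_0 k_unit H_sq H_0 H_bd B_sq B_0 B_bd C_sq C_0 C_bd C_mean grad curl)+

text \<open>Only \<open>k\<close> has to converge strongly, for the nonlinear constraint on its
  length; the other fields enter the equations linearly.\<close>

locale layer_limit = layer_sequence +
  fixes kk :: "real^2 \<Rightarrow> real^2" and HH \<beta> :: "real^2 \<Rightarrow> real^2^2" and \<alpha> :: "real^2 \<Rightarrow> real^2"
  assumes kk: "sq_integrable kk" "\<And>x. x \<notin> Omega \<Longrightarrow> kk x = 0" "(\<lambda>n. to_l2 (k n)) \<longlonglongrightarrow> to_l2 kk"
    and HH: "sq_integrable HH" "\<And>x. x \<notin> Omega \<Longrightarrow> HH x = 0" "\<And>y. (\<lambda>n. to_l2 (H n) \<bullet> y) \<longlonglongrightarrow> to_l2 HH \<bullet> y"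
    and \<beta>: "sq_integrable \<beta>" "\<And>x. x \<notin> layer 1 \<xi> \<Longrightarrow> \<beta> x = 0" "\<And>y. (\<lambda>n. to_l2 (Bt n) \<bullet> y) \<longlonglongrightarrow> to_l2 \<beta> \<bullet> y"
    and \<alpha>: "sq_integrable \<alpha>" "\<And>x. x \<notin> layer 1 \<xi> \<Longrightarrow> \<alpha> x = 0" "\<And>y. (\<lambda>n. to_l2 (Ct n) \<bullet> y) \<longlonglongrightarrow> to_l2 \<alpha> \<bullet> y"

text \<open>The four bounded sequences form one bounded sequence in a product of Hilbert spaces, so
  a single extraction serves all of them.\<close>

lemma (in layer_sequence) ex_layer_limit:
  obtains r kk HH \<beta> \<alpha> where "strict_mono (r :: nat \<Rightarrow> nat)"
    "layer_limit \<xi> M (\<lambda>n. \<epsilon> (r n)) (\<lambda>n. k (r n)) (\<lambda>n. H (r n)) (\<lambda>n. B (r n)) (\<lambda>n. C (r n)) kk HH \<beta> \<alpha>"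
proof -
  define X where "X n = (to_l2 (k n), to_l2 (H n), to_l2 (Bt n), to_l2 (Ct n))" for n
  have bd: "norm (X n) \<le> sqrt (2 * M + 2 * measure lborel Omega) + (sqrt M + (sqrt M + sqrt M))" for n
  proof -
    have "norm (a, b, c, d) \<le> norm a + (norm b + (norm c + norm d))"
      for a :: "(real^2, real^2) l2" and b c :: "(real^2, real^2^2) l2" and d :: "(real^2, real^2) l2"
      using norm_Pair_le[of a "(b, c, d)"] norm_Pair_le[of b "(c, d)"] norm_Pair_le[of c d] by linarith
    then show ?thesis
      unfolding X_def by (rule order_trans) (intro add_mono norm_k norm_H norm_Bt norm_Ct)
  qed
  obtain r l where r: "strict_mono r" "\<And>y. (\<lambda>n. X (r n) \<bullet> y) \<longlonglongrightarrow> l \<bullet> y"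
    using bounded_weakly_convergent_subsequence[where X = X, OF bd] by blast
  obtain l1 l2 l3 l4 where l: "l = (l1, l2, l3, l4)" by (rule prod_cases4)
  interpret s: layer_sequence \<xi> M "\<lambda>n. \<epsilon> (r n)" "\<lambda>n. k (r n)" "\<lambda>n. H (r n)" "\<lambda>n. B (r n)" "\<lambda>n. C (r n)"
    by (rule subsequence[OF r(1)])
  have w1: "(\<lambda>n. to_l2 (k (r n)) \<bullet> y) \<longlonglongrightarrow> l1 \<bullet> y" for y using r(2)[of "(y, 0, 0, 0)"] by (simp add: X_def l)
  have w2: "(\<lambda>n. to_l2 (H (r n)) \<bullet> y) \<longlonglongrightarrow> l2 \<bullet> y" for y using r(2)[of "(0, y, 0, 0)"] by (simp add: X_def l)
  have w3: "(\<lambda>n. to_l2 (Bt (r n)) \<bullet> y) \<longlonglongrightarrow> l3 \<bullet> y" for y using r(2)[of "(0, 0, y, 0)"] by (simp add: X_def l)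
  have w4: "(\<lambda>n. to_l2 (Ct (r n)) \<bullet> y) \<longlonglongrightarrow> l4 \<bullet> y" for y using r(2)[of "(0, 0, 0, y)"] by (simp add: X_def l)
  obtain kk where kk: "sq_integrable kk" "\<And>x. x \<notin> Omega \<Longrightarrow> kk x = 0" "l1 = to_l2 kk"
    using weak_limit_support[where F = "\<lambda>n. k (r n)", OF k_sq k_0 sets_Omega w1] by blast
  obtain HH where HH: "sq_integrable HH" "\<And>x. x \<notin> Omega \<Longrightarrow> HH x = 0" "l2 = to_l2 HH"
    using weak_limit_support[where F = "\<lambda>n. H (r n)", OF H_sq H_0 sets_Omega w2] by blast
  obtain \<beta> where \<beta>: "sq_integrable \<beta>" "\<And>x. x \<notin> layer 1 \<xi> \<Longrightarrow> \<beta> x = 0" "l3 = to_l2 \<beta>"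
    using weak_limit_support[where F = "\<lambda>n. Bt (r n)", OF Bt_sq Bt_0 sets_layer w3] by blast
  obtain \<alpha> where \<alpha>: "sq_integrable \<alpha>" "\<And>x. x \<notin> layer 1 \<xi> \<Longrightarrow> \<alpha> x = 0" "l4 = to_l2 \<alpha>"
    using weak_limit_support[where F = "\<lambda>n. Ct (r n)", OF Ct_sq Ct_0 sets_layer w4] by blast
  have "layer_limit \<xi> M (\<lambda>n. \<epsilon> (r n)) (\<lambda>n. k (r n)) (\<lambda>n. H (r n)) (\<lambda>n. B (r n)) (\<lambda>n. C (r n)) kk HH \<beta> \<alpha>"
  proof
    show "(\<lambda>n. to_l2 (k (r n))) \<longlonglongrightarrow> to_l2 kk" unfolding kk(3)[symmetric] by (rule s.strongly_convergent[OF w1])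
  qed (fact kk HH \<beta> \<alpha> w2[unfolded HH(3)] w3[unfolded \<beta>(3)] w4[unfolded \<alpha>(3)])+
  with r(1) show ?thesis by (rule that)
qed

context layer_limit
begin

lemma measurable_limits [measurable]:
  "kk \<in> borel_measurable borel" "HH \<in> borel_measurable borel" "\<beta> \<in> borel_measurable borel" "\<alpha> \<in> borel_measurable borel"
  by (rule sq_integrable_measurable, rule kk HH \<beta> \<alpha>)+

lemma kk_int: "integrable lborel kk" and HH_int: "integrable lborel HH"
  by (intro integrable_Omega kk HH; simp)+

lemma \<beta>_int: "integrable lborel \<beta>"
  by (rule sq_integrable_imp_integrable(1)[OF \<beta>(1) sets_layer emeasure_layer_finite \<beta>(2)])

lemma \<alpha>_int: "integrable lborel \<alpha>"
  by (rule sq_integrable_imp_integrable(1)[OF \<alpha>(1) sets_layer emeasure_layer_finite \<alpha>(2)])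

section \<open>Densities on the segment and their equations\<close>

definition b :: "2 \<Rightarrow> real \<Rightarrow> real^2" where "b j s = (LINT t|lborel. column j (\<beta> (pt s t)))"

definition a :: "real \<Rightarrow> real^2" where "a s = (LINT t|lborel. \<alpha> (pt s t))"

text \<open>The lower limit minus infinity amounts to -\<xi>, because \<open>a\<close> vanishes to
  the left of it; so the jump is 0 at the inner end of the segment.\<close>

definition J :: "real \<Rightarrow> real^2" where "J s = (LINT r|lborel. indicator {..s} r *\<^sub>R a r)"

lemma column_\<beta>_int: "integrable lborel (\<lambda>x. column j (\<beta> x))"
  by (rule integrable_bounded_linear[OF bounded_linear_column \<beta>_int])

lemma b_int: "integrable lborel (b j)"
  unfolding b_def[abs_def] by (rule integrable_pt_outer[OF column_\<beta>_int])

lemma a_int: "integrable lborel a"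
  unfolding a_def[abs_def] by (rule integrable_pt_outer[OF \<alpha>_int])

lemma a_measurable [measurable]: "a \<in> borel_measurable borel"
  using borel_measurable_integrable[OF a_int] by simp

lemma b_measurable [measurable]: "b j \<in> borel_measurable borel"
  using borel_measurable_integrable[OF b_int] by simp

lemma J_measurable [measurable]: "J \<in> borel_measurable borel"
  unfolding J_def[abs_def] by measurable

lemma a_0: "s \<notin> {-\<xi><..<1} \<Longrightarrow> a s = 0"
proof -
  assume "s \<notin> {-\<xi><..<1}"
  then have "\<alpha> (pt s t) = 0" for t by (intro \<alpha>(2)) (auto simp: mem_layer)
  then show ?thesis by (simp add: a_def)
qed

lemma b_0: "s \<notin> {-\<xi><..<1} \<Longrightarrow> b j s = 0"
proof -
  assume "s \<notin> {-\<xi><..<1}"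
  then have "\<beta> (pt s t) = 0" for t by (intro \<beta>(2)) (auto simp: mem_layer)
  then show ?thesis by (simp add: b_def column_0)
qed

lemma J_left: "s \<le> -\<xi> \<Longrightarrow> J s = 0"
proof -
  assume "s \<le> -\<xi>"
  then have eq: "indicator {..s} r *\<^sub>R a r = 0" for r using a_0[of r] by (auto split: split_indicator)
  show ?thesis unfolding J_def eq by simp
qed

lemma line_integral_b:
  assumes \<phi>: "\<phi> \<in> test_functions U"
  shows "(LINT x|lborel. \<phi> (pt (x $ 1) 0) *\<^sub>R column j (\<beta> x)) = (LINT s|lborel. \<phi> (pt s 0) *\<^sub>R b j s)"
proof -
  note [measurable] = test_functions_measurable[OF \<phi>]
  obtain C where C: "\<And>x. \<bar>\<phi> x\<bar> \<le> C" using test_functions_bounded[OF \<phi>] by metis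
  have "integrable lborel (\<lambda>x. \<phi> (pt (x $ 1) 0) *\<^sub>R column j (\<beta> x))"
    by (rule integrable_bounded_scaleR[OF column_\<beta>_int, where C = C]) (use C in auto)
  from integral_pt[OF this] show ?thesis by (simp add: b_def)
qed

lemma line_integral_a:
  assumes \<phi>: "\<phi> \<in> test_functions U"
  shows "(LINT x|lborel. \<phi> (pt (x $ 1) 0) *\<^sub>R \<alpha> x) = (LINT s|lborel. \<phi> (pt s 0) *\<^sub>R a s)"
proof -
  note [measurable] = test_functions_measurable[OF \<phi>]
  obtain C where C: "\<And>x. \<bar>\<phi> x\<bar> \<le> C" using test_functions_bounded[OF \<phi>] by metis
  have "integrable lborel (\<lambda>x. \<phi> (pt (x $ 1) 0) *\<^sub>R \<alpha> x)"
    by (rule integrable_bounded_scaleR[OF \<alpha>_int, where C = C]) (use C in auto)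
  from integral_pt[OF this] show ?thesis by (simp add: a_def)
qed

text \<open>The change of variables moves the factor \<epsilon> into the argument of the test
  function, which flattens in the limit; Fubini then collects the limit field over the cross
  sections.\<close>

lemma B_limit:
  assumes \<phi>: "\<phi> \<in> test_functions U"
  shows "(\<lambda>n. LINT x|lborel. \<phi> x *\<^sub>R column j (B n x)) \<longlonglongrightarrow> (LINT s|lborel. \<phi> (pt s 0) *\<^sub>R b j s)"
proof -
  obtain C where C: "\<And>x. \<bar>\<phi> x\<bar> \<le> C" using test_functions_bounded[OF \<phi>] by metis
  note [measurable] = test_functions_measurable[OF \<phi>] sq_integrable_measurable[OF B_sq]
  have col: "column j (c *\<^sub>R A) = c *\<^sub>R column j A" for c :: real and A :: "real^2^2"
    by (rule linear_cmul[OF bounded_linear.linear[OF bounded_linear_column]])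
  have "(\<lambda>n. LINT x|lborel. \<phi> (pt (x $ 1) (\<epsilon> n * x $ 2)) *\<^sub>R Bt n x) \<longlonglongrightarrow> (LINT x|lborel. \<phi> (pt (x $ 1) 0) *\<^sub>R \<beta> x)"
    by (rule blow_up_limit[OF \<epsilon>(3) Bt_sq Bt_0 norm_Bt \<beta> test_functions_continuous[OF \<phi>] C])
  moreover have "(LINT x|lborel. \<phi> x *\<^sub>R B n x) = (LINT x|lborel. \<phi> (pt (x $ 1) (\<epsilon> n * x $ 2)) *\<^sub>R Bt n x)" for n
    by (rule integral_blow_up[OF _ _ \<epsilon>(1)]) measurable
  ultimately have "(\<lambda>n. LINT x|lborel. \<phi> x *\<^sub>R B n x) \<longlonglongrightarrow> (LINT x|lborel. \<phi> (pt (x $ 1) 0) *\<^sub>R \<beta> x)"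
    by simp
  from bounded_linear.tendsto[OF bounded_linear_column this, of j]
  have "(\<lambda>n. column j (LINT x|lborel. \<phi> x *\<^sub>R B n x)) \<longlonglongrightarrow> column j (LINT x|lborel. \<phi> (pt (x $ 1) 0) *\<^sub>R \<beta> x)" .
  moreover have "column j (LINT x|lborel. \<phi> x *\<^sub>R B n x) = (LINT x|lborel. \<phi> x *\<^sub>R column j (B n x))" for n
    using integral_bounded_linear[OF bounded_linear_column integrable_test_scaleR[OF integrable_Omega[OF B_sq B_0'] \<phi>], of j n]
    by (simp add: col)
  moreover have "column j (LINT x|lborel. \<phi> (pt (x $ 1) 0) *\<^sub>R \<beta> x) = (LINT x|lborel. \<phi> (pt (x $ 1) 0) *\<^sub>R column j (\<beta> x))"
  proof -
    have "integrable lborel (\<lambda>x. \<phi> (pt (x $ 1) 0) *\<^sub>R \<beta> x)"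
      by (rule integrable_bounded_scaleR[OF \<beta>_int, where C = C]) (use C in auto)
    from integral_bounded_linear[OF bounded_linear_column this, of j] show ?thesis by (simp add: col)
  qed
  ultimately show ?thesis using line_integral_b[OF \<phi>] by simp
qed

lemma C_limit:
  assumes \<phi>: "\<phi> \<in> test_functions U"
  shows "(\<lambda>n. LINT x|lborel. \<phi> x *\<^sub>R C n x) \<longlonglongrightarrow> (LINT s|lborel. \<phi> (pt s 0) *\<^sub>R a s)"
proof -
  obtain C' where C': "\<And>x. \<bar>\<phi> x\<bar> \<le> C'" using test_functions_bounded[OF \<phi>] by metis
  note [measurable] = test_functions_measurable[OF \<phi>] sq_integrable_measurable[OF C_sq]
  have "(\<lambda>n. LINT x|lborel. \<phi> (pt (x $ 1) (\<epsilon> n * x $ 2)) *\<^sub>R Ct n x) \<longlonglongrightarrow> (LINT x|lborel. \<phi> (pt (x $ 1) 0) *\<^sub>R \<alpha> x)"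
    by (rule blow_up_limit[OF \<epsilon>(3) Ct_sq Ct_0 norm_Ct \<alpha> test_functions_continuous[OF \<phi>] C'])
  moreover have "(LINT x|lborel. \<phi> x *\<^sub>R C n x) = (LINT x|lborel. \<phi> (pt (x $ 1) (\<epsilon> n * x $ 2)) *\<^sub>R Ct n x)" for n
    by (rule integral_blow_up[OF _ _ \<epsilon>(1)]) measurable
  ultimately show ?thesis by (simp add: line_integral_a[OF \<phi>])
qed

text \<open>The constant 1 is not a test function on \<Omega>, but it is admissible in
  \<open>blow_up_limit\<close>, as the blow-ups live on a fixed bounded layer. So the total curl
  survives up to the end x_1 = 1.\<close>

lemma norm_J_1: "norm (J 1) = 2"
proof -
  note [measurable] = sq_integrable_measurable[OF C_sq]
  have "(\<lambda>n. LINT x|lborel. 1 *\<^sub>R Ct n x) \<longlonglongrightarrow> (LINT x|lborel. 1 *\<^sub>R \<alpha> x)"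
    by (rule blow_up_limit[OF \<epsilon>(3) Ct_sq Ct_0 norm_Ct \<alpha>, where \<phi> = "\<lambda>_. 1" and C = 1]) auto
  moreover have "(LINT x|lborel. C n x) = (LINT x|lborel. 1 *\<^sub>R Ct n x)" for n
    using integral_blow_up[of "C n" "\<lambda>_. 1" "\<epsilon> n"] \<epsilon>(1)[of n] by simp
  ultimately have "(\<lambda>n. LINT x|lborel. C n x) \<longlonglongrightarrow> (LINT x|lborel. \<alpha> x)" by simp
  from tendsto_norm[OF this] have "norm (LINT x|lborel. \<alpha> x) = 2"
    by (simp add: C_mean LIMSEQ_const_iff)
  moreover have "(LINT x|lborel. \<alpha> x) = J 1"
  proof -
    have "indicator {..1} s *\<^sub>R a s = a s" for s using a_0[of s] by (auto split: split_indicator)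
    then show ?thesis using integral_pt[OF \<alpha>_int] by (simp add: J_def a_def)
  qed
  ultimately show ?thesis by simp
qed

lemma limit_curl:
  assumes \<phi>: "\<phi> \<in> test_functions Omega"
  shows "- (LINT s|lborel. dir_deriv \<phi> (axis 1 1) (pt s 0) *\<^sub>R b 2 s) + (LINT s|lborel. dir_deriv \<phi> (axis 2 1) (pt s 0) *\<^sub>R b 1 s)
     = (LINT s|lborel. \<phi> (pt s 0) *\<^sub>R a s)"
proof (rule LIMSEQ_unique[OF _ C_limit[OF \<phi>]])
  have "(\<lambda>n. - (LINT x|lborel. dir_deriv \<phi> (axis 1 1) x *\<^sub>R column 2 (B n x))
      + (LINT x|lborel. dir_deriv \<phi> (axis 2 1) x *\<^sub>R column 1 (B n x))) \<longlonglongrightarrow>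
     - (LINT s|lborel. dir_deriv \<phi> (axis 1 1) (pt s 0) *\<^sub>R b 2 s) + (LINT s|lborel. dir_deriv \<phi> (axis 2 1) (pt s 0) *\<^sub>R b 1 s)"
    by (intro tendsto_intros B_limit[OF test_functions_dir_deriv[OF \<phi> axis_Basis_2]])
  then show "(\<lambda>n. LINT x|lborel. \<phi> x *\<^sub>R C n x) \<longlonglongrightarrow>
     - (LINT s|lborel. dir_deriv \<phi> (axis 1 1) (pt s 0) *\<^sub>R b 2 s) + (LINT s|lborel. dir_deriv \<phi> (axis 2 1) (pt s 0) *\<^sub>R b 1 s)"
    unfolding curl[OF \<phi>] .
qed

text \<open>The function \<psi>(x_1) x_2 \<eta>(x_2) vanishes on the segment together with its
  horizontal derivative, but its vertical derivative there is \<psi>(x_1) \<eta>(0). Only the term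
  with \<open>b 1\<close> is left.\<close>

lemma b_1_eq_0: "AE s in lborel. b 1 s = 0"
proof -
  obtain \<eta> where \<eta>: "\<eta> \<in> test_functions {-1<..<1::real}" "(LINT t|lborel. \<eta> t) = 1" "\<eta> 0 > 0"
    by (rule ex_test_integral_1)
  define \<theta> where "\<theta> t = t * \<eta> t" for t
  have \<theta>: "\<theta> \<in> test_functions {-1<..<1}"
    unfolding \<theta>_def[abs_def] by (rule test_functions_mult[OF \<eta>(1) Ck_id_real])
  have "dir_deriv \<theta> 1 0 = \<eta> 0"
  proof (rule dir_deriv_real_eqI)
    show "(\<theta> has_real_derivative \<eta> 0) (at 0)"
      unfolding \<theta>_def[abs_def]
      using DERIV_mult[OF DERIV_ident test_functions_has_real_derivative[OF \<eta>(1), of 0]] by simp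
  qed
  have "AE s in lborel. s \<in> {-1<..<1} \<longrightarrow> b 1 s = 0"
  proof (rule fundamental_lemma_real[OF b_int])
    fix \<psi> :: "real \<Rightarrow> real" assume \<psi>: "\<psi> \<in> test_functions {-1<..<1}"
    from limit_curl[OF prod_test_Omega[OF \<psi> \<theta>]] \<open>dir_deriv \<theta> 1 0 = \<eta> 0\<close>
    have "(LINT s|lborel. (\<psi> s * \<eta> 0) *\<^sub>R b 1 s) = 0"
      by (simp add: prod_test_dir_deriv[OF \<psi> \<theta>]) (simp add: \<theta>_def)
    then have "\<eta> 0 *\<^sub>R (LINT s|lborel. \<psi> s *\<^sub>R b 1 s) = 0"
      by (simp add: mult.commute flip: integral_scaleR_right)
    with \<eta>(3) show "(LINT s|lborel. \<psi> s *\<^sub>R b 1 s) = 0" by simp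
  qed
  then show ?thesis
    by eventually_elim (use b_0 \<xi> in fastforce)
qed

text \<open>The planar curl equation is tested with \<psi>(x_1) \<eta>(x_2), the term with
  \<open>b 1\<close> is gone, and the factor \<eta>(0) cancels.\<close>

lemma weak_deriv_b_2:
  assumes \<psi>: "\<psi> \<in> test_functions {-1<..<1}"
  shows "(LINT s|lborel. dir_deriv \<psi> 1 s *\<^sub>R b 2 s) = - (LINT s|lborel. \<psi> s *\<^sub>R a s)"
proof -
  obtain \<eta> where \<eta>: "\<eta> \<in> test_functions {-1<..<1::real}" "(LINT t|lborel. \<eta> t) = 1" "\<eta> 0 > 0"
    by (rule ex_test_integral_1)
  have [measurable]: "\<psi> \<in> borel_measurable borel" by (rule test_functions_measurable[OF \<psi>])
  have "(LINT s|lborel. (\<psi> s * dir_deriv \<eta> 1 0) *\<^sub>R b 1 s) = (LINT s::real|lborel. 0)"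
    by (rule integral_cong_AE) (use b_1_eq_0 in \<open>auto elim!: eventually_mono\<close>)
  with limit_curl[OF prod_test_Omega[OF \<psi> \<eta>(1)]]
  have "- (LINT s|lborel. (dir_deriv \<psi> 1 s * \<eta> 0) *\<^sub>R b 2 s) = (LINT s|lborel. (\<psi> s * \<eta> 0) *\<^sub>R a s)"
    by (simp add: prod_test_dir_deriv[OF \<psi> \<eta>(1)])
  then have "\<eta> 0 *\<^sub>R - (LINT s|lborel. dir_deriv \<psi> 1 s *\<^sub>R b 2 s) = \<eta> 0 *\<^sub>R (LINT s|lborel. \<psi> s *\<^sub>R a s)"
    by (simp add: mult.commute flip: integral_scaleR_right)
  then have "- (LINT s|lborel. dir_deriv \<psi> 1 s *\<^sub>R b 2 s) = (LINT s|lborel. \<psi> s *\<^sub>R a s)"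
    using \<eta>(3) by (simp only: scaleR_cancel_left) auto
  then show ?thesis by (simp add: minus_equation_iff)
qed

text \<open>Equal weak derivatives leave a constant, which is 0 because both functions vanish on
  (-1, -\<xi>); this interval is nonempty as \<xi> < 1.\<close>

lemma b_2_eq_J: "AE s in lborel. s \<in> {-1<..<1} \<longrightarrow> b 2 s = J s"
proof -
  let ?I = "\<lambda>x::real^2. indicator {-1<..<1} (x $ 2) :: real"
  have i: "integrable lborel (\<lambda>x. ?I x *\<^sub>R u (x $ 1))" if "integrable lborel u" for u :: "real \<Rightarrow> real^2"
    by (rule integrable_prod_pt[OF _ that]) (simp add: integrable_real_indicator)
  obtain S where S: "integrable lborel S" "AE x in lborel. x \<in> Omega \<longrightarrow> ?I x *\<^sub>R b 2 (x $ 1) = S (x $ 2) +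
    (LINT t|lborel. indicator {..x $ 1} t *\<^sub>R (?I (pt t (x $ 2)) *\<^sub>R a (pt t (x $ 2) $ 1)))"
  proof (rule weak_deriv_1_imp_prim[OF i[OF b_int] i[OF a_int]])
    fix x :: "real^2" assume "x \<notin> Omega"
    then show "?I x *\<^sub>R b 2 (x $ 1) = 0" using b_0[of "x $ 1" 2] \<xi> by (auto simp: mem_Omega split: split_indicator)
  next
    fix \<psi> \<theta> :: "real \<Rightarrow> real"
    assume t: "\<psi> \<in> test_functions {-1<..<1}" "\<theta> \<in> test_functions {-1<..<1}"
    have d: "dir_deriv \<psi> 1 \<in> test_functions {-1<..<1}" by (rule test_functions_dir_deriv[OF t(1)]) simp
    show "(LINT x|lborel. (dir_deriv \<psi> 1 (x $ 1) * \<theta> (x $ 2)) *\<^sub>R (?I x *\<^sub>R b 2 (x $ 1)))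
        = - (LINT x|lborel. (\<psi> (x $ 1) * \<theta> (x $ 2)) *\<^sub>R (?I x *\<^sub>R a (x $ 1)))"
      unfolding integral_prod_test[OF b_int d t(2)] integral_prod_test[OF a_int t] weak_deriv_b_2[OF t(1)] by simp
  qed
  have "AE x in lborel. x \<in> Omega \<longrightarrow> b 2 (x $ 1) = S (x $ 2) + J (x $ 1)"
    using S(2) by eventually_elim (auto simp: mem_Omega J_def)
  from AE_pt_swap[OF this] have "AE t in lborel. t \<in> {-1<..<1} \<longrightarrow>
      (AE s in lborel. s \<in> {-1<..<1} \<longrightarrow> b 2 s = S t + J s)"
    by eventually_elim (auto simp: mem_Omega elim!: eventually_mono)
  \<comment> \<open>The planar representation delivers the constant as a value \<open>S t\<close>;
    any vertical coordinate outside a null set will do.\<close>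
  then obtain t where t: "AE s in lborel. s \<in> {-1<..<1} \<longrightarrow> b 2 s = S t + J s"
    by (rule AE_interval_ex) auto
  then have "AE s in lborel. s \<in> {-1<..<-\<xi>} \<longrightarrow> S t = 0"
  proof eventually_elim
    case (elim s)
    show ?case
    proof
      assume "s \<in> {-1<..<-\<xi>}"
      with elim b_0[of s 2] J_left[of s] \<xi> show "S t = 0" by auto
    qed
  qed
  then have "S t = 0" by (rule AE_interval_const) (use \<xi> in simp)
  with t show ?thesis by simp
qed

text \<open>The inner product with the vector field \<open>\<phi> x *\<^sub>R v\<close> is the
  component in direction \<open>v\<close> of the tested integral.\<close>

lemma k_limit:
  assumes \<phi>: "\<phi> \<in> test_functions U"
  shows "(\<lambda>n. LINT x|lborel. \<phi> x *\<^sub>R k n x) \<longlonglongrightarrow> (LINT x|lborel. \<phi> x *\<^sub>R kk x)"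
proof -
  have "(\<lambda>n. (LINT x|lborel. \<phi> x *\<^sub>R k n x) \<bullet> v) \<longlonglongrightarrow> (LINT x|lborel. \<phi> x *\<^sub>R kk x) \<bullet> v" for v
  proof -
    have Y: "sq_integrable (\<lambda>x. \<phi> x *\<^sub>R v)"
    proof -
      have "(\<lambda>x. \<phi> x * \<phi> x) \<in> test_functions U" by (rule test_functions_mult[OF \<phi> test_functions_Ck[OF \<phi>]])
      from test_functions_integrable[OF this] have "integrable lborel (\<lambda>x. (\<phi> x)\<^sup>2)"
        by (simp add: power2_eq_square)
      then have "integrable lborel (\<lambda>x. (norm (\<phi> x *\<^sub>R v))\<^sup>2)"
        by (simp add: power_mult_distrib)
      then show ?thesis using test_functions_measurable[OF \<phi>] by (simp add: sq_integrable_def)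
    qed
    have eq: "to_l2 f \<bullet> to_l2 (\<lambda>x. \<phi> x *\<^sub>R v) = (LINT x|lborel. \<phi> x *\<^sub>R f x) \<bullet> v"
      if "sq_integrable f" "\<And>x. x \<notin> Omega \<Longrightarrow> f x = 0" for f :: "real^2 \<Rightarrow> real^2"
    proof -
      have "integrable lborel (\<lambda>x. \<phi> x *\<^sub>R f x)"
        by (rule integrable_test_scaleR[OF integrable_Omega[OF that] \<phi>])
      then have "(LINT x|lborel. (\<phi> x *\<^sub>R f x) \<bullet> v) = (LINT x|lborel. \<phi> x *\<^sub>R f x) \<bullet> v"
        by (simp only: integral_inner_left)
      then show ?thesis by (simp add: inner_to_l2 that(1) Y)
    qed
    have "(\<lambda>n. to_l2 (k n) \<bullet> to_l2 (\<lambda>x. \<phi> x *\<^sub>R v)) \<longlonglongrightarrow> to_l2 kk \<bullet> to_l2 (\<lambda>x. \<phi> x *\<^sub>R v)"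
      by (intro tendsto_intros kk)
    moreover have "to_l2 (k n) \<bullet> to_l2 (\<lambda>x. \<phi> x *\<^sub>R v) = (LINT x|lborel. \<phi> x *\<^sub>R k n x) \<bullet> v" for n
      by (rule eq[OF k_sq]) (rule k_0)
    moreover have "to_l2 kk \<bullet> to_l2 (\<lambda>x. \<phi> x *\<^sub>R v) = (LINT x|lborel. \<phi> x *\<^sub>R kk x) \<bullet> v"
      by (rule eq[OF kk(1)]) (rule kk(2))
    ultimately show ?thesis by (simp only:)
  qed
  then show ?thesis by (subst tendsto_componentwise_iff) auto
qed

lemma H_limit:
  assumes \<phi>: "\<phi> \<in> test_functions U"
  shows "(\<lambda>n. LINT x|lborel. \<phi> x *\<^sub>R H n x) \<longlonglongrightarrow> (LINT x|lborel. \<phi> x *\<^sub>R HH x)"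
proof -
  have "(\<lambda>n. (LINT x|lborel. \<phi> x *\<^sub>R H n x) \<bullet> v) \<longlonglongrightarrow> (LINT x|lborel. \<phi> x *\<^sub>R HH x) \<bullet> v" for v
  proof -
    have Y: "sq_integrable (\<lambda>x. \<phi> x *\<^sub>R v)"
    proof -
      have "(\<lambda>x. \<phi> x * \<phi> x) \<in> test_functions U" by (rule test_functions_mult[OF \<phi> test_functions_Ck[OF \<phi>]])
      from test_functions_integrable[OF this] have "integrable lborel (\<lambda>x. (\<phi> x)\<^sup>2)"
        by (simp add: power2_eq_square)
      then have "integrable lborel (\<lambda>x. (norm (\<phi> x *\<^sub>R v))\<^sup>2)"
        by (simp add: power_mult_distrib)
      then show ?thesis using test_functions_measurable[OF \<phi>] by (simp add: sq_integrable_def)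
    qed
    have eq: "to_l2 f \<bullet> to_l2 (\<lambda>x. \<phi> x *\<^sub>R v) = (LINT x|lborel. \<phi> x *\<^sub>R f x) \<bullet> v"
      if "sq_integrable f" "\<And>x. x \<notin> Omega \<Longrightarrow> f x = 0" for f :: "real^2 \<Rightarrow> real^2^2"
    proof -
      have "integrable lborel (\<lambda>x. \<phi> x *\<^sub>R f x)"
        by (rule integrable_test_scaleR[OF integrable_Omega[OF that] \<phi>])
      then have "(LINT x|lborel. (\<phi> x *\<^sub>R f x) \<bullet> v) = (LINT x|lborel. \<phi> x *\<^sub>R f x) \<bullet> v"
        by (simp only: integral_inner_left)
      then show ?thesis by (simp add: inner_to_l2 that(1) Y)
    qed
    note HH(3)[of "to_l2 (\<lambda>x. \<phi> x *\<^sub>R v)"]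
    moreover have "to_l2 (H n) \<bullet> to_l2 (\<lambda>x. \<phi> x *\<^sub>R v) = (LINT x|lborel. \<phi> x *\<^sub>R H n x) \<bullet> v" for n
      by (rule eq[OF H_sq]) (rule H_0)
    moreover have "to_l2 HH \<bullet> to_l2 (\<lambda>x. \<phi> x *\<^sub>R v) = (LINT x|lborel. \<phi> x *\<^sub>R HH x) \<bullet> v"
      by (rule eq[OF HH(1)]) (rule HH(2))
    ultimately show ?thesis by (simp only:)
  qed
  then show ?thesis by (subst tendsto_componentwise_iff) auto
qed

text \<open>The squared deviation of the length from 1 is controlled by that of \<open>k n\<close>,
  which is of order \<open>\<epsilon> n\<close>, and by the squared distance to the limit.\<close>

lemma norm_kk: "AE x in lborel. x \<in> Omega \<longrightarrow> norm (kk x) = 1"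
proof -
  note [measurable] = sq_integrable_measurable[OF k_sq]
  let ?e = "\<lambda>f x. indicator Omega x * (norm (f x) - 1)\<^sup>2 :: real"
  have ptw: "?e kk x \<le> 2 * ?e (k n) x + 2 * (norm (k n x - kk x))\<^sup>2" for n x
  proof -
    have "(norm (kk x) - norm (k n x))\<^sup>2 \<le> (norm (k n x - kk x))\<^sup>2"
      using norm_triangle_ineq3[of "kk x" "k n x"] by (simp add: abs_le_square_iff[symmetric] norm_minus_commute)
    with norm_add_sq_le[of "norm (k n x) - 1" "norm (kk x) - norm (k n x)"] show ?thesis
      by (auto split: split_indicator)
  qed
  have i: "integrable lborel (\<lambda>x. 2 * ?e (k n) x + 2 * (norm (k n x - kk x))\<^sup>2)" for n
    by (intro Bochner_Integration.integrable_add integrable_mult_right unit_integrable sq_integrable_norm sq_integrable_diff k_sq kk)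
  have e: "integrable lborel (?e kk)"
    by (rule Bochner_Integration.integrable_bound[OF i[of 0]]) (use ptw[of _ 0] in \<open>auto intro: order_trans[OF ptw]\<close>)
  have "(LINT x|lborel. ?e kk x) \<le> 2 * (M * \<epsilon> n) + 2 * (dist (to_l2 (k n)) (to_l2 kk))\<^sup>2" for n
  proof -
    have "(LINT x|lborel. ?e kk x) \<le> (LINT x|lborel. 2 * ?e (k n) x + 2 * (norm (k n x - kk x))\<^sup>2)"
      by (rule integral_mono[OF e i ptw])
    also have "\<dots> = 2 * (LINT x|lborel. ?e (k n) x) + 2 * (dist (to_l2 (k n)) (to_l2 kk))\<^sup>2"
      unfolding dist_to_l2[OF k_sq kk(1)]
      by (subst Bochner_Integration.integral_add)
         (auto intro!: unit_integrable sq_integrable_norm sq_integrable_diff k_sq kk)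
    finally show ?thesis using k_unit[of n] by simp
  qed
  moreover have "(\<lambda>n. 2 * (M * \<epsilon> n) + 2 * (dist (to_l2 (k n)) (to_l2 kk))\<^sup>2) \<longlonglongrightarrow> 2 * (M * 0) + 2 * (dist (to_l2 kk) (to_l2 kk))\<^sup>2"
    by (intro tendsto_intros \<epsilon> kk)
  ultimately have "(LINT x|lborel. ?e kk x) \<le> 0" by (intro LIMSEQ_le_const) (auto intro!: exI[of _ 0])
  moreover have "(LINT x|lborel. ?e kk x) \<ge> 0" by (rule integral_nonneg_AE) auto
  ultimately have "AE x in lborel. ?e kk x = 0"
    using integral_nonneg_eq_0_iff_AE[OF e] by simp
  then show ?thesis by eventually_elim (auto split: split_indicator_asm)
qed

text \<open>The limit of \<open>B\<^sub>\<epsilon>\<close> concentrates on the segment, where only its second column survives;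
  this is the jump part of \<open>Dk\<close>.\<close>

lemma deriv_limit:
  assumes \<phi>: "\<phi> \<in> test_functions Omega"
  shows "(LINT x|lborel. dir_deriv \<phi> (axis 1 1) x *\<^sub>R kk x) = - (LINT x|lborel. \<phi> x *\<^sub>R column 1 (HH x))"
    and "(LINT x|lborel. dir_deriv \<phi> (axis 2 1) x *\<^sub>R kk x) =
      - (LINT x|lborel. \<phi> x *\<^sub>R column 2 (HH x)) - (LINT s|lborel. (indicator {-\<xi><..<1} s * \<phi> (pt s 0)) *\<^sub>R J s)"
proof -
  have col: "column j (c *\<^sub>R A) = c *\<^sub>R column j A" for c :: real and A :: "real^2^2" and j
    by (rule linear_cmul[OF bounded_linear.linear[OF bounded_linear_column]])
  have [measurable]: "\<phi> \<in> borel_measurable borel" by (rule test_functions_measurable[OF \<phi>])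
  have colint: "column j (LINT x|lborel. \<phi> x *\<^sub>R F x) = (LINT x|lborel. \<phi> x *\<^sub>R column j (F x))"
    if "integrable lborel F" for F :: "real^2 \<Rightarrow> real^2^2" and j
    using integral_bounded_linear[OF bounded_linear_column integrable_test_scaleR[OF that \<phi>], of j] by (simp add: col)
  have ci: "integrable lborel (\<lambda>x. \<phi> x *\<^sub>R column j (F x))" if "integrable lborel F" for F :: "real^2 \<Rightarrow> real^2^2" and j
    by (intro integrable_test_scaleR[OF _ \<phi>] integrable_bounded_linear[OF bounded_linear_column that])
  have Hi: "integrable lborel (H n)" for n
    by (rule integrable_Omega[OF H_sq]) (rule H_0)
  have main: "(LINT x|lborel. dir_deriv \<phi> (axis j 1) x *\<^sub>R kk x) =
      - (LINT x|lborel. \<phi> x *\<^sub>R column j (HH x)) - (LINT s|lborel. \<phi> (pt s 0) *\<^sub>R b j s)" for j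
  proof (rule LIMSEQ_unique[OF k_limit[OF test_functions_dir_deriv[OF \<phi> axis_Basis_2]]])
    have "(\<lambda>n. column j (LINT x|lborel. \<phi> x *\<^sub>R H n x)) \<longlonglongrightarrow> column j (LINT x|lborel. \<phi> x *\<^sub>R HH x)"
      by (intro bounded_linear.tendsto[OF bounded_linear_column] H_limit[OF \<phi>])
    then have "(\<lambda>n. LINT x|lborel. \<phi> x *\<^sub>R column j (H n x)) \<longlonglongrightarrow> (LINT x|lborel. \<phi> x *\<^sub>R column j (HH x))"
      by (simp only: colint[OF Hi] colint[OF HH_int])
    then have "(\<lambda>n. - (LINT x|lborel. \<phi> x *\<^sub>R column j (H n x)) - (LINT x|lborel. \<phi> x *\<^sub>R column j (B n x))) \<longlonglongrightarrow>
       - (LINT x|lborel. \<phi> x *\<^sub>R column j (HH x)) - (LINT s|lborel. \<phi> (pt s 0) *\<^sub>R b j s)"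
      by (intro tendsto_intros B_limit[OF \<phi>])
    moreover have "(LINT x|lborel. dir_deriv \<phi> (axis j 1) x *\<^sub>R k n x) =
       - (LINT x|lborel. \<phi> x *\<^sub>R column j (H n x)) - (LINT x|lborel. \<phi> x *\<^sub>R column j (B n x))" for n
      unfolding grad[OF \<phi>] column_add scaleR_add_right
      using ci[OF integrable_Omega[OF H_sq H_0]] ci[OF integrable_Omega[OF B_sq B_0']] by simp
    ultimately show "(\<lambda>n. LINT x|lborel. dir_deriv \<phi> (axis j 1) x *\<^sub>R k n x) \<longlonglongrightarrow>
       - (LINT x|lborel. \<phi> x *\<^sub>R column j (HH x)) - (LINT s|lborel. \<phi> (pt s 0) *\<^sub>R b j s)" by simp
  qed
  have "(LINT s|lborel. \<phi> (pt s 0) *\<^sub>R b 1 s) = (LINT s::real|lborel. 0)"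
    by (rule integral_cong_AE) (use b_1_eq_0 in \<open>auto elim!: eventually_mono\<close>)
  with main[of 1] show "(LINT x|lborel. dir_deriv \<phi> (axis 1 1) x *\<^sub>R kk x) = - (LINT x|lborel. \<phi> x *\<^sub>R column 1 (HH x))" by simp
  have "(LINT s|lborel. \<phi> (pt s 0) *\<^sub>R b 2 s) = (LINT s|lborel. (indicator {-\<xi><..<1} s * \<phi> (pt s 0)) *\<^sub>R J s)"
  proof (rule integral_cong_AE)
    show "AE s in lborel. \<phi> (pt s 0) *\<^sub>R b 2 s = (indicator {-\<xi><..<1} s * \<phi> (pt s 0)) *\<^sub>R J s"
      using b_2_eq_J
    proof eventually_elim
      case (elim s)
      then show ?case using b_0[of s 2] \<xi> by (cases "s \<in> {-\<xi><..<1}") auto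
    qed
  qed measurable
  with main[of 2] show "(LINT x|lborel. dir_deriv \<phi> (axis 2 1) x *\<^sub>R kk x) =
      - (LINT x|lborel. \<phi> x *\<^sub>R column 2 (HH x)) - (LINT s|lborel. (indicator {-\<xi><..<1} s * \<phi> (pt s 0)) *\<^sub>R J s)" by simp
qed

text \<open>The two equations for \<open>Dk\<close> are tested with the partial derivatives of
  \<phi> in crossed order. Mixed derivatives commute, so \<open>kk\<close> cancels; what remains is
  the jump paired with the horizontal derivative of \<phi>, and \<open>limit_curl\<close> expresses
  it by \<open>a\<close>.\<close>

lemma curl_limit:
  assumes \<phi>: "\<phi> \<in> test_functions Omega"
  shows "- (LINT x|lborel. dir_deriv \<phi> (axis 1 1) x *\<^sub>R column 2 (HH x))
      + (LINT x|lborel. dir_deriv \<phi> (axis 2 1) x *\<^sub>R column 1 (HH x)) = - (LINT s|lborel. \<phi> (pt s 0) *\<^sub>R a s)"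
proof -
  let ?d1 = "dir_deriv \<phi> (axis 1 1)" and ?d2 = "dir_deriv \<phi> (axis 2 1)"
  have d1: "?d1 \<in> test_functions Omega" and d2: "?d2 \<in> test_functions Omega"
    by (rule test_functions_dir_deriv[OF \<phi> axis_Basis_2])+
  have [measurable]: "\<phi> \<in> borel_measurable borel" "?d1 \<in> borel_measurable borel" "?d2 \<in> borel_measurable borel"
    by (rule test_functions_measurable, fact \<phi> d1 d2)+
  have "dir_deriv ?d1 (axis 2 1) = dir_deriv ?d2 (axis 1 1)"
    by (rule ext) (rule dir_deriv_commute[OF test_functions_Ck[OF \<phi>] axis_Basis_2 axis_Basis_2])
  with deriv_limit(2)[OF d1] deriv_limit(1)[OF d2]
  have "- (LINT x|lborel. ?d1 x *\<^sub>R column 2 (HH x)) + (LINT x|lborel. ?d2 x *\<^sub>R column 1 (HH x))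
     = (LINT s|lborel. (indicator {-\<xi><..<1} s * ?d1 (pt s 0)) *\<^sub>R J s)" by (simp add: algebra_simps)
  also have "\<dots> = (LINT s|lborel. ?d1 (pt s 0) *\<^sub>R b 2 s)"
  proof (rule integral_cong_AE)
    show "AE s in lborel. (indicator {-\<xi><..<1} s * ?d1 (pt s 0)) *\<^sub>R J s = ?d1 (pt s 0) *\<^sub>R b 2 s"
      using b_2_eq_J
    proof eventually_elim
      case (elim s)
      then show ?case using b_0[of s 2] \<xi> by (cases "s \<in> {-\<xi><..<1}") auto
    qed
  qed measurable
  also have "\<dots> = - (LINT s|lborel. \<phi> (pt s 0) *\<^sub>R a s)"
  proof -
    have "(LINT s|lborel. ?d2 (pt s 0) *\<^sub>R b 1 s) = (LINT s::real|lborel. 0)"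
      by (rule integral_cong_AE) (use b_1_eq_0 in \<open>auto elim!: eventually_mono\<close>)
    then show ?thesis using limit_curl[OF \<phi>] by (simp add: minus_equation_iff)
  qed
  finally show ?thesis .
qed

end

section \<open>Traces\<close>

lemma AE_uminus_real:
  assumes "AE x::real in lborel. P x"
  shows "AE x in lborel. P (- x)"
proof -
  have "AE x in distr lborel borel uminus. P x" using assms by (simp only: lborel_distr_uminus)
  then show ?thesis by (rule AE_distrD[rotated]) simp
qed

lemma lebesgue_differentiation_right:
  fixes w :: "real \<Rightarrow> real"
  assumes w: "integrable lborel w"
  shows "AE s in lborel. ((\<lambda>\<rho>. integral {s..s + \<rho>} w / \<rho>) \<longlongrightarrow> w s) (at_right 0)"
proof -
  have "w integrable_on cbox c d" for c d
    using integrable_on_lborel[OF w] integrable_on_subcbox by blast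
  then obtain N where N: "negligible N"
    and lim: "\<And>x e. \<lbrakk>x \<notin> N; 0 < e\<rbrakk> \<Longrightarrow> \<exists>d>0. \<forall>h. 0 < h \<and> h < d \<longrightarrow>
       norm(integral (cbox x (x + h *\<^sub>R One)) w /\<^sub>R h ^ DIM(real) - w x) < e"
    using integrable_ccontinuous_explicit by blast
  have "((\<lambda>\<rho>. integral {s..s + \<rho>} w / \<rho>) \<longlongrightarrow> w s) (at_right 0)" if "s \<notin> N" for s
  proof (rule tendstoI)
    fix e :: real assume "e > 0"
    from lim[OF that this] obtain d where d: "d > 0" "\<And>h. 0 < h \<Longrightarrow> h < d \<Longrightarrow>
       norm(integral (cbox s (s + h *\<^sub>R One)) w /\<^sub>R h ^ DIM(real) - w s) < e" by blast
    show "\<forall>\<^sub>F \<rho> in at_right 0. dist (integral {s..s + \<rho>} w / \<rho>) (w s) < e"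
      unfolding eventually_at_right_field
      using d by (intro exI[of _ d]) (auto simp: dist_real_def divide_inverse mult.commute)
  qed
  moreover have "AE s in lebesgue. s \<notin> N"
    using N by (intro AE_not_in) (simp add: negligible_iff_null_sets)
  then have "AE s in lborel. s \<notin> N" by (simp only: AE_completion_iff)
  ultimately show ?thesis by (auto elim: eventually_mono)
qed

text \<open>The averages to the right of \<open>s\<close> and, for the reflected function, to the
  right of \<open>-s\<close> are added. Division is by \<rho>, not by the length of the interval,
  hence the factor 2.\<close>

lemma lebesgue_differentiation_real:
  fixes w :: "real \<Rightarrow> real"
  assumes w: "integrable lborel w"
  shows "AE s in lborel. ((\<lambda>\<rho>. integral {s - \<rho>..s + \<rho>} w / \<rho>) \<longlongrightarrow> 2 * w s) (at_right 0)"
proof -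
  have int: "w integrable_on {c..d}" for c d
    using integrable_on_lborel[OF w] integrable_on_subcbox by (metis interval_cbox subset_UNIV)
  have "integrable lborel (\<lambda>t. w (- t))"
    using w lborel_integrable_real_affine_iff[of "-1" w 0] by simp
  from AE_uminus_real[OF lebesgue_differentiation_right[OF this]] lebesgue_differentiation_right[OF w]
  show ?thesis
  proof eventually_elim
    case (elim s)
    have "((\<lambda>\<rho>. integral {- s..- s + \<rho>} (\<lambda>t. w (- t)) / \<rho> + integral {s..s + \<rho>} w / \<rho>) \<longlongrightarrow> w s + w s) (at_right 0)"
      using tendsto_add[OF elim] by simp
    then show ?case
    proof (rule Lim_transform_eventually[THEN tendsto_eq_rhs])
      show "\<forall>\<^sub>F \<rho> in at_right 0. integral {- s..- s + \<rho>} (\<lambda>t. w (- t)) / \<rho> + integral {s..s + \<rho>} w / \<rho>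
         = integral {s - \<rho>..s + \<rho>} w / \<rho>"
        unfolding eventually_at_right_field
      proof (intro exI[of _ 1] conjI allI impI)
        fix \<rho> :: real assume "0 < \<rho>" "\<rho> < 1"
        have "integral {- s..- s + \<rho>} (\<lambda>t. w (- t)) = integral {s - \<rho>..s} w"
          using Henstock_Kurzweil_Integration.integral_reflect_real[of s "s - \<rho>" w] by simp
        moreover have "integral {s - \<rho>..s} w + integral {s..s + \<rho>} w = integral {s - \<rho>..s + \<rho>} w"
          using \<open>0 < \<rho>\<close> by (intro Henstock_Kurzweil_Integration.integral_combine int) auto
        ultimately show "integral {- s..- s + \<rho>} (\<lambda>t. w (- t)) / \<rho> + integral {s..s + \<rho>} w / \<rho> = integral {s - \<rho>..s + \<rho>} w / \<rho>"
          by (simp add: add_divide_distrib[symmetric])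
      qed simp
    qed simp
  qed
qed

text \<open>The factor 8 compares the upper bound \<open>4 * \<rho>\<^sup>2\<close> for the area of
  a piece of a disc with the lower bound \<open>\<rho>\<^sup>2 / 2\<close> for a thick set.\<close>

lemma ratio_le:
  fixes p q m m' :: real
  assumes "p \<le> q" "0 \<le> q" "0 < m" "m \<le> m'" "m' \<le> 8 * m"
  shows "p / m \<le> 8 * (q / m')"
proof -
  have "p / m \<le> q / m" using assms by (simp add: divide_right_mono)
  also have "q * m' \<le> q * (8 * m)" using assms by (intro mult_left_mono) auto
  then have "q / m \<le> 8 * (q / m')" using assms by (simp add: field_simps)
  finally show ?thesis .
qed

lemma AE_first:
  assumes "AE s in lborel. Q s"
  shows "AE x::real^2 in lborel. Q (x $ 1)"
proof -
  obtain N where N: "N \<in> null_sets lborel" "{s \<in> space lborel. \<not> Q s} \<subseteq> N"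
    using assms unfolding eventually_ae_filter by blast
  have [measurable]: "N \<in> sets borel" using N(1) by auto
  have "AE s in lborel. s \<notin> N" by (rule AE_not_in[OF N(1)])
  then have "AE s in lborel. AE t::real in lborel. pt s t $ 1 \<notin> N" by (auto elim!: eventually_mono)
  then have "AE x::real^2 in lborel. x $ 1 \<notin> N" by (subst AE_pt_iff) auto
  then show ?thesis by eventually_elim (use N(2) in auto)
qed

section \<open>Approximate limits in half discs\<close>

text \<open>A lower density bound at \<open>x\<close>. The constant 1/2 is that of the rectangle
  with sides \<rho> and \<rho>/2, which fits into a half disc of radius \<rho>.\<close>

definition thick :: "(real^2) set \<Rightarrow> real^2 \<Rightarrow> bool" where
  "thick S x \<longleftrightarrow> S \<in> sets borel \<and> (\<forall>\<^sub>F \<rho> in at_right 0. measure lborel (ball x \<rho> \<inter> S) \<ge> \<rho>\<^sup>2 / 2)"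

lemma measure_box_le: "l $ 1 \<le> u $ 1 \<Longrightarrow> l $ 2 \<le> u $ 2 \<Longrightarrow> measure lborel (box l (u::real^2)) = (u $ 1 - l $ 1) * (u $ 2 - l $ 2)"
  by (simp add: measure_lborel_box_eq Basis_real2 axis_eq_axis inner_axis)

lemma emeasure_ball_finite: "S \<in> sets borel \<Longrightarrow> emeasure lborel (ball x \<rho> \<inter> S) < \<infinity>"
  by (rule emeasure_bounded_finite) (auto intro: bounded_subset[OF bounded_ball])

lemma fmeasurable_ball: "S \<in> sets borel \<Longrightarrow> ball x \<rho> \<inter> S \<in> fmeasurable lborel"
  by (intro fmeasurableI emeasure_ball_finite) auto

lemma ball_sets [measurable]: "ball (x::'a::euclidean_space) \<rho> \<in> sets borel"
  by simp

lemma ball_coordinates: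
  assumes "y \<in> ball (x::real^2) \<rho>"
  shows "\<bar>y $ i - x $ i\<bar> < \<rho>"
proof -
  have "\<bar>(y - x) $ i\<bar> \<le> norm (y - x)" by (rule component_le_norm_cart)
  with assms show ?thesis by (simp add: dist_norm norm_minus_commute)
qed

lemma measure_ball_le:
  fixes x :: "real^2"
  shows "0 < \<rho> \<Longrightarrow> S \<in> sets borel \<Longrightarrow> measure lborel (ball x \<rho> \<inter> S) \<le> 4 * \<rho>\<^sup>2"
proof -
  assume \<rho>: "0 < \<rho>" and S: "S \<in> sets borel"
  let ?b = "box (pt (x $ 1 - \<rho>) (x $ 2 - \<rho>)) (pt (x $ 1 + \<rho>) (x $ 2 + \<rho>))"
  have "ball x \<rho> \<inter> S \<subseteq> ?b"
  proof
    fix y assume "y \<in> ball x \<rho> \<inter> S"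
    then have "\<bar>y $ 1 - x $ 1\<bar> < \<rho>" "\<bar>y $ 2 - x $ 2\<bar> < \<rho>" using ball_coordinates by blast+
    then show "y \<in> ?b" by (auto simp: mem_box Basis_real2 inner_axis)
  qed
  then have "measure lborel (ball x \<rho> \<inter> S) \<le> measure lborel ?b"
    using S by (intro measure_mono_fmeasurable) (auto simp: fmeasurable_box)
  also have "\<dots> = 4 * \<rho>\<^sup>2" using \<rho> by (subst measure_box_le) (auto simp: power2_eq_square)
  finally show ?thesis .
qed

lemma thick_half:
  assumes s: "s \<in> {-1<..<1}"
  shows "thick (Omega \<inter> {x. x $ 2 > 0}) (pt s 0)" "thick (Omega \<inter> {x. x $ 2 < 0}) (pt s 0)"
proof -
  have [measurable]: "{x::real^2. x $ 2 > 0} \<in> sets borel" "{x::real^2. x $ 2 < 0} \<in> sets borel"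
    by measurable
  \<comment> \<open>The sum of the coordinate distances dominates the Euclidean distance, so the
    rectangle lies in the disc; the bound on \<rho> keeps it inside \<Omega>.\<close>
  have near: "y \<in> ball (pt s 0) \<rho> \<and> \<bar>y $ 1\<bar> < 1 \<and> \<bar>y $ 2\<bar> < 1"
    if "\<rho> < 1 - \<bar>s\<bar>" "\<bar>y $ 1 - s\<bar> < \<rho> / 2" "\<bar>y $ 2\<bar> < \<rho> / 2" for y \<rho>
  proof -
    have "norm (pt s 0 - y) \<le> \<bar>(pt s 0 - y) $ 1\<bar> + \<bar>(pt s 0 - y) $ 2\<bar>"
      using norm_le_l1_cart[of "pt s 0 - y"] by (simp add: sum_2)
    then have "norm (pt s 0 - y) \<le> \<bar>y $ 1 - s\<bar> + \<bar>y $ 2\<bar>" by (simp add: abs_minus_commute)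
    then have "norm (pt s 0 - y) < \<rho>" "\<bar>y $ 1\<bar> < 1" "\<bar>y $ 2\<bar> < 1" using that by linarith+
    then show ?thesis by (simp add: dist_norm)
  qed
  have half: "\<rho>\<^sup>2 / 2 \<le> measure lborel (ball (pt s 0) \<rho> \<inter> S)"
    if \<rho>: "0 < \<rho>" "\<rho> < 1 - \<bar>s\<bar>" and S: "S \<in> sets borel"
      "box (pt (s - \<rho>/2) c) (pt (s + \<rho>/2) (c + \<rho>/2)) \<subseteq> ball (pt s 0) \<rho> \<inter> S" for \<rho> S c
  proof -
    have "\<rho>\<^sup>2 / 2 = measure lborel (box (pt (s - \<rho>/2) c) (pt (s + \<rho>/2) (c + \<rho>/2)))"
      using \<rho> by (subst measure_box_le) (auto simp: power2_eq_square field_simps)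
    also have "\<dots> \<le> measure lborel (ball (pt s 0) \<rho> \<inter> S)"
      using S by (intro measure_mono_fmeasurable fmeasurable_ball) auto
    finally show ?thesis .
  qed
  have pos: "0 < 1 - \<bar>s\<bar>" using s by auto
  show "thick (Omega \<inter> {x. x $ 2 > 0}) (pt s 0)"
    unfolding thick_def eventually_at_right_field
  proof (intro conjI exI[of _ "1 - \<bar>s\<bar>"] allI impI pos)
    fix \<rho> assume \<rho>: "0 < \<rho>" "\<rho> < 1 - \<bar>s\<bar>"
    show "\<rho>\<^sup>2 / 2 \<le> measure lborel (ball (pt s 0) \<rho> \<inter> (Omega \<inter> {x. 0 < x $ 2}))"
    proof (rule half[OF \<rho>, where c = 0])
      show "box (pt (s - \<rho>/2) 0) (pt (s + \<rho>/2) (0 + \<rho>/2)) \<subseteq> ball (pt s 0) \<rho> \<inter> (Omega \<inter> {x. 0 < x $ 2})"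
      proof
        fix y assume "y \<in> box (pt (s - \<rho>/2) 0) (pt (s + \<rho>/2) (0 + \<rho>/2))"
        then have b: "s - \<rho> / 2 < y $ 1" "y $ 1 < s + \<rho> / 2" "0 < y $ 2" "y $ 2 < \<rho> / 2"
          by (auto simp: mem_box Basis_real2 inner_axis)
        then have "\<bar>y $ 1 - s\<bar> < \<rho> / 2" by linarith
        with b near[of \<rho> y] \<rho> show "y \<in> ball (pt s 0) \<rho> \<inter> (Omega \<inter> {x. 0 < x $ 2})" by (auto simp: mem_Omega)
      qed
    qed measurable
  qed measurable
  show "thick (Omega \<inter> {x. x $ 2 < 0}) (pt s 0)"
    unfolding thick_def eventually_at_right_field
  proof (intro conjI exI[of _ "1 - \<bar>s\<bar>"] allI impI pos)
    fix \<rho> assume \<rho>: "0 < \<rho>" "\<rho> < 1 - \<bar>s\<bar>"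
    show "\<rho>\<^sup>2 / 2 \<le> measure lborel (ball (pt s 0) \<rho> \<inter> (Omega \<inter> {x. x $ 2 < 0}))"
    proof (rule half[OF \<rho>, where c = "- \<rho>/2"])
      show "box (pt (s - \<rho>/2) (- \<rho>/2)) (pt (s + \<rho>/2) (- \<rho>/2 + \<rho>/2)) \<subseteq> ball (pt s 0) \<rho> \<inter> (Omega \<inter> {x. x $ 2 < 0})"
      proof
        fix y assume "y \<in> box (pt (s - \<rho>/2) (- \<rho>/2)) (pt (s + \<rho>/2) (- \<rho>/2 + \<rho>/2))"
        then have b: "s - \<rho> / 2 < y $ 1" "y $ 1 < s + \<rho> / 2" "y $ 2 < 0" "- \<rho> / 2 < y $ 2"
          by (auto simp: mem_box Basis_real2 inner_axis)
        then have "\<bar>y $ 1 - s\<bar> < \<rho> / 2" by linarith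
        with b near[of \<rho> y] \<rho> show "y \<in> ball (pt s 0) \<rho> \<inter> (Omega \<inter> {x. x $ 2 < 0})" by (auto simp: mem_Omega)
      qed
    qed measurable
  qed measurable
qed

text \<open>The quotient of \<open>approx_lim\<close>, formed with \<open>lborel\<close> so that
  Fubini and the bounds for Borel sets apply directly.\<close>

definition mean_dev :: "(real^2) set \<Rightarrow> (real^2 \<Rightarrow> real^2) \<Rightarrow> real^2 \<Rightarrow> real^2 \<Rightarrow> real \<Rightarrow> real" where
  "mean_dev S u x z \<rho> = (LINT y|lborel. indicator (ball x \<rho> \<inter> S) y * norm (u y - z)) / measure lborel (ball x \<rho> \<inter> S)"

lemma approx_lim_iff_mean_dev:
  assumes [measurable]: "S \<in> sets borel" "u \<in> borel_measurable borel"
  shows "approx_lim S u x z \<longleftrightarrow> (mean_dev S u x z \<longlongrightarrow> 0) (at_right 0)"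
proof -
  have "(LINT y:ball x \<rho> \<inter> S|lebesgue. norm (u y - z)) = (LINT y|lborel. indicator (ball x \<rho> \<inter> S) y * norm (u y - z))" for \<rho>
    unfolding set_lebesgue_integral_def by (subst integral_completion) simp_all
  moreover have "measure lebesgue (ball x \<rho> \<inter> S) = measure lborel (ball x \<rho> \<inter> S)" for \<rho>
    by simp
  ultimately show ?thesis by (simp add: approx_lim_def mean_dev_def[abs_def])
qed

context
  fixes u :: "real^2 \<Rightarrow> real^2"
  assumes u: "integrable lborel u"
begin

lemma u_measurable [measurable]: "u \<in> borel_measurable borel"
  using borel_measurable_integrable[OF u] by simp

lemma integrable_mean_dev:
  assumes [measurable]: "S \<in> sets borel"
  shows "integrable lborel (\<lambda>y. indicator (ball x \<rho> \<inter> S) y * norm (u y - z))"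
proof (rule Bochner_Integration.integrable_bound[where f = "\<lambda>y. norm (u y) + norm z * indicator (ball x \<rho> \<inter> S) y"])
  show "integrable lborel (\<lambda>y. norm (u y) + norm z * indicator (ball x \<rho> \<inter> S) y :: real)"
    using emeasure_ball_finite[OF assms]
    by (intro Bochner_Integration.integrable_add integrable_norm u integrable_mult_right integrable_real_indicator) auto
  show "AE y in lborel. norm (indicator (ball x \<rho> \<inter> S) y * norm (u y - z)) \<le> norm (norm (u y) + norm z * indicator (ball x \<rho> \<inter> S) y :: real)"
    using norm_triangle_ineq4[of "u _" z] by (intro AE_I2) (auto split: split_indicator)
qed measurable

lemma mean_dev_nonneg: "0 \<le> mean_dev S u x z \<rho>"
  unfolding mean_dev_def by (intro divide_nonneg_nonneg integral_nonneg_AE) auto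

text \<open>Passing to a thick subset shrinks the integral and raises the mean at most by the factor
  8. It transfers a limit in the full disc to both half discs.\<close>

lemma approx_lim_subset:
  assumes S: "thick S x" "S \<subseteq> S'" and [measurable]: "S' \<in> sets borel" and lim: "approx_lim S' u x z"
  shows "approx_lim S u x z"
proof -
  have [measurable]: "S \<in> sets borel" using S by (simp add: thick_def)
  have "(mean_dev S' u x z \<longlongrightarrow> 0) (at_right 0)" using lim by (simp add: approx_lim_iff_mean_dev)
  from tendsto_mult_left[OF this, of 8] have lim8: "((\<lambda>\<rho>. 8 * mean_dev S' u x z \<rho>) \<longlongrightarrow> 0) (at_right 0)" by simp
  have "(mean_dev S u x z \<longlongrightarrow> 0) (at_right 0)"
  proof (rule tendsto_sandwich[OF _ _ tendsto_const lim8])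
    have "\<forall>\<^sub>F \<rho> in at_right 0. measure lborel (ball x \<rho> \<inter> S) \<ge> \<rho>\<^sup>2 / 2" using S by (simp add: thick_def)
    moreover have "\<forall>\<^sub>F \<rho>::real in at_right 0. 0 < \<rho>" by (simp add: eventually_at_right_less)
    ultimately show "\<forall>\<^sub>F \<rho> in at_right 0. mean_dev S u x z \<rho> \<le> 8 * mean_dev S' u x z \<rho>"
    proof eventually_elim
      case (elim \<rho>)
      let ?I = "LINT y|lborel. indicator (ball x \<rho> \<inter> S) y * norm (u y - z)"
      let ?I' = "LINT y|lborel. indicator (ball x \<rho> \<inter> S') y * norm (u y - z)"
      let ?m = "measure lborel (ball x \<rho> \<inter> S)" and ?m' = "measure lborel (ball x \<rho> \<inter> S')"
      have "?I \<le> ?I'"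
        by (rule integral_mono[OF integrable_mean_dev integrable_mean_dev]) (use S(2) in \<open>auto split: split_indicator\<close>)
      moreover have "0 \<le> ?I'" by (rule integral_nonneg_AE) auto
      moreover have "0 < \<rho>\<^sup>2 / 2" using elim by simp
      moreover have "?m' \<le> 8 * ?m"
        using measure_ball_le[OF elim(2), of S' x] elim(1) by simp
      moreover have "0 < ?m" using elim \<open>0 < \<rho>\<^sup>2 / 2\<close> by linarith
      moreover have "?m \<le> ?m'"
        using S(2) by (intro measure_mono_fmeasurable fmeasurable_ball) auto
      ultimately have "?I / ?m \<le> 8 * (?I' / ?m')"
        by (intro ratio_le)
      then show ?case by (simp add: mean_dev_def)
    qed
  qed (simp add: mean_dev_nonneg)
  then show ?thesis by (simp add: approx_lim_iff_mean_dev)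
qed

text \<open>The triangle inequality through \<open>u y\<close> is averaged; thickness keeps the
  measure in the denominator positive.\<close>

lemma approx_lim_unique:
  assumes S: "thick S x" and lim: "approx_lim S u x z" "approx_lim S u x z'"
  shows "z = z'"
proof -
  have [measurable]: "S \<in> sets borel" using S by (simp add: thick_def)
  have "((\<lambda>\<rho>. mean_dev S u x z \<rho> + mean_dev S u x z' \<rho>) \<longlongrightarrow> 0 + 0) (at_right 0)"
    using lim by (intro tendsto_add) (simp_all add: approx_lim_iff_mean_dev)
  moreover have "\<forall>\<^sub>F \<rho> in at_right 0. norm (z - z') \<le> mean_dev S u x z \<rho> + mean_dev S u x z' \<rho>"
  proof -
    have "\<forall>\<^sub>F \<rho> in at_right 0. measure lborel (ball x \<rho> \<inter> S) \<ge> \<rho>\<^sup>2 / 2" using S by (simp add: thick_def)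
    moreover have "\<forall>\<^sub>F \<rho>::real in at_right 0. 0 < \<rho>" by (simp add: eventually_at_right_less)
    ultimately show ?thesis
    proof eventually_elim
      case (elim \<rho>)
      let ?m = "measure lborel (ball x \<rho> \<inter> S)"
      have "0 < \<rho>\<^sup>2 / 2" using elim by simp
      then have m: "0 < ?m" using elim by linarith
      have i: "integrable lborel (indicator (ball x \<rho> \<inter> S) :: real^2 \<Rightarrow> real)"
        using emeasure_ball_finite[of S x \<rho>] by (intro integrable_real_indicator) auto
      have "norm (z - z') * ?m = (LINT y|lborel. indicator (ball x \<rho> \<inter> S) y * norm (z - z'))"
        by (simp add: mult.commute)
      also have "\<dots> \<le> (LINT y|lborel. indicator (ball x \<rho> \<inter> S) y * norm (u y - z) + indicator (ball x \<rho> \<inter> S) y * norm (u y - z'))"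
      proof (rule integral_mono)
        show "integrable lborel (\<lambda>y. indicator (ball x \<rho> \<inter> S) y * norm (z - z'))" using i by simp
        show "integrable lborel (\<lambda>y. indicator (ball x \<rho> \<inter> S) y * norm (u y - z) + indicator (ball x \<rho> \<inter> S) y * norm (u y - z'))"
          by (intro Bochner_Integration.integrable_add integrable_mean_dev) auto
        show "indicator (ball x \<rho> \<inter> S) y * norm (z - z') \<le>
            indicator (ball x \<rho> \<inter> S) y * norm (u y - z) + indicator (ball x \<rho> \<inter> S) y * norm (u y - z')" for y
          using norm_triangle_ineq4[of "u y - z'" "u y - z"] by (auto split: split_indicator simp: algebra_simps)
      qed
      also have "\<dots> = (mean_dev S u x z \<rho> + mean_dev S u x z' \<rho>) * ?m"
        using m integrable_mean_dev[of S] by (simp add: mean_dev_def field_simps)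
      finally show ?case using m by simp
    qed
  qed
  ultimately have "norm (z - z') \<le> 0 + 0"
    by (intro tendsto_lowerbound[where F = "at_right (0::real)"]) auto
  then show ?thesis by simp
qed

text \<open>Close to the segment, \<open>u\<close> differs from \<open>P\<close> at the same x_1 by
  an integral over a short vertical piece. Its smallness is not uniform in x_1, and \<open>P\<close>
  need not be continuous, so both errors are averaged in x_1 by Lebesgue differentiation. The
  exceptional null set must not depend on the tolerance or on \<open>P s\<close>, hence only
  countably many functions are differentiated.\<close>

lemma approx_lim_half:
  fixes P :: "real \<Rightarrow> real^2" and g :: "real^2 \<Rightarrow> real^2"
  assumes P: "integrable lborel P" and g: "integrable lborel g"
    and S: "S \<subseteq> Omega" and thick: "\<And>s. s \<in> {-1<..<1} \<Longrightarrow> thick S (pt s 0)"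
    and bound: "\<And>d. AE x in lborel. x \<in> S \<and> \<bar>x $ 2\<bar> < d \<longrightarrow>
      norm (u x - P (x $ 1)) \<le> (LINT t|lborel. indicator {-d..d} t * norm (g (pt (x $ 1) t)))"
  shows "AE s in lborel. s \<in> {-1<..<1} \<longrightarrow> approx_lim S u (pt s 0) (P s)"
proof -
  note [measurable] = borel_measurable_integrable[OF P] borel_measurable_integrable[OF g]
  have [measurable]: "S \<in> sets borel" using thick[of 0] by (simp add: thick_def)
  \<comment> \<open>The oscillation allowed at height below 1/(m+1); a sequence of heights keeps the
    family countable.\<close>
  define \<gamma> where "\<gamma> m s = (LINT t|lborel. indicator {- (1 / real (Suc m))..1 / real (Suc m)} t * norm (g (pt s t)))" for m s
  have \<gamma>: "integrable lborel (\<gamma> m)" for m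
  proof -
    have "integrable lborel (\<lambda>x. indicator {- (1 / real (Suc m))..1 / real (Suc m)} (x $ 2) *\<^sub>R norm (g x))"
      by (rule integrable_bounded_scaleR[where C = 1, OF integrable_norm[OF g]]) (auto split: split_indicator)
    from integrable_pt_outer[OF this] show ?thesis by (simp add: \<gamma>_def[abs_def])
  qed
  have \<gamma>_lim: "AE s in lborel. (\<lambda>m. \<gamma> m s) \<longlonglongrightarrow> 0"
    using integrable_pt[OF g]
  proof eventually_elim
    case (elim s)
    have "(\<lambda>m. \<gamma> m s) \<longlonglongrightarrow> (LINT t::real|lborel. 0)"
      unfolding \<gamma>_def
    proof (rule integral_dominated_convergence[where w = "\<lambda>t. norm (g (pt s t))"])
      have "AE t::real in lborel. t \<noteq> 0" by (rule AE_lborel_singleton)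
      then show "AE t in lborel. (\<lambda>m. indicator {- (1 / real (Suc m))..1 / real (Suc m)} t * norm (g (pt s t))) \<longlonglongrightarrow> 0"
      proof eventually_elim
        case (elim t)
        have "\<forall>\<^sub>F m in sequentially. inverse (real (Suc m)) < \<bar>t\<bar>"
          using elim by (intro order_tendstoD[OF LIMSEQ_inverse_real_of_nat]) auto
        then have "\<forall>\<^sub>F m in sequentially. indicator {- (1 / real (Suc m))..1 / real (Suc m)} t * norm (g (pt s t)) = 0"
          by eventually_elim (auto simp: inverse_eq_divide split: split_indicator)
        then show ?case by (rule tendsto_eventually)
      qed
    qed (use elim in \<open>auto split: split_indicator\<close>)
    then show ?case by simp
  qed
  \<comment> \<open>Points of a countable dense set replace the value \<open>P s\<close>, which
    varies with \<open>s\<close>, inside the function to be differentiated.\<close>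
  obtain D :: "(real^2) set" where D: "countable D" "\<And>X. open X \<Longrightarrow> X \<noteq> {} \<Longrightarrow> \<exists>q\<in>D. q \<in> X"
    using countable_dense_exists by metis
  define w where "w q m s = indicator {-1<..<1} s * norm (P s - q) + \<gamma> m s" for q m s
  have w: "integrable lborel (w q m)" for q m
  proof -
    have "integrable lborel (\<lambda>s. indicator {-1<..<1} s * norm (P s - q))"
    proof (rule Bochner_Integration.integrable_bound[where f = "\<lambda>s. norm (P s) + norm q * indicator {-1<..<1} s"])
      show "integrable lborel (\<lambda>s. norm (P s) + norm q * indicator {-1<..<1} s)"
        by (intro Bochner_Integration.integrable_add integrable_norm P integrable_mult_right integrable_real_indicator) auto
      show "AE s in lborel. norm (indicator {-1<..<1} s * norm (P s - q)) \<le> norm (norm (P s) + norm q * indicator {-1<..<1} s)"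
        using norm_triangle_ineq4[of "P _" q] by (intro AE_I2) (auto split: split_indicator)
    qed measurable
    then show ?thesis unfolding w_def[abs_def] by (intro Bochner_Integration.integrable_add \<gamma>)
  qed
  have w_nonneg: "0 \<le> w q m s" for q m s
    unfolding w_def \<gamma>_def by (intro add_nonneg_nonneg integral_nonneg_AE) auto
  have "AE s in lborel. \<forall>q\<in>D. \<forall>m. ((\<lambda>\<rho>. integral {s - \<rho>..s + \<rho>} (w q m) / \<rho>) \<longlongrightarrow> 2 * w q m s) (at_right 0)"
    using D(1) lebesgue_differentiation_real[OF w] by (simp add: AE_ball_countable AE_all_countable)
  then show ?thesis
    using \<gamma>_lim
  proof eventually_elim
    case (elim s)
    show ?case
    proof
      assume s: "s \<in> {-1<..<1}"
      have "(mean_dev S u (pt s 0) (P s) \<longlongrightarrow> 0) (at_right 0)"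
      proof (rule tendstoI)
        fix e :: real assume "e > 0"
        \<comment> \<open>Both parts of \<open>w q m s\<close> are below \<open>d\<close> and enter
          with the factor 8, the error of differentiation contributes \<open>2 * d\<close> and the
          distance of \<open>q\<close> to \<open>P s\<close> another \<open>d\<close>: in total less
          than \<open>19 * d\<close>.\<close>
        define d where "d = e / 20"
        have d: "d > 0" using \<open>e > 0\<close> by (simp add: d_def)
        obtain q where q: "q \<in> D" "norm (P s - q) < d"
          using D(2)[of "ball (P s) d"] d by (auto simp: dist_norm)
        have "\<forall>\<^sub>F m in sequentially. \<gamma> m s < d" using elim(2) d by (intro order_tendstoD) auto
        then obtain m where m: "\<gamma> m s < d" by (auto simp: eventually_sequentially)
        have "\<forall>\<^sub>F \<rho> in at_right 0. integral {s - \<rho>..s + \<rho>} (w q m) / \<rho> < 2 * w q m s + d / 2"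
          using elim(1) q(1) d by (intro order_tendstoD[of _ "2 * w q m s"]) auto
        moreover have "\<forall>\<^sub>F \<rho> in at_right 0. measure lborel (ball (pt s 0) \<rho> \<inter> S) \<ge> \<rho>\<^sup>2 / 2"
          using thick[OF s] by (simp add: thick_def)
        moreover have "\<forall>\<^sub>F \<rho>::real in at_right 0. 0 < \<rho>" by (simp add: eventually_at_right_less)
        moreover have "\<forall>\<^sub>F \<rho>::real in at_right 0. \<rho> < 1 / real (Suc m)"
          by (rule eventually_at_right_field[THEN iffD2]) (auto intro!: exI[of _ "1 / real (Suc m)"])
        ultimately show "\<forall>\<^sub>F \<rho> in at_right 0. dist (mean_dev S u (pt s 0) (P s) \<rho>) 0 < e"
        proof eventually_elim
          case (elim \<rho>)
          let ?B = "ball (pt s 0) \<rho> \<inter> S" and ?m = "measure lborel (ball (pt s 0) \<rho> \<inter> S)"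
          let ?A = "{s - \<rho>..s + \<rho>}"
          have "0 < \<rho>\<^sup>2 / 2" using elim(3) by simp
          then have mpos: "0 < ?m" using elim(2) by linarith
          have wA: "integrable lborel (\<lambda>s. indicator ?A s *\<^sub>R w q m s)"
            by (rule integrable_mult_indicator[OF _ w]) simp
          have iI: "integrable lborel (\<lambda>t::real. indicator {-\<rho>..\<rho>} t :: real)"
            by (intro integrable_real_indicator) (use elim(3) in auto)
          \<comment> \<open>The disc is enlarged to the square around it, on which the integrand
            depends on x_1 only and Fubini gives the factor \<open>2 * \<rho>\<close>.\<close>
          have rect: "integrable lborel (\<lambda>x::real^2. indicator {-\<rho>..\<rho>} (x $ 2) *\<^sub>R (indicator ?A (x $ 1) *\<^sub>R w q m (x $ 1)))"
            by (rule integrable_prod_pt[OF iI wA])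
          have rect_eq: "(LINT x::real^2|lborel. indicator {-\<rho>..\<rho>} (x $ 2) *\<^sub>R (indicator ?A (x $ 1) *\<^sub>R w q m (x $ 1)))
             = 2 * \<rho> * integral ?A (w q m)"
          proof -
            have "(LINT x::real^2|lborel. indicator {-\<rho>..\<rho>} (x $ 2) *\<^sub>R (indicator ?A (x $ 1) *\<^sub>R w q m (x $ 1)))
               = (LINT s'|lborel. (2 * \<rho>) *\<^sub>R (indicator ?A s' *\<^sub>R w q m s'))"
              unfolding integral_pt[OF rect] using elim(3) by simp
            also have "\<dots> = 2 * \<rho> * (LINT s'|lborel. indicator ?A s' *\<^sub>R w q m s')"
              by (subst integral_scaleR_right) simp
            also have "(LINT s'|lborel. indicator ?A s' *\<^sub>R w q m s') = integral ?A (w q m)"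
              using set_borel_integral_eq_integral(2)[of ?A "w q m"] wA
              by (simp add: set_integrable_def set_lebesgue_integral_def)
            finally show ?thesis .
          qed
          have BI: "integrable lborel (\<lambda>y. norm (q - P s) * indicator ?B y :: real)"
            using emeasure_ball_finite[of S "pt s 0" \<rho>] by (intro integrable_mult_right integrable_real_indicator) auto
          have "(LINT y|lborel. indicator ?B y * norm (u y - P s)) \<le>
             (LINT y|lborel. indicator {-\<rho>..\<rho>} (y $ 2) *\<^sub>R (indicator ?A (y $ 1) *\<^sub>R w q m (y $ 1)) + norm (q - P s) * indicator ?B y)"
          proof (rule integral_mono_AE[OF integrable_mean_dev])
            show "integrable lborel (\<lambda>y. indicator {-\<rho>..\<rho>} (y $ 2) *\<^sub>R (indicator ?A (y $ 1) *\<^sub>R w q m (y $ 1)) + norm (q - P s) * indicator ?B y)"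
              by (rule Bochner_Integration.integrable_add[OF rect BI])
            show "AE y in lborel. indicator ?B y * norm (u y - P s) \<le>
               indicator {-\<rho>..\<rho>} (y $ 2) *\<^sub>R (indicator ?A (y $ 1) *\<^sub>R w q m (y $ 1)) + norm (q - P s) * indicator ?B y"
              using bound[of "1 / real (Suc m)"]
            proof eventually_elim
              case (elim y)
              show ?case
              proof (cases "y \<in> ?B")
                case True
                then have y: "\<bar>y $ 1 - s\<bar> < \<rho>" "\<bar>y $ 2\<bar> < \<rho>" "y \<in> S"
                  using ball_coordinates[of y "pt s 0" \<rho> 1] ball_coordinates[of y "pt s 0" \<rho> 2] by auto
                then have "norm (u y - P (y $ 1)) \<le> \<gamma> m (y $ 1)"
                  using elim \<open>\<rho> < 1 / real (Suc m)\<close> by (simp add: \<gamma>_def)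
                moreover have "norm (u y - P s) \<le> norm (u y - P (y $ 1)) + (norm (P (y $ 1) - q) + norm (q - P s))"
                  using norm_triangle_ineq[of "u y - P (y $ 1)" "P (y $ 1) - P s"]
                    norm_triangle_ineq[of "P (y $ 1) - q" "q - P s"] by simp
                moreover have "y $ 1 \<in> {-1<..<1}" using y(3) S by (auto simp: mem_Omega)
                ultimately have "norm (u y - P s) \<le> w q m (y $ 1) + norm (q - P s)" by (simp add: w_def)
                with y True show ?thesis by (auto split: split_indicator)
              next
                case False
                then show ?thesis using w_nonneg[of q m "y $ 1"] by (auto split: split_indicator)
              qed
            qed
          qed measurable
          also have "\<dots> = 2 * \<rho> * integral ?A (w q m) + norm (q - P s) * ?m"
            unfolding Bochner_Integration.integral_add[OF rect BI] rect_eq by simp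
          finally have "mean_dev S u (pt s 0) (P s) \<rho> \<le> (2 * \<rho> * integral ?A (w q m) + norm (q - P s) * ?m) / ?m"
            unfolding mean_dev_def using mpos by (intro divide_right_mono) auto
          also have "\<dots> = 2 * \<rho> * integral ?A (w q m) / ?m + norm (q - P s)"
            using mpos by (simp add: add_divide_distrib)
          also have "2 * \<rho> * integral ?A (w q m) / ?m \<le> 2 * \<rho> * integral ?A (w q m) / (\<rho>\<^sup>2 / 2)"
          proof (rule divide_left_mono[OF elim(2)])
            have "w q m integrable_on ?A"
              using integrable_on_lborel[OF w] integrable_on_subcbox by (metis interval_cbox subset_UNIV)
            then have "0 \<le> integral ?A (w q m)"
              by (rule Henstock_Kurzweil_Integration.integral_nonneg) (rule w_nonneg)
            then show "0 \<le> 2 * \<rho> * integral ?A (w q m)" using elim(3) by simp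
          qed (use mpos \<open>0 < \<rho>\<^sup>2 / 2\<close> in \<open>auto intro: mult_pos_pos\<close>)
          also have "2 * \<rho> * integral ?A (w q m) / (\<rho>\<^sup>2 / 2) = 4 * (integral ?A (w q m) / \<rho>)"
            using elim(3) by (simp add: power2_eq_square field_simps)
          also have "\<dots> < 4 * (2 * w q m s + d / 2)" using elim(1) by simp
          also have "w q m s = norm (P s - q) + \<gamma> m s" using s by (simp add: w_def)
          finally have "mean_dev S u (pt s 0) (P s) \<rho> < 20 * d"
            using q(2) m d by (simp add: norm_minus_commute)
          then show ?case using mean_dev_nonneg[of S "pt s 0" "P s" \<rho>] by (simp add: d_def)
        qed
      qed
      then show "approx_lim S u (pt s 0) (P s)" by (simp add: approx_lim_iff_mean_dev)
    qed
  qed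
qed

end

context layer_limit
begin

section \<open>The traces of the limit and their difference\<close>

lemma norm_J_le: "norm (J s) \<le> (LINT r|lborel. norm (a r))"
proof -
  have "norm (J s) \<le> (LINT r|lborel. norm (indicator {..s} r *\<^sub>R a r))"
    unfolding J_def by (rule integral_norm_bound)
  also have "\<dots> \<le> (LINT r|lborel. norm (a r))"
    by (rule integral_mono[OF integrable_norm[OF integrable_mult_indicator] integrable_norm[OF a_int]])
       (auto intro: a_int split: split_indicator)
  finally show ?thesis .
qed

text \<open>\<open>J\<close> keeps its nonzero value to the right of 1 and is not integrable on the
  line; this is its restriction to the segment.\<close>

definition Jl :: "real \<Rightarrow> real^2" where "Jl s = indicator {-\<xi><..<1} s *\<^sub>R J s"

lemma Jl_int: "integrable lborel Jl"
proof (rule Bochner_Integration.integrable_bound[where f = "\<lambda>s. (LINT r|lborel. norm (a r)) * indicator {-\<xi><..<1} s"])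
  show "integrable lborel (\<lambda>s. (LINT r|lborel. norm (a r)) * indicator {-\<xi><..<1} s :: real)"
    by (intro integrable_mult_right integrable_real_indicator) (use \<xi> in auto)
  show "Jl \<in> borel_measurable lborel" unfolding Jl_def[abs_def] by measurable
  show "AE s in lborel. norm (Jl s) \<le> norm ((LINT r|lborel. norm (a r)) * indicator {-\<xi><..<1} s :: real)"
    using norm_J_le by (intro AE_I2) (auto simp: Jl_def split: split_indicator intro: order_trans[OF _ abs_ge_self])
qed

text \<open>Subtracting the jump in the upper half of the square removes the singular part of the
  vertical derivative. What is left has an integrable vertical derivative and is a function of x_1
  plus a primitive.\<close>

lemma ex_profile:
  obtains T where "integrable lborel T"
    "AE x in lborel. x \<in> Omega \<longrightarrow> kk x - indicator {0<..<1} (x $ 2) *\<^sub>R Jl (x $ 1) = T (x $ 1) + prim (\<lambda>x. column 2 (HH x)) x"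
proof (rule weak_deriv_2_imp_prim)
  have Ii: "integrable lborel (indicator {0<..<1::real} :: real \<Rightarrow> real)"
    by (intro integrable_real_indicator) auto
  have jump: "integrable lborel (\<lambda>x::real^2. indicator {0<..<1} (x $ 2) *\<^sub>R Jl (x $ 1))"
    by (rule integrable_prod_pt[OF Ii Jl_int])
  show "integrable lborel (\<lambda>x. kk x - indicator {0<..<1} (x $ 2) *\<^sub>R Jl (x $ 1))"
    by (intro Bochner_Integration.integrable_diff kk_int jump)
  show "integrable lborel (\<lambda>x. column 2 (HH x))"
    by (rule integrable_bounded_linear[OF bounded_linear_column HH_int])
  show "kk x - indicator {0<..<1} (x $ 2) *\<^sub>R Jl (x $ 1) = 0" if "x \<notin> Omega" for x
    using that kk(2)[OF that] \<xi> by (auto simp: Jl_def mem_Omega split: split_indicator)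
  fix \<psi> \<theta> :: "real \<Rightarrow> real"
  assume t: "\<psi> \<in> test_functions {-1<..<1}" "\<theta> \<in> test_functions {-1<..<1}"
  have d: "dir_deriv \<theta> 1 \<in> test_functions {-1<..<1}" by (rule test_functions_dir_deriv[OF t(2)]) simp
  note [measurable] = test_functions_measurable[OF t(1)] test_functions_measurable[OF t(2)] test_functions_measurable[OF d]
  \<comment> \<open>The vertical derivative of the step in x_2 is a unit mass at 0; the contribution
    of the upper end vanishes because \<theta> does.\<close>
  have ft: "(LINT r|lborel. indicator {0<..<1} r * dir_deriv \<theta> 1 r) = - \<theta> 0"
  proof -
    have "AE r::real in lborel. r \<noteq> 0" "AE r::real in lborel. r \<noteq> 1" by (rule AE_lborel_singleton)+
    then have "AE r in lborel. indicator {0<..<1} r * dir_deriv \<theta> 1 r = indicator {0..1} r *\<^sub>R dir_deriv \<theta> 1 r"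
      by eventually_elim (auto split: split_indicator)
    then have "(LINT r|lborel. indicator {0<..<1} r * dir_deriv \<theta> 1 r) = (LINT r|lborel. indicator {0..1} r *\<^sub>R dir_deriv \<theta> 1 r)"
      by (intro integral_cong_AE) auto
    also have "\<dots> = \<theta> 1 - \<theta> 0"
      using test_functions_has_real_derivative[OF t(2)]
      by (intro integral_FTC_Icc test_functions_continuous[OF d])
         (auto simp: has_real_derivative_iff_has_vector_derivative intro: has_vector_derivative_at_within)
    also have "\<theta> 1 = 0" by (rule test_functions_eq_0[OF t(2)]) simp
    finally show ?thesis by simp
  qed
  have k_i: "integrable lborel (\<lambda>x. (\<psi> (x $ 1) * dir_deriv \<theta> 1 (x $ 2)) *\<^sub>R kk x)"
    by (rule integrable_test_scaleR[OF kk_int prod_test_Omega[OF t(1) d]])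
  have j_i: "integrable lborel (\<lambda>x::real^2. (\<psi> (x $ 1) * dir_deriv \<theta> 1 (x $ 2)) *\<^sub>R (indicator {0<..<1} (x $ 2) *\<^sub>R Jl (x $ 1)))"
    by (rule integrable_test_scaleR[OF jump prod_test_Omega[OF t(1) d]])
  have "(LINT x::real^2|lborel. (\<psi> (x $ 1) * dir_deriv \<theta> 1 (x $ 2)) *\<^sub>R (indicator {0<..<1} (x $ 2) *\<^sub>R Jl (x $ 1)))
     = (LINT s|lborel. LINT r|lborel. (indicator {0<..<1} r * dir_deriv \<theta> 1 r) *\<^sub>R (\<psi> s *\<^sub>R Jl s))"
    unfolding integral_pt[OF j_i] by (simp add: mult_ac)
  also have "\<dots> = (LINT s|lborel. (- \<theta> 0) *\<^sub>R (\<psi> s *\<^sub>R Jl s))"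
  proof (intro Bochner_Integration.integral_cong refl)
    fix s :: real
    have "integrable lborel (\<lambda>r. indicator {0<..<1} r * dir_deriv \<theta> 1 r)"
      using integrable_mult_indicator[OF _ test_functions_integrable[OF d], of "{0<..<1}"] by simp
    then have "(LINT r|lborel. (indicator {0<..<1} r * dir_deriv \<theta> 1 r) *\<^sub>R (\<psi> s *\<^sub>R Jl s))
       = (LINT r|lborel. indicator {0<..<1} r * dir_deriv \<theta> 1 r) *\<^sub>R (\<psi> s *\<^sub>R Jl s)"
      by (intro integral_scaleR_left)
    then show "(LINT r|lborel. (indicator {0<..<1} r * dir_deriv \<theta> 1 r) *\<^sub>R (\<psi> s *\<^sub>R Jl s)) = (- \<theta> 0) *\<^sub>R (\<psi> s *\<^sub>R Jl s)"
      unfolding ft .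
  qed
  also have "\<dots> = - (LINT s|lborel. (indicator {-\<xi><..<1} s * (\<psi> s * \<theta> 0)) *\<^sub>R J s)"
    by (simp add: Jl_def mult_ac)
  finally have j_eq: "(LINT x::real^2|lborel. (\<psi> (x $ 1) * dir_deriv \<theta> 1 (x $ 2)) *\<^sub>R (indicator {0<..<1} (x $ 2) *\<^sub>R Jl (x $ 1)))
     = - (LINT s|lborel. (indicator {-\<xi><..<1} s * (\<psi> s * \<theta> 0)) *\<^sub>R J s)" .
  have k_eq: "(LINT x|lborel. (\<psi> (x $ 1) * dir_deriv \<theta> 1 (x $ 2)) *\<^sub>R kk x) =
      - (LINT x|lborel. (\<psi> (x $ 1) * \<theta> (x $ 2)) *\<^sub>R column 2 (HH x)) - (LINT s|lborel. (indicator {-\<xi><..<1} s * (\<psi> s * \<theta> 0)) *\<^sub>R J s)"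
    using deriv_limit(2)[OF prod_test_Omega[OF t]] by (simp add: prod_test_dir_deriv[OF t])
  show "(LINT x|lborel. (\<psi> (x $ 1) * dir_deriv \<theta> 1 (x $ 2)) *\<^sub>R (kk x - indicator {0<..<1} (x $ 2) *\<^sub>R Jl (x $ 1)))
     = - (LINT x|lborel. (\<psi> (x $ 1) * \<theta> (x $ 2)) *\<^sub>R column 2 (HH x))"
    unfolding scaleR_diff_right[of "_ * _"] Bochner_Integration.integral_diff[OF k_i j_i] k_eq j_eq by simp
qed

text \<open>The trace from below is the profile evaluated at x_2 = 0, the one from above exceeds it
  by the subtracted jump. Both sides share the primitive of \<open>g\<close>, which is small on
  short vertical pieces around the segment.\<close>

lemma traces:
  obtains kp km where
    "AE s in lborel. s \<in> {-1<..<1} \<longrightarrow> approx_lim (Omega \<inter> {x. x $ 2 > 0}) kk (pt s 0) (kp s)"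
    "AE s in lborel. s \<in> {-1<..<1} \<longrightarrow> approx_lim (Omega \<inter> {x. x $ 2 < 0}) kk (pt s 0) (km s)"
    "\<And>s. s \<in> {-\<xi><..<1} \<Longrightarrow> J s = kp s - km s"
proof -
  obtain T where T: "integrable lborel T"
    "AE x in lborel. x \<in> Omega \<longrightarrow> kk x - indicator {0<..<1} (x $ 2) *\<^sub>R Jl (x $ 1) = T (x $ 1) + prim (\<lambda>x. column 2 (HH x)) x"
    using ex_profile by blast
  define g where "g x = column 2 (HH x)" for x
  have g: "integrable lborel g"
    unfolding g_def[abs_def] by (rule integrable_bounded_linear[OF bounded_linear_column HH_int])
  have T2: "AE x in lborel. x \<in> Omega \<longrightarrow> kk x - indicator {0<..<1} (x $ 2) *\<^sub>R Jl (x $ 1) = T (x $ 1) + prim g x"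
    using T(2) by (simp add: g_def[abs_def])
  define km where "km s = T s + (LINT t|lborel. indicator {..0} t *\<^sub>R g (pt s t))" for s
  define kp where "kp s = km s + Jl s" for s
  have km_i: "integrable lborel km"
  proof -
    have "integrable lborel (\<lambda>x. indicator {..0} (x $ 2) *\<^sub>R g x)"
      by (rule integrable_bounded_scaleR[where C = 1, OF g]) (auto split: split_indicator)
    from integrable_pt_outer[OF this] T(1) show ?thesis unfolding km_def[abs_def] by simp
  qed
  have kp_i: "integrable lborel kp" unfolding kp_def[abs_def] by (intro Bochner_Integration.integrable_add km_i Jl_int)
  have prim_bound: "norm (prim g x - (LINT t|lborel. indicator {..0} t *\<^sub>R g (pt (x $ 1) t)))
      \<le> (LINT t|lborel. indicator {-d..d} t * norm (g (pt (x $ 1) t)))"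
    if sl: "integrable lborel (\<lambda>t. g (pt (x $ 1) t))" and "\<bar>x $ 2\<bar> < d" for x d
  proof -
    have i: "integrable lborel (\<lambda>t. indicator A t *\<^sub>R g (pt (x $ 1) t))" if "A \<in> sets borel" for A
      by (rule integrable_mult_indicator[OF _ sl]) (use that in simp)
    have "integrable lborel (\<lambda>t. indicator {-d..d} t *\<^sub>R norm (g (pt (x $ 1) t)))"
      by (rule integrable_mult_indicator[OF _ integrable_norm[OF sl]]) simp
    then have i': "integrable lborel (\<lambda>t. indicator {-d..d} t * norm (g (pt (x $ 1) t)))" by simp
    have "norm (prim g x - (LINT t|lborel. indicator {..0} t *\<^sub>R g (pt (x $ 1) t)))
      = norm (LINT t|lborel. indicator {..x $ 2} t *\<^sub>R g (pt (x $ 1) t) - indicator {..0} t *\<^sub>R g (pt (x $ 1) t))"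
      unfolding prim_def by (subst Bochner_Integration.integral_diff) (auto intro: i)
    also have "\<dots> \<le> (LINT t|lborel. norm (indicator {..x $ 2} t *\<^sub>R g (pt (x $ 1) t) - indicator {..0} t *\<^sub>R g (pt (x $ 1) t)))"
      by (rule integral_norm_bound)
    also have "\<dots> \<le> (LINT t|lborel. indicator {-d..d} t * norm (g (pt (x $ 1) t)))"
      using that(2)
      by (intro integral_mono i' integrable_norm Bochner_Integration.integrable_diff i) (auto split: split_indicator)
    finally show ?thesis .
  qed
  have slices: "AE x::real^2 in lborel. integrable lborel (\<lambda>t. g (pt (x $ 1) t))"
    using AE_first[OF integrable_pt[OF g]] .
  have up: "AE s in lborel. s \<in> {-1<..<1} \<longrightarrow> approx_lim (Omega \<inter> {x. x $ 2 > 0}) kk (pt s 0) (kp s)"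
  proof (rule approx_lim_half[OF kk_int kp_i g _ thick_half(1)])
    show "AE x in lborel. x \<in> Omega \<inter> {x. x $ 2 > 0} \<and> \<bar>x $ 2\<bar> < d \<longrightarrow>
        norm (kk x - kp (x $ 1)) \<le> (LINT t|lborel. indicator {-d..d} t * norm (g (pt (x $ 1) t)))" for d
      using T2 slices
    proof eventually_elim
      case (elim x)
      show ?case
      proof
        assume x: "x \<in> Omega \<inter> {x. x $ 2 > 0} \<and> \<bar>x $ 2\<bar> < d"
        with elim(1) have "kk x - Jl (x $ 1) = T (x $ 1) + prim g x" by (auto simp: mem_Omega)
        then have "kk x - kp (x $ 1) = prim g x - (LINT t|lborel. indicator {..0} t *\<^sub>R g (pt (x $ 1) t))"
          by (simp add: kp_def km_def algebra_simps)
        moreover have "\<bar>x $ 2\<bar> < d" using x by blast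
        ultimately show "norm (kk x - kp (x $ 1)) \<le> (LINT t|lborel. indicator {-d..d} t * norm (g (pt (x $ 1) t)))"
          using prim_bound[OF elim(2)] by (simp only:)
      qed
    qed
  qed auto
  have down: "AE s in lborel. s \<in> {-1<..<1} \<longrightarrow> approx_lim (Omega \<inter> {x. x $ 2 < 0}) kk (pt s 0) (km s)"
  proof (rule approx_lim_half[OF kk_int km_i g _ thick_half(2)])
    show "AE x in lborel. x \<in> Omega \<inter> {x. x $ 2 < 0} \<and> \<bar>x $ 2\<bar> < d \<longrightarrow>
        norm (kk x - km (x $ 1)) \<le> (LINT t|lborel. indicator {-d..d} t * norm (g (pt (x $ 1) t)))" for d
      using T2 slices
    proof eventually_elim
      case (elim x)
      show ?case
      proof
        assume x: "x \<in> Omega \<inter> {x. x $ 2 < 0} \<and> \<bar>x $ 2\<bar> < d"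
        with elim(1) have "kk x = T (x $ 1) + prim g x" by auto
        then have "kk x - km (x $ 1) = prim g x - (LINT t|lborel. indicator {..0} t *\<^sub>R g (pt (x $ 1) t))"
          by (simp add: km_def algebra_simps)
        moreover have "\<bar>x $ 2\<bar> < d" using x by blast
        ultimately show "norm (kk x - km (x $ 1)) \<le> (LINT t|lborel. indicator {-d..d} t * norm (g (pt (x $ 1) t)))"
          using prim_bound[OF elim(2)] by (simp only:)
      qed
    qed
  qed auto
  show ?thesis
    by (rule that[OF up down]) (simp add: kp_def Jl_def)
qed

text \<open>An approximate limit in full discs would also be the limit in each half disc and force
  the two traces to coincide.\<close>

lemma jump_approx_discont: "AE s in lborel. s \<in> {-\<xi><..<1} \<and> J s \<noteq> 0 \<longrightarrow> pt s 0 \<in> approx_discont_set Omega kk"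
proof -
  obtain kp km where tr:
    "AE s in lborel. s \<in> {-1<..<1} \<longrightarrow> approx_lim (Omega \<inter> {x. x $ 2 > 0}) kk (pt s 0) (kp s)"
    "AE s in lborel. s \<in> {-1<..<1} \<longrightarrow> approx_lim (Omega \<inter> {x. x $ 2 < 0}) kk (pt s 0) (km s)"
    and J: "\<And>s. s \<in> {-\<xi><..<1} \<Longrightarrow> J s = kp s - km s"
    using traces by blast
  from tr show ?thesis
  proof eventually_elim
    case (elim s)
    show ?case
    proof
      assume s: "s \<in> {-\<xi><..<1} \<and> J s \<noteq> 0"
      then have s1: "s \<in> {-1<..<1}" using \<xi> by auto
      have False if z: "approx_lim Omega kk (pt s 0) z" for z
      proof -
        have "approx_lim (Omega \<inter> {x. x $ 2 > 0}) kk (pt s 0) z"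
          by (rule approx_lim_subset[OF kk_int thick_half(1)[OF s1] _ sets_Omega z]) auto
        moreover have "approx_lim (Omega \<inter> {x. x $ 2 < 0}) kk (pt s 0) z"
          by (rule approx_lim_subset[OF kk_int thick_half(2)[OF s1] _ sets_Omega z]) auto
        ultimately have "kp s = z" "km s = z"
          using approx_lim_unique[OF kk_int thick_half(1)[OF s1]] approx_lim_unique[OF kk_int thick_half(2)[OF s1]] elim s1
          by blast+
        with J[of s] s show False by simp
      qed
      moreover have "pt s 0 \<in> Omega" using s1 by (simp add: mem_Omega)
      ultimately show "pt s 0 \<in> approx_discont_set Omega kk" by (auto simp: approx_discont_set_def)
    qed
  qed
qed

text \<open>The point -2 is just some point to the left of the support of \<open>a\<close>; with a
  finite lower limit continuity of \<open>J\<close> is that of an indefinite integral.\<close>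

lemma J_eq_integral:
  assumes "-2 \<le> s"
  shows "J s = integral {-2..s} a"
proof -
  have "indicator {..s} r *\<^sub>R a r = indicator {-2..s} r *\<^sub>R a r" for r
    using a_0[of r] \<xi> by (auto split: split_indicator)
  then have "J s = (LINT r:{-2..s}|lborel. a r)" by (simp only: J_def set_lebesgue_integral_def)
  also have "\<dots> = integral {-2..s} a"
    by (rule set_borel_integral_eq_integral(2)) (auto simp: set_integrable_def intro: integrable_mult_indicator a_int)
  finally show ?thesis .
qed

lemma continuous_J: "continuous_on {-\<xi>..1} J"
proof -
  have "a integrable_on {-2..1}"
    using integrable_on_lborel[OF a_int] integrable_on_subcbox by (metis interval_cbox subset_UNIV)
  then have "continuous_on {-2..1} (\<lambda>s. integral {-2..s} a)" by (rule indefinite_integral_continuous_1)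
  then have "continuous_on {-\<xi>..1} (\<lambda>s. integral {-2..s} a)" by (rule continuous_on_subset) (use \<xi> in auto)
  then show ?thesis
    by (rule continuous_on_cong[THEN iffD1, rotated 2]) (use \<xi> in \<open>auto simp: J_eq_integral\<close>)
qed

end

section \<open>Hausdorff measure on a line\<close>

lemma hausdorff1_pre_le:
  assumes "A \<subseteq> (\<Union>i. C i)" "\<And>i. bounded (C i)" "\<And>i. diameter (C i) \<le> \<delta>"
  shows "hausdorff1_pre \<delta> A \<le> (\<Sum>i. ennreal (diameter (C i)))"
  unfolding hausdorff1_pre_def using assms by (intro INF_lower) auto

lemma hausdorff1_pre_greatest:
  assumes "\<And>C. A \<subseteq> (\<Union>i. C i) \<Longrightarrow> (\<And>i::nat. bounded (C i)) \<Longrightarrow> (\<And>i. diameter (C i) \<le> \<delta>) \<Longrightarrow> x \<le> (\<Sum>i. ennreal (diameter (C i)))"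
  shows "x \<le> hausdorff1_pre \<delta> A"
  unfolding hausdorff1_pre_def using assms by (intro INF_greatest) auto

lemma hausdorff1_pre_cover:
  assumes "hausdorff1_pre \<delta> A < x"
  obtains C where "A \<subseteq> (\<Union>i. C i)" "\<And>i::nat. bounded (C i)" "\<And>i. diameter (C i) \<le> \<delta>" "(\<Sum>i. ennreal (diameter (C i))) < x"
  using assms unfolding hausdorff1_pre_def INF_less_iff by blast

lemma hausdorff1_pre_mono: "A \<subseteq> B \<Longrightarrow> hausdorff1_pre \<delta> A \<le> hausdorff1_pre \<delta> B"
  by (rule hausdorff1_pre_greatest, rule hausdorff1_pre_le) auto

lemma hausdorff1_pre_antimono: "\<delta> \<le> \<delta>' \<Longrightarrow> hausdorff1_pre \<delta>' A \<le> hausdorff1_pre \<delta> A"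
  by (rule hausdorff1_pre_greatest, rule hausdorff1_pre_le) (auto intro: order_trans)

lemma hausdorff1_pre_le_outer: "\<delta> > 0 \<Longrightarrow> hausdorff1_pre \<delta> A \<le> hausdorff1_outer A"
  unfolding hausdorff1_outer_def by (intro SUP_upper) auto

lemma hausdorff1_outer_least: "(\<And>\<delta>. \<delta> > 0 \<Longrightarrow> hausdorff1_pre \<delta> A \<le> x) \<Longrightarrow> hausdorff1_outer A \<le> x"
  unfolding hausdorff1_outer_def by (intro SUP_least) auto

lemma hausdorff1_outer_mono: "A \<subseteq> B \<Longrightarrow> hausdorff1_outer A \<le> hausdorff1_outer B"
  by (rule hausdorff1_outer_least) (meson hausdorff1_pre_mono hausdorff1_pre_le_outer order_trans)

lemma hausdorff1_outer_empty: "hausdorff1_outer {} = 0"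
proof -
  have "hausdorff1_outer {} \<le> 0"
  proof (rule hausdorff1_outer_least)
    fix \<delta> :: real assume "\<delta> > 0"
    then have "hausdorff1_pre \<delta> {} \<le> (\<Sum>i::nat. ennreal (diameter ({} :: (real^2) set)))"
      by (intro hausdorff1_pre_le) auto
    then show "hausdorff1_pre \<delta> {} \<le> 0" by simp
  qed
  then show ?thesis by simp
qed

text \<open>Nearly optimal covers with errors e / 2^(i+1) are merged into one cover by enumerating
  the pairs of indices.\<close>

lemma hausdorff1_pre_subadditive:
  "hausdorff1_pre \<delta> (\<Union>i::nat. A i) \<le> (\<Sum>i. hausdorff1_pre \<delta> (A i))"
proof (rule ennreal_le_epsilon)
  fix e :: real assume fin: "(\<Sum>i. hausdorff1_pre \<delta> (A i)) < top" and "e > 0"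
  have "\<exists>C. A i \<subseteq> (\<Union>j. C j) \<and> (\<forall>j::nat. bounded (C j)) \<and> (\<forall>j. diameter (C j) \<le> \<delta>) \<and>
      (\<Sum>j. ennreal (diameter (C j))) \<le> hausdorff1_pre \<delta> (A i) + ennreal (e * (1/2) ^ Suc i)" for i
  proof -
    have "hausdorff1_pre \<delta> (A i) \<le> (\<Sum>i. hausdorff1_pre \<delta> (A i))"
      using ennreal_suminf_lessD fin by (intro sum_le_suminf[of _ "{i}", simplified]) auto
    then have "hausdorff1_pre \<delta> (A i) < top" using fin by (rule le_less_trans)
    then have "hausdorff1_pre \<delta> (A i) < hausdorff1_pre \<delta> (A i) + ennreal (e * (1/2) ^ Suc i)"
      using \<open>e > 0\<close> ennreal_add_left_cancel_less[of "hausdorff1_pre \<delta> (A i)" 0 "ennreal (e * (1/2) ^ Suc i)"] by simp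
    then show ?thesis by (metis hausdorff1_pre_cover less_imp_le)
  qed
  then obtain C where C: "\<And>i. A i \<subseteq> (\<Union>j. C i j)" "\<And>i j::nat. bounded (C i j)" "\<And>i j. diameter (C i j) \<le> \<delta>"
    "\<And>i. (\<Sum>j. ennreal (diameter (C i j))) \<le> hausdorff1_pre \<delta> (A i) + ennreal (e * (1/2) ^ Suc i)"
    by metis
  define f where "f = (\<lambda>(i, j). ennreal (diameter (C i j)))"
  have "hausdorff1_pre \<delta> (\<Union>i. A i) \<le> (\<Sum>n. f (prod_decode n))"
  proof -
    have "(\<Union>i. A i) \<subseteq> (\<Union>n. case prod_decode n of (i, j) \<Rightarrow> C i j)"
    proof
      fix x assume "x \<in> (\<Union>i. A i)"
      then obtain i j where "x \<in> C i j" using C(1) by blast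
      then have "x \<in> (case prod_decode (prod_encode (i, j)) of (i, j) \<Rightarrow> C i j)" by simp
      then show "x \<in> (\<Union>n. case prod_decode n of (i, j) \<Rightarrow> C i j)" by (rule UN_I[OF UNIV_I])
    qed
    then have "hausdorff1_pre \<delta> (\<Union>i. A i) \<le> (\<Sum>n. ennreal (diameter (case prod_decode n of (i, j) \<Rightarrow> C i j)))"
      by (rule hausdorff1_pre_le) (auto simp: C split: prod.split)
    also have "\<dots> = (\<Sum>n. f (prod_decode n))" by (intro suminf_cong) (simp add: f_def split: prod.split)
    finally show ?thesis .
  qed
  also have "\<dots> = (\<Sum>i. \<Sum>j. ennreal (diameter (C i j)))"
    by (rule suminf_ennreal_2dimen) (simp add: f_def)
  also have "\<dots> \<le> (\<Sum>i. hausdorff1_pre \<delta> (A i) + ennreal (e * (1/2) ^ Suc i))"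
    by (intro suminf_le C) auto
  also have "\<dots> = (\<Sum>i. hausdorff1_pre \<delta> (A i)) + (\<Sum>i. ennreal (e * (1/2) ^ Suc i))"
    by (intro suminf_add[symmetric]) auto
  also have "(\<Sum>i. ennreal (e * (1/2) ^ Suc i)) = ennreal e"
  proof -
    have "(\<lambda>i. e * (1/2) ^ Suc i) sums (e * 1)"
      using power_half_series by (rule sums_mult)
    with \<open>e > 0\<close> show ?thesis by (subst suminf_ennreal_eq) auto
  qed
  finally show "hausdorff1_pre \<delta> (\<Union>i. A i) \<le> (\<Sum>i. hausdorff1_pre \<delta> (A i)) + ennreal e" .
qed

lemma hausdorff1_outer_subadditive:
  "hausdorff1_outer (\<Union>i::nat. A i) \<le> (\<Sum>i. hausdorff1_outer (A i))"
proof (rule hausdorff1_outer_least)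
  fix \<delta> :: real assume "\<delta> > 0"
  have "hausdorff1_pre \<delta> (\<Union>i. A i) \<le> (\<Sum>i. hausdorff1_pre \<delta> (A i))" by (rule hausdorff1_pre_subadditive)
  also have "\<dots> \<le> (\<Sum>i. hausdorff1_outer (A i))"
    using \<open>\<delta> > 0\<close> by (intro suminf_le hausdorff1_pre_le_outer) auto
  finally show "hausdorff1_pre \<delta> (\<Union>i. A i) \<le> (\<Sum>i. hausdorff1_outer (A i))" .
qed

lemma hausdorff1_outer_Un: "hausdorff1_outer (A \<union> B) \<le> hausdorff1_outer A + hausdorff1_outer B"
proof -
  define g where "g i = (if i = 0 then A else if i = 1 then B else {})" for i :: nat
  have g: "g 0 = A" "g 1 = B" "i \<notin> {0, 1} \<Longrightarrow> g i = {}" for i by (auto simp: g_def)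
  have "A \<union> B \<subseteq> (\<Union>i. g i)" using g(1,2) by blast
  then have "hausdorff1_outer (A \<union> B) \<le> hausdorff1_outer (\<Union>i. g i)" by (rule hausdorff1_outer_mono)
  also have "\<dots> \<le> (\<Sum>i. hausdorff1_outer (g i))" by (rule hausdorff1_outer_subadditive)
  also have "\<dots> = (\<Sum>i\<in>{0,1}. hausdorff1_outer (g i))"
    by (rule suminf_finite) (use g(3) hausdorff1_outer_empty in auto)
  finally show ?thesis using g by simp
qed

section \<open>The Caratheodory measure and its Borel sets\<close>

lemma outer_measure_space_hausdorff1: "outer_measure_space (Pow UNIV) hausdorff1_outer"
  unfolding outer_measure_space_def positive_def increasing_def countably_subadditive_def
  using hausdorff1_outer_empty hausdorff1_outer_mono hausdorff1_outer_subadditive by blast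

lemma hausdorff1_measure_space:
  "measure_space UNIV (lambda_system UNIV (Pow UNIV) hausdorff1_outer) hausdorff1_outer"
  by (rule sigma_algebra.caratheodory_lemma[OF sigma_algebra_Pow outer_measure_space_hausdorff1])

lemma sets_hausdorff1: "sets hausdorff1 = lambda_system UNIV (Pow UNIV) hausdorff1_outer"
proof -
  have "sigma_algebra UNIV (lambda_system UNIV (Pow UNIV) hausdorff1_outer)"
    using hausdorff1_measure_space unfolding measure_space_def by blast
  from sigma_algebra.sets_measure_of_eq[OF this] show ?thesis by (simp add: hausdorff1_def)
qed

lemma space_hausdorff1: "space hausdorff1 = UNIV"
  unfolding hausdorff1_def by (simp add: space_measure_of_conv)

lemma emeasure_hausdorff1:
  assumes "A \<in> sets hausdorff1"
  shows "emeasure hausdorff1 A = hausdorff1_outer A"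
proof -
  have "emeasure (measure_of UNIV (lambda_system UNIV (Pow UNIV) hausdorff1_outer) hausdorff1_outer) A = hausdorff1_outer A"
    using hausdorff1_measure_space assms unfolding sets_hausdorff1 measure_space_def
    by (intro emeasure_measure_of_sigma) auto
  then show ?thesis by (simp add: hausdorff1_def)
qed

text \<open>A set of diameter below \<open>d\<close> cannot meet both \<open>A\<close> and
  \<open>B\<close>, so a fine cover of the union splits into a cover of each. This metric additivity
  is what makes half-planes measurable.\<close>

lemma hausdorff1_outer_separated:
  assumes d: "d > 0" and sep: "\<And>x y. x \<in> A \<Longrightarrow> y \<in> B \<Longrightarrow> d \<le> dist x y"
  shows "hausdorff1_outer A + hausdorff1_outer B \<le> hausdorff1_outer (A \<union> B)"
proof -
  have split: "hausdorff1_pre \<delta> A + hausdorff1_pre \<delta> B \<le> hausdorff1_pre \<delta> (A \<union> B)" if \<delta>: "0 < \<delta>" "\<delta> < d" for \<delta>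
  proof (rule hausdorff1_pre_greatest)
    fix C :: "nat \<Rightarrow> (real^2) set"
    assume C: "A \<union> B \<subseteq> (\<Union>i. C i)" "\<And>i. bounded (C i)" "\<And>i. diameter (C i) \<le> \<delta>"
    define P where "P i = (if C i \<inter> A = {} then {} else C i)" for i
    define Q where "Q i = (if C i \<inter> A = {} then C i else {})" for i
    have "hausdorff1_pre \<delta> A \<le> (\<Sum>i. ennreal (diameter (P i)))"
    proof (rule hausdorff1_pre_le)
      show "A \<subseteq> (\<Union>i. P i)"
      proof
        fix x assume "x \<in> A"
        then obtain i where "x \<in> C i" using C(1) by blast
        with \<open>x \<in> A\<close> have "x \<in> P i" by (auto simp: P_def)
        then show "x \<in> (\<Union>i. P i)" by blast
      qed
    qed (use C \<delta> in \<open>auto simp: P_def\<close>)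
    moreover have "hausdorff1_pre \<delta> B \<le> (\<Sum>i. ennreal (diameter (Q i)))"
    proof (rule hausdorff1_pre_le)
      show "B \<subseteq> (\<Union>i. Q i)"
      proof
        fix y assume "y \<in> B"
        then obtain i where i: "y \<in> C i" using C(1) by blast
        have "C i \<inter> A = {}"
        proof (rule ccontr)
          assume "C i \<inter> A \<noteq> {}"
          then obtain x where "x \<in> C i" "x \<in> A" by blast
          with diameter_bounded_bound[OF C(2) this(1) i] sep[OF this(2) \<open>y \<in> B\<close>] C(3)[of i] \<delta> show False by linarith
        qed
        with i show "y \<in> (\<Union>i. Q i)" by (auto simp: Q_def)
      qed
    qed (use C \<delta> in \<open>auto simp: Q_def\<close>)
    ultimately have "hausdorff1_pre \<delta> A + hausdorff1_pre \<delta> B \<le> (\<Sum>i. ennreal (diameter (P i))) + (\<Sum>i. ennreal (diameter (Q i)))"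
      by (rule add_mono)
    also have "\<dots> = (\<Sum>i. ennreal (diameter (P i)) + ennreal (diameter (Q i)))"
      by (rule suminf_add) auto
    also have "\<dots> = (\<Sum>i. ennreal (diameter (C i)))"
      by (intro suminf_cong) (simp add: P_def Q_def)
    finally show "hausdorff1_pre \<delta> A + hausdorff1_pre \<delta> B \<le> (\<Sum>i. ennreal (diameter (C i)))" .
  qed
  have "hausdorff1_outer A + hausdorff1_outer B = (SUP \<delta>\<in>{0<..}. hausdorff1_pre \<delta> A + hausdorff1_outer B)"
    unfolding hausdorff1_outer_def[of A] by (subst ennreal_SUP_add_left) auto
  also have "\<dots> \<le> hausdorff1_outer (A \<union> B)"
  proof (rule SUP_least)
    fix \<delta> :: real assume "\<delta> \<in> {0<..}"
    then have "\<delta> > 0" by simp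
    have "hausdorff1_pre \<delta> A + hausdorff1_outer B = (SUP \<delta>'\<in>{0<..}. hausdorff1_pre \<delta> A + hausdorff1_pre \<delta>' B)"
      unfolding hausdorff1_outer_def by (subst ennreal_SUP_add_right) auto
    also have "\<dots> \<le> hausdorff1_outer (A \<union> B)"
    proof (rule SUP_least)
      fix \<delta>' :: real assume "\<delta>' \<in> {0<..}"
      \<comment> \<open>The two suprema run over independent scales; the smaller scale serves both,
        since finer covers only increase the pre-measure, and is kept below
        \<open>d\<close>.\<close>
      define \<eta> where "\<eta> = min (d / 2) (min \<delta> \<delta>')"
      have \<eta>: "0 < \<eta>" "\<eta> < d" "\<eta> \<le> \<delta>" "\<eta> \<le> \<delta>'" using d \<open>\<delta> > 0\<close> \<open>\<delta>' \<in> {0<..}\<close> by (auto simp: \<eta>_def)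
      have "hausdorff1_pre \<delta> A + hausdorff1_pre \<delta>' B \<le> hausdorff1_pre \<eta> A + hausdorff1_pre \<eta> B"
        using \<eta> by (intro add_mono hausdorff1_pre_antimono)
      also have "\<dots> \<le> hausdorff1_pre \<eta> (A \<union> B)" by (rule split[OF \<eta>(1,2)])
      also have "\<dots> \<le> hausdorff1_outer (A \<union> B)" by (rule hausdorff1_pre_le_outer[OF \<eta>(1)])
      finally show "hausdorff1_pre \<delta> A + hausdorff1_pre \<delta>' B \<le> hausdorff1_outer (A \<union> B)" .
    qed
    finally show "hausdorff1_pre \<delta> A + hausdorff1_outer B \<le> hausdorff1_outer (A \<union> B)" .
  qed
  finally show ?thesis .
qed

lemma hausdorff1_outer_coordinate_gap:
  fixes A B :: "(real^2) set"
  assumes "p < q" "\<And>x. x \<in> A \<Longrightarrow> x $ i \<le> p" "\<And>x. x \<in> B \<Longrightarrow> q \<le> x $ i"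
  shows "hausdorff1_outer A + hausdorff1_outer B \<le> hausdorff1_outer (A \<union> B)"
proof (rule hausdorff1_outer_separated)
  show "q - p > 0" using assms by simp
  fix x y assume "x \<in> A" "y \<in> B"
  then have "q - p \<le> \<bar>(x - y) $ i\<bar>" using assms(2)[of x] assms(3)[of y] by auto
  also have "\<dots> \<le> dist x y" unfolding dist_norm by (rule component_le_norm_cart)
  finally show "q - p \<le> dist x y" .
qed

text \<open>Caratheodory's argument: the slabs approaching the hyperplane are separated two by two,
  hence have finite total measure.\<close>

lemma halfspace_in_sets_hausdorff1: "{x::real^2. x $ i \<le> c} \<in> sets hausdorff1"
proof -
  let ?S = "{x::real^2. x $ i \<le> c}" and ?f = hausdorff1_outer
  define u where "u n = inverse (real (Suc n))" for n
  have u_less: "u m < u n" if "n < m" for n m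
    unfolding u_def using that by (intro less_imp_inverse_less) auto
  have u_le: "u m \<le> u n" if "n \<le> m" for n m
    using u_less[of n m] that by (cases "n = m") auto
  have u_pos: "0 < u n" for n by (simp add: u_def)
  have "?f (T \<inter> ?S) + ?f (T - ?S) \<le> ?f T" for T
  proof (cases "?f T < top")
    case fin: True
    define A where "A n = {x \<in> T. c + u (Suc n) \<le> x $ i}" for n
    define R where "R n = {x \<in> T. c + u (n + 2) \<le> x $ i \<and> x $ i < c + u (n + 1)}" for n
    have RT: "R n \<subseteq> T" for n by (auto simp: R_def)
    \<comment> \<open>Slabs with indices of equal parity have a whole slab between them, so each new
      one is separated from the union of its predecessors.\<close>
    have alternate: "(\<Sum>k<m. ?f (R (2 * k + j))) \<le> ?f (\<Union>k<m. R (2 * k + j))" for m j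
    proof (induction m)
      case (Suc m)
      have "(\<Sum>k<Suc m. ?f (R (2 * k + j))) \<le> ?f (R (2 * m + j)) + ?f (\<Union>k<m. R (2 * k + j))"
        using Suc by (simp add: add.commute add_left_mono)
      also have "\<dots> \<le> ?f (R (2 * m + j) \<union> (\<Union>k<m. R (2 * k + j)))"
      proof (rule hausdorff1_outer_coordinate_gap[where p = "c + u (2 * m + j + 1)" and q = "c + u (2 * m + j)" and i = i])
        show "c + u (2 * m + j + 1) < c + u (2 * m + j)" by (simp add: u_less)
        show "x $ i \<le> c + u (2 * m + j + 1)" if "x \<in> R (2 * m + j)" for x using that by (simp add: R_def)
        show "c + u (2 * m + j) \<le> x $ i" if "x \<in> (\<Union>k<m. R (2 * k + j))" for x
        proof -
          from that obtain k where k: "k < m" "x \<in> R (2 * k + j)" by blast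
          have "u (2 * m + j) \<le> u (2 * k + j + 2)" by (rule u_le) (use k in simp)
          with k(2) show ?thesis by (simp add: R_def)
        qed
      qed
      also have "R (2 * m + j) \<union> (\<Union>k<m. R (2 * k + j)) = (\<Union>k<Suc m. R (2 * k + j))"
        by (auto simp: lessThan_Suc)
      finally show ?case .
    qed (simp add: hausdorff1_outer_empty)
    have half: "(\<Sum>k<m. ?f (R (2 * k + j))) \<le> ?f T" for m j
      by (rule order_trans[OF alternate hausdorff1_outer_mono]) (use RT in blast)
    have "(\<Sum>k<m. ?f (R k)) \<le> ?f T + ?f T" for m
    proof -
      have "(\<Sum>k<m. ?f (R k)) \<le> (\<Sum>k<2 * m. ?f (R k))" by (intro sum_mono2) auto
      also have "\<dots> = (\<Sum>k<m. ?f (R (2 * k))) + (\<Sum>k<m. ?f (R (2 * k + 1)))"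
        by (induction m) (simp_all add: algebra_simps)
      also have "\<dots> \<le> ?f T + ?f T" using half[of 0] half[of 1] by (intro add_mono) auto
      finally show ?thesis .
    qed
    then have "(\<Sum>k. ?f (R k)) \<le> ?f T + ?f T"
      using ennreal_suminf_bound_add[of "\<lambda>k. ?f (R k)" 0] by simp
    also have "\<dots> < top" using fin by simp
    finally have s_fin: "(\<Sum>k. ?f (R k)) < top" .
    \<comment> \<open>The partial sum is added on the left so that the tail of the series completes
      it on the right; the finite total sum is cancelled afterwards, which avoids subtracting
      extended reals.\<close>
    have "(\<Sum>k<n. ?f (R k)) + (?f (T \<inter> ?S) + ?f (T - ?S)) \<le> ?f T + (\<Sum>k. ?f (R k))" for n
    proof -
      have "T - ?S \<subseteq> A n \<union> (\<Union>k. R (k + n))"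
      proof
        fix x assume x: "x \<in> T - ?S"
        show "x \<in> A n \<union> (\<Union>k. R (k + n))"
        proof (cases "c + u (Suc n) \<le> x $ i")
          case False
          have "\<exists>m. u (Suc m) \<le> x $ i - c"
          proof -
            have "0 < x $ i - c" using x by simp
            then obtain m where "u m < x $ i - c" using reals_Archimedean unfolding u_def by blast
            with u_le[of m "Suc m"] show ?thesis by (intro exI[of _ m]) linarith
          qed
          define m where "m = (LEAST m. u (Suc m) \<le> x $ i - c)"
          have m: "u (Suc m) \<le> x $ i - c" unfolding m_def by (rule LeastI_ex) fact
          have "n < m"
          proof (rule ccontr)
            assume "\<not> n < m"
            then have "u (Suc n) \<le> u (Suc m)" by (intro u_le) simp
            with m False show False by simp
          qed
          then have "m - 1 < m" by simp
          then have "\<not> u (Suc (m - 1)) \<le> x $ i - c" unfolding m_def by (rule not_less_Least)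
          with m \<open>n < m\<close> x have "x \<in> R (m - 1 - n + n)" by (auto simp: R_def)
          then show ?thesis by blast
        qed (use x in \<open>auto simp: A_def\<close>)
      qed
      then have "?f (T - ?S) \<le> ?f (A n \<union> (\<Union>k. R (k + n)))" by (rule hausdorff1_outer_mono)
      also have "\<dots> \<le> ?f (A n) + (\<Sum>k. ?f (R (k + n)))"
        by (rule order_trans[OF hausdorff1_outer_Un]) (intro add_left_mono hausdorff1_outer_subadditive)
      finally have 1: "?f (T - ?S) \<le> ?f (A n) + (\<Sum>k. ?f (R (k + n)))" .
      have "?f (T \<inter> ?S) + ?f (A n) \<le> ?f ((T \<inter> ?S) \<union> A n)"
        by (rule hausdorff1_outer_coordinate_gap[where p = c and q = "c + u (Suc n)" and i = i])
           (use u_pos in \<open>auto simp: A_def\<close>)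
      also have "\<dots> \<le> ?f T" by (rule hausdorff1_outer_mono) (auto simp: A_def)
      finally have 2: "?f (T \<inter> ?S) + ?f (A n) \<le> ?f T" .
      have "(\<Sum>k<n. ?f (R k)) + (?f (T \<inter> ?S) + ?f (T - ?S))
          \<le> (\<Sum>k<n. ?f (R k)) + (?f (T \<inter> ?S) + (?f (A n) + (\<Sum>k. ?f (R (k + n)))))"
        by (intro add_left_mono 1)
      also have "\<dots> = (?f (T \<inter> ?S) + ?f (A n)) + ((\<Sum>k. ?f (R (k + n))) + (\<Sum>k<n. ?f (R k)))"
        by (simp add: ac_simps)
      also have "\<dots> \<le> ?f T + ((\<Sum>k. ?f (R (k + n))) + (\<Sum>k<n. ?f (R k)))"
        by (intro add_right_mono 2)
      also have "(\<Sum>k. ?f (R (k + n))) + (\<Sum>k<n. ?f (R k)) = (\<Sum>k. ?f (R k))"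
        by (rule suminf_offset[symmetric]) auto
      finally show ?thesis .
    qed
    then have "(\<Sum>k. ?f (R k)) + (?f (T \<inter> ?S) + ?f (T - ?S)) \<le> ?f T + (\<Sum>k. ?f (R k))"
      by (rule ennreal_suminf_bound_add)
    then have "(\<Sum>k. ?f (R k)) + (?f (T \<inter> ?S) + ?f (T - ?S)) \<le> (\<Sum>k. ?f (R k)) + ?f T"
      by (simp add: add.commute)
    with s_fin show ?thesis by (auto simp: ennreal_add_left_cancel_le)
  qed (simp add: not_less top_unique)
  moreover have "?f T \<le> ?f (T \<inter> ?S) + ?f (T - ?S)" for T
    using hausdorff1_outer_Un[of "T \<inter> ?S" "T - ?S"] by (simp add: Int_Diff_Un)
  ultimately have "?f (T \<inter> ?S) + ?f (T - ?S) = ?f T" for T by (intro antisym)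
  then show ?thesis
    unfolding sets_hausdorff1 algebra.lambda_system_eq[OF algebra_Pow] by auto
qed

lemma measurable_ident_hausdorff1: "(\<lambda>x. x) \<in> hausdorff1 \<rightarrow>\<^sub>M borel"
  unfolding borel_measurable_iff_halfspace_le
  using halfspace_in_sets_hausdorff1 by (auto simp: space_hausdorff1 Basis_real2 inner_axis)

lemma sets_borel_hausdorff1: "A \<in> sets borel \<Longrightarrow> A \<in> sets hausdorff1"
  using measurable_sets[OF measurable_ident_hausdorff1, of A] by (simp add: space_hausdorff1)

lemma measurable_hausdorff1:
  "f \<in> borel_measurable borel \<Longrightarrow> f \<in> borel_measurable hausdorff1"
  by (rule measurable_compose[OF measurable_ident_hausdorff1])

section \<open>Length of a segment\<close>

text \<open>Projection to a coordinate does not increase distances, so an interval of the length of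
  the diameter contains the image.\<close>

lemma diameter_le_real:
  fixes C :: "(real^2) set"
  assumes "bounded C"
  obtains p where "(\<lambda>x. x $ 1) ` C \<subseteq> {p..p + diameter C}"
proof (cases "C = {}")
  case False
  let ?P = "(\<lambda>x. x $ 1) ` C"
  have d: "\<bar>x $ 1 - y $ 1\<bar> \<le> diameter C" if "x \<in> C" "y \<in> C" for x y
  proof -
    have "\<bar>(x - y) $ 1\<bar> \<le> norm (x - y)" by (rule component_le_norm_cart)
    also have "\<dots> \<le> diameter C" using diameter_bounded_bound[OF assms that] by (simp add: dist_norm)
    finally show ?thesis by simp
  qed
  obtain x0 where x0: "x0 \<in> C" using False by blast
  have "x0 $ 1 - diameter C \<le> y $ 1" if "y \<in> C" for y using d[OF that x0] by linarith
  then have bb: "bdd_below ?P" by (rule bdd_belowI2)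
  have "y $ 1 \<in> {Inf ?P..Inf ?P + diameter C}" if "y \<in> C" for y
  proof -
    have "Inf ?P \<le> y $ 1" using bb that by (intro cInf_lower) auto
    moreover have "y $ 1 - diameter C \<le> x $ 1" if "x \<in> C" for x using d[OF \<open>y \<in> C\<close> that] by linarith
    then have "y $ 1 - diameter C \<le> Inf ?P"
      using False by (intro cInf_greatest) auto
    ultimately show ?thesis by simp
  qed
  with that[of "Inf ?P"] show ?thesis by blast
qed (use that in auto)

text \<open>From above, the segment is cut into equal pieces shorter than \<delta>. From below, the
  projections of any cover lie in intervals as long as the diameters, and these must exhaust the
  Lebesgue measure of the interval.\<close>

lemma hausdorff1_outer_segment:
  assumes "l \<le> u"
  shows "hausdorff1_outer ((\<lambda>s. pt s 0) ` {l<..<u}) = ennreal (u - l)"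
proof (rule antisym)
  let ?L = "(\<lambda>s. pt s 0) ` {l<..<u}"
  show "hausdorff1_outer ?L \<le> ennreal (u - l)"
  proof (rule hausdorff1_outer_least)
    fix \<delta> :: real assume "\<delta> > 0"
    define n where "n = nat \<lceil>(u - l) / \<delta>\<rceil> + 1"
    define h where "h = (u - l) / real n"
    have n: "0 < n" by (simp add: n_def)
    have h: "0 \<le> h" "real n * h = u - l" using assms n by (auto simp: h_def)
    have "(u - l) / \<delta> \<le> real n" unfolding n_def by linarith
    then have "h \<le> \<delta>" using \<open>\<delta> > 0\<close> n by (simp add: h_def field_simps)
    define C where "C i = (if i < n then (\<lambda>s. pt s 0) ` {l + real i * h..l + real (Suc i) * h} else {})" for i
    have diam: "diameter (C i) \<le> (if i < n then h else 0)" for i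
    proof (cases "i < n")
      case True
      have "dist (pt s 0) (pt t 0) \<le> h" if "s \<in> {l + real i * h..l + real (Suc i) * h}" "t \<in> {l + real i * h..l + real (Suc i) * h}" for s t
      proof -
        have "dist (pt s 0) (pt t 0) \<le> \<bar>s - t\<bar>"
          using norm_le_l1_cart[of "pt s 0 - pt t 0"] by (simp add: dist_norm sum_2)
        also have "\<dots> \<le> h" using that by (auto simp: algebra_simps)
        finally show ?thesis .
      qed
      with True h(1) show ?thesis by (intro diameter_le) (auto simp: C_def dist_norm[symmetric])
    qed (simp add: C_def)
    have "?L \<subseteq> (\<Union>i. C i)"
    proof
      fix x assume "x \<in> ?L"
      then obtain s where s: "x = pt s 0" "l < s" "s < u" by auto
      then have "0 < u - l" by simp
      then have hp: "0 < h" using n by (simp add: h_def)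
      define i where "i = nat \<lfloor>(s - l) / h\<rfloor>"
      have fl: "real i \<le> (s - l) / h" "(s - l) / h < real i + 1"
        using s hp by (auto simp: i_def)
      then have "real i * h \<le> s - l" "s - l < (real i + 1) * h" using hp by (simp_all add: field_simps)
      moreover have "i < n"
      proof -
        have "real i * h < real n * h" using calculation(1) s h(2) by linarith
        then show ?thesis using hp by simp
      qed
      ultimately have "x \<in> C i" using s(1) by (auto simp: C_def algebra_simps)
      then show "x \<in> (\<Union>i. C i)" by blast
    qed
    moreover have "bounded (C i)" for i
      unfolding C_def by (auto intro!: compact_imp_bounded compact_continuous_image continuous_intros)
    moreover have "diameter (C i) \<le> \<delta>" for i using diam[of i] \<open>h \<le> \<delta>\<close> \<open>\<delta> > 0\<close> by (auto split: if_splits)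
    ultimately have "hausdorff1_pre \<delta> ?L \<le> (\<Sum>i. ennreal (diameter (C i)))" by (rule hausdorff1_pre_le)
    also have "\<dots> \<le> (\<Sum>i. ennreal (if i < n then h else 0))"
      by (intro suminf_le ennreal_leI diam) auto
    also have "\<dots> = (\<Sum>i<n. ennreal h)"
      by (subst suminf_finite[of "{..<n}"]) auto
    also have "\<dots> = ennreal (u - l)"
      using h by (simp add: ennreal_of_nat_eq_real_of_nat flip: ennreal_mult)
    finally show "hausdorff1_pre \<delta> ?L \<le> ennreal (u - l)" .
  qed
  \<comment> \<open>Every positive scale gives this lower bound; 1 is an arbitrary choice.\<close>
  have "ennreal (u - l) \<le> hausdorff1_pre 1 ?L"
  proof (rule hausdorff1_pre_greatest)
    fix C :: "nat \<Rightarrow> (real^2) set"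
    assume C: "?L \<subseteq> (\<Union>i. C i)" "\<And>i. bounded (C i)" "\<And>i. diameter (C i) \<le> 1"
    have "\<forall>i. \<exists>p. (\<lambda>x. x $ 1) ` C i \<subseteq> {p..p + diameter (C i)}" using diameter_le_real[OF C(2)] by metis
    then obtain p where p: "\<And>i. (\<lambda>x. x $ 1) ` C i \<subseteq> {p i..p i + diameter (C i)}" by metis
    have "{l<..<u} \<subseteq> (\<Union>i. {p i..p i + diameter (C i)})"
    proof
      fix s assume "s \<in> {l<..<u}"
      then obtain i where "pt s 0 \<in> C i" using C(1) by blast
      then have "pt s 0 $ 1 \<in> {p i..p i + diameter (C i)}" using p[of i] by blast
      then show "s \<in> (\<Union>i. {p i..p i + diameter (C i)})" by auto
    qed
    then have "emeasure lborel {l<..<u} \<le> emeasure lborel (\<Union>i. {p i..p i + diameter (C i)})"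
      by (intro emeasure_mono) auto
    also have "\<dots> \<le> (\<Sum>i. emeasure lborel {p i..p i + diameter (C i)})"
      by (rule emeasure_subadditive_countably) auto
    also have "\<dots> = (\<Sum>i. ennreal (diameter (C i)))"
      using C(2) by (simp add: diameter_ge_0)
    finally show "ennreal (u - l) \<le> (\<Sum>i. ennreal (diameter (C i)))" using assms by simp
  qed
  also have "\<dots> \<le> hausdorff1_outer ?L" by (rule hausdorff1_pre_le_outer) simp
  finally show "ennreal (u - l) \<le> hausdorff1_outer ?L" .
qed

text \<open>The projection x_1 carries the Hausdorff measure on the line x_2 = 0 to Lebesgue
  measure, since the two agree on intervals. The restriction to the line is written as a density, to
  which the integral transformation rules apply.\<close>

lemma integral_hausdorff1_line:
  fixes F :: "real^2 \<Rightarrow> 'b::euclidean_space"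
  assumes [measurable]: "F \<in> borel_measurable borel" and line: "\<And>x. x $ 2 \<noteq> 0 \<Longrightarrow> F x = 0"
  shows "(LINT x|hausdorff1. F x) = (LINT s|lborel. F (pt s 0))"
proof -
  let ?L = "{x::real^2. x $ 2 = 0}"
  have L: "?L \<in> sets borel" by measurable
  have LH: "?L \<in> sets hausdorff1" by (rule sets_borel_hausdorff1[OF L])
  have c1: "(\<lambda>x::real^2. x $ 1) \<in> borel_measurable hausdorff1"
    by (rule measurable_hausdorff1) measurable
  let ?M = "distr (density hausdorff1 (indicator ?L)) borel (\<lambda>x. x $ 1)"
  have M: "lborel = ?M"
  proof (rule lborel_eqI)
    fix l u :: real assume "\<And>b. b \<in> Basis \<Longrightarrow> l \<bullet> b \<le> u \<bullet> b"
    then have lu: "l \<le> u" by simp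
    have S: "(\<lambda>x::real^2. x $ 1) -` box l u \<in> sets hausdorff1"
      using measurable_sets[OF c1, of "box l u"] by (simp add: space_hausdorff1)
    have eq: "?L \<inter> (\<lambda>x::real^2. x $ 1) -` box l u = (\<lambda>s. pt s 0) ` {l<..<u}"
    proof
      show "?L \<inter> (\<lambda>x::real^2. x $ 1) -` box l u \<subseteq> (\<lambda>s. pt s 0) ` {l<..<u}"
      proof
        fix x assume "x \<in> ?L \<inter> (\<lambda>x::real^2. x $ 1) -` box l u"
        then have "x = pt (x $ 1) 0" "x $ 1 \<in> {l<..<u}" using pt_eta[of x] by auto
        then show "x \<in> (\<lambda>s. pt s 0) ` {l<..<u}" by blast
      qed
    qed auto
    have "emeasure ?M (box l u) = emeasure (density hausdorff1 (indicator ?L)) ((\<lambda>x::real^2. x $ 1) -` box l u)"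
      using c1 by (subst emeasure_distr) (auto simp: space_hausdorff1)
    also have "\<dots> = emeasure hausdorff1 (?L \<inter> (\<lambda>x::real^2. x $ 1) -` box l u)"
      using LH S by (subst emeasure_density) (auto simp: indicator_inter_arith[symmetric])
    also have "\<dots> = hausdorff1_outer (?L \<inter> (\<lambda>x::real^2. x $ 1) -` box l u)"
      by (rule emeasure_hausdorff1) (intro sets.Int LH S)
    also have "\<dots> = ennreal (u - l)"
      unfolding eq by (rule hausdorff1_outer_segment[OF lu])
    finally show "emeasure ?M (box l u) = (\<Prod>b\<in>Basis. (u - l) \<bullet> b)" by simp
  qed simp
  have "(LINT s|lborel. F (pt s 0)) = (LINT s|?M. F (pt s 0))" by (subst M) simp
  also have "\<dots> = (LINT x|density hausdorff1 (indicator ?L). F (pt (x $ 1) 0))"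
    using c1 by (subst integral_distr) auto
  also have "\<dots> = (LINT x|hausdorff1. indicator ?L x *\<^sub>R F (pt (x $ 1) 0))"
    using LH by (subst integral_density[where g = "indicator ?L", simplified ennreal_indicator])
      (auto intro!: measurable_hausdorff1)
  also have "(\<lambda>x. indicator ?L x *\<^sub>R F (pt (x $ 1) 0)) = F"
  proof
    fix x show "indicator ?L x *\<^sub>R F (pt (x $ 1) 0) = F x"
      using line[of x] pt_eta[of x] by (cases "x $ 2 = 0") auto
  qed
  finally show ?thesis by simp
qed

section \<open>The derivative measure of the limit\<close>

lemma measurable_lebesgue_AE:
  fixes f g :: "'a::euclidean_space \<Rightarrow> 'b::euclidean_space"
  assumes [measurable]: "g \<in> borel_measurable borel" and ae: "AE x in lborel. f x = g x"
  shows "f \<in> borel_measurable lebesgue"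
proof (rule borel_measurableI)
  fix S :: "'b set" assume "open S"
  obtain N where N: "N \<in> null_sets lborel" "{x \<in> space lborel. f x \<noteq> g x} \<subseteq> N"
    using ae unfolding eventually_ae_filter by blast
  have N': "N \<in> null_sets lebesgue" using N(1) by (simp add: null_sets_completionI)
  have "g -` S \<in> sets lebesgue"
    using measurable_sets[OF assms(1), of S] \<open>open S\<close> by simp
  moreover have "f -` S \<inter> N \<in> sets lebesgue"
    using null_sets_completion_subset[of "f -` S \<inter> N" N lborel] N' by auto
  moreover have "f -` S \<inter> space lebesgue = (g -` S - N) \<union> (f -` S \<inter> N)"
    using N(2) by auto
  ultimately show "f -` S \<inter> space lebesgue \<in> sets lebesgue"
    using null_setsD2[OF N'] by (metis sets.Diff sets.Un)
qed

lemma measurable_lebesgue_on_AE: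
  fixes f g :: "'a::euclidean_space \<Rightarrow> 'b::euclidean_space"
  assumes [measurable]: "g \<in> borel_measurable borel" "U \<in> sets borel" and ae: "AE x in lborel. x \<in> U \<longrightarrow> f x = g x"
  shows "f \<in> borel_measurable (lebesgue_on U)"
proof -
  have "(\<lambda>x. indicator U x *\<^sub>R f x) \<in> borel_measurable lebesgue"
    by (rule measurable_lebesgue_AE[where g = "\<lambda>x. indicator U x *\<^sub>R g x"])
       (use ae in \<open>auto elim!: eventually_mono split: split_indicator\<close>)
  then show ?thesis by (simp add: borel_measurable_restrict_space_iff mult.commute)
qed

lemma locally_integrable_on_AE:
  fixes f g :: "'a::euclidean_space \<Rightarrow> 'b::euclidean_space"
  assumes g: "integrable lborel g" and ae: "AE x in lborel. x \<in> U \<longrightarrow> f x = g x"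
  shows "locally_integrable_on U f"
  unfolding locally_integrable_on_def set_integrable_def
proof (intro allI impI)
  fix K assume K: "compact K \<and> K \<subseteq> U"
  note [measurable] = borel_measurable_integrable[OF g]
  have [measurable]: "K \<in> sets borel" using K by (simp add: compact_imp_closed)
  have ae': "AE x in lborel. indicator K x *\<^sub>R f x = indicator K x *\<^sub>R g x"
    using ae by eventually_elim (use K in \<open>auto split: split_indicator\<close>)
  have "integrable lborel (\<lambda>x. indicator K x *\<^sub>R g x)"
    by (rule integrable_mult_indicator[OF _ g]) simp
  then have "integrable lebesgue (\<lambda>x. indicator K x *\<^sub>R g x)"
    by (subst integrable_completion) auto
  then show "integrable lebesgue (\<lambda>x. indicator K x *\<^sub>R f x)"
  proof (rule integrable_cong_AE_imp)
    show "(\<lambda>x. indicator K x *\<^sub>R f x) \<in> borel_measurable lebesgue"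
      by (rule measurable_lebesgue_AE[OF _ ae']) measurable
    show "AE x in lebesgue. indicator K x *\<^sub>R g x = indicator K x *\<^sub>R f x"
      using ae' by (intro AE_completion) (auto elim!: eventually_mono)
  qed
qed

lemma integral_lebesgue_on_AE:
  fixes f g :: "'a::euclidean_space \<Rightarrow> 'b::euclidean_space"
  assumes "U \<in> sets borel" "g \<in> borel_measurable borel"
    "AE x in lborel. x \<in> U \<longrightarrow> f x = g x" "\<And>x. x \<notin> U \<Longrightarrow> g x = 0"
  shows "(LINT x|lebesgue_on U. f x) = (LINT x|lborel. g x)"
  by (rule integral_lebesgue_on_eq[OF measurable_lebesgue_on_AE]) (use assms in auto)

lemma lp_on_borel_supp:
  fixes g :: "'a::euclidean_space \<Rightarrow> 'b::euclidean_space"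
  assumes "U \<in> sets borel" "g \<in> borel_measurable borel" "p > 0" "\<And>x. x \<notin> U \<Longrightarrow> g x = 0"
  shows "lp_on p U g \<longleftrightarrow> integrable lborel (\<lambda>x. norm (g x) ^ p)"
proof -
  have "(\<lambda>x. indicator U x * norm (g x) ^ p) = (\<lambda>x. norm (g x) ^ p)"
    using assms(3,4) by (auto simp: fun_eq_iff split: split_indicator)
  then show ?thesis using assms by (simp add: lp_on_borel)
qed

section \<open>The total variation measure and its polar factor\<close>

text \<open>The tensor product of \<open>v\<close> with the normal e_2 of the segment, the form of
  the jump part of a derivative.\<close>

definition tensor_e2 :: "real^2 \<Rightarrow> real^2^2" where
  "tensor_e2 v = (\<chi> i j. if j = 2 then v $ i else 0)"

lemma column_tensor_e2: "column 1 (tensor_e2 v) = 0" "column 2 (tensor_e2 v) = v"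
  by (simp_all add: tensor_e2_def column_def vec_eq_iff)

lemma norm_tensor_e2: "norm (tensor_e2 v) = norm v"
  by (simp add: norm_eq_sqrt_inner inner_vec_def sum_2 tensor_e2_def)

lemma tensor_e2_measurable [measurable (raw)]:
  assumes "f \<in> borel_measurable M"
  shows "(\<lambda>x. tensor_e2 (f x)) \<in> borel_measurable M"
proof (rule measurable_compose[OF assms])
  have "linear tensor_e2" by (rule linearI) (simp_all add: tensor_e2_def vec_eq_iff)
  then have "bounded_linear tensor_e2" by (simp add: linear_conv_bounded_linear)
  then show "tensor_e2 \<in> borel_measurable borel"
    by (intro borel_measurable_continuous_onI linear_continuous_on)
qed

lemma column_scaleR: "column j (c *\<^sub>R A) = c *\<^sub>R column j (A :: real^2^2)"
  by (simp add: column_def vec_eq_iff)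

lemma layer0_sets [measurable]: "layer0 \<xi> \<in> sets borel"
  unfolding layer0_def by measurable

lemma layer0_AE: "AE x in lborel. x \<notin> layer0 \<xi>"
  using AE_vec_nth_ne[of 2 0] by eventually_elim (simp add: layer0_def)

lemma pt_layer0 [simp]: "pt s t \<in> layer0 \<xi> \<longleftrightarrow> s \<in> {-\<xi><..<1} \<and> t = 0"
  by (auto simp: layer0_def)

context layer_limit
begin

text \<open>\<open>|Dk|\<close> is the image of a weighted measure on two copies of the plane: the first copy carries
  the density \<open>|\<nabla>k|\<close>, the second one is projected to the segment with the weight \<open>|[k]|\<close>.\<close>

definition wt :: "bool \<times> (real^2) \<Rightarrow> real" where
  "wt z = (if fst z then norm (HH (snd z)) else indicator {0<..<1} (snd z $ 2) * norm (Jl (snd z $ 1)))"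

text \<open>The origin is a default value inside \<Omega>, so that the map goes into \<Omega>.
  Nothing is moved there by it: \<open>HH\<close> vanishes outside \<Omega> and \<open>Jl\<close>
  outside (-1,1), so the weight is 0 at such points.\<close>

definition pr :: "bool \<times> (real^2) \<Rightarrow> real^2" where
  "pr z = (if fst z then (if snd z \<in> Omega then snd z else 0)
           else (if snd z $ 1 \<in> {-1<..<1} then pt (snd z $ 1) 0 else 0))"

definition \<mu> :: "(real^2) measure" where
  "\<mu> = distr (density (count_space UNIV \<Otimes>\<^sub>M lborel) (\<lambda>z. ennreal (wt z))) (restrict_space borel Omega) pr"

lemma Jl_measurable [measurable]: "Jl \<in> borel_measurable borel"
  using borel_measurable_integrable[OF Jl_int] by simp

lemma wt_measurable [measurable]: "wt \<in> borel_measurable (count_space UNIV \<Otimes>\<^sub>M lborel)"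
  unfolding wt_def by measurable

lemma wt_nonneg: "0 \<le> wt z"
  by (simp add: wt_def)

lemma pr_measurable [measurable]: "pr \<in> (count_space UNIV \<Otimes>\<^sub>M lborel) \<rightarrow>\<^sub>M restrict_space borel Omega"
proof (rule measurable_restrict_space2)
  show "pr \<in> space (count_space UNIV \<Otimes>\<^sub>M lborel) \<rightarrow> Omega"
    by (auto simp: pr_def mem_Omega)
  show "pr \<in> borel_measurable (count_space UNIV \<Otimes>\<^sub>M lborel)"
    unfolding pr_def by measurable
qed

lemma sets_\<mu> [measurable_cong]: "sets \<mu> = sets (restrict_space borel Omega)"
  by (simp add: \<mu>_def)

lemma pair_sigma_finite_bool: "pair_sigma_finite (count_space (UNIV :: bool set)) (lborel :: (real^2) measure)"
  by (intro pair_sigma_finite.intro sigma_finite_lborel sigma_finite_measure_count_space_finite) simp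

lemma integral_bool_pair:
  fixes F :: "bool \<times> (real^2) \<Rightarrow> 'b::euclidean_space"
  assumes [measurable]: "F \<in> borel_measurable (count_space UNIV \<Otimes>\<^sub>M lborel)"
    and i: "integrable lborel (\<lambda>x. F (True, x))" "integrable lborel (\<lambda>x. F (False, x))"
  shows "integrable (count_space UNIV \<Otimes>\<^sub>M lborel) F"
    and "(LINT z|(count_space UNIV \<Otimes>\<^sub>M lborel). F z) = (LINT x|lborel. F (True, x)) + (LINT x|lborel. F (False, x))"
proof -
  interpret pair_sigma_finite "count_space (UNIV :: bool set)" "lborel :: (real^2) measure"
    by (rule pair_sigma_finite_bool)
  show int: "integrable (count_space UNIV \<Otimes>\<^sub>M lborel) F"
  proof (rule Fubini_integrable)
    show "integrable (count_space UNIV) (\<lambda>b. LINT x|lborel. norm (F (b, x)))"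
      by (rule integrable_count_space) simp
    show "AE b in count_space UNIV. integrable lborel (\<lambda>x. F (b, x))"
    proof (rule AE_I2)
      fix b show "integrable lborel (\<lambda>x. F (b, x))" using i by (cases b) auto
    qed
  qed measurable
  have "(LINT z|(count_space UNIV \<Otimes>\<^sub>M lborel). F z) = (LINT b|count_space UNIV. LINT x|lborel. F (b, x))"
    by (rule integral_fst'[OF int, symmetric])
  also have "\<dots> = (\<Sum>b\<in>UNIV. LINT x|lborel. F (b, x))"
    by (rule lebesgue_integral_count_space_finite) simp
  finally show "(LINT z|(count_space UNIV \<Otimes>\<^sub>M lborel). F z) = (LINT x|lborel. F (True, x)) + (LINT x|lborel. F (False, x))"
    by (simp add: UNIV_bool add.commute)
qed

text \<open>The second copy is charged on the strip 0 < x_2 < 1 of height 1, so its projection has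
  the density |J| with respect to length.\<close>

lemma integral_\<mu>:
  fixes f :: "real^2 \<Rightarrow> 'b::euclidean_space"
  assumes [measurable]: "f \<in> borel_measurable borel" and bd: "\<And>x. norm (f x) \<le> D"
  shows "(LINT x|\<mu>. f x) = (LINT x|lborel. norm (HH x) *\<^sub>R f x) + (LINT s|lborel. norm (Jl s) *\<^sub>R f (pt s 0))"
proof -
  have f_r: "f \<in> borel_measurable (restrict_space borel Omega)" by (rule measurable_restrict_space1) measurable
  let ?F = "\<lambda>z. wt z *\<^sub>R f (pr z)"
  have fpr [measurable]: "(\<lambda>z. f (pr z)) \<in> borel_measurable (count_space UNIV \<Otimes>\<^sub>M lborel)"
    by (rule measurable_compose[OF pr_measurable f_r])
  have T: "?F (True, x) = norm (HH x) *\<^sub>R f x" for x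
    using HH(2)[of x] by (auto simp: wt_def pr_def)
  have Jl_out: "Jl s = 0" if "s \<notin> {-1<..<1}" for s using that \<xi> by (auto simp: Jl_def split: split_indicator)
  have F: "?F (False, x) = indicator {0<..<1} (x $ 2) *\<^sub>R (norm (Jl (x $ 1)) *\<^sub>R f (pt (x $ 1) 0))" for x
    using Jl_out[of "x $ 1"] by (auto simp: wt_def pr_def)
  have iT: "integrable lborel (\<lambda>x. norm (HH x) *\<^sub>R f x)"
    by (rule Bochner_Integration.integrable_bound[where f = "\<lambda>x. norm (HH x) *\<^sub>R D"])
       (use bd order_trans[OF norm_ge_zero bd] in \<open>auto intro!: integrable_norm HH_int AE_I2 simp: abs_mult intro: mult_left_mono\<close>)
  have iJ: "integrable lborel (\<lambda>s. norm (Jl s) *\<^sub>R f (pt s 0))"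
    by (rule Bochner_Integration.integrable_bound[where f = "\<lambda>x. norm (Jl x) *\<^sub>R D"])
       (use bd order_trans[OF norm_ge_zero bd] in \<open>auto intro!: integrable_norm Jl_int AE_I2 simp: abs_mult intro: mult_left_mono\<close>)
  have iF: "integrable lborel (\<lambda>x::real^2. indicator {0<..<1} (x $ 2) *\<^sub>R (norm (Jl (x $ 1)) *\<^sub>R f (pt (x $ 1) 0)))"
    by (rule integrable_prod_pt[OF _ iJ]) (simp add: integrable_real_indicator)
  have "(LINT x|\<mu>. f x) = (LINT z|(count_space UNIV \<Otimes>\<^sub>M lborel). ?F z)"
    unfolding \<mu>_def using f_r wt_nonneg
    by (subst integral_distr) (auto simp: integral_density)
  also have "\<dots> = (LINT x|lborel. ?F (True, x)) + (LINT x|lborel. ?F (False, x))"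
    by (rule integral_bool_pair(2)) (use iT iF in \<open>simp_all only: T F\<close>, measurable)
  also have "(LINT x|lborel. ?F (False, x)) = (LINT s|lborel. norm (Jl s) *\<^sub>R f (pt s 0))"
    unfolding F by (subst integral_pt[OF iF]) simp
  finally show ?thesis unfolding T .
qed

lemma finite_measure_\<mu>: "finite_measure \<mu>"
proof (rule finite_measureI)
  have iF: "integrable lborel (\<lambda>x::real^2. indicator {0<..<1} (x $ 2) *\<^sub>R norm (Jl (x $ 1)))"
    by (rule integrable_prod_pt[OF _ integrable_norm[OF Jl_int]]) (simp add: integrable_real_indicator)
  have "integrable (count_space UNIV \<Otimes>\<^sub>M lborel) wt"
    by (rule integral_bool_pair(1)) (use iF integrable_norm[OF HH_int] in \<open>auto simp: wt_def\<close>)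
  then have "(\<integral>\<^sup>+z. ennreal (wt z) \<partial>(count_space UNIV \<Otimes>\<^sub>M lborel)) < \<infinity>"
    by (simp add: integrable_iff_bounded wt_nonneg)
  moreover have "emeasure \<mu> (space \<mu>) = (\<integral>\<^sup>+z. ennreal (wt z) \<partial>(count_space UNIV \<Otimes>\<^sub>M lborel))"
  proof -
    have "emeasure \<mu> (space \<mu>) = emeasure (density (count_space UNIV \<Otimes>\<^sub>M lborel) (\<lambda>z. ennreal (wt z))) (pr -` space \<mu> \<inter> space (count_space UNIV \<Otimes>\<^sub>M lborel))"
      unfolding \<mu>_def by (subst emeasure_distr) (use sets.top[of "restrict_space borel Omega"] in \<open>auto simp: space_density space_restrict_space\<close>)
    also have "pr -` space \<mu> \<inter> space (count_space UNIV \<Otimes>\<^sub>M lborel) = space (count_space UNIV \<Otimes>\<^sub>M lborel)"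
      using measurable_space[OF pr_measurable] by (auto simp: \<mu>_def)
    also have "emeasure (density (count_space UNIV \<Otimes>\<^sub>M lborel) (\<lambda>z. ennreal (wt z))) (space (count_space UNIV \<Otimes>\<^sub>M lborel))
       = (\<integral>\<^sup>+z. ennreal (wt z) \<partial>(count_space UNIV \<Otimes>\<^sub>M lborel))"
      by (subst emeasure_density) (auto intro!: nn_integral_cong)
    finally show ?thesis .
  qed
  ultimately show "emeasure \<mu> (space \<mu>) \<noteq> \<infinity>" by simp
qed

text \<open>The direction of the jump on the segment and that of the density elsewhere. Where these
  vanish an arbitrary unit matrix is inserted, so that the norm is 1 everywhere.\<close>

definition \<sigma> :: "real^2 \<Rightarrow> real^2^2" where
  "\<sigma> x = (if x \<in> layer0 \<xi> then (if J (x $ 1) = 0 then tensor_e2 (axis 1 1) else tensor_e2 (sgn (J (x $ 1))))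
          else (if HH x = 0 then tensor_e2 (axis 1 1) else sgn (HH x)))"

lemma norm_\<sigma>: "norm (\<sigma> x) = 1"
  by (simp add: \<sigma>_def norm_tensor_e2 norm_sgn)

lemma \<sigma>_measurable [measurable]: "\<sigma> \<in> borel_measurable borel"
  unfolding \<sigma>_def sgn_div_norm by measurable

lemma HH_\<sigma>: "x \<notin> layer0 \<xi> \<Longrightarrow> norm (HH x) *\<^sub>R \<sigma> x = HH x"
  by (simp add: \<sigma>_def sgn_div_norm)

lemma Jl_\<sigma>: "norm (Jl s) *\<^sub>R \<sigma> (pt s 0) = tensor_e2 (Jl s)"
proof -
  have "tensor_e2 (c *\<^sub>R v) = c *\<^sub>R tensor_e2 v" for c v
    by (simp add: tensor_e2_def vec_eq_iff)
  moreover have "tensor_e2 0 = 0" by (simp add: tensor_e2_def vec_eq_iff)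
  ultimately show ?thesis
    by (auto simp: \<sigma>_def Jl_def sgn_div_norm split: split_indicator)
qed

text \<open>Weight times polar factor restores the density on each copy: \<open>HH\<close> off the
  segment, which is a null set of the plane, and the tensor of the jump on it. The claim is then
  \<open>deriv_limit\<close>, column by column.\<close>

lemma has_deriv_measure_kk: "has_deriv_measure Omega kk \<mu> \<sigma>"
  unfolding has_deriv_measure_def
proof (intro conjI ballI allI finite_measure_\<mu> sets_\<mu>)
  show "\<sigma> \<in> borel_measurable \<mu>"
    using measurable_restrict_space1[of \<sigma> borel borel Omega] by (simp add: measurable_cong_sets[OF sets_\<mu> refl])
  show "AE x in \<mu>. norm (\<sigma> x) = 1" by (simp add: norm_\<sigma>)
  fix \<phi> and j :: 2
  assume \<phi>: "\<phi> \<in> test_functions Omega"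
  have d: "dir_deriv \<phi> (axis j 1) \<in> test_functions Omega" by (rule test_functions_dir_deriv[OF \<phi> axis_Basis_2])
  note [measurable] = test_functions_measurable[OF \<phi>] test_functions_measurable[OF d]
  have [measurable]: "(\<lambda>x. column j (HH x)) \<in> borel_measurable borel" "(\<lambda>x. column j (\<sigma> x)) \<in> borel_measurable borel"
    by (rule column_measurable, simp)+
  obtain D where D: "\<And>x. \<bar>\<phi> x\<bar> \<le> D" using test_functions_bounded[OF \<phi>] by metis
  have "(LINT x|lebesgue_on Omega. dir_deriv \<phi> (axis j 1) x *\<^sub>R kk x) = (LINT x|lborel. dir_deriv \<phi> (axis j 1) x *\<^sub>R kk x)"
    by (rule integral_lebesgue_on_AE) (auto simp: kk(2))
  also have "\<dots> = - ((LINT x|lborel. \<phi> x *\<^sub>R column j (HH x)) + (LINT s|lborel. \<phi> (pt s 0) *\<^sub>R column j (tensor_e2 (Jl s))))"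
    using exhaust_2[of j]
    by (auto simp: deriv_limit[OF \<phi>] column_tensor_e2 Jl_def mult.commute)
  also have "(LINT x|lborel. \<phi> x *\<^sub>R column j (HH x)) = (LINT x|lborel. norm (HH x) *\<^sub>R (\<phi> x *\<^sub>R column j (\<sigma> x)))"
  proof (rule integral_cong_AE)
    show "AE x in lborel. \<phi> x *\<^sub>R column j (HH x) = norm (HH x) *\<^sub>R (\<phi> x *\<^sub>R column j (\<sigma> x))"
      using layer0_AE[of \<xi>]
    proof eventually_elim
      case (elim x)
      have "column j (HH x) = norm (HH x) *\<^sub>R column j (\<sigma> x)"
        using arg_cong[OF HH_\<sigma>[OF elim], of "column j"] by (simp add: column_scaleR)
      then show ?case by (simp only: scaleR_left_commute)
    qed
  qed simp_all
  also have "(LINT s|lborel. \<phi> (pt s 0) *\<^sub>R column j (tensor_e2 (Jl s))) = (LINT s|lborel. norm (Jl s) *\<^sub>R (\<phi> (pt s 0) *\<^sub>R column j (\<sigma> (pt s 0))))"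
  proof (intro Bochner_Integration.integral_cong refl)
    fix s
    have "column j (tensor_e2 (Jl s)) = norm (Jl s) *\<^sub>R column j (\<sigma> (pt s 0))"
      using arg_cong[OF Jl_\<sigma>[of s], of "column j"] by (simp add: column_scaleR)
    then show "\<phi> (pt s 0) *\<^sub>R column j (tensor_e2 (Jl s)) = norm (Jl s) *\<^sub>R (\<phi> (pt s 0) *\<^sub>R column j (\<sigma> (pt s 0)))"
      by (simp only: scaleR_left_commute)
  qed
  also have "(LINT x|lborel. norm (HH x) *\<^sub>R (\<phi> x *\<^sub>R column j (\<sigma> x))) + (LINT s|lborel. norm (Jl s) *\<^sub>R (\<phi> (pt s 0) *\<^sub>R column j (\<sigma> (pt s 0))))
     = (LINT x|\<mu>. \<phi> x *\<^sub>R column j (\<sigma> x))"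
  proof (rule integral_\<mu>[symmetric])
    show "norm (\<phi> x *\<^sub>R column j (\<sigma> x)) \<le> D * 1" for x
      unfolding norm_scaleR using D norm_column_le[of j "\<sigma> x"] by (intro mult_mono) (auto simp: norm_\<sigma> intro: order_trans[OF abs_ge_zero D])
  qed measurable
  finally show "(LINT x|lebesgue_on Omega. dir_deriv \<phi> (axis j 1) x *\<^sub>R kk x) = - (LINT x|\<mu>. \<phi> x *\<^sub>R column j (\<sigma> x))" .
qed

lemma lp_on_kk: "lp_on 2 Omega kk" "lp_on 1 Omega kk"
  using sq_integrable_norm[OF kk(1)] integrable_norm[OF kk_int] by (simp_all add: lp_on_borel_supp kk(2))

lemma lp_on_HH: "lp_on 1 Omega HH"
  using integrable_norm[OF HH_int] by (simp add: lp_on_borel_supp HH(2))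

lemma lebesgue_decomp_kk: "lebesgue_decomp Omega \<mu> \<sigma> HH (layer0 \<xi>)"
  unfolding lebesgue_decomp_def
proof (intro conjI ballI impI lp_on_HH layer0_sets)
  show "layer0 \<xi> \<subseteq> Omega" using \<xi> by (auto simp: layer0_def mem_Omega)
  show "layer0 \<xi> \<in> null_sets lebesgue"
    using layer0_AE[of \<xi>] by (intro null_sets_completionI) (simp add: AE_iff_null_sets)
  fix A :: "(real^2) set" assume A[measurable]: "A \<in> sets borel" and sub: "A \<subseteq> Omega - layer0 \<xi>"
  have "(LINT x:A|\<mu>. \<sigma> x) = (LINT x|lborel. norm (HH x) *\<^sub>R (indicator A x *\<^sub>R \<sigma> x)) + (LINT s|lborel. norm (Jl s) *\<^sub>R (indicator A (pt s 0) *\<^sub>R \<sigma> (pt s 0)))"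
    unfolding set_lebesgue_integral_def
    by (rule integral_\<mu>[where D = 1]) (auto simp: norm_\<sigma> split: split_indicator)
  also have "(\<lambda>s. norm (Jl s) *\<^sub>R (indicator A (pt s 0) *\<^sub>R \<sigma> (pt s 0))) = (\<lambda>s. 0)"
  proof
    fix s show "norm (Jl s) *\<^sub>R (indicator A (pt s 0) *\<^sub>R \<sigma> (pt s 0)) = 0"
      using sub pt_layer0[of s 0 \<xi>] by (cases "s \<in> {-\<xi><..<1}") (auto simp: Jl_def split: split_indicator)
  qed
  also have "(\<lambda>x. norm (HH x) *\<^sub>R (indicator A x *\<^sub>R \<sigma> x)) = (\<lambda>x. indicator A x *\<^sub>R HH x)"
  proof
    fix x show "norm (HH x) *\<^sub>R (indicator A x *\<^sub>R \<sigma> x) = indicator A x *\<^sub>R HH x"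
      using sub HH_\<sigma>[of x] by (cases "x \<in> A") auto
  qed
  also have "(LINT x|lborel. indicator A x *\<^sub>R HH x) = (LINT x:A|lebesgue. HH x)"
    unfolding set_lebesgue_integral_def by (subst integral_completion) auto
  finally show "(LINT x:A|\<mu>. \<sigma> x) = (LINT x:A|lebesgue. HH x)" by simp
qed

lemma has_ac_grad_kk: "has_ac_grad Omega kk HH"
  unfolding has_ac_grad_def using has_deriv_measure_kk lebesgue_decomp_kk by blast

text \<open>The points of the segment that are not known to be approximate discontinuities lie over
  a null set of the line or over zeros of \<open>J\<close>. Since |Dk| has the density |J| on the
  segment, they carry no mass.\<close>

lemma sbv_kk: "sbv Omega kk"
proof -
  obtain N where N: "N \<in> null_sets lborel" "\<And>s. s \<notin> N \<Longrightarrow> s \<in> {-\<xi><..<1} \<Longrightarrow> J s \<noteq> 0 \<Longrightarrow> pt s 0 \<in> approx_discont_set Omega kk"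
    using jump_approx_discont unfolding eventually_ae_filter by auto
  have [measurable]: "N \<in> sets borel" using N(1) by auto
  let ?B = "{x. x \<in> layer0 \<xi> \<and> (x $ 1 \<in> N \<or> J (x $ 1) = 0)}"
  have B[measurable]: "?B \<in> sets borel" by measurable
  have sub: "?B \<subseteq> Omega" using \<xi> by (auto simp: layer0_def mem_Omega)
  then have B\<mu>: "?B \<in> sets \<mu>" using B by (subst sets_\<mu>) (auto simp: sets_restrict_space_iff)
  have "measure \<mu> ?B = (LINT x|\<mu>. indicator ?B x)"
    using sets.sets_into_space[OF B\<mu>] by (simp add: Int_absorb2)
  also have "\<dots> = (LINT x|lborel. norm (HH x) *\<^sub>R indicator ?B x) + (LINT s|lborel. norm (Jl s) *\<^sub>R indicator ?B (pt s 0))"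
    by (rule integral_\<mu>[where D = 1]) (auto split: split_indicator)
  also have "(LINT x|lborel. norm (HH x) *\<^sub>R indicator ?B x) = (LINT x::real^2|lborel. 0::real)"
    by (rule integral_cong_AE) (use layer0_AE[of \<xi>] in \<open>auto elim!: eventually_mono split: split_indicator\<close>)
  also have "(LINT s|lborel. norm (Jl s) *\<^sub>R indicator ?B (pt s 0)) = (LINT s::real|lborel. 0::real)"
  proof (rule integral_cong_AE)
    show "AE s in lborel. norm (Jl s) *\<^sub>R indicator ?B (pt s 0) = (0::real)"
      using AE_not_in[OF N(1)] by eventually_elim (auto simp: Jl_def split: split_indicator)
  qed measurable
  finally have "measure \<mu> ?B = 0" by simp
  then have "?B \<in> null_sets \<mu>"
    using B\<mu> finite_measure.emeasure_eq_measure[OF finite_measure_\<mu>, of ?B] by (auto intro: null_setsI)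
  then have "AE x in \<mu>. x \<notin> ?B" by (rule AE_not_in)
  then have "AE x in \<mu>. x \<in> layer0 \<xi> \<longrightarrow> x \<in> approx_discont_set Omega kk"
  proof eventually_elim
    case (elim x)
    show ?case
    proof
      assume x: "x \<in> layer0 \<xi>"
      with elim have "pt (x $ 1) 0 \<in> approx_discont_set Omega kk" by (intro N(2)) (auto simp: layer0_def)
      moreover have "x = pt (x $ 1) 0" using x pt_eta[of x] by (simp add: layer0_def)
      ultimately show "x \<in> approx_discont_set Omega kk" by metis
    qed
  qed
  then show ?thesis
    unfolding sbv_def bv_def using has_deriv_measure_kk lebesgue_decomp_kk lp_on_kk by blast
qed

lemma circle_valued_kk: "circle_valued Omega kk"
  using norm_kk by (auto simp: circle_valued_def AE_lebesgue_on_iff elim!: eventually_mono)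

end

section \<open>Translation back to fields on domains\<close>

lemma integral_lebesgue_on_supp:
  fixes g :: "'a::euclidean_space \<Rightarrow> 'b::euclidean_space"
  assumes "U \<in> sets borel" "g \<in> borel_measurable borel" "\<And>x. x \<notin> U \<Longrightarrow> g x = 0"
  shows "(LINT x|lebesgue_on U. g x) = (LINT x|lborel. g x)"
  by (rule integral_lebesgue_on_AE) (use assms in auto)

lemma lp_on_1_integrable:
  fixes g :: "'a::euclidean_space \<Rightarrow> 'b::euclidean_space"
  assumes "integrable lborel g" "U \<in> sets borel"
  shows "lp_on 1 U g"
  using assms(2) borel_measurable_integrable[OF assms(1)]
    integrable_mult_indicator[OF _ integrable_norm[OF assms(1)], of U]
  by (subst lp_on_borel) auto

lemma lp_on_AE:
  fixes f g :: "'a::euclidean_space \<Rightarrow> 'b::euclidean_space"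
  assumes "U \<in> sets borel" "sq_integrable g" "AE x in lborel. x \<in> U \<longrightarrow> f x = g x" "\<And>x. x \<notin> U \<Longrightarrow> g x = 0"
  shows "lp_on 2 U f"
  using assms sq_integrable_measurable[OF assms(2)] sq_integrable_norm[OF assms(2)]
  by (subst lp_on_rep_iff[OF measurable_lebesgue_on_AE]) auto

lemma L2_tendsto_to_l2:
  fixes f F :: "nat \<Rightarrow> 'a::euclidean_space \<Rightarrow> 'b::euclidean_space"
  assumes U: "U \<in> sets borel" and F: "\<And>n. sq_integrable (F n)" "\<And>n x. x \<notin> U \<Longrightarrow> F n x = 0"
    and G: "sq_integrable G" "\<And>x. x \<notin> U \<Longrightarrow> G x = 0"
    and f: "\<And>n. AE x in lborel. x \<in> U \<longrightarrow> f n x = F n x"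
    and lim: "(\<lambda>n. to_l2 (F n)) \<longlonglongrightarrow> to_l2 G"
  shows "L2_tendsto U f G"
  unfolding L2_tendsto_def
proof (intro conjI allI)
  show "lp_on 2 U (f n)" for n by (rule lp_on_AE[OF U F(1) f F(2)])
  show "lp_on 2 U G" by (rule lp_on_AE[OF U G(1) _ G(2)]) auto
  note [measurable] = sq_integrable_measurable[OF F(1)] sq_integrable_measurable[OF G(1)]
  have "(LINT x|lebesgue_on U. norm (f n x - G x) ^ 2) = (dist (to_l2 (F n)) (to_l2 G))\<^sup>2" for n
    unfolding dist_to_l2[OF F(1) G(1)]
  proof (rule integral_lebesgue_on_AE[OF U])
    show "AE x in lborel. x \<in> U \<longrightarrow> (norm (f n x - G x))\<^sup>2 = (norm (F n x - G x))\<^sup>2"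
      using f[of n] by eventually_elim simp
    show "(\<lambda>x. (norm (F n x - G x))\<^sup>2) \<in> borel_measurable borel" by measurable
  qed (simp add: F(2) G(2))
  moreover have "(\<lambda>n. (dist (to_l2 (F n)) (to_l2 G))\<^sup>2) \<longlonglongrightarrow> 0\<^sup>2"
    by (rule tendsto_power[OF iffD1[OF tendsto_dist_iff lim]])
  ultimately show "(\<lambda>n. LINT x|lebesgue_on U. norm (f n x - G x) ^ 2) \<longlonglongrightarrow> 0" by simp
qed

text \<open>A Borel representative of the Lebesgue measurable test field, extended by zero, is an
  element of the Hilbert space with the same pairings.\<close>

lemma L2_weak_tendsto_to_l2:
  fixes F :: "nat \<Rightarrow> 'a::euclidean_space \<Rightarrow> 'b::euclidean_space"
  assumes U: "U \<in> sets borel" and F: "\<And>n. sq_integrable (F n)" "\<And>n x. x \<notin> U \<Longrightarrow> F n x = 0"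
    and G: "sq_integrable G" "\<And>x. x \<notin> U \<Longrightarrow> G x = 0"
    and lim: "\<And>y. (\<lambda>n. to_l2 (F n) \<bullet> y) \<longlonglongrightarrow> to_l2 G \<bullet> y"
  shows "L2_weak_tendsto U F G"
  unfolding L2_weak_tendsto_def
proof (intro conjI allI impI)
  show "lp_on 2 U (F n)" for n by (rule lp_on_AE[OF U F(1) _ F(2)]) auto
  show "lp_on 2 U G" by (rule lp_on_AE[OF U G(1) _ G(2)]) auto
  fix \<psi> :: "'a \<Rightarrow> 'b" assume \<psi>: "lp_on 2 U \<psi>"
  then have \<psi>_meas: "\<psi> \<in> borel_measurable (lebesgue_on U)" by (simp add: lp_on_def)
  obtain g where g: "g \<in> borel_measurable borel" "AE x in lborel. x \<in> U \<longrightarrow> \<psi> x = g x" "\<And>x. x \<notin> U \<Longrightarrow> g x = 0"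
    using borel_rep[OF \<psi>_meas U] by blast
  have g_sq: "sq_integrable g"
    using \<psi> lp_on_rep_iff[OF \<psi>_meas U g, of 2] g(1) by (simp add: sq_integrable_def)
  have eq: "(LINT x|lebesgue_on U. f x \<bullet> \<psi> x) = to_l2 f \<bullet> to_l2 g" if f: "sq_integrable f" for f
    unfolding inner_to_l2[OF f g_sq]
  proof (rule integral_lebesgue_on_AE[OF U])
    note [measurable] = sq_integrable_measurable[OF f] g(1)
    show "(\<lambda>x. f x \<bullet> g x) \<in> borel_measurable borel" by measurable
    show "AE x in lborel. x \<in> U \<longrightarrow> f x \<bullet> \<psi> x = f x \<bullet> g x" using g(2) by eventually_elim simp
  qed (simp add: g(3))
  show "(\<lambda>n. LINT x|lebesgue_on U. F n x \<bullet> \<psi> x) \<longlonglongrightarrow> (LINT x|lebesgue_on U. G x \<bullet> \<psi> x)"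
    unfolding eq[OF F(1)] eq[OF G(1)] by (rule lim)
qed

context layer_limit
begin

text \<open>Test functions supported off the closed segment do not see the jump term, so
  \<open>HH\<close> is the full weak gradient there.\<close>

lemma sobolev1_kk: "sobolev1 1 (Omega - closure (layer0 \<xi>)) kk"
proof -
  let ?U = "Omega - closure (layer0 \<xi>)"
  have U[measurable]: "?U \<in> sets borel" by (simp add: sets.Diff)
  have "has_weak_grad ?U kk HH"
    unfolding has_weak_grad_def has_weak_deriv_def
  proof (intro allI conjI ballI)
    fix j :: 2
    show "locally_integrable_on ?U kk" by (rule locally_integrable_on_AE[OF kk_int]) simp
    show "locally_integrable_on ?U (\<lambda>x. column j (HH x))"
      by (rule locally_integrable_on_AE[OF integrable_bounded_linear[OF bounded_linear_column[of j] HH_int]]) simp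
    fix \<phi> assume \<phi>: "\<phi> \<in> test_functions ?U"
    then have \<phi>': "\<phi> \<in> test_functions Omega" using test_functions_mono[of ?U Omega] by auto
    have d: "dir_deriv \<phi> (axis j 1) \<in> test_functions ?U" by (rule test_functions_dir_deriv[OF \<phi> axis_Basis_2])
    note [measurable] = test_functions_measurable[OF \<phi>] test_functions_measurable[OF d]
    have [measurable]: "(\<lambda>x. column j (HH x)) \<in> borel_measurable borel" by (rule column_measurable) simp
    have "(LINT x|lebesgue_on ?U. dir_deriv \<phi> (axis j 1) x *\<^sub>R kk x) = (LINT x|lborel. dir_deriv \<phi> (axis j 1) x *\<^sub>R kk x)"
      by (rule integral_lebesgue_on_supp) (use test_functions_eq_0[OF d] in auto)
    also have "\<dots> = - (LINT x|lborel. \<phi> x *\<^sub>R column j (HH x))"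
    proof -
      have z: "indicator {-\<xi><..<1} s * \<phi> (pt s 0) = 0" for s
        using test_functions_eq_0[OF \<phi>, of "pt s 0"] subsetD[OF closure_subset, of "pt s 0" "layer0 \<xi>"] by (auto split: split_indicator)
      show ?thesis
        using exhaust_2[of j] by (elim disjE) (simp_all only: deriv_limit[OF \<phi>'] z, simp)
    qed
    also have "(LINT x|lborel. \<phi> x *\<^sub>R column j (HH x)) = (LINT x|lebesgue_on ?U. \<phi> x *\<^sub>R column j (HH x))"
      by (rule integral_lebesgue_on_supp[symmetric]) (use test_functions_eq_0[OF \<phi>] in auto)
    finally show "(LINT x|lebesgue_on ?U. dir_deriv \<phi> (axis j 1) x *\<^sub>R kk x) = - (LINT x|lebesgue_on ?U. \<phi> x *\<^sub>R column j (HH x))" .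
  qed
  then show ?thesis
    unfolding sobolev1_def using lp_on_1_integrable[OF kk_int U] lp_on_1_integrable[OF HH_int U] by blast
qed

lemma has_jump_kk: "has_jump \<xi> kk J"
proof -
  obtain kp km where tr:
    "AE s in lborel. s \<in> {-1<..<1} \<longrightarrow> approx_lim (Omega \<inter> {x. x $ 2 > 0}) kk (pt s 0) (kp s)"
    "AE s in lborel. s \<in> {-1<..<1} \<longrightarrow> approx_lim (Omega \<inter> {x. x $ 2 < 0}) kk (pt s 0) (km s)"
    "\<And>s. s \<in> {-\<xi><..<1} \<Longrightarrow> J s = kp s - km s"
    using traces by blast
  have sub: "s \<in> {-1<..<1}" if "s \<in> {-\<xi><..<1}" for s using that \<xi> by auto
  show ?thesis
    unfolding has_jump_def
  proof (rule conjI[OF continuous_J], rule exI[of _ kp], rule exI[of _ km], intro conjI)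
    show "AE s in lebesgue_on {-\<xi><..<1}. approx_lim (Omega \<inter> {x. x $ 2 > 0}) kk (pt s 0) (kp s)"
      unfolding AE_lebesgue_on_iff[OF borel_open[OF open_greaterThanLessThan]]
      using tr(1) by eventually_elim (use sub in blast)
    show "AE s in lebesgue_on {-\<xi><..<1}. approx_lim (Omega \<inter> {x. x $ 2 < 0}) kk (pt s 0) (km s)"
      unfolding AE_lebesgue_on_iff[OF borel_open[OF open_greaterThanLessThan]]
      using tr(2) by eventually_elim (use sub in blast)
    show "AE s in lebesgue_on {-\<xi><..<1}. J s = kp s - km s"
      by (rule AE_I2) (use tr(3) in simp)
  qed
qed

lemma J_eq:
  assumes s: "s \<in> {-\<xi><..<1}"
  shows "J s = (LINT x1|lebesgue_on {-\<xi><..<s}. LINT x2|lebesgue_on {-\<xi>/2<..<\<xi>/2}. \<alpha> (pt x1 x2))"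
proof -
  have "(LINT x2|lebesgue_on {-\<xi>/2<..<\<xi>/2}. \<alpha> (pt x1 x2)) = a x1" for x1
    unfolding a_def by (rule integral_lebesgue_on_supp) (auto simp: \<alpha>(2) mem_layer)
  moreover have "(LINT r|lebesgue_on {-\<xi><..<s}. a r) = J s"
    unfolding J_def
  proof (rule trans[OF integral_lebesgue_on_borel integral_cong_AE])
    show "AE r in lborel. indicator {-\<xi><..<s} r *\<^sub>R a r = indicator {..s} r *\<^sub>R a r"
      using AE_lborel_singleton[of s]
    proof eventually_elim
      case (elim r)
      then show ?case using a_0[of r] by (cases "r > -\<xi>") (auto split: split_indicator)
    qed
  qed auto
  ultimately show ?thesis by simp
qed

text \<open>\<open>J\<close> equals \<open>b 2\<close> almost everywhere, and the weak equation of
  the latter is already available.\<close>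

lemma has_weak_deriv_J: "has_weak_deriv {-\<xi><..<1} 1 J a"
  unfolding has_weak_deriv_def
proof (intro conjI ballI)
  show "locally_integrable_on {-\<xi><..<1} J"
    by (rule locally_integrable_on_AE[OF Jl_int]) (simp add: Jl_def)
  show "locally_integrable_on {-\<xi><..<1} a"
    by (rule locally_integrable_on_AE[OF a_int]) simp
  fix \<phi> assume \<phi>: "\<phi> \<in> test_functions {-\<xi><..<1}"
  then have \<phi>': "\<phi> \<in> test_functions {-1<..<1}" using test_functions_mono[of "{-\<xi><..<1}" "{-1<..<1}"] \<xi> by (auto simp: subset_iff)
  have d: "dir_deriv \<phi> 1 \<in> test_functions {-\<xi><..<1}" by (rule test_functions_dir_deriv[OF \<phi>]) simp
  note [measurable] = test_functions_measurable[OF \<phi>] test_functions_measurable[OF d]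
  have "(LINT s|lebesgue_on {-\<xi><..<1}. dir_deriv \<phi> 1 s *\<^sub>R J s) = (LINT s|lborel. dir_deriv \<phi> 1 s *\<^sub>R b 2 s)"
  proof (rule integral_lebesgue_on_AE)
    show "AE s in lborel. s \<in> {-\<xi><..<1} \<longrightarrow> dir_deriv \<phi> 1 s *\<^sub>R J s = dir_deriv \<phi> 1 s *\<^sub>R b 2 s"
      using b_2_eq_J by eventually_elim (use \<xi> in auto)
  qed (use test_functions_eq_0[OF d] in auto)
  also have "\<dots> = - (LINT s|lborel. \<phi> s *\<^sub>R a s)" by (rule weak_deriv_b_2[OF \<phi>'])
  also have "(LINT s|lborel. \<phi> s *\<^sub>R a s) = (LINT s|lebesgue_on {-\<xi><..<1}. \<phi> s *\<^sub>R a s)"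
    by (rule integral_lebesgue_on_supp[symmetric]) (auto simp: a_0)
  finally show "(LINT s|lebesgue_on {-\<xi><..<1}. dir_deriv \<phi> 1 s *\<^sub>R J s) = - (LINT s|lebesgue_on {-\<xi><..<1}. \<phi> s *\<^sub>R a s)" .
qed

lemma distr_curl_HH:
  assumes \<phi>: "\<phi> \<in> test_functions Omega"
  shows "distr_curl Omega HH \<phi> = - (LINT x:layer0 \<xi>|hausdorff1. \<phi> x *\<^sub>R a (x $ 1))"
proof -
  have d: "dir_deriv \<phi> (axis j 1) \<in> test_functions Omega" for j by (rule test_functions_dir_deriv[OF \<phi> axis_Basis_2])
  note [measurable] = test_functions_measurable[OF \<phi>]
  have "(LINT x|lebesgue_on Omega. dir_deriv \<phi> (axis i 1) x *\<^sub>R column j (HH x)) = (LINT x|lborel. dir_deriv \<phi> (axis i 1) x *\<^sub>R column j (HH x))" for i j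
  proof (rule integral_lebesgue_on_supp)
    have [measurable]: "(\<lambda>x. column j (HH x)) \<in> borel_measurable borel" by (rule column_measurable) simp
    note [measurable] = test_functions_measurable[OF d]
    show "(\<lambda>x. dir_deriv \<phi> (axis i 1) x *\<^sub>R column j (HH x)) \<in> borel_measurable borel" by measurable
  qed (use test_functions_eq_0[OF d] in auto)
  then have "distr_curl Omega HH \<phi> = - (LINT s|lborel. \<phi> (pt s 0) *\<^sub>R a s)"
    unfolding distr_scaled_curl_def curl_limit[OF \<phi>, symmetric] by simp
  also have "(LINT s|lborel. \<phi> (pt s 0) *\<^sub>R a s) = (LINT s|lborel. indicator (layer0 \<xi>) (pt s 0) *\<^sub>R (\<phi> (pt s 0) *\<^sub>R a s))"
    by (intro Bochner_Integration.integral_cong refl) (auto simp: a_0 split: split_indicator)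
  also have "\<dots> = (LINT x|hausdorff1. indicator (layer0 \<xi>) x *\<^sub>R (\<phi> x *\<^sub>R a (x $ 1)))"
    by (subst integral_hausdorff1_line) (auto simp: layer0_def split: split_indicator)
  finally show ?thesis by (simp add: set_lebesgue_integral_def)
qed

end

section \<open>Borel representatives of the fields\<close>

lemma fundamental_lemma_test:
  fixes F :: "real^2 \<Rightarrow> 'b::euclidean_space"
  assumes F: "integrable lborel F" and V: "open V"
    and z: "\<And>\<phi>. \<phi> \<in> test_functions V \<Longrightarrow> (LINT x|lborel. \<phi> x *\<^sub>R F x) = 0"
  shows "AE x in lborel. x \<in> V \<longrightarrow> F x = 0"
proof (rule fundamental_lemma_box[OF F V])
  fix m a b c d :: real
  assume *: "m > 0" "a < b" "c < d" "cbox (pt a c) (pt b d) \<subseteq> V"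
  have "(\<lambda>x::real^2. bump m a b (x $ 1) * bump m c d (x $ 2)) \<in> test_functions {x. x $ 1 \<in> {a..b} \<and> x $ 2 \<in> {c..d}}"
    by (intro prod_test bump_test *(1) order_refl)
  moreover have "{x::real^2. x $ 1 \<in> {a..b} \<and> x $ 2 \<in> {c..d}} \<subseteq> V"
    using *(4) by (auto simp: subset_iff mem_box Basis_real2 inner_axis)
  ultimately show "(LINT x|lborel. (bump m a b (x $ 1) * bump m c d (x $ 2)) *\<^sub>R F x) = 0"
    using z test_functions_mono by blast
qed

lemma AE_stretch:
  assumes "AE x::real^2 in lborel. P x" "c > 0"
  shows "AE x::real^2 in lborel. P (pt (x $ 1) (c * x $ 2))"
proof -
  have "AE x in density (distr lborel borel (\<lambda>x::real^2. pt (x $ 1) (c * x $ 2))) (\<lambda>_. ennreal c). P x"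
    using assms(1) by (simp only: lborel_stretch[OF assms(2), symmetric])
  then have "AE x in distr lborel borel (\<lambda>x::real^2. pt (x $ 1) (c * x $ 2)). P x"
    using assms(2) by (subst (asm) AE_density) auto
  moreover have "(\<lambda>x::real^2. pt (x $ 1) (c * x $ 2)) \<in> borel_measurable borel" by measurable
  ultimately show ?thesis using AE_distrD[of "\<lambda>x::real^2. pt (x $ 1) (c * x $ 2)" lborel borel P] by simp
qed

text \<open>Only a Borel function \<open>T\<close> below the energy density is integrated;
  monotonicity of the nonnegative integral transfers the energy bound to it.\<close>

lemma integral_le_nn_integral:
  fixes T e :: "'a::euclidean_space \<Rightarrow> real"
  assumes U: "U \<in> sets borel" and T: "T \<in> borel_measurable borel" "\<And>x. 0 \<le> T x" "\<And>x. x \<notin> U \<Longrightarrow> T x = 0"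
    and le: "AE x in lborel. x \<in> U \<longrightarrow> T x \<le> e x"
    and E: "(\<integral>\<^sup>+x. ennreal (e x) \<partial>lebesgue_on U) \<le> ennreal E" "0 \<le> E"
  shows "integrable lborel T" "(LINT x|lborel. T x) \<le> E"
proof -
  have "(\<integral>\<^sup>+x. ennreal (T x) \<partial>lborel) = (\<integral>\<^sup>+x. ennreal (T x) * indicator U x \<partial>lebesgue)"
    using T by (subst nn_integral_completion[symmetric]) (auto intro!: nn_integral_cong split: split_indicator)
  also have "\<dots> = (\<integral>\<^sup>+x. ennreal (T x) \<partial>lebesgue_on U)"
    using U by (subst nn_integral_restrict_space) auto
  also have "\<dots> \<le> (\<integral>\<^sup>+x. ennreal (e x) \<partial>lebesgue_on U)"
  proof (rule nn_integral_mono_AE)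
    show "AE x in lebesgue_on U. ennreal (T x) \<le> ennreal (e x)"
      unfolding AE_lebesgue_on_iff[OF U] using le by eventually_elim (auto intro: ennreal_leI)
  qed
  finally have *: "(\<integral>\<^sup>+x. ennreal (T x) \<partial>lborel) \<le> ennreal E" using E(1) by (rule order_trans)
  show i: "integrable lborel T"
    using T(1,2) order.strict_trans1[OF * ennreal_less_top] by (simp add: integrable_iff_bounded)
  have "ennreal (LINT x|lborel. T x) \<le> ennreal E"
    using * T(2) by (subst nn_integral_eq_integral[symmetric, OF i]) auto
  then show "(LINT x|lborel. T x) \<le> E" using E(2) by simp
qed

text \<open>The area of the layer is proportional to \<open>c\<close>, which compensates the factor
  1/\<epsilon> in front of the potential.\<close>

lemma measure_layer_stretch:
  assumes "c > 0"
  shows "measure lborel (layer c \<xi>) = c * measure lborel (layer 1 \<xi>)"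
proof -
  have "measure lborel (layer c \<xi>) = (LINT x|lborel. indicator (layer c \<xi>) x)" by simp
  also have "\<dots> = c * (LINT x::real^2|lborel. indicator (layer c \<xi>) (pt (x $ 1) (c * x $ 2)))"
    by (subst integral_stretch[OF assms]) auto
  also have "(\<lambda>x::real^2. indicator (layer c \<xi>) (pt (x $ 1) (c * x $ 2)) :: real) = indicator (layer 1 \<xi>)"
    using stretch_mem_layer[OF assms] by (auto simp: fun_eq_iff split: split_indicator)
  finally show ?thesis by simp
qed

text \<open>Weak gradients are locally integrable column by column; the Borel versions of the
  columns are reassembled by this.\<close>

definition columns :: "real^2 \<Rightarrow> real^2 \<Rightarrow> real^2^2" where
  "columns u v = (\<chi> i j. if j = 1 then u $ i else v $ i)"

lemma columns_column: "columns (column 1 A) (column 2 A) = A"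
  unfolding vec_eq_iff
proof (intro allI)
  fix i j show "columns (column 1 A) (column 2 A) $ i $ j = A $ i $ j"
    using exhaust_2[of j] by (auto simp: columns_def column_def)
qed

lemma columns_measurable [measurable]:
  assumes [measurable]: "f \<in> borel_measurable borel" "g \<in> borel_measurable borel"
  shows "(\<lambda>x. columns (f x) (g x)) \<in> borel_measurable borel"
proof -
  have "linear (\<lambda>p. columns (fst p) (snd p))"
    by (rule linearI) (auto simp: columns_def vec_eq_iff)
  then have "bounded_linear (\<lambda>p. columns (fst p) (snd p))" by (simp add: linear_conv_bounded_linear)
  then have "(\<lambda>p. columns (fst p) (snd p)) \<in> borel_measurable borel"
    by (intro borel_measurable_continuous_onI linear_continuous_on)
  moreover have "(\<lambda>x. (f x, g x)) \<in> borel_measurable borel" by (rule borel_measurable_Pair) measurable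
  ultimately show ?thesis using measurable_compose[of "\<lambda>x. (f x, g x)" borel borel "\<lambda>p. columns (fst p) (snd p)" borel] by simp
qed

text \<open>Collects, for one index, the demands of \<open>layer_sequence\<close> on the Borel
  fields and their agreement with the given fields, so that the fields can be chosen simultaneously
  for all indices.\<close>

definition layer_data ::
  "real \<Rightarrow> real \<Rightarrow> real \<Rightarrow> (real^2 \<Rightarrow> real^2) \<Rightarrow> (real^2 \<Rightarrow> real^2^2) \<Rightarrow>
    (real^2 \<Rightarrow> real^2) \<Rightarrow> (real^2 \<Rightarrow> real^2^2) \<Rightarrow> (real^2 \<Rightarrow> real^2^2) \<Rightarrow> (real^2 \<Rightarrow> real^2) \<Rightarrow> bool" where
  "layer_data \<xi> M \<epsilon> k B k' H' B' C' \<longleftrightarrow>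
     (AE x in lborel. x \<in> Omega \<longrightarrow> k x = k' x) \<and> (AE x in lborel. x \<in> Omega \<longrightarrow> B x = B' x) \<and>
     sq_integrable k' \<and> sq_integrable H' \<and> sq_integrable B' \<and> sq_integrable C' \<and>
     (\<forall>x. x \<notin> Omega \<longrightarrow> k' x = 0 \<and> H' x = 0) \<and> (\<forall>x. x \<notin> layer \<epsilon> \<xi> \<longrightarrow> B' x = 0 \<and> C' x = 0) \<and>
     (LINT x|lborel. indicator Omega x * (norm (k' x) - 1)\<^sup>2) \<le> M * \<epsilon> \<and>
     (LINT x|lborel. (norm (H' x))\<^sup>2) \<le> M \<and> \<epsilon> * (LINT x|lborel. (norm (B' x))\<^sup>2) \<le> M \<and>
     \<epsilon> * (LINT x|lborel. (norm (C' x))\<^sup>2) \<le> M \<and> norm (LINT x|lborel. C' x) = 2 \<and>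
     (\<forall>\<phi>\<in>test_functions Omega. \<forall>j.
        (LINT x|lborel. dir_deriv \<phi> (axis j 1) x *\<^sub>R k' x) = - (LINT x|lborel. \<phi> x *\<^sub>R column j (H' x + B' x))) \<and>
     (\<forall>\<phi>\<in>test_functions Omega.
        - (LINT x|lborel. dir_deriv \<phi> (axis 1 1) x *\<^sub>R column 2 (B' x))
        + (LINT x|lborel. dir_deriv \<phi> (axis 2 1) x *\<^sub>R column 1 (B' x)) = (LINT x|lborel. \<phi> x *\<^sub>R C' x))"

lemma layer_sequenceI:
  assumes "0 < \<xi>" "\<xi> < 1" "\<And>n. 0 < \<epsilon> n" "\<And>n. \<epsilon> n < 1" "\<epsilon> \<longlonglongrightarrow> 0"
    and "\<And>n. layer_data \<xi> M (\<epsilon> n) (k n) (B n) (k' n) (H' n) (B' n) (C' n)"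
  shows "layer_sequence \<xi> M \<epsilon> k' H' B' C'"
  using assms unfolding layer_data_def by unfold_locales blast+

lemma has_weak_grad_weak_grad: "sobolev1 p U u \<Longrightarrow> has_weak_grad U u (weak_grad U u)"
  unfolding sobolev1_def weak_grad_def by (metis someI_ex)

lemma has_weak_curl_weak_curl: "H_curl U B \<Longrightarrow> has_weak_curl U B (weak_curl U B)"
  unfolding H_curl_def weak_curl_def by (metis someI_ex)

lemma lp_on_2_rep:
  fixes f :: "'a::euclidean_space \<Rightarrow> 'b::euclidean_space"
  assumes f: "lp_on 2 U f" and U: "U \<in> sets borel"
  obtains g where "sq_integrable g" "AE x in lborel. x \<in> U \<longrightarrow> f x = g x" "\<And>x. x \<notin> U \<Longrightarrow> g x = 0"
proof -
  have m: "f \<in> borel_measurable (lebesgue_on U)" using f by (simp add: lp_on_def)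
  obtain g where g: "g \<in> borel_measurable borel" "AE x in lborel. x \<in> U \<longrightarrow> f x = g x" "\<And>x. x \<notin> U \<Longrightarrow> g x = 0"
    using borel_rep[OF m U] by blast
  with f lp_on_rep_iff[OF m U g, of 2] have "sq_integrable g" by (simp add: sq_integrable_def)
  with g that show ?thesis by blast
qed

lemma AE_layer_boundary: "AE x in lborel. x \<notin> layer \<epsilon> \<xi> \<longrightarrow> x \<notin> cbox (pt (-\<xi>) (- (\<epsilon> * \<xi> / 2))) (pt 1 (\<epsilon> * \<xi> / 2))"
  using AE_vec_nth_ne[of 1 "-\<xi>"] AE_vec_nth_ne[of 1 1] AE_vec_nth_ne[of 2 "- (\<epsilon> * \<xi> / 2)"] AE_vec_nth_ne[of 2 "\<epsilon> * \<xi> / 2"]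
  by eventually_elim (auto simp: mem_layer mem_box Basis_real2 inner_axis)

text \<open>Off the closed layer \<open>B'\<close> vanishes on an open set, hence so does its
  distributional curl; the boundary of the layer is a null set.\<close>

lemma curl_zero_off_layer:
  fixes B' :: "real^2 \<Rightarrow> real^2^2" and C' :: "real^2 \<Rightarrow> real^2"
  assumes C: "integrable lborel C'" "\<And>x. x \<notin> Omega \<Longrightarrow> C' x = 0" and B: "\<And>x. x \<notin> layer \<epsilon> \<xi> \<Longrightarrow> B' x = 0"
    and curl: "\<And>\<phi>. \<phi> \<in> test_functions Omega \<Longrightarrow>
        - (LINT x|lborel. dir_deriv \<phi> (axis 1 1) x *\<^sub>R column 2 (B' x))
        + (LINT x|lborel. dir_deriv \<phi> (axis 2 1) x *\<^sub>R column 1 (B' x)) = (LINT x|lborel. \<phi> x *\<^sub>R C' x)"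
  shows "AE x in lborel. x \<notin> layer \<epsilon> \<xi> \<longrightarrow> C' x = 0"
proof -
  let ?K = "cbox (pt (-\<xi>) (- (\<epsilon> * \<xi> / 2))) (pt 1 (\<epsilon> * \<xi> / 2))"
  have sub: "layer \<epsilon> \<xi> \<subseteq> ?K" unfolding layer_def by (rule box_subset_cbox)
  have "AE x in lborel. x \<in> Omega - ?K \<longrightarrow> C' x = 0"
  proof (rule fundamental_lemma_test[OF C(1)])
    show "open (Omega - ?K)" by (intro open_Diff open_Omega closed_cbox)
    fix \<phi> assume \<phi>: "\<phi> \<in> test_functions (Omega - ?K)"
    then have \<phi>': "\<phi> \<in> test_functions Omega" using test_functions_mono[of "Omega - ?K" Omega] by auto
    have "(\<lambda>x. dir_deriv \<phi> (axis i 1) x *\<^sub>R column j (B' x)) = (\<lambda>x. 0)" for i j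
    proof
      fix x show "dir_deriv \<phi> (axis i 1) x *\<^sub>R column j (B' x) = 0"
      using test_functions_eq_0[OF test_functions_dir_deriv[OF \<phi> axis_Basis_2], of x i] B[of x] sub
        by (cases "x \<in> layer \<epsilon> \<xi>") (auto simp: column_0)
    qed
    then show "(LINT x|lborel. \<phi> x *\<^sub>R C' x) = 0" by (simp only: curl[OF \<phi>', symmetric]) simp
  qed
  then show ?thesis using AE_layer_boundary[of \<epsilon> \<xi>] by eventually_elim (use C(2) in auto)
qed

text \<open>All four terms of the energy are nonnegative, so each of them alone is bounded by
  \<open>E\<close>. Removing its weight gives one of the four constants that are compared with
  \<open>M\<close>.\<close>

lemma ex_layer_data:
  fixes W :: "real \<Rightarrow> real"
  assumes \<xi>: "0 < \<xi>" "\<xi> < 1" and \<epsilon>: "0 < \<epsilon>" "\<epsilon> < 1" and E: "0 \<le> E" and K: "K > 0"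
    and W: "\<And>x. 0 \<le> x \<Longrightarrow> 0 \<le> W x" "\<And>x. 0 \<le> x \<Longrightarrow> 1 / K * \<bar>x\<bar>\<^sup>2 - K \<le> W x"
    and k: "sobolev1 2 Omega k" and B: "H_curl Omega B"
    and en: "energy W \<epsilon> \<xi> k B \<le> ennreal E"
    and supp: "AE x in lebesgue_on (Omega - layer \<epsilon> \<xi>). B x = 0"
    and mean: "norm (LINT x|lebesgue_on Omega. weak_curl Omega B x) = 2"
    and M: "E * \<xi>\<^sup>2 \<le> M" "E \<le> M" "E / \<xi>\<^sup>2 \<le> M" "K * E + K\<^sup>2 / \<xi>\<^sup>2 * measure lborel (layer 1 \<xi>) \<le> M"
  shows "\<exists>k' H' B' C'. layer_data \<xi> M \<epsilon> k B k' H' B' C'"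
proof -
  let ?G = "weak_grad Omega k" and ?c = "weak_curl Omega B"
  define e where "e x = (norm (k x) - 1)\<^sup>2 / (\<epsilon> * \<xi>\<^sup>2) + (norm (?G x - B x))\<^sup>2
         + \<epsilon> * \<xi>\<^sup>2 * (norm (?c x))\<^sup>2 + 1 / (\<epsilon> * \<xi>\<^sup>2) * W (\<epsilon> * \<xi> * norm (B x))" for x
  have en': "(\<integral>\<^sup>+x. ennreal (e x) \<partial>lebesgue_on Omega) \<le> ennreal E"
    using en by (simp add: energy_def e_def)
  have e1: "(norm (k x) - 1)\<^sup>2 / (\<epsilon> * \<xi>\<^sup>2) \<ge> 0" and e2: "(norm (?G x - B x))\<^sup>2 \<ge> 0"
    and e3: "\<epsilon> * \<xi>\<^sup>2 * (norm (?c x))\<^sup>2 \<ge> 0" and e4: "1 / (\<epsilon> * \<xi>\<^sup>2) * W (\<epsilon> * \<xi> * norm (B x)) \<ge> 0" for x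
    using \<epsilon> \<xi> W(1) by simp_all
  note bound = integral_le_nn_integral[OF sets_Omega _ _ _ _ en' E]
  have lay: "layer \<epsilon> \<xi> \<subseteq> Omega"
  proof
    fix x assume x: "x \<in> layer \<epsilon> \<xi>"
    have "\<epsilon> * \<xi> \<le> 1 * 1" using \<epsilon> \<xi> by (intro mult_mono) auto
    with x \<xi> show "x \<in> Omega" by (auto simp: mem_layer mem_Omega)
  qed

  obtain k' where k': "sq_integrable k'" "AE x in lborel. x \<in> Omega \<longrightarrow> k x = k' x" "\<And>x. x \<notin> Omega \<Longrightarrow> k' x = 0"
    using lp_on_2_rep[OF _ sets_Omega, of k] k unfolding sobolev1_def by blast
  obtain B0 where B0: "sq_integrable B0" "AE x in lborel. x \<in> Omega \<longrightarrow> B x = B0 x" "\<And>x. x \<notin> Omega \<Longrightarrow> B0 x = 0"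
    using lp_on_2_rep[OF _ sets_Omega, of B] B unfolding H_curl_def by blast
  define B' where "B' x = indicator (layer \<epsilon> \<xi>) x *\<^sub>R B0 x" for x
  have B'_0: "B' x = 0" if "x \<notin> layer \<epsilon> \<xi>" for x using that by (simp add: B'_def)
  have B'_sq: "sq_integrable B'"
  proof (rule sq_integrable_bounded_by[OF B0(1)])
    note [measurable] = sq_integrable_measurable[OF B0(1)]
    show "B' \<in> borel_measurable borel" unfolding B'_def[abs_def] by measurable
  qed (simp add: B'_def split: split_indicator)
  have sB: "AE x in lborel. x \<in> Omega - layer \<epsilon> \<xi> \<longrightarrow> B x = 0"
    using supp by (subst (asm) AE_lebesgue_on_iff) (auto intro: sets.Diff)
  have B'_eq: "AE x in lborel. x \<in> Omega \<longrightarrow> B x = B' x"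
    using B0(2) sB by eventually_elim (auto simp: B'_def split: split_indicator)
  have wg: "has_weak_grad Omega k ?G" by (rule has_weak_grad_weak_grad[OF k])
  have "\<exists>g. g \<in> borel_measurable borel \<and> (AE x in lborel. x \<in> Omega \<longrightarrow> column j (?G x) = g x) \<and> (\<forall>x. x \<notin> Omega \<longrightarrow> g x = 0)" for j
  proof -
    have "(\<lambda>x. column j (?G x)) \<in> borel_measurable (lebesgue_on Omega)"
      using wg by (intro locally_integrable_on_measurable open_Omega) (simp add: has_weak_grad_def has_weak_deriv_def)
    then obtain h where "h \<in> borel_measurable borel" "AE x in lborel. x \<in> Omega \<longrightarrow> column j (?G x) = h x" "\<And>x. x \<notin> Omega \<Longrightarrow> h x = 0"
      using borel_rep[OF _ sets_Omega] by blast
    then show ?thesis by blast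
  qed
  then have "\<exists>g. \<forall>j. g j \<in> borel_measurable borel \<and> (AE x in lborel. x \<in> Omega \<longrightarrow> column j (?G x) = g j x) \<and> (\<forall>x. x \<notin> Omega \<longrightarrow> g j x = 0)"
    by (intro choice allI)
  then obtain g where g: "\<And>j. g j \<in> borel_measurable borel" "\<And>j. AE x in lborel. x \<in> Omega \<longrightarrow> column j (?G x) = g j x"
      "\<And>j x. x \<notin> Omega \<Longrightarrow> g j x = 0" by blast
  note [measurable] = g(1) sq_integrable_measurable[OF k'(1)] sq_integrable_measurable[OF B'_sq]
  define H' where "H' x = columns (g 1 x) (g 2 x) - B' x" for x
  have H'_0: "H' x = 0" if "x \<notin> Omega" for x
    using that lay B'_0[of x] g(3)[of x] by (auto simp: H'_def columns_def vec_eq_iff)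
  have H'_meas [measurable]: "H' \<in> borel_measurable borel" unfolding H'_def[abs_def] by measurable
  have H'_eq: "AE x in lborel. x \<in> Omega \<longrightarrow> ?G x - B x = H' x"
    using g(2)[of 1] g(2)[of 2] B'_eq
  proof eventually_elim
    case (elim x)
    then show ?case using columns_column[of "?G x"] by (auto simp: H'_def)
  qed
  have wc: "has_weak_curl Omega B ?c" by (rule has_weak_curl_weak_curl[OF B])
  have c_meas: "?c \<in> borel_measurable (lebesgue_on Omega)"
    using wc by (intro locally_integrable_on_measurable open_Omega) (simp add: has_scaled_curl_def)
  obtain C0 where C0: "C0 \<in> borel_measurable borel" "AE x in lborel. x \<in> Omega \<longrightarrow> ?c x = C0 x" "\<And>x. x \<notin> Omega \<Longrightarrow> C0 x = 0"
    using borel_rep[OF c_meas sets_Omega] by blast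
  note [measurable] = C0(1)

  have k_bd: "(LINT x|lborel. indicator Omega x * (norm (k' x) - 1)\<^sup>2) \<le> M * \<epsilon>"
  proof -
    have "(LINT x|lborel. indicator Omega x * (norm (k' x) - 1)\<^sup>2 / (\<epsilon> * \<xi>\<^sup>2)) \<le> E"
    proof (rule bound(2))
      show "AE x in lborel. x \<in> Omega \<longrightarrow> indicator Omega x * (norm (k' x) - 1)\<^sup>2 / (\<epsilon> * \<xi>\<^sup>2) \<le> e x"
        using k'(2)
      proof eventually_elim
        case (elim x)
        then show ?case using e1[of x] e2[of x] e3[of x] e4[of x] unfolding e_def by auto
      qed
    qed (use \<epsilon> \<xi> in auto)
    then have "(LINT x|lborel. indicator Omega x * (norm (k' x) - 1)\<^sup>2) \<le> (E * \<xi>\<^sup>2) * \<epsilon>"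
      using \<epsilon> \<xi> by (simp add: field_simps)
    also have "\<dots> \<le> M * \<epsilon>" using M(1) \<epsilon>(1) by (intro mult_right_mono) auto
    finally show ?thesis .
  qed
  have H'_sq: "sq_integrable H'" and H_bd: "(LINT x|lborel. (norm (H' x))\<^sup>2) \<le> M"
  proof -
    have le: "AE x in lborel. x \<in> Omega \<longrightarrow> (norm (H' x))\<^sup>2 \<le> e x"
      using H'_eq
    proof eventually_elim
      case (elim x)
      then show ?case using e1[of x] e2[of x] e3[of x] e4[of x] unfolding e_def by auto
    qed
    have "integrable lborel (\<lambda>x. (norm (H' x))\<^sup>2)" by (rule bound(1)[OF _ _ _ le]) (auto simp: H'_0)
    then show "sq_integrable H'" by (simp add: sq_integrable_def)
    have "(LINT x|lborel. (norm (H' x))\<^sup>2) \<le> E" by (rule bound(2)[OF _ _ _ le]) (auto simp: H'_0)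
    then show "(LINT x|lborel. (norm (H' x))\<^sup>2) \<le> M" using M(2) by simp
  qed
  have C0_sq: "sq_integrable C0" and C0_bd: "\<epsilon> * (LINT x|lborel. (norm (C0 x))\<^sup>2) \<le> M"
  proof -
    have le: "AE x in lborel. x \<in> Omega \<longrightarrow> \<epsilon> * \<xi>\<^sup>2 * (norm (C0 x))\<^sup>2 \<le> e x"
      using C0(2)
    proof eventually_elim
      case (elim x)
      then show ?case using e1[of x] e2[of x] e3[of x] e4[of x] unfolding e_def by auto
    qed
    have "integrable lborel (\<lambda>x. \<epsilon> * \<xi>\<^sup>2 * (norm (C0 x))\<^sup>2)"
      by (rule bound(1)[OF _ _ _ le]) (use \<epsilon> in \<open>auto simp: C0(3)\<close>)
    then show "sq_integrable C0" using \<epsilon> \<xi> by (simp add: sq_integrable_def)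
    have "(LINT x|lborel. \<epsilon> * \<xi>\<^sup>2 * (norm (C0 x))\<^sup>2) \<le> E"
      by (rule bound(2)[OF _ _ _ le]) (use \<epsilon> in \<open>auto simp: C0(3)\<close>)
    then have "\<epsilon> * (LINT x|lborel. (norm (C0 x))\<^sup>2) \<le> E / \<xi>\<^sup>2" using \<xi> by (simp add: field_simps)
    then show "\<epsilon> * (LINT x|lborel. (norm (C0 x))\<^sup>2) \<le> M" using M(3) by simp
  qed
  have B_bd: "\<epsilon> * (LINT x|lborel. (norm (B' x))\<^sup>2) \<le> M"
  proof -
    \<comment> \<open>The lower bound 1/K x^2 - K for the potential at x = \<epsilon> \<xi> |B|,
      multiplied by the weight of the potential. It may be negative, hence the positive part; the
      restriction to the layer keeps the loss of the constant proportional to \<epsilon>.\<close>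
    define T where "T x = indicator (layer \<epsilon> \<xi>) x * max 0 (\<epsilon> * (norm (B' x))\<^sup>2 / K - K / (\<epsilon> * \<xi>\<^sup>2))" for x
    have T_meas: "T \<in> borel_measurable borel" unfolding T_def[abs_def] by measurable
    have T_0: "0 \<le> T x" "x \<notin> Omega \<Longrightarrow> T x = 0" for x using lay by (auto simp: T_def split: split_indicator)
    have T_le: "AE x in lborel. x \<in> Omega \<longrightarrow> T x \<le> e x"
      using B'_eq
    proof eventually_elim
      case (elim x)
      show ?case
      proof
        assume "x \<in> Omega"
        with elim have eq: "B x = B' x" by simp
        have "\<epsilon> * (norm (B' x))\<^sup>2 / K - K / (\<epsilon> * \<xi>\<^sup>2) = 1 / (\<epsilon> * \<xi>\<^sup>2) * (1 / K * \<bar>\<epsilon> * \<xi> * norm (B' x)\<bar>\<^sup>2 - K)"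
          using \<epsilon> \<xi> K by (simp add: field_simps power2_eq_square)
        also have "\<dots> \<le> 1 / (\<epsilon> * \<xi>\<^sup>2) * W (\<epsilon> * \<xi> * norm (B' x))"
          using \<epsilon> \<xi> by (intro mult_left_mono W(2)) auto
        finally have "T x \<le> 1 / (\<epsilon> * \<xi>\<^sup>2) * W (\<epsilon> * \<xi> * norm (B x))"
          using e4[of x] by (auto simp: T_def eq split: split_indicator)
        then show "T x \<le> e x" using e1[of x] e2[of x] e3[of x] unfolding e_def by linarith
      qed
    qed
    have T: "integrable lborel T" "(LINT x|lborel. T x) \<le> E"
      by (rule bound[OF T_meas T_0 T_le]; simp)+
    have lay_int: "integrable lborel (indicator (layer \<epsilon> \<xi>) :: _ \<Rightarrow> real)"
      using emeasure_layer_finite[of \<epsilon> \<xi>] by (intro integrable_real_indicator) auto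
    have "\<epsilon> * (LINT x|lborel. (norm (B' x))\<^sup>2) = (LINT x|lborel. \<epsilon> * (norm (B' x))\<^sup>2)" by simp
    \<comment> \<open>Solving for |B'|^2 costs the constant K^2 / (\<epsilon> \<xi>^2) on the layer,
      whose integral does not depend on \<epsilon>.\<close>
    also have "\<dots> \<le> (LINT x|lborel. K * T x + K\<^sup>2 / (\<epsilon> * \<xi>\<^sup>2) * indicator (layer \<epsilon> \<xi>) x)"
    proof (rule integral_mono)
      show "integrable lborel (\<lambda>x. \<epsilon> * (norm (B' x))\<^sup>2)" using sq_integrable_norm[OF B'_sq] by simp
      show "integrable lborel (\<lambda>x. K * T x + K\<^sup>2 / (\<epsilon> * \<xi>\<^sup>2) * indicator (layer \<epsilon> \<xi>) x)"
        using T(1) lay_int by simp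
      fix x
      show "\<epsilon> * (norm (B' x))\<^sup>2 \<le> K * T x + K\<^sup>2 / (\<epsilon> * \<xi>\<^sup>2) * indicator (layer \<epsilon> \<xi>) x"
      proof (cases "x \<in> layer \<epsilon> \<xi>")
        case True
        have "\<epsilon> * (norm (B' x))\<^sup>2 = K * (\<epsilon> * (norm (B' x))\<^sup>2 / K - K / (\<epsilon> * \<xi>\<^sup>2)) + K\<^sup>2 / (\<epsilon> * \<xi>\<^sup>2)"
          using K by (simp add: right_diff_distrib power2_eq_square)
        also have "K * (\<epsilon> * (norm (B' x))\<^sup>2 / K - K / (\<epsilon> * \<xi>\<^sup>2)) \<le> K * T x"
          using K True by (intro mult_left_mono) (auto simp: T_def)
        finally show ?thesis using True by simp
      qed (use K T_0(1)[of x] in \<open>simp add: B'_0\<close>)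
    qed
    also have "\<dots> = K * (LINT x|lborel. T x) + K\<^sup>2 / (\<epsilon> * \<xi>\<^sup>2) * measure lborel (layer \<epsilon> \<xi>)"
      using T(1) lay_int by (subst Bochner_Integration.integral_add) auto
    also have "\<dots> = K * (LINT x|lborel. T x) + K\<^sup>2 / \<xi>\<^sup>2 * measure lborel (layer 1 \<xi>)"
      using \<epsilon>(1) by (simp add: measure_layer_stretch[of \<epsilon>])
    also have "\<dots> \<le> K * E + K\<^sup>2 / \<xi>\<^sup>2 * measure lborel (layer 1 \<xi>)"
      using T(2) K by (intro add_right_mono mult_left_mono) auto
    finally show ?thesis using M(4) by linarith
  qed

  have grad: "(LINT x|lborel. dir_deriv \<phi> (axis j 1) x *\<^sub>R k' x) = - (LINT x|lborel. \<phi> x *\<^sub>R column j (H' x + B' x))"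
    if \<phi>: "\<phi> \<in> test_functions Omega" for \<phi> j
  proof -
    note [measurable] = test_functions_measurable[OF \<phi>] test_functions_measurable[OF test_functions_dir_deriv[OF \<phi> axis_Basis_2]]
    have "(LINT x|lborel. dir_deriv \<phi> (axis j 1) x *\<^sub>R k' x) = (LINT x|lebesgue_on Omega. dir_deriv \<phi> (axis j 1) x *\<^sub>R k x)"
    proof (rule integral_lebesgue_on_AE[symmetric])
      show "AE x in lborel. x \<in> Omega \<longrightarrow> dir_deriv \<phi> (axis j 1) x *\<^sub>R k x = dir_deriv \<phi> (axis j 1) x *\<^sub>R k' x"
        using k'(2) by eventually_elim simp
    qed (simp_all add: k'(3))
    also have "\<dots> = - (LINT x|lebesgue_on Omega. \<phi> x *\<^sub>R column j (?G x))"
      using wg \<phi> by (simp add: has_weak_grad_def has_weak_deriv_def)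
    also have "(LINT x|lebesgue_on Omega. \<phi> x *\<^sub>R column j (?G x)) = (LINT x|lborel. \<phi> x *\<^sub>R column j (H' x + B' x))"
    proof (rule integral_lebesgue_on_AE)
      have [measurable]: "(\<lambda>x. column j (H' x + B' x)) \<in> borel_measurable borel" by (rule column_measurable) measurable
      show "(\<lambda>x. \<phi> x *\<^sub>R column j (H' x + B' x)) \<in> borel_measurable borel" by measurable
      show "AE x in lborel. x \<in> Omega \<longrightarrow> \<phi> x *\<^sub>R column j (?G x) = \<phi> x *\<^sub>R column j (H' x + B' x)"
        using H'_eq B'_eq
      proof eventually_elim
        case (elim x)
        have "?G x = H' x + B' x" if "x \<in> Omega" using elim that by (metis diff_add_cancel)
        then show ?case by simp
      qed
    qed (simp_all add: test_functions_eq_0[OF \<phi>])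
    finally show ?thesis .
  qed
  have curl: "- (LINT x|lborel. dir_deriv \<phi> (axis 1 1) x *\<^sub>R column 2 (B' x))
        + (LINT x|lborel. dir_deriv \<phi> (axis 2 1) x *\<^sub>R column 1 (B' x)) = (LINT x|lborel. \<phi> x *\<^sub>R C0 x)"
    if \<phi>: "\<phi> \<in> test_functions Omega" for \<phi>
  proof -
    have B: "(LINT x|lborel. dir_deriv \<phi> (axis i 1) x *\<^sub>R column j (B' x)) = (LINT x|lebesgue_on Omega. dir_deriv \<phi> (axis i 1) x *\<^sub>R column j (B x))" for i j
    proof (rule integral_lebesgue_on_AE[symmetric])
      have d: "dir_deriv \<phi> (axis i 1) \<in> test_functions Omega" by (rule test_functions_dir_deriv[OF \<phi> axis_Basis_2])
      have [measurable]: "(\<lambda>x. column j (B' x)) \<in> borel_measurable borel" by (rule column_measurable) simp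
      note [measurable] = test_functions_measurable[OF d]
      show "(\<lambda>x. dir_deriv \<phi> (axis i 1) x *\<^sub>R column j (B' x)) \<in> borel_measurable borel" by measurable
      show "AE x in lborel. x \<in> Omega \<longrightarrow> dir_deriv \<phi> (axis i 1) x *\<^sub>R column j (B x) = dir_deriv \<phi> (axis i 1) x *\<^sub>R column j (B' x)"
        using B'_eq by eventually_elim simp
      show "x \<notin> Omega \<Longrightarrow> dir_deriv \<phi> (axis i 1) x *\<^sub>R column j (B' x) = 0" for x
        by (simp add: test_functions_eq_0[OF d])
    qed (rule sets_Omega)
    have "(LINT x|lborel. \<phi> x *\<^sub>R C0 x) = (LINT x|lebesgue_on Omega. \<phi> x *\<^sub>R ?c x)"
    proof (rule integral_lebesgue_on_AE[symmetric])
      note [measurable] = test_functions_measurable[OF \<phi>]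
      show "(\<lambda>x. \<phi> x *\<^sub>R C0 x) \<in> borel_measurable borel" by measurable
      show "AE x in lborel. x \<in> Omega \<longrightarrow> \<phi> x *\<^sub>R ?c x = \<phi> x *\<^sub>R C0 x"
        using C0(2) by eventually_elim simp
    qed (simp_all add: C0(3))
    then show ?thesis unfolding B using wc \<phi> by (simp add: has_scaled_curl_def distr_scaled_curl_def)
  qed
  have C0_off: "AE x in lborel. x \<notin> layer \<epsilon> \<xi> \<longrightarrow> C0 x = 0"
    by (rule curl_zero_off_layer[OF sq_integrable_imp_integrable(1)[OF C0_sq sets_Omega emeasure_Omega_finite C0(3)] C0(3) B'_0 curl])
  \<comment> \<open>The representative \<open>C0\<close> vanishes off the layer only almost
    everywhere; the cutoff makes it vanish there exactly, as required for the blow-up.\<close>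
  define C' where "C' x = indicator (layer \<epsilon> \<xi>) x *\<^sub>R C0 x" for x
  have C'_eq: "AE x in lborel. C' x = C0 x"
    using C0_off by eventually_elim (auto simp: C'_def)
  have C'_meas [measurable]: "C' \<in> borel_measurable borel" unfolding C'_def[abs_def] by measurable
  have C'_sq: "sq_integrable C'"
    by (rule sq_integrable_bounded_by[OF C0_sq C'_meas]) (simp add: C'_def split: split_indicator)
  have C'_bd: "\<epsilon> * (LINT x|lborel. (norm (C' x))\<^sup>2) \<le> M"
  proof -
    have "(LINT x|lborel. (norm (C' x))\<^sup>2) = (LINT x|lborel. (norm (C0 x))\<^sup>2)"
      by (rule integral_cong_AE) (use C'_eq in \<open>auto elim!: eventually_mono\<close>)
    with C0_bd show ?thesis by simp
  qed
  have C'_int: "(LINT x|lborel. \<phi> x *\<^sub>R C' x) = (LINT x|lborel. \<phi> x *\<^sub>R C0 x)"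
    if [measurable]: "\<phi> \<in> borel_measurable borel" for \<phi>
    by (rule integral_cong_AE) (use C'_eq in \<open>auto elim!: eventually_mono\<close>)
  have mean': "norm (LINT x|lborel. C' x) = 2"
  proof -
    have "(LINT x|lebesgue_on Omega. ?c x) = (LINT x|lborel. C0 x)"
      by (rule integral_lebesgue_on_AE[OF sets_Omega C0])
    with mean C'_int[of "\<lambda>_. 1"] show ?thesis by simp
  qed
  have "layer_data \<xi> M \<epsilon> k B k' H' B' C'"
    unfolding layer_data_def
  proof (intro conjI ballI allI impI k'(1,2) B'_eq H'_sq B'_sq C'_sq k_bd H_bd B_bd C'_bd mean' grad)
    show "x \<notin> layer \<epsilon> \<xi> \<Longrightarrow> C' x = 0" for x by (simp add: C'_def)
    fix \<phi> assume \<phi>: "\<phi> \<in> test_functions Omega"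
    show "- (LINT x|lborel. dir_deriv \<phi> (axis 1 1) x *\<^sub>R column 2 (B' x))
        + (LINT x|lborel. dir_deriv \<phi> (axis 2 1) x *\<^sub>R column 1 (B' x)) = (LINT x|lborel. \<phi> x *\<^sub>R C' x)"
      unfolding C'_int[OF test_functions_measurable[OF \<phi>]] by (rule curl[OF \<phi>])
  qed (simp_all add: k'(3) H'_0 B'_0)
  then show ?thesis by blast
qed

text \<open>A test function on the unit layer is compressed to the thin layer and inserted into the
  unscaled equation. The Jacobian is absorbed by the factor in the blow-up, and the vertical
  derivative brings 1/\<epsilon>.\<close>

lemma has_scaled_curl_rescale:
  fixes B B' :: "real^2 \<Rightarrow> real^2^2" and C' :: "real^2 \<Rightarrow> real^2"
  assumes \<epsilon>: "0 < \<epsilon>" and sub: "layer \<epsilon> \<xi> \<subseteq> Omega"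
    and BB': "AE x in lborel. x \<in> Omega \<longrightarrow> B x = B' x"
    and B': "integrable lborel B'" "\<And>x. x \<notin> layer \<epsilon> \<xi> \<Longrightarrow> B' x = 0"
    and C': "integrable lborel C'" "\<And>x. x \<notin> layer \<epsilon> \<xi> \<Longrightarrow> C' x = 0"
    and curl: "\<And>\<phi>. \<phi> \<in> test_functions Omega \<Longrightarrow>
        - (LINT x|lborel. dir_deriv \<phi> (axis 1 1) x *\<^sub>R column 2 (B' x))
        + (LINT x|lborel. dir_deriv \<phi> (axis 2 1) x *\<^sub>R column 1 (B' x)) = (LINT x|lborel. \<phi> x *\<^sub>R C' x)"
  shows "has_scaled_curl \<epsilon> (layer 1 \<xi>) (rescale \<epsilon> B) (blow_up \<epsilon> C')"
  unfolding has_scaled_curl_def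
proof (intro conjI ballI)
  let ?L = "layer 1 \<xi>"
  have meas [measurable]: "B' \<in> borel_measurable borel" "C' \<in> borel_measurable borel"
    using borel_measurable_integrable[OF B'(1)] borel_measurable_integrable[OF C'(1)] by simp_all
  have int: "integrable lborel (blow_up \<epsilon> B')" "integrable lborel (blow_up \<epsilon> C')"
    using B'(1) C'(1) \<epsilon> by (simp_all add: blow_up_def[abs_def] integrable_stretch_iff)
  have off: "blow_up \<epsilon> B' x = 0" "blow_up \<epsilon> C' x = 0" if "x \<notin> ?L" for x
    using that B'(2) C'(2) stretch_mem_layer[OF \<epsilon>, of x \<xi>] by (simp_all add: blow_up_def)
  have eq: "AE x in lborel. x \<in> ?L \<longrightarrow> rescale \<epsilon> B x = blow_up \<epsilon> B' x"
    using AE_stretch[OF BB' \<epsilon>]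
    by eventually_elim (use sub stretch_mem_layer[OF \<epsilon>] in \<open>auto simp: rescale_def blow_up_def\<close>)
  show "locally_integrable_on ?L (rescale \<epsilon> B)" by (rule locally_integrable_on_AE[OF int(1) eq])
  show "locally_integrable_on ?L (blow_up \<epsilon> C')" by (rule locally_integrable_on_AE[OF int(2)]) simp
  fix \<phi> assume \<phi>: "\<phi> \<in> test_functions ?L"
  define \<phi>' where "\<phi>' y = \<phi> (pt (y $ 1) (1 / \<epsilon> * y $ 2))" for y :: "real^2"
  have "\<phi>' \<in> test_functions (layer \<epsilon> \<xi>)"
    unfolding \<phi>'_def
  proof (rule stretch_test[OF \<phi>])
    fix y :: "real^2" assume "pt (y $ 1) (1 / \<epsilon> * y $ 2) \<in> ?L"
    then show "y \<in> layer \<epsilon> \<xi>"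
      using stretch_mem_layer[OF \<epsilon>, of "pt (y $ 1) (1 / \<epsilon> * y $ 2)" \<xi>] \<epsilon> by (simp add: pt_eta)
  qed (use \<epsilon> in simp)
  then have \<phi>': "\<phi>' \<in> test_functions Omega" using test_functions_mono[OF sub] by blast
  have d: "dir_deriv \<phi> (axis j 1) \<in> test_functions ?L" for j by (rule test_functions_dir_deriv[OF \<phi> axis_Basis_2])
  have d': "dir_deriv \<phi>' (axis j 1) \<in> test_functions Omega" for j by (rule test_functions_dir_deriv[OF \<phi>' axis_Basis_2])
  note [measurable] = test_functions_measurable[OF \<phi>] test_functions_measurable[OF \<phi>']
    test_functions_measurable[OF d[of 1]] test_functions_measurable[OF d[of 2]]
    test_functions_measurable[OF d'[of 1]] test_functions_measurable[OF d'[of 2]]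
  have cB [measurable]: "(\<lambda>x. column j (B' x)) \<in> borel_measurable borel" for j by (rule column_measurable) simp
  have s: "\<phi>' (pt (x $ 1) (\<epsilon> * x $ 2)) = \<phi> x"
    "dir_deriv \<phi>' (axis 1 1) (pt (x $ 1) (\<epsilon> * x $ 2)) = dir_deriv \<phi> (axis 1 1) x"
    "dir_deriv \<phi>' (axis 2 1) (pt (x $ 1) (\<epsilon> * x $ 2)) = 1 / \<epsilon> * dir_deriv \<phi> (axis 2 1) x" for x
    unfolding \<phi>'_def stretch_dir_deriv[OF \<phi>] using \<epsilon> by (simp_all add: pt_eta)
  have col: "blow_up \<epsilon> (\<lambda>x. column j (B' x)) = (\<lambda>x. column j (blow_up \<epsilon> B' x))" for j
    by (simp add: blow_up_def fun_eq_iff column_scaleR)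
  have L: "(LINT x|lebesgue_on ?L. dir_deriv \<phi> (axis i 1) x *\<^sub>R column j (rescale \<epsilon> B x))
      = (LINT x|lborel. dir_deriv \<phi> (axis i 1) x *\<^sub>R column j (blow_up \<epsilon> B' x))" for i j
  proof (rule integral_lebesgue_on_AE)
    have [measurable]: "(\<lambda>x. column j (blow_up \<epsilon> B' x)) \<in> borel_measurable borel" by (rule column_measurable) simp
    note [measurable] = test_functions_measurable[OF d]
    show "(\<lambda>x. dir_deriv \<phi> (axis i 1) x *\<^sub>R column j (blow_up \<epsilon> B' x)) \<in> borel_measurable borel" by measurable
    show "AE x in lborel. x \<in> ?L \<longrightarrow> dir_deriv \<phi> (axis i 1) x *\<^sub>R column j (rescale \<epsilon> B x) = dir_deriv \<phi> (axis i 1) x *\<^sub>R column j (blow_up \<epsilon> B' x)"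
      using eq by eventually_elim simp
  qed (simp_all add: off column_0 sets_layer)
  have "distr_scaled_curl \<epsilon> ?L (rescale \<epsilon> B) \<phi>
      = - (LINT x|lborel. dir_deriv \<phi> (axis 1 1) x *\<^sub>R column 2 (blow_up \<epsilon> B' x))
        + (LINT x|lborel. (1 / \<epsilon> * dir_deriv \<phi> (axis 2 1) x) *\<^sub>R column 1 (blow_up \<epsilon> B' x))"
    unfolding distr_scaled_curl_def L by (simp only: scaleR_scaleR[symmetric] integral_scaleR_right)
  also have "\<dots> = - (LINT x|lborel. dir_deriv \<phi>' (axis 1 1) x *\<^sub>R column 2 (B' x))
        + (LINT x|lborel. dir_deriv \<phi>' (axis 2 1) x *\<^sub>R column 1 (B' x))"
    unfolding integral_blow_up[OF cB test_functions_measurable[OF d'] \<epsilon>] s col ..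
  also have "\<dots> = (LINT x|lborel. \<phi>' x *\<^sub>R C' x)" by (rule curl[OF \<phi>'])
  also have "\<dots> = (LINT x|lborel. \<phi> x *\<^sub>R blow_up \<epsilon> C' x)"
    unfolding integral_blow_up[OF meas(2) test_functions_measurable[OF \<phi>'] \<epsilon>] s ..
  also have "\<dots> = (LINT x|lebesgue_on ?L. \<phi> x *\<^sub>R blow_up \<epsilon> C' x)"
    by (rule integral_lebesgue_on_supp[symmetric]) (simp_all add: off sets_layer)
  finally show "distr_scaled_curl \<epsilon> ?L (rescale \<epsilon> B) \<phi> = (LINT x|lebesgue_on ?L. \<phi> x *\<^sub>R blow_up \<epsilon> C' x)" .
qed

theorem theorem1p3:
  fixes W :: "real \<Rightarrow> real" and \<xi> :: real and \<epsilon> :: "nat \<Rightarrow> real"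
    and k\<^sub>\<epsilon> :: "nat \<Rightarrow> real^2 \<Rightarrow> real^2" and B\<^sub>\<epsilon> :: "nat \<Rightarrow> real^2 \<Rightarrow> real^2^2"
  assumes W_cont: "continuous_on {0..} W"
    and W_nonneg: "\<forall>x\<ge>0. W x \<ge> 0"
    and W_growth: "\<exists>C>0. \<forall>x\<ge>0. 1 / C * \<bar>x\<bar>\<^sup>2 - C \<le> W x \<and> W x \<le> C * (1 + \<bar>x\<bar>\<^sup>2)"
    and W_zeros: "{x. x \<ge> 0 \<and> W x = 0} = {0, 2}"
    and \<xi>: "0 < \<xi>" "\<xi> < 1"
    and \<epsilon>_pos: "\<forall>n. \<epsilon> n > 0"
    and \<epsilon>_lim: "\<epsilon> \<longlonglongrightarrow> 0"
    and k_W12: "\<forall>n. sobolev1 2 Omega (k\<^sub>\<epsilon> n)"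
    and B_Hcurl: "\<forall>n. H_curl Omega (B\<^sub>\<epsilon> n)"
    and energy_bd: "(SUP n. energy W (\<epsilon> n) \<xi> (k\<^sub>\<epsilon> n) (B\<^sub>\<epsilon> n)) < \<infinity>"
    and B_supp: "\<forall>n. AE x in lebesgue_on (Omega - layer (\<epsilon> n) \<xi>). B\<^sub>\<epsilon> n x = 0"
    and B_curl: "\<forall>n. norm (LINT x|lebesgue_on Omega. weak_curl Omega (B\<^sub>\<epsilon> n) x) = 2"
  shows "\<exists>(r :: nat \<Rightarrow> nat) k c \<alpha> J D G.
     strict_mono r \<and>
     L2_tendsto Omega (\<lambda>n. k\<^sub>\<epsilon> (r n)) k \<and>
     sbv Omega k \<and> circle_valued Omega k \<and>
     sobolev1 1 (Omega - closure (layer0 \<xi>)) k \<and>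
     (\<forall>n. has_scaled_curl (\<epsilon> (r n)) (layer 1 \<xi>) (rescale (\<epsilon> (r n)) (B\<^sub>\<epsilon> (r n))) (c n)) \<and>
     L2_weak_tendsto (layer 1 \<xi>) c \<alpha> \<and>
     has_jump \<xi> k J \<and>
     (\<forall>s\<in>{-\<xi><..<1}. J s =
        (LINT x1|lebesgue_on {-\<xi><..<s}. LINT x2|lebesgue_on {-\<xi>/2<..<\<xi>/2}. \<alpha> (vector [x1, x2]))) \<and>
     norm (J 1) = 2 \<and>
     has_ac_grad Omega k G \<and>
     has_weak_deriv {-\<xi><..<1} 1 J D \<and> lp_on 1 {-\<xi><..<1} D \<and>
     (\<forall>\<phi>\<in>test_functions Omega.
        distr_curl Omega G \<phi> = - (LINT x:layer0 \<xi>|hausdorff1. \<phi> x *\<^sub>R D (x $ 1)))"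
proof -
  obtain K where K: "K > 0" "\<And>x. 0 \<le> x \<Longrightarrow> 1 / K * \<bar>x\<bar>\<^sup>2 - K \<le> W x" using W_growth by blast
  define E where "E = enn2real (SUP n. energy W (\<epsilon> n) \<xi> (k\<^sub>\<epsilon> n) (B\<^sub>\<epsilon> n))"
  have E0: "0 \<le> E" by (simp add: E_def)
  have en: "energy W (\<epsilon> n) \<xi> (k\<^sub>\<epsilon> n) (B\<^sub>\<epsilon> n) \<le> ennreal E" for n
    using energy_bd by (auto simp: E_def intro: SUP_upper)
  define M1 where "M1 = K * E + K\<^sup>2 / \<xi>\<^sup>2 * measure lborel (layer 1 \<xi>)"
  define M where "M = E * \<xi>\<^sup>2 + E + E / \<xi>\<^sup>2 + M1"
  have "0 \<le> E * \<xi>\<^sup>2" "0 \<le> E / \<xi>\<^sup>2" "0 \<le> M1" using E0 K(1) by (simp_all add: M1_def)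
  then have M: "E * \<xi>\<^sup>2 \<le> M" "E \<le> M" "E / \<xi>\<^sup>2 \<le> M" "M1 \<le> M" using E0 by (simp_all add: M_def)
  \<comment> \<open>The thin layer lies in \<Omega> once \<epsilon> is below 1, which holds only
    from some index on. All sequences are shifted by \<open>n0\<close>, and the final subsequence is
    \<open>r n + n0\<close>.\<close>
  obtain n0 where n0: "\<And>n. n \<ge> n0 \<Longrightarrow> \<epsilon> n < 1"
    using order_tendstoD(2)[OF \<epsilon>_lim, of 1] by (auto simp: eventually_sequentially)
  have "\<exists>k' H' B' C'. layer_data \<xi> M (\<epsilon> (n + n0)) (k\<^sub>\<epsilon> (n + n0)) (B\<^sub>\<epsilon> (n + n0)) k' H' B' C'" for n
    by (rule ex_layer_data[where W = W and E = E and K = K])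
       (use \<xi> \<epsilon>_pos n0 E0 K W_nonneg k_W12 B_Hcurl en B_supp B_curl M[unfolded M1_def] in \<open>simp_all\<close>)
  then obtain k' H' B' C' where data:
    "\<And>n. layer_data \<xi> M (\<epsilon> (n + n0)) (k\<^sub>\<epsilon> (n + n0)) (B\<^sub>\<epsilon> (n + n0)) (k' n) (H' n) (B' n) (C' n)"
    by metis
  interpret s: layer_sequence \<xi> M "\<lambda>n. \<epsilon> (n + n0)" k' H' B' C'
    by (rule layer_sequenceI[OF \<xi> _ _ _ data])
       (use \<epsilon>_pos n0 LIMSEQ_ignore_initial_segment[OF \<epsilon>_lim] in simp_all)
  obtain r kk HH \<beta> \<alpha> where r: "strict_mono r"
    and lim: "layer_limit \<xi> M (\<lambda>n. \<epsilon> (r n + n0)) (\<lambda>n. k' (r n)) (\<lambda>n. H' (r n)) (\<lambda>n. B' (r n)) (\<lambda>n. C' (r n)) kk HH \<beta> \<alpha>"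
    using s.ex_layer_limit by blast
  interpret l: layer_limit \<xi> M "\<lambda>n. \<epsilon> (r n + n0)" "\<lambda>n. k' (r n)" "\<lambda>n. H' (r n)" "\<lambda>n. B' (r n)" "\<lambda>n. C' (r n)" kk HH \<beta> \<alpha>
    by (rule lim)
  have k_eq: "AE x in lborel. x \<in> Omega \<longrightarrow> k\<^sub>\<epsilon> (n + n0) x = k' n x"
    and B_eq: "AE x in lborel. x \<in> Omega \<longrightarrow> B\<^sub>\<epsilon> (n + n0) x = B' n x" for n
    using data[of n] by (auto simp: layer_data_def)
  have C_0': "C' n x = 0" if "x \<notin> Omega" for n x
    using s.C_0[of x n] s.layer_subset_Omega[of n] that by blast
  show ?thesis
  proof (intro exI conjI ballI allI)
    show "strict_mono (\<lambda>n. r n + n0)" using r by (auto simp: strict_mono_def)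
    show "L2_tendsto Omega (\<lambda>n. k\<^sub>\<epsilon> (r n + n0)) kk"
      by (rule L2_tendsto_to_l2[OF sets_Omega s.k_sq s.k_0 l.kk(1,2) k_eq l.kk(3)])
    show "has_scaled_curl (\<epsilon> (r n + n0)) (layer 1 \<xi>) (rescale (\<epsilon> (r n + n0)) (B\<^sub>\<epsilon> (r n + n0))) (l.Ct n)" for n
      by (rule has_scaled_curl_rescale[OF s.\<epsilon>(1) s.layer_subset_Omega B_eq
            s.integrable_Omega[OF s.B_sq s.B_0'] s.B_0 s.integrable_Omega[OF s.C_sq C_0'] s.C_0 s.curl])
    show "L2_weak_tendsto (layer 1 \<xi>) l.Ct \<alpha>"
      by (rule L2_weak_tendsto_to_l2[OF sets_layer l.Ct_sq l.Ct_0 l.\<alpha>])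
    show "lp_on 1 {-\<xi><..<1} l.a" by (rule lp_on_1_integrable[OF l.a_int]) simp
  qed (rule l.sbv_kk l.circle_valued_kk l.sobolev1_kk l.has_jump_kk l.norm_J_1 l.has_ac_grad_kk l.has_weak_deriv_J
      | erule l.J_eq l.distr_curl_HH)+
qed

end
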